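(* In the setting and notation of the context, let $\hat p_t=p_{\kappa t}$ (the density at time $t$ of the law of $X_t$, where $dX_t=\sqrt2\,dB_t+(\nabla\ln\hat p_t+v_t)(X_t)\,dt$, $\mathcal L(X_0)=\tilde\nu$), and let $\hat\mu_t$ be the density at time $t$ of the law of $Y_t$, where $dY_t=\sqrt2\,dB_t+\nabla\ln\hat p_t(Y_t)\,dt$, $\mathcal L(Y_0)=\tilde\nu$. Consider $\lambda_t$ such that $\lambda_0=0$. If $\nu$ is strictly log-concave and $\nabla\ln p_t$ is $L(t)$-Lipschitz with $L(t)\le c$ for $t\in[0,T]$, then $$d_{KL}(\tilde\pi,\mathcal L(Y_{T/\kappa}))\le\frac\kappa2\int_0^T|p'_s|^2\,e^{-\frac1\kappa\int_s^TC_{LS}^{-1}(\hat\mu_{u/\kappa})\,du}\,ds .$$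
   Context: Let $T>0$, $t\in[0,T]\mapsto\lambda_t\in[0,1]$ increasing, and let $\pi(dx)=e^{-U(x)}dx$, $\nu(dx)=e^{-W(x)}dx$ be probability measures on $\mathbb R^d$ with $e^{-U},e^{-W}$ bounded and finite second moments. Let $\xi\sim\pi$, $\zeta\sim\nu$ be independent; $p_t$ is the law and density of $\sqrt{\lambda_t}\,\xi+\sqrt{1-\lambda_t}\,\zeta$; $\tilde\pi$, $\tilde\nu$ are the laws at $t=T$, $t=0$. $\kappa\in(0,1)$. $|p'_t|=\lim_{h\to0}\frac1{|h|}W_2(p_{t+h},p_t)$, and it is assumed that $\int_0^T|p'_t|^2dt<\infty$. $v$ is a Borel vector field with $\partial_t\hat p_t+\nabla\cdot(v_t\hat p_t)=0$ weakly and $\|v_t\|_{\mathbb L^2(\hat p_tdx)}=\kappa|p'_{\kappa t}|$ for a.e. $t\in[0,T/\kappa]$. $B$ is a standard Brownian motion. $\nu$ strictly log-concave means $\nabla^2W\ge D_W\,Id$ for some $D_W>0$. $d_{KL}(\mu,\theta)=\int\ln(d\mu/d\theta)\,d\mu$. $C_{LS}(\mu)$ is the optimal constant in the logarithmic Sobolev inequality $\int f^2\ln\big(\frac{f^2}{\int f^2d\mu}\big)d\mu\le2\,C_{LS}(\mu)\int|\nabla f|^2d\mu$. *)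

theory Defs
  imports "HOL-Probability.Probability"
begin

section \<open>Measures, relative entropy, Wasserstein distance\<close>

abbreviation dens :: "('a::euclidean_space \<Rightarrow> real) \<Rightarrow> 'a measure" where
  "dens f \<equiv> density lborel (\<lambda>x. ennreal (f x))"

text \<open>
  The relative entropy of \<open>\<mu>\<close> with respect to \<open>\<theta>\<close>, i.e. the integral of \<open>ln (d\<mu>/d\<theta>)\<close> against \<open>\<mu>\<close>.
  The library constants take the reference measure \<open>\<theta>\<close> first, and \<open>KL_divergence\<close> is only
  meaningful in the first case below. For probability measures the negative part of the integrand
  is always integrable and the integral is nonnegative, so the remaining cases are those of
  infinite entropy, and \<open>ennreal\<close> truncates nothing.
\<close>
definition d_KL :: "'a measure \<Rightarrow> 'a measure \<Rightarrow> ennreal" where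
  "d_KL \<mu> \<theta> =
    (if absolutely_continuous \<theta> \<mu> \<and> integrable \<mu> (entropy_density (exp 1) \<theta> \<mu>)
     then ennreal (KL_divergence (exp 1) \<theta> \<mu>) else \<top>)"

definition couplings :: "'a::euclidean_space measure \<Rightarrow> 'a measure \<Rightarrow> ('a \<times> 'a) measure set" where
  "couplings \<mu> \<theta> =
    {\<gamma>. sets \<gamma> = sets (borel \<Otimes>\<^sub>M borel) \<and> distr \<gamma> borel fst = \<mu> \<and> distr \<gamma> borel snd = \<theta>}"

text \<open>Meant for probability measures with finite second moment, where the infimum is finite.\<close>
definition W2 :: "'a::euclidean_space measure \<Rightarrow> 'a measure \<Rightarrow> real" where
  "W2 \<mu> \<theta> =
    sqrt (enn2real (INF \<gamma>\<in>couplings \<mu> \<theta>. \<integral>\<^sup>+z. ennreal ((dist (fst z) (snd z))\<^sup>2) \<partial>\<gamma>))"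

definition W2_quotient :: "(real \<Rightarrow> 'a::euclidean_space measure) \<Rightarrow> real \<Rightarrow> real \<Rightarrow> real" where
  "W2_quotient \<mu> t h = W2 (\<mu> (t + h)) (\<mu> t) / \<bar>h\<bar>"

text \<open>Increments are restricted to those that stay in the time interval.\<close>
definition metric_derivative_filter :: "real \<Rightarrow> real \<Rightarrow> real filter" where
  "metric_derivative_filter T t = at 0 within {h. t + h \<in> {0..T}}"

definition metric_derivative :: "real \<Rightarrow> (real \<Rightarrow> 'a::euclidean_space measure) \<Rightarrow> real \<Rightarrow> real" where
  "metric_derivative T \<mu> t = Lim (metric_derivative_filter T t) (W2_quotient \<mu> t)"

definition metric_derivative_exists ::
    "real \<Rightarrow> (real \<Rightarrow> 'a::euclidean_space measure) \<Rightarrow> real \<Rightarrow> bool" where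
  "metric_derivative_exists T \<mu> t \<longleftrightarrow>
    (\<exists>l. (W2_quotient \<mu> t \<longlongrightarrow> l) (metric_derivative_filter T t))"

definition W2_absolutely_continuous :: "real \<Rightarrow> (real \<Rightarrow> 'a::euclidean_space measure) \<Rightarrow> bool" where
  "W2_absolutely_continuous T \<mu> \<longleftrightarrow>
    (\<exists>m :: real \<Rightarrow> real. set_integrable lborel {0..T} m \<and>
      (\<forall>s t. 0 \<le> s \<longrightarrow> s \<le> t \<longrightarrow> t \<le> T \<longrightarrow>
        W2 (\<mu> s) (\<mu> t) \<le> (LINT r:{s..t}|lborel. m r)))"


section \<open>Gradients, convexity, logarithmic Sobolev constant\<close>

definition grad :: "('a::euclidean_space \<Rightarrow> real) \<Rightarrow> 'a \<Rightarrow> 'a" where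
  "grad f x = (THE D. GDERIV f x :> D)"

text \<open>The measure \<open>exp (- W x) dx\<close> is strictly log-concave: \<open>H x\<close> is the Hessian of \<open>W\<close> at \<open>x\<close>.\<close>
definition strictly_log_concave :: "('a::euclidean_space \<Rightarrow> real) \<Rightarrow> bool" where
  "strictly_log_concave W \<longleftrightarrow>
    (\<exists>D>0. \<exists>H. (\<forall>x. W differentiable (at x)) \<and>
       (\<forall>x. (grad W has_derivative H x) (at x)) \<and>
       (\<forall>x h. H x h \<bullet> h \<ge> D * (norm h)\<^sup>2))"

text \<open>
  The test functions are the continuously differentiable functions in the Sobolev space
  \<open>H\<^sup>1(\<mu>)\<close>. The entropy on the left-hand side is \<open>+\<infinity>\<close> when its integrand is not integrable,
  hence the integrability clause in the conclusion.
\<close>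
definition log_sobolev :: "'a::euclidean_space measure \<Rightarrow> real \<Rightarrow> bool" where
  "log_sobolev \<mu> C \<longleftrightarrow>
    (\<forall>f :: 'a \<Rightarrow> real.
      (\<forall>x. f differentiable (at x)) \<longrightarrow> continuous_on UNIV (grad f) \<longrightarrow>
      integrable \<mu> (\<lambda>x. (f x)\<^sup>2) \<longrightarrow> integrable \<mu> (\<lambda>x. (norm (grad f x))\<^sup>2) \<longrightarrow>
      integrable \<mu> (\<lambda>x. (f x)\<^sup>2 * ln ((f x)\<^sup>2 / (\<integral>y. (f y)\<^sup>2 \<partial>\<mu>))) \<and>
      (\<integral>x. (f x)\<^sup>2 * ln ((f x)\<^sup>2 / (\<integral>y. (f y)\<^sup>2 \<partial>\<mu>)) \<partial>\<mu>)
        \<le> 2 * C * (\<integral>x. (norm (grad f x))\<^sup>2 \<partial>\<mu>))"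

text \<open>\<open>C_LS \<mu> = \<top>\<close>, so \<open>inverse (C_LS \<mu>) = 0\<close>, if no inequality holds.\<close>
definition C_LS :: "'a::euclidean_space measure \<Rightarrow> ennreal" where
  "C_LS \<mu> = Inf {ennreal C | C. 0 \<le> C \<and> log_sobolev \<mu> C}"

text \<open>\<open>exp (- x)\<close> for \<open>x\<close> in \<open>[0, \<infinity>]\<close>.\<close>
definition exp_minus :: "ennreal \<Rightarrow> ennreal" where
  "exp_minus x = (if x = \<top> then 0 else ennreal (exp (- enn2real x)))"


section \<open>Weak continuity equation\<close>

primrec Ck :: "nat \<Rightarrow> ('a::euclidean_space \<Rightarrow> real) \<Rightarrow> bool" where
  "Ck 0 f \<longleftrightarrow> continuous_on UNIV f"
| "Ck (Suc k) f \<longleftrightarrow>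
    (\<forall>x. f differentiable (at x)) \<and> (\<forall>h. Ck k (\<lambda>x. frechet_derivative f (at x) h))"

definition test_function :: "('a::euclidean_space) set \<Rightarrow> ('a \<Rightarrow> real) \<Rightarrow> bool" where
  "test_function \<Omega> \<phi> \<longleftrightarrow>
    (\<forall>k. Ck k \<phi>) \<and> (\<exists>K. compact K \<and> K \<subseteq> \<Omega> \<and> (\<forall>z. z \<notin> K \<longrightarrow> \<phi> z = 0))"

text \<open>
  The derivative of \<open>\<phi>\<close> at \<open>(t, x)\<close> in direction \<open>(1, v t x)\<close> is
  \<open>\<partial>\<^sub>t \<phi> (t, x) + v t x \<bullet> \<nabla>\<^sub>x \<phi> (t, x)\<close>.
\<close>
definition weak_continuity_equation ::
    "real \<Rightarrow> (real \<Rightarrow> 'a::euclidean_space \<Rightarrow> real) \<Rightarrow> (real \<Rightarrow> 'a \<Rightarrow> 'a) \<Rightarrow> bool" where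
  "weak_continuity_equation S q v \<longleftrightarrow>
    (\<forall>\<phi> :: real \<times> 'a \<Rightarrow> real. test_function ({0<..<S} \<times> UNIV) \<phi> \<longrightarrow>
      (LINT t:{0..S}|lborel.
        (\<integral>x. frechet_derivative \<phi> (at (t, x)) (1, v t x) * q t x \<partial>lborel)) = 0)"


section \<open>Brownian motion and stochastic differential equations\<close>

text \<open>Standard Brownian motion (started at 0) with respect to the filtration \<open>F\<close>.\<close>
definition brownian_motion ::
    "'w measure \<Rightarrow> (real \<Rightarrow> 'w measure) \<Rightarrow> (real \<Rightarrow> 'w \<Rightarrow> 'a::euclidean_space) \<Rightarrow> bool" where
  "brownian_motion M F B \<longleftrightarrow>
    prob_space M \<and> filtration (space M) F \<and> (\<forall>t. sets (F t) \<subseteq> sets M) \<and>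
    (\<forall>t\<ge>0. B t \<in> borel_measurable (F t)) \<and>
    (AE \<omega> in M. B 0 \<omega> = 0) \<and>
    (AE \<omega> in M. continuous_on {0..} (\<lambda>t. B t \<omega>)) \<and>
    (\<forall>s t. 0 \<le> s \<longrightarrow> s < t \<longrightarrow>
      distributed M lborel (\<lambda>\<omega>. B t \<omega> - B s \<omega>)
        (\<lambda>x. ennreal (\<Prod>b\<in>Basis. normal_density 0 (sqrt (t - s)) (x \<bullet> b))) \<and>
      prob_space.indep_set M (sets (F s))
        {(\<lambda>\<omega>. B t \<omega> - B s \<omega>) -` A \<inter> space M | A. A \<in> sets borel})"

text \<open>
  \<open>X\<close> is a solution on \<open>[0, S]\<close> of \<open>dX\<^sub>t = \<surd>2 dB\<^sub>t + b t X\<^sub>t dt\<close> with initial law \<open>\<mu>0\<close>, in integral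
  form; the noise being additive, no stochastic integral is involved. Since \<open>X 0\<close> is
  \<open>F 0\<close>-measurable, it is independent of \<open>B\<close>.
\<close>
definition sde_solution ::
    "'w measure \<Rightarrow> (real \<Rightarrow> 'w measure) \<Rightarrow> (real \<Rightarrow> 'w \<Rightarrow> 'a::euclidean_space) \<Rightarrow>
     (real \<Rightarrow> 'a \<Rightarrow> 'a) \<Rightarrow> real \<Rightarrow> 'a measure \<Rightarrow> (real \<Rightarrow> 'w \<Rightarrow> 'a) \<Rightarrow> bool" where
  "sde_solution M F B b S \<mu>0 X \<longleftrightarrow>
    brownian_motion M F B \<and>
    (\<forall>t\<in>{0..S}. X t \<in> borel_measurable (F t)) \<and>
    (AE \<omega> in M. continuous_on {0..S} (\<lambda>t. X t \<omega>)) \<and>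
    distr M borel (X 0) = \<mu>0 \<and>
    (AE \<omega> in M. set_integrable lborel {0..S} (\<lambda>s. b s (X s \<omega>)) \<and>
      (\<forall>t\<in>{0..S}. X t \<omega> =
        X 0 \<omega> + sqrt 2 *\<^sub>R B t \<omega> + (LINT s:{0..t}|lborel. b s (X s \<omega>))))"

end

theory Submission
  imports Defs
begin

text \<open>
  By duality it suffices to bound \<open>E \<phi>(X\<^sub>S) - ln (E exp \<phi>(Y\<^sub>S))\<close>, where \<open>S = T / \<kappa>\<close>, for bounded
  Lipschitz \<open>\<phi>\<close>. Time is cut into steps of length \<open>\<delta>\<close>. Going backwards from \<open>l = \<phi> / 2\<close>, one replaces \<open>l\<close>
  by the logarithm of the Gaussian average of \<open>exp (l / \<theta>)\<close> after one drift step, where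
  \<open>\<theta> = 1 - \<delta> g(t)\<close> and \<open>g\<close> is bounded by the inverse logarithmic Sobolev constant of the law of \<open>Y\<^sub>t\<close>.
  Along \<open>X\<close> the additional drift \<open>v\<close> shifts the Gaussian increment by \<open>V\<close>, which costs \<open>\<bar>V\<bar>\<^sup>2 / (4 \<delta>)\<close> per
  step. Along \<open>Y\<close> the logarithmic Sobolev inequality gives
  \<open>\<theta> ln (E exp (2 l(Y\<^sub>t))) \<le> ln (E exp (2 l'(Y\<^bsub>t + \<delta>\<^esub>)))\<close> up to \<open>o(\<delta>)\<close>, with \<open>l'\<close> the preceding function:
  this is hypercontractivity along the flow. The products of the factors \<open>\<theta>\<close> converge to
  \<open>exp (- \<integral> g)\<close>.
\<close>

section \<open>Gaussian measures\<close>

text \<open>Fixing a test function and working backwards avoids this: on each cell only Gaussian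
  identities occur, and the errors are mean distances, which Lipschitz test functions control. The
  exponent 2 comes from the logarithmic Sobolev inequality, whose entropy is that of a square; hence
  the start from half the test function. Multiplied by products of the factors \<theta>, the
  inequalities along both processes telescope. They meet at time 0, where the laws agree, by
  Jensen's inequality in the form 2 E l(X_0) \<le> ln E exp(2 l(Y_0)). Two further issues concern
  the rate. It may be unbounded or infinite, so it is capped by an integer and the cap is removed in
  a limit. Its measurability in time is not given, so it is replaced by a measurable minorant with
  the same lower integrals; the lower integral is what the bound contains.\<close>

definition gauss_density :: "real \<Rightarrow> 'a::euclidean_space \<Rightarrow> real" where
  "gauss_density s x = (1 / sqrt (2 * pi * s)) ^ DIM('a) * exp (- (norm x)\<^sup>2 / (2 * s))"

definition gauss :: "real \<Rightarrow> 'a::euclidean_space measure" where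
  "gauss s = density lborel (\<lambda>x. ennreal (gauss_density s x))"

lemma gauss_density_measurable [measurable]: "gauss_density s \<in> borel_measurable borel"
  unfolding gauss_density_def by measurable

lemma gauss_density_pos: "s > 0 \<Longrightarrow> gauss_density s x > 0"
  by (simp add: gauss_density_def)

text \<open>Links the radial density to the product form in which \<open>brownian_motion\<close>
  specifies its increments; \<open>s\<close> is the variance of each coordinate.\<close>

lemma gauss_density_prod:
  fixes x :: "'a::euclidean_space"
  assumes "s > 0"
  shows "(\<Prod>b\<in>Basis. normal_density 0 (sqrt s) (x \<bullet> b)) = gauss_density s x"
proof -
  have "(\<Prod>b\<in>Basis. normal_density 0 (sqrt s) (x \<bullet> b))
      = (\<Prod>b\<in>(Basis::'a set). 1 / sqrt (2 * pi * s)) * (\<Prod>b\<in>Basis. exp (- (x \<bullet> b)\<^sup>2 / (2 * s)))"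
    using assms by (subst prod.distrib[symmetric], intro prod.cong) (auto simp: normal_density_def)
  also have "(\<Prod>b\<in>Basis. exp (- (x \<bullet> b)\<^sup>2 / (2 * s))) = exp (\<Sum>b\<in>Basis. - (x \<bullet> b)\<^sup>2 / (2 * s))"
    by (simp add: exp_sum)
  also have "(\<Sum>b\<in>Basis. - (x \<bullet> b)\<^sup>2 / (2 * s)) = - (norm x)\<^sup>2 / (2 * s)"
    unfolding power2_norm_eq_inner by (subst euclidean_inner) (simp add: power2_eq_square sum_divide_distrib sum_negf)
  finally show ?thesis by (simp add: gauss_density_def prod_constant)
qed

lemma sets_gauss [measurable_cong, simp]: "sets (gauss s) = sets borel"
  by (simp add: gauss_def)

lemma space_gauss [simp]: "space (gauss s) = UNIV"
  by (simp add: gauss_def)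

lemma prob_space_gauss:
  assumes "s > 0"
  shows "prob_space (gauss s :: 'a::euclidean_space measure)"
proof
  have "emeasure (gauss s :: 'a measure) UNIV = (\<integral>\<^sup>+x. ennreal (gauss_density s (x::'a)) \<partial>lborel)"
    by (simp add: gauss_def emeasure_density)
  also have "\<dots> = (\<integral>\<^sup>+x. (\<Prod>b\<in>Basis. ennreal (normal_density 0 (sqrt s) ((x::'a) \<bullet> b))) \<partial>lborel)"
    using assms by (simp add: gauss_density_prod[symmetric] prod_ennreal)
  also have "\<dots> = (\<Prod>b\<in>(Basis::'a set). (\<integral>\<^sup>+x. ennreal (normal_density 0 (sqrt s) x) \<partial>lborel))"
    by (subst nn_integral_lborel_prod) auto
  also have "(\<integral>\<^sup>+x. ennreal (normal_density 0 (sqrt s) x) \<partial>lborel) = 1"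
    using assms by (subst nn_integral_eq_integral) auto
  finally show "emeasure (gauss s :: 'a measure) (space (gauss s)) = 1" by simp
qed

text \<open>The equations carry \<open>sqrt 2\<close> times Brownian motion, so a time step of
  length \<delta> has Gaussian increments of variance 2 \<delta>. The Jacobian of the scaling
  cancels against the change of normalisation.\<close>

lemma distr_scale_gauss:
  assumes "s > 0"
  shows "distr (gauss s) borel (\<lambda>x. sqrt 2 *\<^sub>R x) = (gauss (2 * s) :: 'a::euclidean_space measure)"
proof -
  have e: "(sqrt 2) ^ DIM('a) * gauss_density (2 * s) (sqrt 2 *\<^sub>R x) = gauss_density s x" for x :: 'a
  proof -
    have "(2::real) ^ DIM('a) = sqrt 2 ^ DIM('a) * sqrt 2 ^ DIM('a)"
      by (simp add: power_mult_distrib[symmetric])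
    then show ?thesis
      using assms by (simp add: gauss_density_def power_mult_distrib real_sqrt_mult power_divide)
  qed
  have "gauss (2 * s) = density (density (distr lborel borel (\<lambda>x. 0 + sqrt 2 *\<^sub>R x)) (\<lambda>_. ennreal (\<bar>sqrt 2\<bar> ^ DIM('a))))
       (\<lambda>x. ennreal (gauss_density (2 * s) (x::'a)))"
    unfolding gauss_def by (subst lborel_affine[of "sqrt 2" 0]) auto
  also have "\<dots> = density (distr lborel borel (\<lambda>x. sqrt 2 *\<^sub>R x))
       (\<lambda>x. ennreal ((sqrt 2) ^ DIM('a)) * ennreal (gauss_density (2 * s) (x::'a)))"
    by (subst density_density_eq) auto
  also have "\<dots> = distr (density lborel (\<lambda>x. ennreal ((sqrt 2) ^ DIM('a)) * ennreal (gauss_density (2 * s) (sqrt 2 *\<^sub>R x)))) borel (\<lambda>x::'a. sqrt 2 *\<^sub>R x)"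
    by (subst density_distr) auto
  also have "(\<lambda>x::'a. ennreal ((sqrt 2) ^ DIM('a)) * ennreal (gauss_density (2 * s) (sqrt 2 *\<^sub>R x))) = (\<lambda>x. ennreal (gauss_density s x))"
    by (subst e[symmetric]) (use assms in \<open>simp add: ennreal_mult'' less_imp_le[OF gauss_density_pos]\<close>)
  finally show ?thesis by (simp add: gauss_def)
qed

lemma gauss_density_shift:
  assumes "s > 0"
  shows "gauss_density s (x - v) = gauss_density s x * exp ((x \<bullet> v) / s - (norm v)\<^sup>2 / (2 * s))"
proof -
  have d: "(norm (x - v))\<^sup>2 = (norm x)\<^sup>2 - 2 * (x \<bullet> v) + (norm v)\<^sup>2"
    by (simp add: power2_norm_eq_inner inner_diff_left inner_diff_right inner_commute)
  have e: "- (norm (x - v))\<^sup>2 / (2 * s) = - (norm x)\<^sup>2 / (2 * s) + ((x \<bullet> v) / s - (norm v)\<^sup>2 / (2 * s))"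
    unfolding d using assms by (simp add: diff_divide_distrib add_divide_distrib)
  show ?thesis
    unfolding gauss_density_def e exp_add by simp
qed

text \<open>The Cameron-Martin formula in finite dimension, from translation invariance of Lebesgue
  measure. The exponential moments, the derivative of a smoothed function and the cost of a drift
  are all read off it.\<close>

lemma distr_shift_gauss:
  assumes "s > 0"
  shows "distr (gauss s) borel (\<lambda>x. x + v)
    = density (gauss s) (\<lambda>x. ennreal (exp ((x \<bullet> v) / s - (norm v)\<^sup>2 / (2 * s))))"
proof -
  have "distr (gauss s) borel (\<lambda>x. x + v) = distr (density lborel (\<lambda>x. ennreal (gauss_density s (x + v - v)))) borel (\<lambda>x. x + v)"
    by (simp add: gauss_def)
  also have "\<dots> = density (distr lborel borel (\<lambda>x. x + v)) (\<lambda>x. ennreal (gauss_density s (x - v)))"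
    by (subst density_distr) auto
  also have "distr lborel borel (\<lambda>x. x + v) = lborel"
    using lborel_distr_plus[of v] by (metis (no_types, lifting) add.commute distr_cong)
  also have "density lborel (\<lambda>x. ennreal (gauss_density s (x - v))) =
      density lborel (\<lambda>x. ennreal (gauss_density s x) * ennreal (exp ((x \<bullet> v) / s - (norm v)\<^sup>2 / (2 * s))))"
    using assms by (intro density_cong) (auto simp: gauss_density_shift ennreal_mult'' less_imp_le[OF gauss_density_pos])
  also have "\<dots> = density (gauss s) (\<lambda>x. ennreal (exp ((x \<bullet> v) / s - (norm v)\<^sup>2 / (2 * s))))"
    unfolding gauss_def by (subst density_density_eq) auto
  finally show ?thesis .
qed

lemma integral_shift_gauss:
  fixes h :: "'a::euclidean_space \<Rightarrow> real"
  assumes "s > 0" and [measurable]: "h \<in> borel_measurable borel"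
  shows "(\<integral>x. h (x + v) \<partial>gauss s) = (\<integral>x. exp ((x \<bullet> v) / s - (norm v)\<^sup>2 / (2 * s)) * h x \<partial>gauss s)"
proof -
  have "(\<integral>x. h (x + v) \<partial>gauss s) = (\<integral>x. h x \<partial>(distr (gauss s) borel (\<lambda>x. x + v)))"
    by (subst integral_distr) auto
  also have "\<dots> = (\<integral>x. exp ((x \<bullet> v) / s - (norm v)\<^sup>2 / (2 * s)) * h x \<partial>gauss s)"
    unfolding distr_shift_gauss[OF assms(1)] by (subst integral_density) auto
  finally show ?thesis .
qed

text \<open>The density of the shift by \<open>s *\<^sub>R a\<close> has total mass one; solving
  this equation for the exponential moment gives its value.\<close>

lemma gauss_mgf_nn:
  fixes a :: "'a::euclidean_space"
  assumes "s > 0"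
  shows "(\<integral>\<^sup>+x. ennreal (exp (x \<bullet> a)) \<partial>gauss s) = ennreal (exp (s * (norm a)\<^sup>2 / 2))"
proof -
  interpret prob_space "gauss s :: 'a measure" by (rule prob_space_gauss) fact
  have "prob_space (distr (gauss s) borel (\<lambda>x. x + s *\<^sub>R a))"
    by (rule prob_space_distr) auto
  then have "emeasure (distr (gauss s) borel (\<lambda>x. x + s *\<^sub>R a)) UNIV = 1"
    using prob_space.emeasure_space_1 by fastforce
  then have "(\<integral>\<^sup>+x. ennreal (exp ((x \<bullet> (s *\<^sub>R a)) / s - (norm (s *\<^sub>R a))\<^sup>2 / (2 * s))) \<partial>gauss s) = 1"
    unfolding distr_shift_gauss[OF assms] by (simp add: emeasure_density)
  also have "(\<lambda>x. ennreal (exp ((x \<bullet> (s *\<^sub>R a)) / s - (norm (s *\<^sub>R a))\<^sup>2 / (2 * s))))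
     = (\<lambda>x. ennreal (exp (- (s * (norm a)\<^sup>2 / 2))) * ennreal (exp (x \<bullet> a)))"
    using assms by (auto simp: ennreal_mult''[symmetric] exp_add[symmetric] power_mult_distrib field_simps power2_eq_square fun_eq_iff)
  finally have *: "ennreal (exp (- (s * (norm a)\<^sup>2 / 2))) * (\<integral>\<^sup>+x. ennreal (exp (x \<bullet> a)) \<partial>gauss s) = 1"
    by (subst (asm) nn_integral_cmult) auto
  have "(\<integral>\<^sup>+x. ennreal (exp (x \<bullet> a)) \<partial>gauss s) = ennreal (exp (s * (norm a)\<^sup>2 / 2)) *
      (ennreal (exp (- (s * (norm a)\<^sup>2 / 2))) * (\<integral>\<^sup>+x. ennreal (exp (x \<bullet> a)) \<partial>gauss s))"
    by (simp add: mult.assoc[symmetric] ennreal_mult''[symmetric] exp_add[symmetric])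
  then show ?thesis unfolding * by simp
qed

lemma gauss_mgf:
  fixes a :: "'a::euclidean_space"
  assumes "s > 0"
  shows "integrable (gauss s) (\<lambda>x. exp (x \<bullet> a))"
    and "(\<integral>x. exp (x \<bullet> a) \<partial>gauss s) = exp (s * (norm a)\<^sup>2 / 2)"
proof -
  have "has_bochner_integral (gauss s) (\<lambda>x. exp (x \<bullet> a)) (exp (s * (norm a)\<^sup>2 / 2))"
    by (rule has_bochner_integral_nn_integral) (auto simp: gauss_mgf_nn[OF assms])
  then show "integrable (gauss s) (\<lambda>x. exp (x \<bullet> a))"
    and "(\<integral>x. exp (x \<bullet> a) \<partial>gauss s) = exp (s * (norm a)\<^sup>2 / 2)"
    by (auto simp: has_bochner_integral_iff)
qed

lemma gauss_integrable_inner: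
  fixes a :: "'a::euclidean_space"
  assumes "s > 0"
  shows "integrable (gauss s) (\<lambda>x. x \<bullet> a)" and "integrable (gauss s) (\<lambda>x. (x \<bullet> a)\<^sup>2)"
proof -
  have i: "integrable (gauss s) (\<lambda>x. exp (x \<bullet> a) + exp (x \<bullet> (- a)))"
    by (intro Bochner_Integration.integrable_add gauss_mgf assms)
  have b1: "\<bar>y\<bar> \<le> exp y + exp (- y)" for y :: real
    using exp_ge_add_one_self[of y] exp_ge_add_one_self[of "-y"] exp_gt_zero[of y] exp_gt_zero[of "-y"]
    by linarith
  have b2: "y\<^sup>2 \<le> 2 * (exp y + exp (- y))" for y :: real
  proof -
    have "y\<^sup>2 \<le> 2 * exp \<bar>y\<bar>"
      using exp_lower_Taylor_quadratic[of "\<bar>y\<bar>"] by (simp add: field_simps)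
    also have "exp \<bar>y\<bar> \<le> exp y + exp (- y)" by (auto simp: abs_if)
    finally show ?thesis by simp
  qed
  show "integrable (gauss s) (\<lambda>x. x \<bullet> a)"
    by (rule Bochner_Integration.integrable_bound[OF i]) (use b1[of "_ \<bullet> a"] in auto)
  show "integrable (gauss s) (\<lambda>x. (x \<bullet> a)\<^sup>2)"
    by (rule Bochner_Integration.integrable_bound[OF Bochner_Integration.integrable_mult_right[OF i, of 2]])
       (use b2[of "_ \<bullet> a"] in auto)
qed

text \<open>With e the mean, 1 + r e \<le> exp(r^2 q) holds for every real r, with equality at r =
  0, so the derivatives of both sides agree there.\<close>

lemma gauss_mean:
  fixes a :: "'a::euclidean_space"
  assumes s: "s > 0"
  shows "(\<integral>x. x \<bullet> a \<partial>gauss s) = 0"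
proof -
  interpret prob_space "gauss s :: 'a measure" by (rule prob_space_gauss) fact
  let ?e = "\<integral>x. x \<bullet> a \<partial>gauss s"
  define q where "q = s * (norm a)\<^sup>2 / 2"
  have le: "1 + r * ?e \<le> exp (r\<^sup>2 * q)" for r
  proof -
    have "prob UNIV = 1" using prob_space by simp
    then have "1 + r * ?e = (\<integral>x. 1 + r * (x \<bullet> a) \<partial>gauss s)"
      using gauss_integrable_inner[OF s, of a] by simp
    also have "\<dots> \<le> (\<integral>x. exp (x \<bullet> (r *\<^sub>R a)) \<partial>gauss s)"
      using gauss_integrable_inner[OF s, of a] gauss_mgf(1)[OF s, of "r *\<^sub>R a"] exp_ge_add_one_self
      by (intro integral_mono) (auto simp: inner_scaleR_right)
    finally show ?thesis using gauss_mgf[OF s, of "r *\<^sub>R a"] by (simp add: q_def power_mult_distrib algebra_simps)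
  qed
  have "((\<lambda>r. exp (r\<^sup>2 * q) - (1 + r * ?e)) has_real_derivative (- ?e)) (at 0)"
    by (auto intro!: derivative_eq_intros)
  then have "- ?e = 0"
    by (rule DERIV_local_min[where d = 1]) (use le in auto)
  then show ?thesis by simp
qed

lemma gauss_second_moment:
  fixes a :: "'a::euclidean_space"
  assumes s: "s > 0"
  shows "(\<integral>x. (x \<bullet> a)\<^sup>2 \<partial>gauss s) \<le> s * (norm a)\<^sup>2"
proof -
  interpret prob_space "gauss s :: 'a measure" by (rule prob_space_gauss) fact
  let ?e = "\<integral>x. (x \<bullet> a)\<^sup>2 \<partial>gauss s"
  define q where "q = s * (norm a)\<^sup>2 / 2"
  \<comment> \<open>The remainder of the cubic Taylor expansion is nonnegative. Adding the bounds at
    y and -y cancels the odd terms and leaves y squared with coefficient one, which is what yields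
    the sharp variance.\<close>
  have ch: "y\<^sup>2 \<le> exp y + exp (- y) - 2" for y :: real
  proof -
    have "1 + z + z\<^sup>2/2 + z^3/6 \<le> exp z" for z :: real
    proof -
      obtain t where "exp z = (\<Sum>m<4. z^m / fact m) + (exp t / fact 4) * z ^ 4"
        using Maclaurin_exp_le[of z 4] by blast
      moreover have "(exp t / fact 4) * z ^ 4 \<ge> 0" by (intro mult_nonneg_nonneg) auto
      ultimately show ?thesis by (simp add: eval_nat_numeral)
    qed
    from this[of y] this[of "-y"] show ?thesis by simp
  qed
  have le: "r\<^sup>2 * ?e \<le> 2 * (exp (r\<^sup>2 * q) - 1)" for r
  proof -
    have "r\<^sup>2 * ?e = (\<integral>x. (x \<bullet> (r *\<^sub>R a))\<^sup>2 \<partial>gauss s)"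
      using gauss_integrable_inner[OF s, of a] by (simp add: power_mult_distrib)
    also have "\<dots> \<le> (\<integral>x. exp (x \<bullet> (r *\<^sub>R a)) + exp (x \<bullet> (- (r *\<^sub>R a))) - 2 \<partial>gauss s)"
      using ch
      by (intro integral_mono gauss_integrable_inner[OF s] Bochner_Integration.integrable_diff Bochner_Integration.integrable_add gauss_mgf(1)[OF s]) auto
    also have "\<dots> = 2 * (exp (r\<^sup>2 * q) - 1)"
      using gauss_mgf[OF s, of "r *\<^sub>R a"] gauss_mgf[OF s, of "-(r *\<^sub>R a)"]
      prob_space by (simp add: q_def power_mult_distrib algebra_simps)
    finally show ?thesis .
  qed
  \<comment> \<open>With r the square root of x, \<open>le\<close> bounds half the moment by a
    difference quotient of exp(x q) at 0, whose limit is q.\<close>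
  have "((\<lambda>x. (exp (x * q) - 1) / x) \<longlongrightarrow> q) (at_right 0)"
  proof -
    have "((\<lambda>x. exp (x * q)) has_real_derivative q) (at 0)"
      by (auto intro!: derivative_eq_intros)
    then have "((\<lambda>x. (exp (x * q) - 1) / x) \<longlongrightarrow> q) (at 0)"
      by (simp add: DERIV_def)
    then show ?thesis by (rule filterlim_mono) (auto simp: at_within_le_at)
  qed
  moreover have "eventually (\<lambda>x. ?e / 2 \<le> (exp (x * q) - 1) / x) (at_right (0::real))"
    unfolding eventually_at_right_field
  proof (intro exI[of _ 1] conjI allI impI)
    fix x :: real assume "0 < x"
    then show "?e / 2 \<le> (exp (x * q) - 1) / x" using le[of "sqrt x"] by (simp add: field_simps)
  qed simp
  ultimately have "?e / 2 \<le> q"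
    by (intro tendsto_lowerbound) auto
  then show ?thesis by (simp add: q_def)
qed

text \<open>The mean norm is at most the root of the second moment, summed over coordinates. This is
  the source of the terms \<open>sqrt (2 * real DIM('a) * \<delta>)\<close> in the error
  bounds.\<close>

lemma gauss_norm_moments:
  assumes s: "s > 0"
  shows "integrable (gauss s) (\<lambda>x::'a::euclidean_space. norm x)"
    and "integrable (gauss s) (\<lambda>x::'a. (norm x)\<^sup>2)"
    and "(\<integral>x. norm x \<partial>(gauss s :: 'a measure)) \<le> sqrt (real DIM('a) * s)"
proof -
  interpret prob_space "gauss s :: 'a measure" by (rule prob_space_gauss) fact
  have n: "(norm x)\<^sup>2 = (\<Sum>b\<in>Basis. (x \<bullet> b)\<^sup>2)" for x :: 'a
    unfolding power2_norm_eq_inner by (subst euclidean_inner) (simp add: power2_eq_square)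
  show i2: "integrable (gauss s) (\<lambda>x::'a. (norm x)\<^sup>2)"
    unfolding n by (intro Bochner_Integration.integrable_sum gauss_integrable_inner s)
  show i1: "integrable (gauss s) (\<lambda>x::'a. norm x)"
  proof (rule Bochner_Integration.integrable_bound[OF Bochner_Integration.integrable_add[OF integrable_const[of 1] i2]])
    show "AE x in gauss s. norm (norm (x::'a)) \<le> norm (1 + (norm x)\<^sup>2)"
    proof (rule AE_I2)
      fix x :: 'a
      have "2 * norm x \<le> 1 + (norm x)\<^sup>2" using sum_squares_bound[of "norm x" 1] by simp
      then show "norm (norm x) \<le> norm (1 + (norm x)\<^sup>2)"
        using norm_ge_zero[of x] unfolding real_norm_def by linarith
    qed
  qed simp
  have "(\<integral>x. norm x \<partial>(gauss s :: 'a measure))\<^sup>2 \<le> (\<integral>x. (norm x)\<^sup>2 \<partial>(gauss s :: 'a measure))"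
    using variance_positive[of "norm :: 'a \<Rightarrow> real"] variance_eq[OF i1 i2] by simp
  also have "\<dots> = (\<Sum>b\<in>Basis. \<integral>x. (x \<bullet> b)\<^sup>2 \<partial>(gauss s :: 'a measure))"
    unfolding n by (intro Bochner_Integration.integral_sum gauss_integrable_inner s)
  also have "\<dots> \<le> (\<Sum>b\<in>(Basis::'a set). s)"
  proof (rule sum_mono)
    fix b :: 'a assume "b \<in> Basis"
    then show "(\<integral>x. (x \<bullet> b)\<^sup>2 \<partial>(gauss s :: 'a measure)) \<le> s"
      using gauss_second_moment[OF s, of b] by simp
  qed
  finally show "(\<integral>x. norm x \<partial>(gauss s :: 'a measure)) \<le> sqrt (real DIM('a) * s)"
    by (intro real_le_rsqrt) simp
qed

lemma integrable_bounded_gauss: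
  fixes h :: "'a::euclidean_space \<Rightarrow> 'b::{banach, second_countable_topology}"
  assumes "s > 0" "h \<in> borel_measurable borel" "\<And>x. norm (h x) \<le> K"
  shows "integrable (gauss s) h"
proof -
  interpret prob_space "gauss s :: 'a measure" by (rule prob_space_gauss) fact
  show ?thesis by (rule integrable_const_bound[where B = K]) (use assms in auto)
qed

section \<open>Gradients of Gaussian averages and the cost of a shift\<close>

lemma grad_eqI:
  assumes "GDERIV f x :> D"
  shows "grad f x = D"
  unfolding grad_def
proof (rule the_equality)
  fix D' assume "GDERIV f x :> D'"
  then have "(\<lambda>h. h \<bullet> D') = (\<lambda>h. h \<bullet> D)"
    using assms unfolding gderiv_def by (metis has_derivative_unique)
  then show "D' = D" by (metis inner_commute vector_eq_ldot)
qed (rule assms)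

text \<open>
  A smoothed bounded function obeys \<open>\<bar>\<nabla>u\<bar>\<^sup>2 \<le> Var h / s\<close>, by Cauchy-Schwarz applied to Stein's
  formula for the gradient; \<open>h\<close> itself need not be differentiable.
\<close>
lemma gauss_smoothing:
  fixes h :: "'a::euclidean_space \<Rightarrow> real"
  assumes s: "s > 0" and h [measurable]: "h \<in> borel_measurable borel" and K: "\<And>x. \<bar>h x\<bar> \<le> K"
  defines "u \<equiv> \<lambda>x. \<integral>w. h (x + w) \<partial>gauss s"
    and "D \<equiv> \<lambda>x. (1 / s) *\<^sub>R (\<integral>w. h (x + w) *\<^sub>R w \<partial>gauss s)"
  shows "GDERIV u x :> D x"
    and "s * (norm (D x))\<^sup>2 \<le> (\<integral>w. (h (x + w))\<^sup>2 \<partial>gauss s) - (u x)\<^sup>2"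
    and "C-lipschitz_on UNIV h \<Longrightarrow> continuous_on UNIV D"
proof -
  interpret prob_space "gauss s :: 'a measure" by (rule prob_space_gauss) fact
  have K0: "K \<ge> 0" using K[of 0] by linarith
  have iw: "integrable (gauss s) (\<lambda>w::'a. norm w)" by (rule gauss_norm_moments[OF s])
  have ihw: "integrable (gauss s) (\<lambda>w. f w *\<^sub>R w)"
    if [measurable]: "f \<in> borel_measurable borel" and "\<And>w. \<bar>f w\<bar> \<le> K" for f :: "'a \<Rightarrow> real" and K
    by (rule Bochner_Integration.integrable_bound[OF Bochner_Integration.integrable_mult_right[OF iw, of K]])
       (use that in \<open>auto intro!: AE_I2 mult_right_mono simp: abs_mult\<close>,
        metis abs_ge_self order_trans mult_right_mono norm_ge_zero)
  have Dv: "D x \<bullet> v = (\<integral>w. h (x + w) * (w \<bullet> v) \<partial>gauss s) / s" for x v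
  proof -
    have "(\<integral>w. h (x + w) *\<^sub>R w \<partial>gauss s) \<bullet> v = (\<integral>w. (h (x + w) *\<^sub>R w) \<bullet> v \<partial>gauss s)"
      using integral_inner_left[OF ihw[of "\<lambda>w. h (x + w)" K]] K by simp
    then show ?thesis by (simp add: D_def)
  qed
  \<comment> \<open>The increment of u is an integral of h against the shift density minus its
    first-order part. Domination by an explicitly integrable function gives a quadratic remainder
    that depends on h only through its bound K.\<close>
  have rem: "\<bar>u (x + v) - u x - v \<bullet> D x\<bar> \<le> K / s * (norm v)\<^sup>2" for x v
  proof -
    let ?e = "\<lambda>w. exp ((w \<bullet> v) / s - (norm v)\<^sup>2 / (2 * s))"
    let ?t = "(norm v)\<^sup>2 / (2 * s)"
    have eeq: "?e w = exp (- ?t) * exp (w \<bullet> ((1/s) *\<^sub>R v))" for w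
      by (simp add: exp_add[symmetric])
    have ie: "integrable (gauss s) ?e"
      unfolding eeq by (intro Bochner_Integration.integrable_mult_right gauss_mgf s)
    have inte: "(\<integral>w. ?e w \<partial>gauss s) = 1"
    proof -
      have "(\<integral>w. ?e w \<partial>gauss s) = exp (- ?t) * exp (s * (norm ((1/s) *\<^sub>R v))\<^sup>2 / 2)"
        unfolding eeq by (subst integral_mult_right_zero) (simp only: gauss_mgf(2)[OF s])
      also have "s * (norm ((1/s) *\<^sub>R v))\<^sup>2 / 2 = ?t"
        using s by (simp add: power_divide power2_eq_square)
      finally show ?thesis by (simp add: exp_add[symmetric])
    qed
    have iwv: "integrable (gauss s) (\<lambda>w. (w \<bullet> v) / s)"
      using gauss_integrable_inner(1)[OF s, of v] by simp
    have ih: "integrable (gauss s) (\<lambda>w. h (x + w))"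
      by (rule integrable_bounded_gauss[OF s, of _ K]) (use K in auto)
    have ihe: "integrable (gauss s) (\<lambda>w. ?e w * h (x + w))"
      by (rule Bochner_Integration.integrable_bound[OF Bochner_Integration.integrable_mult_right[OF ie, of K]])
         (use K K0 in \<open>auto intro!: AE_I2 simp: abs_mult mult.commute mult_right_mono\<close>)
    have ihv: "integrable (gauss s) (\<lambda>w. h (x + w) * ((w \<bullet> v) / s))"
      by (rule Bochner_Integration.integrable_bound[OF Bochner_Integration.integrable_mult_right[OF iwv, of K]])
         (use K K0 in \<open>auto intro!: AE_I2 divide_right_mono mult_right_mono simp: abs_mult\<close>)
    have "u (x + v) = (\<integral>w. h (x + (w + v)) \<partial>gauss s)" by (simp add: u_def algebra_simps)
    also have "\<dots> = (\<integral>w. ?e w * h (x + w) \<partial>gauss s)"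
      by (rule integral_shift_gauss[OF s, of "\<lambda>w. h (x + w)"]) simp
    finally have ueq: "u (x + v) - u x - v \<bullet> D x =
        (\<integral>w. ?e w * h (x + w) - h (x + w) - h (x + w) * ((w \<bullet> v) / s) \<partial>gauss s)"
      using ihe ih ihv by (simp add: inner_commute[of v] Dv u_def)
    have "\<bar>u (x + v) - u x - v \<bullet> D x\<bar> \<le> (\<integral>w. K * (?e w - 1 - (w \<bullet> v) / s + 2 * ?t) \<partial>gauss s)"
      unfolding ueq
    proof (rule integral_abs_bound_integral)
      show "integrable (gauss s) (\<lambda>w. ?e w * h (x + w) - h (x + w) - h (x + w) * ((w \<bullet> v) / s))"
        using ihe ih ihv by auto
      show "integrable (gauss s) (\<lambda>w. K * (?e w - 1 - (w \<bullet> v) / s + 2 * ?t))"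
        using ie iwv by auto
      fix w :: 'a
      \<comment> \<open>The remainder is at least \<open>- ?t\<close>, hence its absolute value is
        at most itself plus \<open>2 * ?t\<close>. Its mean is zero, so the dominating function has
        integral exactly \<open>K * (2 * ?t)\<close>.\<close>
      have "?e w \<ge> 1 + ((w \<bullet> v) / s - ?t)" by (rule exp_ge_add_one_self)
      moreover have "?t \<ge> 0" using s by simp
      ultimately have "\<bar>?e w - 1 - (w \<bullet> v) / s\<bar> \<le> ?e w - 1 - (w \<bullet> v) / s + 2 * ?t"
        unfolding abs_le_iff by linarith
      then have "\<bar>h (x + w)\<bar> * \<bar>?e w - 1 - (w \<bullet> v) / s\<bar> \<le> K * (?e w - 1 - (w \<bullet> v) / s + 2 * ?t)"
        by (intro mult_mono K K0) auto
      then show "\<bar>?e w * h (x + w) - h (x + w) - h (x + w) * ((w \<bullet> v) / s)\<bar> \<le> K * (?e w - 1 - (w \<bullet> v) / s + 2 * ?t)"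
        unfolding abs_mult[symmetric] by (simp add: algebra_simps)
    qed
    also have "\<dots> = K * (1 - 1 - 0 + 2 * ?t)"
    proof -
      have gen: "(\<integral>w. K * (e w - 1 - q w + c) \<partial>gauss s) = K * ((\<integral>w. e w \<partial>gauss s) - 1 - (\<integral>w. q w \<partial>gauss s) + c)"
        if "integrable (gauss s) e" "integrable (gauss s) q" for e q :: "'a \<Rightarrow> real" and c
        using that prob_space by simp
      show ?thesis unfolding gen[OF ie iwv] inte by (simp add: gauss_mean[OF s])
    qed
    finally show ?thesis using s by simp
  qed
  show "GDERIV u x :> D x"
    unfolding gderiv_def has_derivative_at
  proof
    show "bounded_linear (\<lambda>h. h \<bullet> D x)" by (rule bounded_linear_inner_left)
    show "(\<lambda>v. norm (u (x + v) - u x - v \<bullet> D x) / norm v) \<midarrow>0\<rightarrow> 0"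
    proof (rule Lim_null_comparison)
      show "eventually (\<lambda>v. norm (norm (u (x + v) - u x - v \<bullet> D x) / norm v) \<le> K / s * norm v) (at 0)"
        unfolding eventually_at
      proof (intro exI[of _ 1] conjI ballI impI)
        fix v :: 'a assume v: "v \<noteq> 0 \<and> dist v 0 < 1"
        then have "\<bar>u (x + v) - u x - v \<bullet> D x\<bar> / norm v \<le> (K / s * (norm v)\<^sup>2) / norm v"
          by (intro divide_right_mono rem) auto
        then show "norm (norm (u (x + v) - u x - v \<bullet> D x) / norm v) \<le> K / s * norm v"
          using v by (simp add: power2_eq_square)
      qed simp
      show "(\<lambda>v. K / s * norm v) \<midarrow>0\<rightarrow> 0" by (intro tendsto_eq_intros) auto
    qed
  qed
  show "s * (norm (D x))\<^sup>2 \<le> (\<integral>w. (h (x + w))\<^sup>2 \<partial>gauss s) - (u x)\<^sup>2"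
  proof -
    let ?g = "\<lambda>w. h (x + w) - u x"
    have ih: "integrable (gauss s) (\<lambda>w. h (x + w))"
      by (rule integrable_bounded_gauss[OF s, of _ K]) (use K in auto)
    have ih2: "integrable (gauss s) (\<lambda>w. (h (x + w))\<^sup>2)"
      by (rule integrable_bounded_gauss[OF s, of _ "K\<^sup>2"]) (use power_mono[OF K, of _ 2] in auto)
    have V: "(\<integral>w. (?g w)\<^sup>2 \<partial>gauss s) = (\<integral>w. (h (x + w))\<^sup>2 \<partial>gauss s) - (u x)\<^sup>2"
      unfolding u_def by (rule variance_eq[OF ih ih2])
    have gb: "\<bar>?g w\<bar> \<le> K + \<bar>u x\<bar>" for w using K[of "x + w"] by linarith
    have ig2: "integrable (gauss s) (\<lambda>w. (?g w)\<^sup>2)"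
      by (rule integrable_bounded_gauss[OF s, of _ "(K + \<bar>u x\<bar>)\<^sup>2"]) (use power_mono[OF gb, of _ 2] in auto)
    have iv: "integrable (gauss s) (\<lambda>w. w \<bullet> D x)" "integrable (gauss s) (\<lambda>w. (w \<bullet> D x)\<^sup>2)"
      by (rule gauss_integrable_inner[OF s])+
    have ig: "integrable (gauss s) (\<lambda>w. ?g w * (w \<bullet> D x))"
      by (rule Bochner_Integration.integrable_bound[OF Bochner_Integration.integrable_mult_right[OF iv(1), of "K + \<bar>u x\<bar>"]])
         (use gb K0 in \<open>auto intro!: AE_I2 mult_right_mono simp: abs_mult\<close>)
    have ihv: "integrable (gauss s) (\<lambda>w. h (x + w) * (w \<bullet> D x))"
      by (rule Bochner_Integration.integrable_bound[OF Bochner_Integration.integrable_mult_right[OF iv(1), of K]])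
         (use K K0 in \<open>auto intro!: AE_I2 mult_right_mono simp: abs_mult\<close>)
    \<comment> \<open>Stein's formula tested against \<open>D x\<close> itself. Subtracting the
      constant \<open>u x\<close> from h is free because w has mean zero, and it turns the second
      moment into a variance.\<close>
    have eq: "s * (norm (D x))\<^sup>2 = (\<integral>w. ?g w * (w \<bullet> D x) \<partial>gauss s)"
    proof -
      have "(\<integral>w. ?g w * (w \<bullet> D x) \<partial>gauss s) = (\<integral>w. h (x + w) * (w \<bullet> D x) \<partial>gauss s)"
        using ihv iv gauss_mean[OF s, of "D x"] by (simp add: left_diff_distrib)
      then show ?thesis using Dv[of x "D x"] s by (simp add: power2_norm_eq_inner field_simps)
    qed
    \<comment> \<open>AM-GM: \<open>2 g a \<le> g\<^sup>2 + a\<^sup>2\<close>\<close>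
    have "2 * (s * (norm (D x))\<^sup>2) \<le> (\<integral>w. (?g w)\<^sup>2 + (w \<bullet> D x)\<^sup>2 \<partial>gauss s)"
      unfolding eq integral_mult_right_zero[symmetric]
    proof (rule integral_mono)
      show "2 * (?g w * (w \<bullet> D x)) \<le> (?g w)\<^sup>2 + (w \<bullet> D x)\<^sup>2" for w
        using sum_squares_bound[of "?g w" "w \<bullet> D x"] by (simp only: mult.assoc)
    qed (intro Bochner_Integration.integrable_mult_right Bochner_Integration.integrable_add ig ig2 iv)+
    also have "\<dots> \<le> (\<integral>w. (?g w)\<^sup>2 \<partial>gauss s) + s * (norm (D x))\<^sup>2"
      using ig2 iv gauss_second_moment[OF s, of "D x"] by simp
    finally show ?thesis unfolding V by simp
  qed
  \<comment> \<open>The gradient inherits the Lipschitz constant of h up to the factor E|w| / s.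
    Continuity of the gradient is demanded of the test functions in
    \<open>log_sobolev\<close>.\<close>
  show "continuous_on UNIV D" if L: "C-lipschitz_on UNIV h"
  proof -
    let ?m = "\<integral>w. norm w \<partial>(gauss s :: 'a measure)"
    have "norm (D x - D y) \<le> (C * ?m / s) * dist x y" for x y
    proof -
      have "D x - D y = (1 / s) *\<^sub>R (\<integral>w. (h (x + w) - h (y + w)) *\<^sub>R w \<partial>gauss s)"
        using ihw[of "\<lambda>w. h (x + w)" K] ihw[of "\<lambda>w. h (y + w)" K] K
        by (simp add: D_def scaleR_diff_left scaleR_diff_right[symmetric])
      moreover have "norm (\<integral>w. (h (x + w) - h (y + w)) *\<^sub>R w \<partial>gauss s) \<le> (\<integral>w. C * dist x y * norm w \<partial>(gauss s :: 'a measure))"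
      proof (rule order_trans[OF integral_norm_bound integral_mono])
        show "integrable (gauss s) (\<lambda>w. norm ((h (x + w) - h (y + w)) *\<^sub>R w))"
          using ihw[of "\<lambda>w. h (x + w)" K] ihw[of "\<lambda>w. h (y + w)" K] K by (intro integrable_norm) (simp add: scaleR_diff_left)
        show "integrable (gauss s) (\<lambda>w::'a. C * dist x y * norm w)" using iw by auto
        show "norm ((h (x + w) - h (y + w)) *\<^sub>R w) \<le> C * dist x y * norm w" for w
          using lipschitz_onD[OF L, of "x + w" "y + w"] by (auto intro!: mult_right_mono simp: dist_real_def)
      qed
      ultimately show ?thesis using s by (simp add: field_simps)
    qed
    then have "(C * ?m / s)-lipschitz_on UNIV D"
      using s lipschitz_on_nonneg[OF L]
      by (intro lipschitz_onI) (auto simp: dist_norm intro!: divide_nonneg_nonneg mult_nonneg_nonneg integral_nonneg_AE)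
    then show ?thesis by (rule lipschitz_on_continuous_on)
  qed
qed

text \<open>Gibbs' variational inequality: the Gaussian shifted by y has relative entropy |y|^2 / (2
  s) with respect to the centred one. This is the price of the additional drift on one cell.\<close>

lemma gauss_shift_le_log_exp:
  fixes h :: "'a::euclidean_space \<Rightarrow> real"
  assumes s: "s > 0" and h [measurable]: "h \<in> borel_measurable borel" and K: "\<And>x. \<bar>h x\<bar> \<le> K"
  shows "(\<integral>w. h (y + w) \<partial>gauss s) \<le> ln (\<integral>w. exp (h w) \<partial>gauss s) + (norm y)\<^sup>2 / (2 * s)"
proof -
  interpret prob_space "gauss s :: 'a measure" by (rule prob_space_gauss) fact
  \<comment> \<open>\<open>exp (?z w)\<close> is \<open>exp (h (w + y))\<close> times the density of
    the shift by -y, so its mean is that of \<open>exp (h w)\<close>. The mean of \<open>?z\<close>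
    is \<open>?m\<close>, and Jensen's inequality, via the tangent of exp at \<open>?m\<close>,
    concludes.\<close>
  let ?z = "\<lambda>w. h (w + y) - (w \<bullet> y) / s - (norm y)\<^sup>2 / (2 * s)"
  let ?m = "(\<integral>w. h (y + w) \<partial>gauss s) - (norm y)\<^sup>2 / (2 * s)"
  have ie: "integrable (gauss s) (\<lambda>w. exp (w \<bullet> (- (1/s) *\<^sub>R y)))" by (rule gauss_mgf[OF s])
  have zeq: "exp (?z w) = exp (h (w + y)) * (exp (- (norm y)\<^sup>2 / (2 * s)) * exp (w \<bullet> (- (1/s) *\<^sub>R y)))" for w
    by (simp add: exp_add[symmetric])
  have iez: "integrable (gauss s) (\<lambda>w. exp (?z w))"
    unfolding zeq
  proof (rule Bochner_Integration.integrable_bound)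
    show "integrable (gauss s) (\<lambda>w. exp K * (exp (- (norm y)\<^sup>2 / (2 * s)) * exp (w \<bullet> (- (1/s) *\<^sub>R y))))"
      using ie by (intro Bochner_Integration.integrable_mult_right)
    show "AE w in gauss s. norm (exp (h (w + y)) * (exp (- (norm y)\<^sup>2 / (2 * s)) * exp (w \<bullet> (- (1/s) *\<^sub>R y))))
       \<le> norm (exp K * (exp (- (norm y)\<^sup>2 / (2 * s)) * exp (w \<bullet> (- (1/s) *\<^sub>R y))))"
      using K by (intro AE_I2) (simp add: abs_mult abs_le_iff)
  qed simp
  have ih: "integrable (gauss s) (\<lambda>w. h (y + w))"
    by (rule integrable_bounded_gauss[OF s, of _ K]) (use K in auto)
  then have iz: "integrable (gauss s) ?z" and mz: "(\<integral>w. ?z w \<partial>gauss s) = ?m"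
    using gauss_integrable_inner(1)[OF s, of y] gauss_mean[OF s, of y] prob_space by (auto simp: add.commute)
  have "exp ?m = (\<integral>w. exp ?m * (1 + (?z w - ?m)) \<partial>gauss s)"
  proof -
    have gen: "(\<integral>w. c * (1 + (z w - c')) \<partial>gauss s) = c * (1 + ((\<integral>w. z w \<partial>gauss s) - c'))"
      if "integrable (gauss s) z" for z :: "'a \<Rightarrow> real" and c c'
      using that prob_space by simp
    show ?thesis unfolding gen[OF iz] mz by simp
  qed
  also have "\<dots> \<le> (\<integral>w. exp (?z w) \<partial>gauss s)"
  proof (rule integral_mono)
    show "exp ?m * (1 + (?z w - ?m)) \<le> exp (?z w)" for w
    proof -
      have "exp ?m * (1 + (?z w - ?m)) \<le> exp ?m * exp (?z w - ?m)"
        by (intro mult_left_mono exp_ge_add_one_self) auto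
      then show ?thesis by (simp add: exp_add[symmetric])
    qed
  qed (intro Bochner_Integration.integrable_mult_right Bochner_Integration.integrable_add Bochner_Integration.integrable_diff integrable_const iz iez)+
  also have "\<dots> = (\<integral>w. exp (h w) \<partial>gauss s)"
    using integral_shift_gauss[OF s, of "\<lambda>w. exp (h (w + y))" "- y"]
    by (simp add: exp_add[symmetric] algebra_simps)
  finally have "exp ?m \<le> (\<integral>w. exp (h w) \<partial>gauss s)" .
  then have "?m \<le> ln (\<integral>w. exp (h w) \<partial>gauss s)"
    by (metis exp_gt_zero exp_le_cancel_iff exp_ln less_le_trans)
  then show ?thesis by simp
qed

text \<open>The noise precedes the map \<Phi>. The exponential of the step is then a Gaussian
  average of \<open>exp (l (\<Phi> x))\<close>, to which \<open>gauss_smoothing\<close> applies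
  although \<Phi> and l are only Lipschitz.\<close>

definition log_step :: "('a::euclidean_space \<Rightarrow> 'a) \<Rightarrow> real \<Rightarrow> ('a \<Rightarrow> real) \<Rightarrow> 'a \<Rightarrow> real" where
  "log_step \<Phi> s l x = ln (\<integral>w. exp (l (\<Phi> (x + w))) \<partial>gauss s)"

lemma exp_log_step:
  assumes s: "s > 0" and [measurable]: "\<Phi> \<in> borel_measurable borel" "l \<in> borel_measurable borel"
    and K: "\<And>x. \<bar>l x\<bar> \<le> K"
  shows "exp (log_step \<Phi> s l x) = (\<integral>w. exp (l (\<Phi> (x + w))) \<partial>gauss s)"
    and "\<bar>log_step \<Phi> s l x\<bar> \<le> K"
proof -
  interpret prob_space "gauss s :: 'a measure" by (rule prob_space_gauss) fact
  have i: "integrable (gauss s) (\<lambda>w. exp (l (\<Phi> (x + w))))"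
    by (rule integrable_bounded_gauss[OF s, of _ "exp K"]) (use K in \<open>auto simp: abs_le_iff\<close>)
  have K': "l y \<le> K" "- K \<le> l y" for y using K[of y] by auto
  have "exp (- K) \<le> (\<integral>w. exp (l (\<Phi> (x + w))) \<partial>gauss s)"
    using integral_mono[of "gauss s" "\<lambda>_. exp (- K)" "\<lambda>w. exp (l (\<Phi> (x + w)))"] i K' prob_space by simp
  moreover have "(\<integral>w. exp (l (\<Phi> (x + w))) \<partial>gauss s) \<le> exp K"
    using integral_mono[of "gauss s" "\<lambda>w. exp (l (\<Phi> (x + w)))" "\<lambda>_. exp K"] i K' prob_space by simp
  moreover have p: "(\<integral>w. exp (l (\<Phi> (x + w))) \<partial>gauss s) > 0"
    using calculation(1) exp_gt_zero[of "- K"] by linarith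
  ultimately show "\<bar>log_step \<Phi> s l x\<bar> \<le> K"
    unfolding log_step_def abs_le_iff by (metis exp_le_cancel_iff exp_ln minus_le_iff)
  show "exp (log_step \<Phi> s l x) = (\<integral>w. exp (l (\<Phi> (x + w))) \<partial>gauss s)"
    using p by (simp add: log_step_def)
qed

text \<open>Averaging costs nothing: a pointwise bound on the ratio of two integrands passes to the
  integrals, hence to the difference of the logarithms, whatever s is.\<close>

lemma log_step_lipschitz:
  assumes s: "s > 0" and \<Phi>: "\<rho>-lipschitz_on UNIV \<Phi>" and l: "\<Lambda>-lipschitz_on UNIV l"
    and K: "\<And>x. \<bar>l x\<bar> \<le> K"
  shows "(\<Lambda> * \<rho>)-lipschitz_on UNIV (log_step \<Phi> s l)"
proof (rule lipschitz_onI)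
  have [measurable]: "\<Phi> \<in> borel_measurable borel" "l \<in> borel_measurable borel"
    using \<Phi> l by (auto intro!: borel_measurable_continuous_onI lipschitz_on_continuous_on)
  note e = exp_log_step[OF s _ _ K]
  have i: "integrable (gauss s) (\<lambda>w. exp (l (\<Phi> (x + w))))" for x
    by (rule integrable_bounded_gauss[OF s, of _ "exp K"]) (use K in \<open>auto simp: abs_le_iff\<close>)
  have le: "log_step \<Phi> s l x \<le> log_step \<Phi> s l y + \<Lambda> * \<rho> * dist x y" for x y
  proof -
    have "exp (l (\<Phi> (x + w))) \<le> exp (l (\<Phi> (y + w))) * exp (\<Lambda> * \<rho> * dist x y)" for w
    proof -
      have "\<bar>l (\<Phi> (x + w)) - l (\<Phi> (y + w))\<bar> \<le> \<Lambda> * dist (\<Phi> (x + w)) (\<Phi> (y + w))"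
        using lipschitz_onD[OF l, of "\<Phi> (x + w)" "\<Phi> (y + w)"] by (simp add: dist_real_def)
      also have "\<dots> \<le> \<Lambda> * (\<rho> * dist (x + w) (y + w))"
        using lipschitz_on_nonneg[OF l] lipschitz_onD[OF \<Phi>, of "x + w" "y + w"] by (intro mult_left_mono) auto
      finally show ?thesis by (simp add: exp_add[symmetric] mult.assoc)
    qed
    then have "(\<integral>w. exp (l (\<Phi> (x + w))) \<partial>gauss s) \<le> (\<integral>w. exp (l (\<Phi> (y + w))) * exp (\<Lambda> * \<rho> * dist x y) \<partial>gauss s)"
      by (intro integral_mono i) (auto intro: i)
    then have "exp (log_step \<Phi> s l x) \<le> exp (log_step \<Phi> s l y) * exp (\<Lambda> * \<rho> * dist x y)"
      by (simp add: e(1))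
    then show ?thesis by (simp add: exp_add[symmetric])
  qed
  show "dist (log_step \<Phi> s l x) (log_step \<Phi> s l y) \<le> \<Lambda> * \<rho> * dist x y" for x y
    using le[of x y] le[of y x] by (auto simp: dist_real_def dist_commute abs_le_iff)
  show "0 \<le> \<Lambda> * \<rho>" using lipschitz_on_nonneg[OF \<Phi>] lipschitz_on_nonneg[OF l] by simp
qed

text \<open>Independence enters as a product law, the form that \<open>noise_law\<close> provides,
  and \<open>N\<close> is integrated out by Fubini's theorem. \<open>G\<close> may itself be a
  pair.\<close>

lemma (in prob_space) expectation_indep_gauss:
  fixes H :: "'b \<times> 'c::euclidean_space \<Rightarrow> real"
  assumes s: "s > 0"
    and [measurable]: "G \<in> measurable M S" "N \<in> borel_measurable M" "H \<in> borel_measurable (S \<Otimes>\<^sub>M borel)"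
    and law: "distr M (S \<Otimes>\<^sub>M borel) (\<lambda>\<omega>. (G \<omega>, N \<omega>)) = distr M S G \<Otimes>\<^sub>M gauss s"
    and K: "\<And>x. \<bar>H x\<bar> \<le> K"
  shows "(\<integral>\<omega>. H (G \<omega>, N \<omega>) \<partial>M) = (\<integral>\<omega>. (\<integral>w. H (G \<omega>, w) \<partial>gauss s) \<partial>M)"
proof -
  interpret G: prob_space "gauss s :: 'c measure" by (rule prob_space_gauss) fact
  interpret D: prob_space "distr M S G" by (rule prob_space_distr) simp
  interpret P: pair_prob_space "distr M S G" "gauss s :: 'c measure" ..
  have "(\<integral>\<omega>. H (G \<omega>, N \<omega>) \<partial>M) = (\<integral>z. H z \<partial>(distr M (S \<Otimes>\<^sub>M borel) (\<lambda>\<omega>. (G \<omega>, N \<omega>))))"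
    by (subst integral_distr) auto
  also have "\<dots> = (\<integral>x. (\<integral>w. H (x, w) \<partial>gauss s) \<partial>distr M S G)"
    unfolding law by (rule P.integral_fst'[symmetric], rule P.integrable_const_bound[where B = K]) (use K in auto)
  also have "\<dots> = (\<integral>\<omega>. (\<integral>w. H (G \<omega>, w) \<partial>gauss s) \<partial>M)"
    by (subst integral_distr) auto
  finally show ?thesis .
qed

text \<open>The pair of \<open>A\<close> and \<open>V\<close> is independent of the Gaussian
  increment. Given this pair, \<open>V\<close> is a constant shift, so the inequality for shifts
  applies pointwise and is then averaged.\<close>

lemma (in prob_space) drift_step:
  assumes s: "s > 0"
    and [measurable]: "A \<in> borel_measurable M" "V \<in> borel_measurable M" "N \<in> borel_measurable M"
      "\<Phi> \<in> borel_measurable borel" "l \<in> borel_measurable borel"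
    and law: "distr M ((borel \<Otimes>\<^sub>M borel) \<Otimes>\<^sub>M borel) (\<lambda>\<omega>. ((A \<omega>, V \<omega>), N \<omega>))
      = distr M (borel \<Otimes>\<^sub>M borel) (\<lambda>\<omega>. (A \<omega>, V \<omega>)) \<Otimes>\<^sub>M gauss s"
    and K: "\<And>x. \<bar>l x\<bar> \<le> K" and V2: "integrable M (\<lambda>\<omega>. (norm (V \<omega>))\<^sup>2)"
  shows "(\<integral>\<omega>. l (\<Phi> (A \<omega> + V \<omega> + N \<omega>)) \<partial>M)
    \<le> (\<integral>\<omega>. log_step \<Phi> s l (A \<omega>) \<partial>M) + (\<integral>\<omega>. (norm (V \<omega>))\<^sup>2 \<partial>M) / (2 * s)"
proof -
  interpret G: prob_space "gauss s :: 'b measure" by (rule prob_space_gauss) fact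
  have [measurable]: "log_step \<Phi> s l \<in> borel_measurable borel"
    unfolding log_step_def by measurable
  have lb: "\<bar>log_step \<Phi> s l x\<bar> \<le> K" for x by (rule exp_log_step(2)[OF s _ _ K]) simp_all
  have i1: "integrable M (\<lambda>\<omega>. log_step \<Phi> s l (A \<omega>))"
    by (rule integrable_const_bound[where B = K]) (use lb in auto)
  have b: "\<bar>\<integral>w. l (\<Phi> (x + w)) \<partial>gauss s\<bar> \<le> K" for x
    by (rule order_trans[OF integral_abs_bound], rule G.integral_le_const)
       (use K in \<open>auto intro!: integrable_bounded_gauss[OF s, of _ K]\<close>)
  have "(\<integral>\<omega>. l (\<Phi> (A \<omega> + V \<omega> + N \<omega>)) \<partial>M) = (\<integral>\<omega>. (\<integral>w. l (\<Phi> (A \<omega> + V \<omega> + w)) \<partial>gauss s) \<partial>M)"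
    using expectation_indep_gauss[OF s _ _ _ law, of "\<lambda>z. l (\<Phi> (fst (fst z) + snd (fst z) + snd z))" K] K by simp
  also have "\<dots> \<le> (\<integral>\<omega>. log_step \<Phi> s l (A \<omega>) + (norm (V \<omega>))\<^sup>2 / (2 * s) \<partial>M)"
  proof (rule integral_mono)
    show "integrable M (\<lambda>\<omega>. \<integral>w. l (\<Phi> (A \<omega> + V \<omega> + w)) \<partial>gauss s)"
      by (rule integrable_const_bound[where B = K]) (use b in auto)
    show "integrable M (\<lambda>\<omega>. log_step \<Phi> s l (A \<omega>) + (norm (V \<omega>))\<^sup>2 / (2 * s))" using i1 V2 by auto
    show "(\<integral>w. l (\<Phi> (A \<omega> + V \<omega> + w)) \<partial>gauss s) \<le> log_step \<Phi> s l (A \<omega>) + (norm (V \<omega>))\<^sup>2 / (2 * s)" for \<omega>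
      using gauss_shift_le_log_exp[OF s, of "\<lambda>w. l (\<Phi> (A \<omega> + w))" K "V \<omega>"] K
      by (simp add: log_step_def add.assoc)
  qed
  also have "\<dots> = (\<integral>\<omega>. log_step \<Phi> s l (A \<omega>) \<partial>M) + (\<integral>\<omega>. (norm (V \<omega>))\<^sup>2 \<partial>M) / (2 * s)"
    using i1 V2 by simp
  finally show ?thesis .
qed

text \<open>The infimum in \<open>C_LS\<close> need not be attained a priori, so an admissible
  constant slightly above it is used and the excess tends to zero. The rate multiplies the left-hand
  side, which keeps vanishing and infinite \<open>C_LS\<close> in one statement.\<close>

lemma C_LS_inequality:
  fixes f :: "'a::euclidean_space \<Rightarrow> real"
  assumes g: "0 \<le> g" "ennreal g \<le> inverse (C_LS \<mu>)"
    and f: "\<And>x. f differentiable (at x)" "continuous_on UNIV (grad f)"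
      "integrable \<mu> (\<lambda>x. (f x)\<^sup>2)" "integrable \<mu> (\<lambda>x. (norm (grad f x))\<^sup>2)"
  shows "g * (\<integral>x. (f x)\<^sup>2 * ln ((f x)\<^sup>2 / (\<integral>y. (f y)\<^sup>2 \<partial>\<mu>)) \<partial>\<mu>)
    \<le> 2 * (\<integral>x. (norm (grad f x))\<^sup>2 \<partial>\<mu>)"
proof (cases "g = 0")
  case False
  let ?E = "\<integral>x. (f x)\<^sup>2 * ln ((f x)\<^sup>2 / (\<integral>y. (f y)\<^sup>2 \<partial>\<mu>)) \<partial>\<mu>"
  let ?I = "\<integral>x. (norm (grad f x))\<^sup>2 \<partial>\<mu>"
  have g0: "g > 0" using False g by simp
  have I0: "?I \<ge> 0" by simp
  have "ennreal g * C_LS \<mu> \<le> inverse (C_LS \<mu>) * C_LS \<mu>" by (intro mult_right_mono g) simp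
  also have "\<dots> \<le> 1" by (cases "C_LS \<mu>" rule: ennreal_cases; cases "C_LS \<mu> = 0")
     (auto simp: ennreal_inverse_mult mult.commute divide_ennreal_def[symmetric] ennreal_top_mult)
  finally have "ennreal g * C_LS \<mu> \<le> 1" .
  then have "C_LS \<mu> \<le> ennreal (1 / g)"
    using g0 by (cases "C_LS \<mu>" rule: ennreal_cases) (auto simp: ennreal_mult''[symmetric] field_simps ennreal_mult_top top_unique)
  have "?E \<le> 2 * ?I / g + e" if e: "e > 0" for e
  proof -
    \<comment> \<open>The excess \<open>d * (2 * ?I)\<close> stays below e; the 1 in the denominator
      covers a vanishing Dirichlet integral.\<close>
    define d where "d = e / (2 * ?I + 1)"
    have d: "d > 0" using e I0 by (simp add: d_def add_nonneg_pos)
    have "C_LS \<mu> < ennreal (1 / g + d)"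
      using \<open>C_LS \<mu> \<le> ennreal (1 / g)\<close> d g0 by (simp add: ennreal_less_iff order.strict_trans1)
    then obtain C where C: "0 \<le> C" "log_sobolev \<mu> C" "C < 1 / g + d"
      unfolding C_LS_def Inf_less_iff by (auto simp: ennreal_less_iff)
    have "?E \<le> 2 * C * ?I" using C(2) f unfolding log_sobolev_def by blast
    also have "\<dots> \<le> 2 * (1 / g + d) * ?I" using C I0 by (intro mult_right_mono) auto
    also have "\<dots> = 2 * ?I / g + d * (2 * ?I)" by (simp add: algebra_simps)
    also have "d * (2 * ?I) \<le> d * (2 * ?I + 1)" using d by (intro mult_left_mono) auto
    also have "d * (2 * ?I + 1) = e"
    proof -
      have "2 * ?I + 1 \<noteq> 0" using I0 by linarith
      then show ?thesis unfolding d_def by (rule nonzero_eq_divide_eq[THEN iffD1, OF _ refl])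
    qed
    finally show ?thesis by simp
  qed
  then have "?E \<le> 2 * ?I / g" by (rule field_le_epsilon)
  then show ?thesis using g0 by (simp add: field_simps)
qed simp

text \<open>The factor exp(2 K) comes from dividing by a mean of \<open>exp (2 * l x)\<close>, which
  is at least exp(-2 K). The three summands are the coefficients of \<epsilon>^2, of the mean flow
  error, and of \<epsilon> times the sum of both mean distances.\<close>

definition hyper_const :: "real \<Rightarrow> real \<Rightarrow> real" where
  "hyper_const K \<Lambda> = exp (2 * K) * (exp (4 * K) * (16 * K\<^sup>2) + 4 * \<Lambda> * exp (4 * K) + 4 * \<Lambda> * exp (4 * K) * (8 * K + 2))"

section \<open>Elementary estimates and one step of hypercontractivity\<close>

lemma exp_lipschitz_bounded:
  fixes x y :: real
  assumes "x \<le> K" "y \<le> K"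
  shows "\<bar>exp x - exp y\<bar> \<le> exp K * \<bar>x - y\<bar>"
proof -
  have *: "exp b - exp a \<le> exp K * (b - a)" if "a \<le> b" "b \<le> K" for a b :: real
  proof -
    have "exp b * (1 + (a - b)) \<le> exp b * exp (a - b)" by (intro mult_left_mono exp_ge_add_one_self) auto
    then have "exp b - exp a \<le> exp b * (b - a)" by (simp add: exp_diff algebra_simps)
    also have "\<dots> \<le> exp K * (b - a)" using that by (intro mult_right_mono) auto
    finally show ?thesis .
  qed
  show ?thesis using *[of x y] *[of y x] assms by (cases "x \<le> y") (auto simp: abs_if)
qed

text \<open>The mean value theorem for the entropy integrand of a square, on the interval
  [exp(-K), exp K] in which functions with bounded logarithm take their values.\<close>

lemma x_ln_x_lipschitz:
  fixes x y :: real
  assumes "K \<ge> 0" "exp (- K) \<le> x" "x \<le> exp K" "exp (- K) \<le> y" "y \<le> exp K"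
  shows "\<bar>x\<^sup>2 * ln (x\<^sup>2) - y\<^sup>2 * ln (y\<^sup>2)\<bar> \<le> exp K * (4 * K + 2) * \<bar>x - y\<bar>"
proof -
  have "\<exists>z. min x y \<le> z \<and> z \<le> max x y \<and> x\<^sup>2 * ln (x\<^sup>2) - y\<^sup>2 * ln (y\<^sup>2) = (2 * z * ln (z\<^sup>2) + 2 * z) * (x - y)"
  proof -
    have pos: "0 < z" if "min x y \<le> z" for z
      using that assms(2,4) exp_gt_zero[of "- K"] by (smt (verit) min_def)
    have d: "((\<lambda>x. x\<^sup>2 * ln (x\<^sup>2)) has_real_derivative (2 * z * ln (z\<^sup>2) + 2 * z)) (at z)" if "min x y \<le> z" for z
      using pos[OF that] by (auto intro!: derivative_eq_intros simp: field_simps power2_eq_square)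
    show ?thesis
    proof (cases x y rule: linorder_cases)
      case less
      then obtain z where "x < z" "z < y" "y\<^sup>2 * ln (y\<^sup>2) - x\<^sup>2 * ln (x\<^sup>2) = (y - x) * (2 * z * ln (z\<^sup>2) + 2 * z)"
        using MVT2[of x y "\<lambda>x. x\<^sup>2 * ln (x\<^sup>2)" "\<lambda>z. 2 * z * ln (z\<^sup>2) + 2 * z"] d by auto
      then show ?thesis using less by (intro exI[of _ z]) (auto simp: algebra_simps)
    next
      case greater
      then obtain z where "y < z" "z < x" "x\<^sup>2 * ln (x\<^sup>2) - y\<^sup>2 * ln (y\<^sup>2) = (x - y) * (2 * z * ln (z\<^sup>2) + 2 * z)"
        using MVT2[of y x "\<lambda>x. x\<^sup>2 * ln (x\<^sup>2)" "\<lambda>z. 2 * z * ln (z\<^sup>2) + 2 * z"] d by auto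
      then show ?thesis using greater by (intro exI[of _ z]) (auto simp: algebra_simps)
    qed auto
  qed
  then obtain z where z: "min x y \<le> z" "z \<le> max x y"
    "x\<^sup>2 * ln (x\<^sup>2) - y\<^sup>2 * ln (y\<^sup>2) = (2 * z * ln (z\<^sup>2) + 2 * z) * (x - y)" by blast
  have zb: "exp (- K) \<le> z" "z \<le> exp K" using z assms by auto
  have z0: "z > 0" using zb(1) exp_gt_zero[of "- K"] by linarith
  have lz: "\<bar>ln z\<bar> \<le> K" using zb z0 by (metis abs_le_iff exp_le_cancel_iff exp_ln minus_le_iff)
  have "\<bar>2 * z * ln (z\<^sup>2) + 2 * z\<bar> \<le> \<bar>2 * z * ln (z\<^sup>2)\<bar> + 2 * z" using z0 by linarith
  also have "\<bar>2 * z * ln (z\<^sup>2)\<bar> = z * (4 * \<bar>ln z\<bar>)" using z0 by (simp add: ln_realpow abs_mult)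
  also have "\<dots> \<le> z * (4 * K)" using z0 lz by (intro mult_left_mono) auto
  also have "z * (4 * K) + 2 * z = z * (4 * K + 2)" by (simp add: algebra_simps)
  also have "\<dots> \<le> exp K * (4 * K + 2)" using zb assms(1) by (intro mult_right_mono) auto
  finally have "\<bar>2 * z * ln (z\<^sup>2) + 2 * z\<bar> \<le> exp K * (4 * K + 2)" by simp
  then show ?thesis unfolding z(3) abs_mult by (intro mult_right_mono) auto
qed

text \<open>For negative x, exp x \<le> 1 / (1 - x), and 1 + x + x^2 times 1 - x equals 1 - x^3
  \<ge> 1.\<close>

lemma exp_le_quadratic:
  fixes x :: real
  assumes "\<bar>x\<bar> \<le> 1"
  shows "exp x \<le> 1 + x + x\<^sup>2"
proof (cases "x \<ge> 0")
  case True then show ?thesis using exp_bound[of x] assms by simp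
next
  case False
  have "exp x \<le> 1 / (1 - x)"
    using exp_ge_add_one_self[of "- x"] False by (simp add: exp_minus field_simps)
  also have "\<dots> \<le> 1 + x + x\<^sup>2"
  proof -
    have "(1 + x + x\<^sup>2) * (1 - x) = 1 + (- x) ^ 3" by (simp add: algebra_simps power2_eq_square power3_eq_cube)
    moreover have "(- x) ^ 3 \<ge> 0" using False by simp
    ultimately show ?thesis using False by (simp add: divide_le_eq)
  qed
  finally show ?thesis .
qed

text \<open>
  One step of the hypercontractive estimate: since \<open>f = exp (l / \<theta>)\<close> satisfies
  \<open>E f\<^sup>2(\<Phi>(Z + N)) \<ge> E u\<^sup>2 + s E \<bar>\<nabla>u\<bar>\<^sup>2\<close> with \<open>u\<close> the average of \<open>f\<close>, the logarithmic Sobolev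
  inequality for the law of \<open>Z\<close> pays for lowering the exponent from \<open>2\<close> to \<open>2 \<theta>\<close>.
\<close>
lemma (in prob_space) hyper_step:
  fixes Z N Z' :: "'a \<Rightarrow> 'b::euclidean_space"
  assumes s: "s > 0"
    and [measurable]: "Z \<in> borel_measurable M" "N \<in> borel_measurable M" "Z' \<in> borel_measurable M"
    and law: "distr M (borel \<Otimes>\<^sub>M borel) (\<lambda>\<omega>. (Z \<omega>, N \<omega>)) = distr M borel Z \<Otimes>\<^sub>M gauss s"
    and \<Phi>: "\<rho>-lipschitz_on UNIV \<Phi>" and l: "\<Lambda>-lipschitz_on UNIV l" and K: "\<And>x. \<bar>l x\<bar> \<le> K"
    and g: "0 \<le> g" "ennreal g \<le> inverse (C_LS (distr M borel Z))"
    and \<epsilon>: "\<epsilon> = s * g / 2" "\<epsilon> \<le> 1 / 2" "4 * K * \<epsilon> \<le> 1"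
    and i1: "integrable M (\<lambda>\<omega>. dist (Z' \<omega>) (\<Phi> (Z \<omega> + N \<omega>)))"
    and i2: "integrable M (\<lambda>\<omega>. dist (Z' \<omega>) (Z \<omega>))"
  shows "(1 - \<epsilon>) * ln (\<integral>\<omega>. exp (2 * log_step \<Phi> s (\<lambda>x. l x / (1 - \<epsilon>)) (Z \<omega>)) \<partial>M)
    \<le> ln (\<integral>\<omega>. exp (2 * l (Z' \<omega>)) \<partial>M)
      + hyper_const K \<Lambda> * ((\<integral>\<omega>. dist (Z' \<omega>) (\<Phi> (Z \<omega> + N \<omega>)) \<partial>M) + \<epsilon> * (\<integral>\<omega>. dist (Z' \<omega>) (Z \<omega>) \<partial>M) + \<epsilon>\<^sup>2)"
proof -
  \<comment> \<open>Since \<epsilon> \<le> 1/2, division by 1 - \<epsilon> at most doubles both the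
    bound and the Lipschitz constant of l. The exponents 2 K and 4 K below stem from this.\<close>
  define m where "m x = l x / (1 - \<epsilon>)" for x
  define f where "f x = exp (m x)" for x
  define h where "h x = f (\<Phi> x)" for x
  define u where "u x = (\<integral>w. h (x + w) \<partial>gauss s)" for x
  define D where "D x = (1 / s) *\<^sub>R (\<integral>w. h (x + w) *\<^sub>R w \<partial>gauss s)" for x
  define E1 where "E1 = (\<integral>\<omega>. dist (Z' \<omega>) (\<Phi> (Z \<omega> + N \<omega>)) \<partial>M)"
  define E2 where "E2 = (\<integral>\<omega>. dist (Z' \<omega>) (Z \<omega>) \<partial>M)"
  define L where "L = exp (2 * K) * (2 * \<Lambda>)"
  interpret G: prob_space "gauss s :: 'b measure" by (rule prob_space_gauss) fact
  have \<Lambda>0: "\<Lambda> \<ge> 0" and \<rho>0: "\<rho> \<ge> 0" using lipschitz_on_nonneg[OF l] lipschitz_on_nonneg[OF \<Phi>] by auto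
  have K0: "K \<ge> 0" using K[of undefined] by linarith
  have \<epsilon>0: "\<epsilon> \<ge> 0" unfolding \<epsilon>(1) using s g by simp
  have E0: "E1 \<ge> 0" "E2 \<ge> 0" unfolding E1_def E2_def by auto
  have L0: "L \<ge> 0" using \<Lambda>0 by (simp add: L_def)
  have [measurable]: "\<Phi> \<in> borel_measurable borel" "l \<in> borel_measurable borel"
    using \<Phi> l by (auto intro!: borel_measurable_continuous_onI lipschitz_on_continuous_on)
  have [measurable]: "m \<in> borel_measurable borel" "f \<in> borel_measurable borel" "h \<in> borel_measurable borel"
    unfolding m_def f_def h_def by measurable
  have [measurable]: "u \<in> borel_measurable borel" "D \<in> borel_measurable borel"
    unfolding u_def D_def by measurable
  have mK: "\<bar>m x\<bar> \<le> 2 * K" for x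
  proof -
    have "\<bar>m x\<bar> \<le> K / (1 - \<epsilon>)" using \<epsilon> K[of x] by (simp add: m_def divide_right_mono)
    also have "\<dots> \<le> 2 * K"
    proof -
      have "K * 1 \<le> K * (2 * (1 - \<epsilon>))" using \<epsilon> K0 by (intro mult_left_mono) auto
      then show ?thesis using \<epsilon>(2) by (simp add: divide_le_eq algebra_simps)
    qed
    finally show ?thesis .
  qed
  have mL: "\<bar>m x - m y\<bar> \<le> 2 * \<Lambda> * dist x y" for x y
  proof -
    have "\<bar>m x - m y\<bar> = \<bar>l x - l y\<bar> / (1 - \<epsilon>)" using \<epsilon> by (simp add: m_def diff_divide_distrib[symmetric])
    also have "\<dots> \<le> \<bar>l x - l y\<bar> / (1 / 2)" using \<epsilon> by (intro divide_left_mono) auto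
    also have "\<dots> \<le> 2 * (\<Lambda> * dist x y)" using lipschitz_onD[OF l, of x y] by (simp add: dist_real_def)
    finally show ?thesis by simp
  qed
  have fb: "exp (- (2 * K)) \<le> f x" "f x \<le> exp (2 * K)" for x using mK[of x] by (auto simp: f_def abs_le_iff)
  have f0: "f x > 0" for x by (simp add: f_def)
  have fL: "\<bar>f x - f y\<bar> \<le> L * dist x y" for x y
  proof -
    have "\<bar>f x - f y\<bar> \<le> exp (2 * K) * \<bar>m x - m y\<bar>"
      unfolding f_def by (rule exp_lipschitz_bounded) (use mK[of x] mK[of y] in auto)
    also have "\<dots> \<le> exp (2 * K) * (2 * \<Lambda> * dist x y)" by (intro mult_left_mono mL) auto
    finally show ?thesis by (simp add: L_def mult.assoc)
  qed
  have hb: "\<bar>h x\<bar> \<le> exp (2 * K)" for x using fb f0[of "\<Phi> x"] by (simp add: h_def)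
  have hL: "(L * \<rho>)-lipschitz_on UNIV h"
  proof (rule lipschitz_onI)
    fix x y :: 'b
    have "\<bar>h x - h y\<bar> \<le> L * dist (\<Phi> x) (\<Phi> y)" unfolding h_def by (rule fL)
    also have "\<dots> \<le> L * (\<rho> * dist x y)" using L0 lipschitz_onD[OF \<Phi>, of x y] by (intro mult_left_mono) auto
    finally show "dist (h x) (h y) \<le> L * \<rho> * dist x y" by (simp add: dist_real_def mult.assoc)
  qed (use L0 \<rho>0 in simp)
  note sm = gauss_smoothing[OF s \<open>h \<in> borel_measurable borel\<close> hb, folded u_def D_def]
  have lsm: "exp (log_step \<Phi> s m x) = (\<integral>w. exp (m (\<Phi> (x + w))) \<partial>gauss s)" "\<bar>log_step \<Phi> s m x\<bar> \<le> 2 * K" for x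
    by (rule exp_log_step[OF s _ _ mK]; measurable)+
  \<comment> \<open>The average of f is the exponential of the new function, so the second moment of
    \<open>u (Z \<omega>)\<close> is the quantity inside the logarithm on the left of the
    claim.\<close>
  have ur: "exp (log_step \<Phi> s m x) = u x" for x
    unfolding lsm by (simp add: u_def h_def f_def)
  have ub: "exp (- (2 * K)) \<le> u x" "u x \<le> exp (2 * K)" for x
    unfolding ur[symmetric] using lsm(2)[of x] by (auto simp: abs_le_iff)
  have u0: "u x > 0" for x using ur[of x] by (metis exp_gt_zero)
  have u2b: "exp (- (4 * K)) \<le> (u x)\<^sup>2" "(u x)\<^sup>2 \<le> exp (4 * K)" for x
    using power_mono[OF ub(1)[of x], of 2] power_mono[OF ub(2)[of x], of 2] u0[of x]
    by (simp_all add: exp_double[symmetric] power2_eq_square exp_add[symmetric])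
  have Db: "(norm (D x))\<^sup>2 \<le> exp (4 * K) / s" for x
  proof -
    have "(\<integral>w. (h (x + w))\<^sup>2 \<partial>gauss s) \<le> exp (4 * K)"
    proof (rule G.integral_le_const)
      have "(h y)\<^sup>2 \<le> (exp (2 * K))\<^sup>2" for y using hb[of y] by (rule power2_le_iff_abs_le[THEN iffD2, rotated]) simp
      then have hb2: "(h y)\<^sup>2 \<le> exp (4 * K)" for y by (simp add: power2_eq_square exp_add[symmetric])
      then show "AE w in gauss s. (h (x + w))\<^sup>2 \<le> exp (4 * K)" by simp
      show "integrable (gauss s) (\<lambda>w. (h (x + w))\<^sup>2)"
        by (rule integrable_bounded_gauss[OF s, of _ "exp (4 * K)"]) (use hb2 in auto)
    qed
    then have "s * (norm (D x))\<^sup>2 \<le> exp (4 * K)" using sm(2)[of x] by (smt (verit) zero_le_power2)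
    then show ?thesis using s by (simp add: field_simps)
  qed
  have gradu: "grad u = D" using grad_eqI[OF sm(1)] by auto
  have iu2: "integrable M (\<lambda>\<omega>. (u (Z \<omega>))\<^sup>2)"
    by (rule integrable_const_bound[where B = "exp (4 * K)"]) (use u2b in auto)
  have iD: "integrable M (\<lambda>\<omega>. (norm (D (Z \<omega>)))\<^sup>2)"
    by (rule integrable_const_bound[where B = "exp (4 * K) / s"]) (use Db in auto)
  define A where "A = (\<integral>\<omega>. (u (Z \<omega>))\<^sup>2 \<partial>M)"
  define I where "I = (\<integral>\<omega>. (norm (D (Z \<omega>)))\<^sup>2 \<partial>M)"
  define \<eta> where "\<eta> x = x\<^sup>2 * ln (x\<^sup>2)" for x :: real
  define H where "H = (\<integral>\<omega>. \<eta> (u (Z \<omega>)) \<partial>M)"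
  have \<eta>L: "\<bar>\<eta> x - \<eta> y\<bar> \<le> exp (2 * K) * (8 * K + 2) * \<bar>x - y\<bar>"
    if "exp (- (2 * K)) \<le> x" "x \<le> exp (2 * K)" "exp (- (2 * K)) \<le> y" "y \<le> exp (2 * K)" for x y
    using x_ln_x_lipschitz[of "2 * K" x y] that K0 by (simp add: \<eta>_def)
  have \<eta>b: "\<bar>\<eta> x\<bar> \<le> exp (4 * K) * (4 * K)" if "exp (- (2 * K)) \<le> x" "x \<le> exp (2 * K)" for x
  proof -
    have x0: "x > 0" using that(1) exp_gt_zero[of "- (2 * K)"] by linarith
    have "\<bar>ln x\<bar> \<le> 2 * K" using that x0 by (metis abs_le_iff exp_le_cancel_iff exp_ln minus_le_iff)
    moreover have "x\<^sup>2 \<le> exp (4 * K)" using power_mono[OF that(2), of 2] x0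
      by (simp add: power2_eq_square exp_add[symmetric])
    ultimately show ?thesis using x0 unfolding \<eta>_def abs_mult by (intro mult_mono) (auto simp: ln_realpow)
  qed
  have i\<eta>u: "integrable M (\<lambda>\<omega>. \<eta> (u (Z \<omega>)))"
    unfolding \<eta>_def
    by (rule integrable_const_bound[where B = "exp (4 * K) * (4 * K)"]) (use \<eta>b[OF ub] in \<open>auto simp: \<eta>_def\<close>)
  have Ab: "exp (- (4 * K)) \<le> A" "A \<le> exp (4 * K)"
    unfolding A_def using integral_ge_const[OF iu2] integral_le_const[OF iu2] u2b by auto
  have A0: "A > 0" using Ab(1) exp_gt_zero[of "- (4 * K)"] by linarith
  \<comment> \<open>With A the mean of \<open>(u (Z \<omega>))\<^sup>2\<close>, the entropy of that
    square splits as H - A ln A.\<close>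
  have LSI: "g * (H - A * ln A) \<le> 2 * I"
  proof -
    have "g * (\<integral>x. (u x)\<^sup>2 * ln ((u x)\<^sup>2 / (\<integral>y. (u y)\<^sup>2 \<partial>distr M borel Z)) \<partial>distr M borel Z)
      \<le> 2 * (\<integral>x. (norm (grad u x))\<^sup>2 \<partial>distr M borel Z)"
    proof (rule C_LS_inequality[OF g])
      show "u differentiable (at x)" for x using sm(1)[of x] unfolding gderiv_def differentiable_def by blast
      show "continuous_on UNIV (grad u)" unfolding gradu by (rule sm(3)[OF hL])
      show "integrable (distr M borel Z) (\<lambda>x. (u x)\<^sup>2)" using iu2 by (subst integrable_distr_eq) auto
      show "integrable (distr M borel Z) (\<lambda>x. (norm (grad u x))\<^sup>2)"
        unfolding gradu using iD by (subst integrable_distr_eq) auto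
    qed
    also have "(\<integral>y. (u y)\<^sup>2 \<partial>distr M borel Z) = A" unfolding A_def by (subst integral_distr) auto
    also have "(\<integral>x. (norm (grad u x))\<^sup>2 \<partial>distr M borel Z) = I" unfolding gradu I_def by (subst integral_distr) auto
    also have "(\<integral>x. (u x)\<^sup>2 * ln ((u x)\<^sup>2 / A) \<partial>distr M borel Z) = (\<integral>\<omega>. (u (Z \<omega>))\<^sup>2 * ln ((u (Z \<omega>))\<^sup>2 / A) \<partial>M)"
      by (subst integral_distr) auto
    also have "\<dots> = (\<integral>\<omega>. \<eta> (u (Z \<omega>)) - (u (Z \<omega>))\<^sup>2 * ln A \<partial>M)"
      using u0 A0 by (intro Bochner_Integration.integral_cong) (auto simp: \<eta>_def ln_div right_diff_distrib)
    also have "\<dots> = H - A * ln A" unfolding H_def A_def using i\<eta>u iu2 by simp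
    finally show ?thesis .
  qed
  have F2: "(f x)\<^sup>2 = exp (2 * m x)" for x by (simp add: f_def exp_double)
  have F2L: "\<bar>(f x)\<^sup>2 - (f y)\<^sup>2\<bar> \<le> exp (4 * K) * (4 * \<Lambda>) * dist x y" for x y
  proof -
    have "\<bar>(f x)\<^sup>2 - (f y)\<^sup>2\<bar> \<le> exp (4 * K) * \<bar>2 * m x - 2 * m y\<bar>"
      unfolding F2 by (rule exp_lipschitz_bounded) (use mK[of x] mK[of y] in auto)
    also have "\<dots> \<le> exp (4 * K) * (4 * \<Lambda> * dist x y)" using mL[of x y] by (intro mult_left_mono) auto
    finally show ?thesis by (simp add: mult.assoc)
  qed
  have f2b: "(f x)\<^sup>2 \<le> exp (4 * K)" for x unfolding F2 using mK[of x] by auto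
  have if2: "integrable M (\<lambda>\<omega>. (f (V \<omega>))\<^sup>2)" if [measurable]: "V \<in> borel_measurable M" for V
    by (rule integrable_const_bound[where B = "exp (4 * K)"]) (use f2b in auto)
  have if1: "integrable M (\<lambda>\<omega>. f (V \<omega>))" if [measurable]: "V \<in> borel_measurable M" for V
    by (rule integrable_const_bound[where B = "exp (2 * K)"]) (use fb f0 in \<open>auto simp: less_imp_le\<close>)
  have i\<eta>: "integrable M (\<lambda>\<omega>. \<eta> (f (V \<omega>)))" if [measurable]: "V \<in> borel_measurable M" for V
    unfolding \<eta>_def
    by (rule integrable_const_bound[where B = "exp (4 * K) * (4 * K)"]) (use \<eta>b[OF fb] in \<open>auto simp: \<eta>_def\<close>)
  \<comment> \<open>The gain of the step: averaging f over the noise loses a variance, which by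
    \<open>gauss_smoothing\<close> is at least s times the squared gradient.\<close>
  have q1: "A + s * I \<le> (\<integral>\<omega>. (f (\<Phi> (Z \<omega> + N \<omega>)))\<^sup>2 \<partial>M)"
  proof -
    have b: "\<bar>\<integral>w. (h (x + w))\<^sup>2 \<partial>gauss s\<bar> \<le> exp (4 * K)" for x
      by (rule order_trans[OF integral_abs_bound], rule G.integral_le_const)
         (use f2b in \<open>auto simp: h_def intro!: integrable_bounded_gauss[OF s, of _ "exp (4 * K)"]\<close>)
    have "A + s * I = (\<integral>\<omega>. (u (Z \<omega>))\<^sup>2 + s * (norm (D (Z \<omega>)))\<^sup>2 \<partial>M)"
      using iu2 iD by (simp add: A_def I_def)
    also have "\<dots> \<le> (\<integral>\<omega>. (\<integral>w. (h (Z \<omega> + w))\<^sup>2 \<partial>gauss s) \<partial>M)"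
    proof (rule integral_mono)
      show "integrable M (\<lambda>\<omega>. \<integral>w. (h (Z \<omega> + w))\<^sup>2 \<partial>gauss s)"
        by (rule integrable_const_bound[where B = "exp (4 * K)"]) (use b in auto)
      show "(u (Z \<omega>))\<^sup>2 + s * (norm (D (Z \<omega>)))\<^sup>2 \<le> (\<integral>w. (h (Z \<omega> + w))\<^sup>2 \<partial>gauss s)" for \<omega>
        using sm(2)[of "Z \<omega>"] by simp
    qed (use iu2 iD in auto)
    also have "\<dots> = (\<integral>\<omega>. (f (\<Phi> (Z \<omega> + N \<omega>)))\<^sup>2 \<partial>M)"
      using expectation_indep_gauss[OF s _ _ _ law, of "\<lambda>z. (h (fst z + snd z))\<^sup>2" "exp (4 * K)"] f2b
      by (simp add: h_def)
    finally show ?thesis .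
  qed
  have q2: "(\<integral>\<omega>. (f (\<Phi> (Z \<omega> + N \<omega>)))\<^sup>2 \<partial>M) \<le> (\<integral>\<omega>. (f (Z' \<omega>))\<^sup>2 \<partial>M) + exp (4 * K) * (4 * \<Lambda>) * E1"
  proof -
    have "(\<integral>\<omega>. (f (\<Phi> (Z \<omega> + N \<omega>)))\<^sup>2 \<partial>M) \<le> (\<integral>\<omega>. (f (Z' \<omega>))\<^sup>2 + exp (4 * K) * (4 * \<Lambda>) * dist (Z' \<omega>) (\<Phi> (Z \<omega> + N \<omega>)) \<partial>M)"
    proof (rule integral_mono)
      show "(f (\<Phi> (Z \<omega> + N \<omega>)))\<^sup>2 \<le> (f (Z' \<omega>))\<^sup>2 + exp (4 * K) * (4 * \<Lambda>) * dist (Z' \<omega>) (\<Phi> (Z \<omega> + N \<omega>))" for \<omega>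
        using F2L[of "Z' \<omega>" "\<Phi> (Z \<omega> + N \<omega>)"] by linarith
    qed (use if2 i1 in auto)
    then show ?thesis using if2[of Z'] i1 by (simp add: E1_def)
  qed
  have ifu: "integrable M (\<lambda>\<omega>. \<bar>f (Z \<omega>) - u (Z \<omega>)\<bar>)"
    by (intro integrable_abs Bochner_Integration.integrable_diff if1)
       (auto intro!: integrable_const_bound[where B = "exp (2 * K)"] simp: ub less_imp_le[OF u0])
  have q3: "(\<integral>\<omega>. \<bar>f (Z \<omega>) - u (Z \<omega>)\<bar> \<partial>M) \<le> L * (E1 + E2)"
  proof -
    have b: "\<bar>f x - f y\<bar> \<le> exp (2 * K)" for x y
      using fb[of x] fb[of y] f0[of x] f0[of y] by (auto simp: abs_le_iff)
    have ih: "integrable (gauss s) (\<lambda>w. h (x + w))" for x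
      by (rule integrable_bounded_gauss[OF s _ ]) (use hb in auto)
    have idf: "integrable (gauss s) (\<lambda>w. \<bar>f x - h (x + w)\<bar>)" for x
      using ih by auto
    have b': "\<bar>\<integral>w. \<bar>f x - h (x + w)\<bar> \<partial>gauss s\<bar> \<le> exp (2 * K)" for x
      by (rule order_trans[OF integral_abs_bound], rule G.integral_le_const)
         (use idf b in \<open>auto simp: h_def\<close>)
    have "(\<integral>\<omega>. \<bar>f (Z \<omega>) - u (Z \<omega>)\<bar> \<partial>M) \<le> (\<integral>\<omega>. (\<integral>w. \<bar>f (Z \<omega>) - h (Z \<omega> + w)\<bar> \<partial>gauss s) \<partial>M)"
    proof (rule integral_mono[OF ifu])
      show "integrable M (\<lambda>\<omega>. \<integral>w. \<bar>f (Z \<omega>) - h (Z \<omega> + w)\<bar> \<partial>gauss s)"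
        by (rule integrable_const_bound[where B = "exp (2 * K)"]) (use b' in auto)
      show "\<bar>f (Z \<omega>) - u (Z \<omega>)\<bar> \<le> (\<integral>w. \<bar>f (Z \<omega>) - h (Z \<omega> + w)\<bar> \<partial>gauss s)" for \<omega>
      proof -
        have "f (Z \<omega>) - u (Z \<omega>) = (\<integral>w. f (Z \<omega>) - h (Z \<omega> + w) \<partial>gauss s)"
          using ih[of "Z \<omega>"] G.prob_space by (simp add: u_def)
        then show ?thesis by (simp only: integral_abs_bound)
      qed
    qed
    also have "\<dots> = (\<integral>\<omega>. \<bar>f (Z \<omega>) - f (\<Phi> (Z \<omega> + N \<omega>))\<bar> \<partial>M)"
      using expectation_indep_gauss[OF s _ _ _ law, of "\<lambda>z. \<bar>f (fst z) - h (fst z + snd z)\<bar>" "exp (2 * K)"] b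
      by (simp add: h_def)
    also have "\<dots> \<le> (\<integral>\<omega>. L * (dist (Z' \<omega>) (\<Phi> (Z \<omega> + N \<omega>)) + dist (Z' \<omega>) (Z \<omega>)) \<partial>M)"
    proof (rule integral_mono)
      show "\<bar>f (Z \<omega>) - f (\<Phi> (Z \<omega> + N \<omega>))\<bar> \<le> L * (dist (Z' \<omega>) (\<Phi> (Z \<omega> + N \<omega>)) + dist (Z' \<omega>) (Z \<omega>))" for \<omega>
      proof -
        have "dist (Z \<omega>) (\<Phi> (Z \<omega> + N \<omega>)) \<le> dist (Z' \<omega>) (\<Phi> (Z \<omega> + N \<omega>)) + dist (Z' \<omega>) (Z \<omega>)"
          using dist_triangle2[of "Z \<omega>" "\<Phi> (Z \<omega> + N \<omega>)" "Z' \<omega>"] by (simp add: dist_commute)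
        then show ?thesis using fL[of "Z \<omega>" "\<Phi> (Z \<omega> + N \<omega>)"] L0 by (meson mult_left_mono order_trans)
      qed
    qed (use if1 i1 i2 in auto)
    finally show ?thesis using i1 i2 by (simp add: E1_def E2_def)
  qed
  \<comment> \<open>The logarithmic Sobolev term involves u at \<open>Z\<close>, whereas the
    exponent is lowered for f at \<open>Z'\<close>. The Lipschitz bounds on \<eta> and f move one to
    the other at the cost of mean distances.\<close>
  have q4: "(\<integral>\<omega>. \<eta> (f (Z' \<omega>)) \<partial>M) \<le> H + 4 * \<Lambda> * exp (4 * K) * (8 * K + 2) * (E1 + E2)"
  proof -
    define c where "c = exp (2 * K) * (8 * K + 2)"
    have c0: "c \<ge> 0" using K0 by (simp add: c_def)

    have "(\<integral>\<omega>. \<eta> (f (Z' \<omega>)) \<partial>M) \<le> (\<integral>\<omega>. \<eta> (u (Z \<omega>)) + c * (L * dist (Z' \<omega>) (Z \<omega>) + \<bar>f (Z \<omega>) - u (Z \<omega>)\<bar>) \<partial>M)"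
    proof (rule integral_mono)
      show "\<eta> (f (Z' \<omega>)) \<le> \<eta> (u (Z \<omega>)) + c * (L * dist (Z' \<omega>) (Z \<omega>) + \<bar>f (Z \<omega>) - u (Z \<omega>)\<bar>)" for \<omega>
      proof -
        have "\<bar>f (Z' \<omega>) - u (Z \<omega>)\<bar> \<le> L * dist (Z' \<omega>) (Z \<omega>) + \<bar>f (Z \<omega>) - u (Z \<omega>)\<bar>"
          using fL[of "Z' \<omega>" "Z \<omega>"] by linarith
        then have "c * \<bar>f (Z' \<omega>) - u (Z \<omega>)\<bar> \<le> c * (L * dist (Z' \<omega>) (Z \<omega>) + \<bar>f (Z \<omega>) - u (Z \<omega>)\<bar>)"
          by (rule mult_left_mono[OF _ c0])
        then show ?thesis using \<eta>L[OF fb ub, of "Z' \<omega>" "Z \<omega>"] unfolding c_def by linarith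
      qed
    qed (use i\<eta>[of Z'] i\<eta>u i2 ifu in auto)
    also have "\<dots> = H + c * (L * E2 + (\<integral>\<omega>. \<bar>f (Z \<omega>) - u (Z \<omega>)\<bar> \<partial>M))"
      using i\<eta>u i2 ifu by (simp add: H_def E2_def)
    also have "\<dots> \<le> H + c * (L * E2 + L * (E1 + E2))" using q3 c0 by (intro add_left_mono mult_left_mono) auto
    also have "\<dots> \<le> H + c * (2 * L * (E1 + E2))"
      using E0 L0 c0 by (intro add_left_mono mult_left_mono) (auto simp: algebra_simps)
    also have "c * (2 * L * (E1 + E2)) = 4 * \<Lambda> * exp (4 * K) * (8 * K + 2) * (E1 + E2)"
    proof -
      have "exp (2 * K) * exp (2 * K) = exp (4 * K)" by (simp add: exp_add[symmetric])
      moreover have "c * (2 * L * (E1 + E2)) = (exp (2 * K) * exp (2 * K)) * (4 * \<Lambda> * (8 * K + 2) * (E1 + E2))"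
        unfolding c_def L_def by (simp only: mult_ac)
      ultimately show ?thesis by simp
    qed
    finally show ?thesis .
  qed
  define P where "P = (\<integral>\<omega>. exp (2 * l (Z' \<omega>)) \<partial>M)"
  have iP: "integrable M (\<lambda>\<omega>. exp (2 * l (Z' \<omega>)))"
    by (rule integrable_const_bound[where B = "exp (2 * K)"]) (use K in \<open>auto simp: abs_le_iff\<close>)
  have "exp (2 * l x) \<ge> exp (- (2 * K))" for x using K[of x] by auto
  then have Pb: "P \<ge> exp (- (2 * K))" unfolding P_def by (intro integral_ge_const iP) auto
  then have P0: "P > 0" using exp_gt_zero[of "- (2 * K)"] by linarith
  \<comment> \<open>With l = (1 - \<epsilon>) m, \<open>exp (2 * l x)\<close> is
    \<open>(f x)\<^sup>2\<close> times exp(-\<epsilon> ln f^2). The bound exp y \<ge> 1 + y errs on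
    the favourable side here.\<close>
  have q5: "(\<integral>\<omega>. (f (Z' \<omega>))\<^sup>2 \<partial>M) - \<epsilon> * (\<integral>\<omega>. \<eta> (f (Z' \<omega>)) \<partial>M) \<le> P"
  proof -
    have "(\<integral>\<omega>. (f (Z' \<omega>))\<^sup>2 - \<epsilon> * \<eta> (f (Z' \<omega>)) \<partial>M) \<le> P"
      unfolding P_def
    proof (rule integral_mono[OF _ iP])
      show "(f (Z' \<omega>))\<^sup>2 - \<epsilon> * \<eta> (f (Z' \<omega>)) \<le> exp (2 * l (Z' \<omega>))" for \<omega>
      proof -
        have "l (Z' \<omega>) = (1 - \<epsilon>) * m (Z' \<omega>)" using \<epsilon> by (simp add: m_def)
        then have "exp (2 * l (Z' \<omega>)) = exp (2 * m (Z' \<omega>)) * exp (- (\<epsilon> * (2 * m (Z' \<omega>))))"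
          by (simp add: exp_add[symmetric] algebra_simps)
        moreover have "\<dots> \<ge> exp (2 * m (Z' \<omega>)) * (1 + (- (\<epsilon> * (2 * m (Z' \<omega>)))))"
          by (intro mult_left_mono exp_ge_add_one_self) auto
        ultimately show ?thesis by (simp add: \<eta>_def F2 algebra_simps)
      qed
    qed (use if2[of Z'] i\<eta>[of Z'] in auto)
    then show ?thesis using if2[of Z'] i\<eta>[of Z'] by simp
  qed
  \<comment> \<open>The last summand is reserved for the quadratic error of exp in
    \<open>q6\<close>; \<open>main\<close> therefore subtracts it again.\<close>
  define err where "err = exp (4 * K) * (4 * \<Lambda>) * E1 + \<epsilon> * (4 * \<Lambda> * exp (4 * K) * (8 * K + 2) * (E1 + E2)) + exp (4 * K) * (16 * K\<^sup>2) * \<epsilon>\<^sup>2"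
  have err0: "err \<ge> 0" unfolding err_def using E0 \<Lambda>0 K0 \<epsilon>0 by (intro add_nonneg_nonneg mult_nonneg_nonneg) auto
  \<comment> \<open>The gain s I covers \<epsilon> (H - A ln A), and lowering the exponent loses
    \<epsilon> H. The terms H cancel, leaving A (1 - \<epsilon> ln A), the first-order part of A to
    the power 1 - \<epsilon>.\<close>
  have main: "A * (1 - \<epsilon> * ln A) \<le> P + err - exp (4 * K) * (16 * K\<^sup>2) * \<epsilon>\<^sup>2"
  proof -
    have "\<epsilon> * (H - A * ln A) = s / 2 * (g * (H - A * ln A))" by (simp add: \<epsilon>(1))
    also have "\<dots> \<le> s / 2 * (2 * I)" using s by (intro mult_left_mono LSI) auto
    finally have "\<epsilon> * (H - A * ln A) \<le> s * I" by simp
    moreover have "\<epsilon> * (\<integral>\<omega>. \<eta> (f (Z' \<omega>)) \<partial>M) \<le> \<epsilon> * (H + 4 * \<Lambda> * exp (4 * K) * (8 * K + 2) * (E1 + E2))"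
      by (rule mult_left_mono[OF q4 \<epsilon>0])
    ultimately show ?thesis using q1 q2 q5 unfolding err_def by (simp add: algebra_simps)
  qed
  have lnA: "\<bar>ln A\<bar> \<le> 4 * K" using Ab A0 by (metis abs_le_iff exp_le_cancel_iff exp_ln minus_le_iff)
  \<comment> \<open>The quadratic bound on exp asks for |\<epsilon> ln A| \<le> 1, which is the
    assumption 4 K \<epsilon> \<le> 1 because |ln A| \<le> 4 K.\<close>
  have "exp ((1 - \<epsilon>) * ln A) = A * exp (- (\<epsilon> * ln A))"
    using A0 by (simp add: left_diff_distrib exp_diff exp_minus field_simps)
  also have "\<dots> \<le> A * (1 + (- (\<epsilon> * ln A)) + (- (\<epsilon> * ln A))\<^sup>2)"
  proof (intro mult_left_mono exp_le_quadratic)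
    have "\<bar>- (\<epsilon> * ln A)\<bar> \<le> \<epsilon> * (4 * K)" using \<epsilon>0 lnA by (simp add: abs_mult mult_left_mono)
    then show "\<bar>- (\<epsilon> * ln A)\<bar> \<le> 1" using \<epsilon>(3) by (simp add: mult_ac)
  qed (use A0 in simp)
  also have "\<dots> = A * (1 - \<epsilon> * ln A) + A * (\<epsilon>\<^sup>2 * (ln A)\<^sup>2)" by (simp add: algebra_simps power_mult_distrib)
  also have "A * (\<epsilon>\<^sup>2 * (ln A)\<^sup>2) \<le> exp (4 * K) * (\<epsilon>\<^sup>2 * (16 * K\<^sup>2))"
  proof -
    have "(ln A)\<^sup>2 \<le> (4 * K)\<^sup>2" using lnA K0 by (metis abs_of_nonneg mult_nonneg_nonneg power2_le_iff_abs_le zero_le_numeral)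
    then show ?thesis using Ab A0 by (intro mult_mono) (auto simp: power_mult_distrib)
  qed
  finally have q6: "exp ((1 - \<epsilon>) * ln A) \<le> P + err" using main by (simp add: mult_ac)
  have "(1 - \<epsilon>) * ln A - ln P \<le> (exp ((1 - \<epsilon>) * ln A) - P) / P"
    using ln_diff_le[of "exp ((1 - \<epsilon>) * ln A)" P] P0 by simp
  also have "\<dots> \<le> err / P" using q6 P0 by (intro divide_right_mono) auto
  also have "\<dots> \<le> err / exp (- (2 * K))" using Pb P0 err0 by (intro divide_left_mono) auto
  also have "\<dots> = exp (2 * K) * err" by (simp add: exp_minus field_simps)
  also have "\<dots> \<le> hyper_const K \<Lambda> * (E1 + \<epsilon> * E2 + \<epsilon>\<^sup>2)"
  proof -
    let ?a = "exp (4 * K) * (16 * K\<^sup>2)" and ?b = "4 * \<Lambda> * exp (4 * K)" and ?c = "4 * \<Lambda> * exp (4 * K) * (8 * K + 2)"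
    have n: "?a \<ge> 0" "?b \<ge> 0" "?c \<ge> 0" using \<Lambda>0 K0 by auto
    have "\<epsilon> * E1 \<le> 1 * E1" using \<epsilon> E0 by (intro mult_right_mono) auto
    then have e: "\<epsilon> * (E1 + E2) \<le> E1 + \<epsilon> * E2" by (simp add: algebra_simps)
    let ?S = "E1 + \<epsilon> * E2 + \<epsilon>\<^sup>2"
    have S: "E1 \<le> ?S" "\<epsilon> * (E1 + E2) \<le> ?S" "\<epsilon>\<^sup>2 \<le> ?S" using e E0 \<epsilon>0 zero_le_power2[of \<epsilon>] mult_nonneg_nonneg[OF \<epsilon>0 E0(2)] by linarith+
    have "err = ?b * E1 + ?c * (\<epsilon> * (E1 + E2)) + ?a * \<epsilon>\<^sup>2" unfolding err_def by (simp add: mult_ac)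
    also have "\<dots> \<le> ?b * ?S + ?c * ?S + ?a * ?S" using S n by (intro add_mono mult_left_mono) auto
    finally have "exp (2 * K) * err \<le> exp (2 * K) * ((?a + ?b + ?c) * ?S)"
      by (intro mult_left_mono) (auto simp: algebra_simps)
    then show ?thesis unfolding hyper_const_def by (simp add: mult.assoc)
  qed
  finally have "(1 - \<epsilon>) * ln A \<le> ln P + hyper_const K \<Lambda> * (E1 + \<epsilon> * E2 + \<epsilon>\<^sup>2)" by simp
  moreover have "A = (\<integral>\<omega>. exp (2 * log_step \<Phi> s (\<lambda>x. l x / (1 - \<epsilon>)) (Z \<omega>)) \<partial>M)"
    unfolding A_def ur[symmetric] m_def[abs_def] by (simp add: exp_double)
  ultimately show ?thesis by (simp add: P_def E1_def E2_def)
qed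

section \<open>Processes with additive noise\<close>

text \<open>
  Sample path continuity only holds almost surely and the filtration need not be complete, so a
  jointly measurable version is taken as a limit of step processes.
\<close>
lemma progressive_version:
  fixes X :: "real \<Rightarrow> 'w \<Rightarrow> 'a::euclidean_space"
  assumes filt: "filtration (space M) F" and S: "0 < S"
    and X: "\<And>t. t \<in> {0..S} \<Longrightarrow> X t \<in> borel_measurable (F t)"
    and cont: "AE \<omega> in M. continuous_on {0..S} (\<lambda>t. X t \<omega>)"
  obtains X' where "\<And>t. t \<in> {0..S} \<Longrightarrow> (\<lambda>z. X' (min (fst z) t) (snd z)) \<in> borel_measurable (borel \<Otimes>\<^sub>M F t)"
    and "AE \<omega> in M. \<forall>t\<in>{0..S}. X' t \<omega> = X t \<omega>"
proof
  interpret filtration "space M" F by fact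
  \<comment> \<open>Times are rounded down to multiples of 1/(k+1), and negative ones set to 0, so
    the approximation at a time of [0, S] consults only the past. This is what makes the limit
    progressively measurable.\<close>
  define a where "a k s = max 0 (real_of_int \<lfloor>s * real (Suc k)\<rfloor> / real (Suc k))" for k :: nat and s :: real
  define X' where "X' s \<omega> = lim (\<lambda>k. X (a k s) \<omega>)" for s \<omega>
  have a_le: "a k s \<le> t" if "s \<le> t" "0 \<le> t" for k s t
  proof -
    have "real_of_int \<lfloor>s * real (Suc k)\<rfloor> \<le> s * real (Suc k)" by (rule of_int_floor_le)
    then have "real_of_int \<lfloor>s * real (Suc k)\<rfloor> / real (Suc k) \<le> s" by (simp add: field_simps)
    then show ?thesis using that by (simp add: a_def)
  qed
  show "(\<lambda>z. X' (min (fst z) t) (snd z)) \<in> borel_measurable (borel \<Otimes>\<^sub>M F t)" if t: "t \<in> {0..S}" for t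
    unfolding X'_def
  proof (rule borel_measurable_lim_metric)
    fix k
    \<comment> \<open>Only countably many grid values occur. Clipping them to [0, t] makes each of
      these variables measurable for \<open>F t\<close> without changing the value at the index that
      is used.\<close>
    let ?r = "\<lambda>i::int. max 0 (min t (real_of_int i / real (Suc k)))"
    have "(\<lambda>z. X (?r i) (snd z)) \<in> borel_measurable (borel \<Otimes>\<^sub>M F t)" for i
    proof -
      have "X (?r i) \<in> borel_measurable (F (?r i))" using t by (intro X) auto
      then have "X (?r i) \<in> borel_measurable (F t)"
        using sets_F_mono[of "?r i" t] t by (auto simp: measurable_def space_F)
      then show ?thesis by (rule measurable_compose[OF measurable_snd])
    qed
    moreover have "(\<lambda>z. \<lfloor>min (fst z) t * real (Suc k)\<rfloor>) \<in> (borel \<Otimes>\<^sub>M F t) \<rightarrow>\<^sub>M count_space UNIV"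
      by measurable
    ultimately have "(\<lambda>z. X (?r \<lfloor>min (fst z) t * real (Suc k)\<rfloor>) (snd z)) \<in> borel_measurable (borel \<Otimes>\<^sub>M F t)"
      by (rule measurable_compose_countable)
    moreover have "?r \<lfloor>min s t * real (Suc k)\<rfloor> = a k (min s t)" for s
      using a_le[of "min s t" t k] t by (auto simp: a_def min_def max_def)
    ultimately show "(\<lambda>z. X (a k (min (fst z) t)) (snd z)) \<in> borel_measurable (borel \<Otimes>\<^sub>M F t)"
      by simp
  qed
  show "AE \<omega> in M. \<forall>t\<in>{0..S}. X' t \<omega> = X t \<omega>"
    using cont
  proof eventually_elim
    fix \<omega> assume c: "continuous_on {0..S} (\<lambda>t. X t \<omega>)"
    show "\<forall>t\<in>{0..S}. X' t \<omega> = X t \<omega>"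
    proof
      fix t assume t: "t \<in> {0..S}"
      have al: "(\<lambda>k. a k t) \<longlonglongrightarrow> t"
      proof (rule tendsto_sandwich)
        show "\<forall>\<^sub>F k in sequentially. t - 1 / real (Suc k) \<le> a k t"
        proof (intro always_eventually allI)
          fix k
          have "t * real (Suc k) - 1 \<le> real_of_int \<lfloor>t * real (Suc k)\<rfloor>" by linarith
          then have "(t * real (Suc k) - 1) / real (Suc k) \<le> real_of_int \<lfloor>t * real (Suc k)\<rfloor> / real (Suc k)"
            by (rule divide_right_mono) simp
          then have "t - 1 / real (Suc k) \<le> real_of_int \<lfloor>t * real (Suc k)\<rfloor> / real (Suc k)"
            by (simp add: diff_divide_distrib)
          then show "t - 1 / real (Suc k) \<le> a k t" by (simp add: a_def)
        qed
        show "\<forall>\<^sub>F k in sequentially. a k t \<le> t" using a_le[of t t] t by simp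
        show "(\<lambda>k. t - 1 / real (Suc k)) \<longlonglongrightarrow> t"
          using tendsto_diff[OF tendsto_const[of t] LIMSEQ_inverse_real_of_nat] by (simp add: inverse_eq_divide)
      qed simp
      have "(\<lambda>k. X (a k t) \<omega>) \<longlonglongrightarrow> X t \<omega>"
        by (rule continuous_on_tendsto_compose[OF c al t]) (use a_le[of t t] a_le[of t S] t in \<open>auto simp: a_def\<close>)
      then show "X' t \<omega> = X t \<omega>" unfolding X'_def by (rule limI)
    qed
  qed
qed

section \<open>Moments of a process with integrable drift\<close>

lemma integral_indicator_Icc:
  fixes K :: real
  assumes "s \<le> t"
  shows "(\<integral>r. indicator {s..t} r *\<^sub>R K \<partial>lborel) = (t - s) * K"
  using assms by simp

text \<open>\<open>X_prog\<close> is progressive measurability, with the time clipped at t instead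
  of restricted. The drift is integrable over the whole time axis; concrete drifts are extended by
  zero outside [0, S].\<close>

locale ito_process = prob_space M for M :: "'w measure" +
  fixes F :: "real \<Rightarrow> 'w measure" and B X d :: "real \<Rightarrow> 'w \<Rightarrow> 'a::euclidean_space" and S :: real
  assumes S: "0 < S"
    and filt: "filtration (space M) F" and sub: "\<And>t. sets (F t) \<subseteq> sets M"
    and B_meas: "\<And>t. 0 \<le> t \<Longrightarrow> B t \<in> borel_measurable (F t)"
    and B_law: "\<And>s t. 0 \<le> s \<Longrightarrow> s < t \<Longrightarrow> distributed M lborel (\<lambda>\<omega>. B t \<omega> - B s \<omega>)
        (\<lambda>x. ennreal (\<Prod>b\<in>Basis. normal_density 0 (sqrt (t - s)) (x \<bullet> b)))"
    and B_indep: "\<And>s t. 0 \<le> s \<Longrightarrow> s < t \<Longrightarrow> indep_set (sets (F s))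
        {(\<lambda>\<omega>. B t \<omega> - B s \<omega>) -` A \<inter> space M | A. A \<in> sets borel}"
    and X_prog: "\<And>t. t \<in> {0..S} \<Longrightarrow> (\<lambda>z. X (min (fst z) t) (snd z)) \<in> borel_measurable (borel \<Otimes>\<^sub>M F t)"
    and d_int: "integrable (lborel \<Otimes>\<^sub>M M) (\<lambda>z. d (fst z) (snd z))"
    and ito: "AE \<omega> in M. \<forall>t\<in>{0..S}. X t \<omega> = X 0 \<omega> + sqrt 2 *\<^sub>R B t \<omega> + (LINT r:{0..t}|lborel. d r \<omega>)"
begin

sublocale filtration "space M" F by (rule filt)
sublocale LM: pair_sigma_finite lborel M ..

definition noise :: "real \<Rightarrow> real \<Rightarrow> 'w \<Rightarrow> 'a" where
  "noise s t \<omega> = sqrt 2 *\<^sub>R (B t \<omega> - B s \<omega>)"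

text \<open>The measure of the drift used in the errors: it is additive over adjacent intervals and
  vanishes with their length, although the drift itself may be unbounded.\<close>

definition drift_mean :: "real \<Rightarrow> real \<Rightarrow> real" where
  "drift_mean s t = (LINT r:{s..t}|lborel. (\<integral>\<omega>. norm (d r \<omega>) \<partial>M))"

text \<open>The path is compared with its starting point plus the noise of the whole cell, because
  the flow of a cell is evaluated after the noise has been added.\<close>

definition remainder :: "real \<Rightarrow> real \<Rightarrow> 'w \<Rightarrow> real" where
  "remainder s t \<omega> = (LINT r:{s..t}|lborel. norm (X r \<omega> - X s \<omega> - noise s t \<omega>))"

lemma F_M: "f \<in> measurable (F t) N \<Longrightarrow> f \<in> measurable M N"
  using sub[of t] by (auto simp: measurable_def space_F)

lemma F_mono: "s \<le> t \<Longrightarrow> f \<in> measurable (F s) N \<Longrightarrow> f \<in> measurable (F t) N"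
  using sets_F_mono[of s t] by (auto simp: measurable_def space_F)

lemma X_meas: "t \<in> {0..S} \<Longrightarrow> X t \<in> borel_measurable (F t)"
  using measurable_compose[OF _ X_prog, of "\<lambda>\<omega>. (t, \<omega>)" "F t" t] by simp

lemma X_meas_M [measurable]: "t \<in> {0..S} \<Longrightarrow> X t \<in> borel_measurable M"
  by (rule F_M[OF X_meas])

lemma B_meas_M [measurable]: "0 \<le> t \<Longrightarrow> B t \<in> borel_measurable M"
  by (rule F_M[OF B_meas])

lemma noise_meas [measurable]: "0 \<le> s \<Longrightarrow> s \<le> t \<Longrightarrow> noise s t \<in> borel_measurable M"
  unfolding noise_def[abs_def] by measurable

lemma noise_meas_F: "0 \<le> s \<Longrightarrow> s \<le> t \<Longrightarrow> noise s t \<in> borel_measurable (F t)"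
  unfolding noise_def[abs_def]
  by (intro borel_measurable_scaleR borel_measurable_diff borel_measurable_const B_meas F_mono[of s t]) auto

lemma X_joint: "(\<lambda>z. X (min (fst z) S) (snd z)) \<in> borel_measurable (borel \<Otimes>\<^sub>M M)"
proof -
  have "(\<lambda>z. (fst z, snd z)) \<in> (borel \<Otimes>\<^sub>M M) \<rightarrow>\<^sub>M (borel \<Otimes>\<^sub>M F S)"
  proof (intro measurable_Pair)
    have "(\<lambda>\<omega>. \<omega>) \<in> M \<rightarrow>\<^sub>M F S" using sub[of S] by (auto simp: measurable_def space_F dest: sets.sets_into_space)
    then show "snd \<in> (borel \<Otimes>\<^sub>M M) \<rightarrow>\<^sub>M F S" using measurable_compose[OF measurable_snd] by blast
  qed simp
  note P = this
  have "S \<in> {0..S}" using S by simp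
  from measurable_compose[OF P X_prog[OF this]] show ?thesis by simp
qed

lemma distr_noise:
  assumes "0 \<le> s" "s < t"
  shows "distr M borel (noise s t) = gauss (2 * (t - s))"
proof -
  have "distr M borel (\<lambda>\<omega>. B t \<omega> - B s \<omega>) = gauss (t - s)"
    using distributed_distr_eq_density[OF B_law[OF assms]] assms
    by (simp add: gauss_density_prod gauss_def cong: distr_cong)
  then have "gauss (2 * (t - s)) = distr (distr M borel (\<lambda>\<omega>. B t \<omega> - B s \<omega>)) borel (\<lambda>x. sqrt 2 *\<^sub>R x)"
    using distr_scale_gauss[of "t - s", symmetric] assms by simp
  also have "\<dots> = distr M borel (noise s t)"
    using assms by (subst distr_distr) (auto simp: noise_def[abs_def] comp_def)
  finally show ?thesis ..
qed

text \<open>Increments after s are independent of \<open>F s\<close>, and the product law is checked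
  on rectangles. The target of \<open>G\<close> is arbitrary so that pairs of variables can be
  used.\<close>

lemma noise_law:
  assumes st: "0 \<le> s" "s < t" and G: "G \<in> measurable (F s) N"
  shows "distr M (N \<Otimes>\<^sub>M borel) (\<lambda>\<omega>. (G \<omega>, noise s t \<omega>)) = distr M N G \<Otimes>\<^sub>M gauss (2 * (t - s))"
proof -
  have [measurable]: "G \<in> measurable M N" by (rule F_M[OF G])
  have [measurable]: "noise s t \<in> borel_measurable M" using st by simp
  interpret DG: prob_space "distr M N G" by (rule prob_space_distr) simp
  interpret DN: prob_space "distr M borel (noise s t)" by (rule prob_space_distr) simp
  have "distr M N G \<Otimes>\<^sub>M distr M borel (noise s t) = distr M (N \<Otimes>\<^sub>M borel) (\<lambda>\<omega>. (G \<omega>, noise s t \<omega>))"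
  proof (rule pair_measure_eqI)
    show "sigma_finite_measure (distr M N G)" "sigma_finite_measure (distr M borel (noise s t))" by unfold_locales
    show "sets (distr M N G \<Otimes>\<^sub>M distr M borel (noise s t)) = sets (distr M (N \<Otimes>\<^sub>M borel) (\<lambda>\<omega>. (G \<omega>, noise s t \<omega>)))"
      by (simp cong: sets_pair_measure_cong)
    fix A A' assume "A \<in> sets (distr M N G)" "A' \<in> sets (distr M borel (noise s t))"
    then have A: "A \<in> sets N" "A' \<in> sets borel" by auto
    let ?a = "G -` A \<inter> space M" and ?b = "noise s t -` A' \<inter> space M"
    have "?a \<in> sets (F s)" using measurable_sets[OF G A(1)] by (simp add: space_F)
    moreover have b: "?b = (\<lambda>\<omega>. B t \<omega> - B s \<omega>) -` ((\<lambda>x. sqrt 2 *\<^sub>R x) -` A') \<inter> space M"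
      by (auto simp: noise_def)
    moreover have "(\<lambda>x. sqrt 2 *\<^sub>R x) -` A' \<in> sets borel"
      using measurable_sets[of "\<lambda>x. sqrt 2 *\<^sub>R x" borel borel A'] A(2) by simp
    then have "?b \<in> {(\<lambda>\<omega>. B t \<omega> - B s \<omega>) -` A \<inter> space M | A. A \<in> sets borel}"
      unfolding b by blast
    ultimately have "prob (?a \<inter> ?b) = prob ?a * prob ?b"
      by (intro indep_setD[OF B_indep[OF st]])
    moreover have "(\<lambda>\<omega>. (G \<omega>, noise s t \<omega>)) -` (A \<times> A') \<inter> space M = ?a \<inter> ?b" by auto
    ultimately show "emeasure (distr M N G) A * emeasure (distr M borel (noise s t)) A'
        = emeasure (distr M (N \<Otimes>\<^sub>M borel) (\<lambda>\<omega>. (G \<omega>, noise s t \<omega>))) (A \<times> A')"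
      using A by (simp add: emeasure_distr emeasure_eq_measure ennreal_mult'')
  qed
  then show ?thesis unfolding distr_noise[OF st] by simp
qed

lemma noise_moment:
  assumes "0 \<le> s" "s \<le> t"
  shows "integrable M (\<lambda>\<omega>. norm (noise s t \<omega>))"
    and "(\<integral>\<omega>. norm (noise s t \<omega>) \<partial>M) \<le> sqrt (2 * real DIM('a) * (t - s))"
proof -
  have "integrable M (\<lambda>\<omega>. norm (noise s t \<omega>)) \<and> (\<integral>\<omega>. norm (noise s t \<omega>) \<partial>M) \<le> sqrt (2 * real DIM('a) * (t - s))"
  proof (cases "s = t")
    case False
    then have st: "s < t" using assms by simp
    have [measurable]: "noise s t \<in> borel_measurable M" using assms by simp
    have "integrable (distr M borel (noise s t)) (\<lambda>x. norm x)"
      unfolding distr_noise[OF assms(1) st] by (rule gauss_norm_moments) (use st in simp)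
    then have "integrable M (\<lambda>\<omega>. norm (noise s t \<omega>))" by (subst (asm) integrable_distr_eq) auto
    moreover have "(\<integral>\<omega>. norm (noise s t \<omega>) \<partial>M) = (\<integral>x. norm x \<partial>distr M borel (noise s t))"
      by (subst integral_distr) auto
    moreover have "\<dots> \<le> sqrt (2 * real DIM('a) * (t - s))"
    proof -
      have e: "2 * real DIM('a) * (t - s) = real DIM('a) * (2 * (t - s))" by simp
      show ?thesis
        unfolding distr_noise[OF assms(1) st] e by (rule gauss_norm_moments) (use st in simp)
    qed
    ultimately show ?thesis by linarith
  qed (simp add: noise_def)
  then show "integrable M (\<lambda>\<omega>. norm (noise s t \<omega>))"
    and "(\<integral>\<omega>. norm (noise s t \<omega>) \<partial>M) \<le> sqrt (2 * real DIM('a) * (t - s))" by auto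
qed

lemma d_norm_int: "integrable (lborel \<Otimes>\<^sub>M M) (\<lambda>(r, \<omega>). norm (d r \<omega>))"
  using integrable_norm[OF d_int] by (simp add: split_beta')

lemma AE_d_int: "AE \<omega> in M. integrable lborel (\<lambda>r. d r \<omega>)"
  using LM.AE_integrable_snd[of d] d_int by (simp add: split_beta')

lemma mean_d_int: "integrable lborel (\<lambda>r. \<integral>\<omega>. norm (d r \<omega>) \<partial>M)"
  using LM.integrable_fst[OF d_norm_int] by simp

lemma drift_mean_nonneg: "drift_mean s t \<ge> 0"
  unfolding drift_mean_def set_lebesgue_integral_def by (intro integral_nonneg_AE AE_I2) (auto simp: indicator_def)

lemma drift_path_mean:
  shows "integrable M (\<lambda>\<omega>. LINT r:{s..t}|lborel. norm (d r \<omega>))"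
    and "(\<integral>\<omega>. (LINT r:{s..t}|lborel. norm (d r \<omega>)) \<partial>M) = drift_mean s t"
proof -
  have [measurable]: "(\<lambda>(r, \<omega>). d r \<omega>) \<in> borel_measurable (lborel \<Otimes>\<^sub>M M)"
    using borel_measurable_integrable[OF d_int] by (simp add: split_beta')
  have i: "integrable (lborel \<Otimes>\<^sub>M M) (\<lambda>(r, \<omega>). indicator {s..t} r *\<^sub>R norm (d r \<omega>))"
    by (rule Bochner_Integration.integrable_bound[OF d_norm_int]) (auto simp: indicator_def)
  show "integrable M (\<lambda>\<omega>. LINT r:{s..t}|lborel. norm (d r \<omega>))"
    using LM.integrable_snd[OF i] by (simp add: set_lebesgue_integral_def)
  show "(\<integral>\<omega>. (LINT r:{s..t}|lborel. norm (d r \<omega>)) \<partial>M) = drift_mean s t"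
    using LM.Fubini_integral[OF i] by (simp add: set_lebesgue_integral_def drift_mean_def)
qed

lemma path_increment:
  "AE \<omega> in M. \<forall>s t. 0 \<le> s \<longrightarrow> s \<le> t \<longrightarrow> t \<le> S \<longrightarrow>
     X t \<omega> = X s \<omega> + noise s t \<omega> + (LINT r:{s..t}|lborel. d r \<omega>)"
  using ito AE_d_int
proof eventually_elim
  case (elim \<omega>)
  show ?case
  proof (intro allI impI)
    fix s t :: real assume st: "0 \<le> s" "s \<le> t" "t \<le> S"
    have si: "set_integrable lborel A (\<lambda>r. d r \<omega>)" if "A \<in> sets lborel" for A
      using elim(2) that by (simp add: set_integrable_def integrable_mult_indicator)
    have "(LINT r:{0..s} \<union> {s<..t}|lborel. d r \<omega>) = (LINT r:{0..s}|lborel. d r \<omega>) + (LINT r:{s<..t}|lborel. d r \<omega>)"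
      by (rule set_integral_Un) (auto intro!: si)
    moreover have "{0..s} \<union> {s<..t} = {0..t}" using st by auto
    moreover have "(LINT r:{s<..t}|lborel. d r \<omega>) = (LINT r:{s..t}|lborel. d r \<omega>)"
      unfolding set_lebesgue_integral_def
    proof (rule integral_cong_AE)
      have [measurable]: "(\<lambda>r. d r \<omega>) \<in> borel_measurable lborel"
        by (rule borel_measurable_integrable[OF elim(2)])
      show "(\<lambda>r. indicator {s<..t} r *\<^sub>R d r \<omega>) \<in> borel_measurable lborel"
        "(\<lambda>r. indicator {s..t} r *\<^sub>R d r \<omega>) \<in> borel_measurable lborel" by measurable
      show "AE r in lborel. indicator {s<..t} r *\<^sub>R d r \<omega> = indicator {s..t} r *\<^sub>R d r \<omega>"
        using AE_lborel_singleton[of s] by eventually_elim (auto simp: indicator_def)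
    qed
    ultimately have split: "(LINT r:{0..t}|lborel. d r \<omega>) = (LINT r:{0..s}|lborel. d r \<omega>) + (LINT r:{s..t}|lborel. d r \<omega>)"
      by simp
    have "s \<in> {0..S}" "t \<in> {0..S}" using st by auto
    then have "X s \<omega> = X 0 \<omega> + sqrt 2 *\<^sub>R B s \<omega> + (LINT r:{0..s}|lborel. d r \<omega>)"
      "X t \<omega> = X 0 \<omega> + sqrt 2 *\<^sub>R B t \<omega> + (LINT r:{0..t}|lborel. d r \<omega>)"
      using elim(1) by blast+
    then show "X t \<omega> = X s \<omega> + noise s t \<omega> + (LINT r:{s..t}|lborel. d r \<omega>)"
      unfolding split noise_def by (simp only: scaleR_diff_right) simp
  qed
qed

lemma increment_mean:
  assumes "0 \<le> s" "s \<le> r" "r \<le> t" "t \<le> S"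
  shows "integrable M (\<lambda>\<omega>. norm (X r \<omega> - X s \<omega> - noise s t \<omega>))"
    and "(\<integral>\<omega>. norm (X r \<omega> - X s \<omega> - noise s t \<omega>) \<partial>M) \<le> drift_mean s t + sqrt (2 * real DIM('a) * (t - s))"
proof -
  have [measurable]: "X r \<in> borel_measurable M" "X s \<in> borel_measurable M" "noise s t \<in> borel_measurable M"
    using assms by auto
  have le: "AE \<omega> in M. norm (X r \<omega> - X s \<omega> - noise s t \<omega>) \<le> (LINT r:{s..t}|lborel. norm (d r \<omega>)) + norm (noise r t \<omega>)"
    using path_increment AE_d_int
  proof eventually_elim
    case (elim \<omega>)
    have si: "set_integrable lborel A (\<lambda>r. norm (d r \<omega>))" if "A \<in> sets lborel" for A
      using integrable_norm[OF elim(2)] that unfolding set_integrable_def by (intro integrable_mult_indicator)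
    \<comment> \<open>The noise up to r cancels. What remains of the noise of the cell is the part
      after r, of order sqrt(t - s) in mean.\<close>
    have "X r \<omega> - X s \<omega> - noise s t \<omega> = (LINT r:{s..r}|lborel. d r \<omega>) - noise r t \<omega>"
      using elim(1) assms by (simp add: noise_def algebra_simps)
    then have "norm (X r \<omega> - X s \<omega> - noise s t \<omega>) \<le> norm (LINT r:{s..r}|lborel. d r \<omega>) + norm (noise r t \<omega>)"
      by (simp add: norm_triangle_ineq4)
    also have "norm (LINT r:{s..r}|lborel. d r \<omega>) \<le> (LINT r:{s..r}|lborel. norm (d r \<omega>))"
      unfolding set_lebesgue_integral_def by (rule order_trans[OF integral_norm_bound]) simp
    also have "\<dots> \<le> (LINT r:{s..t}|lborel. norm (d r \<omega>))"
      unfolding set_lebesgue_integral_def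
      using si[of "{s..r}"] si[of "{s..t}"] assms by (intro integral_mono) (auto simp: set_integrable_def indicator_def)
    finally show ?case by simp
  qed
  have i: "integrable M (\<lambda>\<omega>. (LINT r:{s..t}|lborel. norm (d r \<omega>)) + norm (noise r t \<omega>))"
    using drift_path_mean(1) noise_moment(1)[of r t] assms by auto
  show i': "integrable M (\<lambda>\<omega>. norm (X r \<omega> - X s \<omega> - noise s t \<omega>))"
    by (rule Bochner_Integration.integrable_bound[OF i]) (use le in \<open>auto elim: eventually_mono\<close>)
  have "(\<integral>\<omega>. norm (X r \<omega> - X s \<omega> - noise s t \<omega>) \<partial>M) \<le> (\<integral>\<omega>. (LINT r:{s..t}|lborel. norm (d r \<omega>)) + norm (noise r t \<omega>) \<partial>M)"
    by (rule integral_mono_AE[OF i' i le])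
  also have "\<dots> = drift_mean s t + (\<integral>\<omega>. norm (noise r t \<omega>) \<partial>M)"
    using drift_path_mean noise_moment(1)[of r t] assms by simp
  also have "(\<integral>\<omega>. norm (noise r t \<omega>) \<partial>M) \<le> sqrt (2 * real DIM('a) * (t - r))"
    using assms by (intro noise_moment) auto
  also have "sqrt (2 * real DIM('a) * (t - r)) \<le> sqrt (2 * real DIM('a) * (t - s))"
    using assms by (intro real_sqrt_le_mono mult_left_mono) auto
  finally show "(\<integral>\<omega>. norm (X r \<omega> - X s \<omega> - noise s t \<omega>) \<partial>M) \<le> drift_mean s t + sqrt (2 * real DIM('a) * (t - s))" by simp
qed

lemma dist_mean:
  assumes "0 \<le> s" "s \<le> t" "t \<le> S"
  shows "integrable M (\<lambda>\<omega>. dist (X t \<omega>) (X s \<omega>))"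
    and "(\<integral>\<omega>. dist (X t \<omega>) (X s \<omega>) \<partial>M) \<le> drift_mean s t + sqrt (2 * real DIM('a) * (t - s))"
proof -
  have [measurable]: "X t \<in> borel_measurable M" "X s \<in> borel_measurable M" "noise s t \<in> borel_measurable M"
    using assms by auto
  have le: "AE \<omega> in M. dist (X t \<omega>) (X s \<omega>) \<le> (LINT r:{s..t}|lborel. norm (d r \<omega>)) + norm (noise s t \<omega>)"
    using path_increment
  proof eventually_elim
    case (elim \<omega>)
    have "X t \<omega> = X s \<omega> + noise s t \<omega> + (LINT r:{s..t}|lborel. d r \<omega>)"
      using elim assms by blast
    then have "X t \<omega> - X s \<omega> = (LINT r:{s..t}|lborel. d r \<omega>) + noise s t \<omega>"
      by simp
    then have "dist (X t \<omega>) (X s \<omega>) \<le> norm (LINT r:{s..t}|lborel. d r \<omega>) + norm (noise s t \<omega>)"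
      by (simp add: dist_norm norm_triangle_ineq)
    also have "norm (LINT r:{s..t}|lborel. d r \<omega>) \<le> (LINT r:{s..t}|lborel. norm (d r \<omega>))"
      unfolding set_lebesgue_integral_def by (rule order_trans[OF integral_norm_bound]) simp
    finally show ?case by simp
  qed
  have i: "integrable M (\<lambda>\<omega>. (LINT r:{s..t}|lborel. norm (d r \<omega>)) + norm (noise s t \<omega>))"
    using drift_path_mean(1) noise_moment(1)[of s t] assms by auto
  show i': "integrable M (\<lambda>\<omega>. dist (X t \<omega>) (X s \<omega>))"
    by (rule Bochner_Integration.integrable_bound[OF i]) (use le in \<open>auto elim: eventually_mono\<close>)
  have "(\<integral>\<omega>. dist (X t \<omega>) (X s \<omega>) \<partial>M) \<le> (\<integral>\<omega>. (LINT r:{s..t}|lborel. norm (d r \<omega>)) + norm (noise s t \<omega>) \<partial>M)"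
    by (rule integral_mono_AE[OF i' i le])
  also have "\<dots> = drift_mean s t + (\<integral>\<omega>. norm (noise s t \<omega>) \<partial>M)"
    using drift_path_mean noise_moment(1)[of s t] assms by simp
  also have "(\<integral>\<omega>. norm (noise s t \<omega>) \<partial>M) \<le> sqrt (2 * real DIM('a) * (t - s))"
    using assms by (intro noise_moment) auto
  finally show "(\<integral>\<omega>. dist (X t \<omega>) (X s \<omega>) \<partial>M) \<le> drift_mean s t + sqrt (2 * real DIM('a) * (t - s))" by simp
qed

text \<open>On a cell of length \<delta> the mean is of order \<delta> times (drift over the cell +
  sqrt \<delta>), so the sum over all cells still vanishes with \<delta>.\<close>

lemma remainder_mean:
  assumes "0 \<le> s" "s \<le> t" "t \<le> S"
  shows "AE \<omega> in M. set_integrable lborel {s..t} (\<lambda>r. norm (X r \<omega> - X s \<omega> - noise s t \<omega>))"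
    and "integrable M (remainder s t)"
    and "(\<integral>\<omega>. remainder s t \<omega> \<partial>M) \<le> (t - s) * (drift_mean s t + sqrt (2 * real DIM('a) * (t - s)))"
proof -
  have [measurable]: "X s \<in> borel_measurable M" "noise s t \<in> borel_measurable M"
    using assms by (auto intro: X_meas_M noise_meas)
  \<comment> \<open>Joint measurability is known for the path clipped at S; on [s, t] the clipping
    changes nothing.\<close>
  let ?f = "\<lambda>r \<omega>. indicator {s..t} r *\<^sub>R norm (X (min r S) \<omega> - X s \<omega> - noise s t \<omega>)"
  let ?K = "drift_mean s t + sqrt (2 * real DIM('a) * (t - s))"
  have meas: "(\<lambda>(r, \<omega>). ?f r \<omega>) \<in> borel_measurable (lborel \<Otimes>\<^sub>M M)"
  proof -
    define h where "h = (\<lambda>z. X (min (fst z) S) (snd z))"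
    have [measurable]: "h \<in> borel_measurable (borel \<Otimes>\<^sub>M M)" unfolding h_def by (rule X_joint)
    have "(\<lambda>z. indicator {s..t} (fst z) *\<^sub>R norm (h z - X s (snd z) - noise s t (snd z))) \<in> borel_measurable (lborel \<Otimes>\<^sub>M M)"
      by measurable
    then show ?thesis unfolding split_beta' h_def .
  qed
  have fr: "integrable M (?f r)" "(\<integral>\<omega>. ?f r \<omega> \<partial>M) \<le> indicator {s..t} r *\<^sub>R ?K" for r
    using increment_mean[of s r t] assms by (cases "r \<in> {s..t}"; auto)+
  have i: "integrable (lborel \<Otimes>\<^sub>M M) (\<lambda>(r, \<omega>). ?f r \<omega>)"
  proof (rule LM.Fubini_integrable[OF meas])
    have nf: "norm (?f r \<omega>) = ?f r \<omega>" for r \<omega> by simp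
    have f0: "(\<integral>\<omega>. ?f r \<omega> \<partial>M) \<ge> 0" for r by (intro integral_nonneg_AE AE_I2) simp
    have m: "(\<lambda>r. \<integral>\<omega>. ?f r \<omega> \<partial>M) \<in> borel_measurable lborel"
      by (rule borel_measurable_lebesgue_integral[OF meas])
    show "integrable lborel (\<lambda>r. \<integral>\<omega>. norm (case (r, \<omega>) of (r, \<omega>) \<Rightarrow> ?f r \<omega>) \<partial>M)"
      unfolding prod.case nf
    proof (rule Bochner_Integration.integrable_bound[OF _ m])
      show "integrable lborel (\<lambda>r. indicator {s..t} r *\<^sub>R ?K)"
        by (intro integrable_scaleR_left integrable_real_indicator) (auto simp: emeasure_lborel_Icc_eq)
      show "AE r in lborel. norm (\<integral>\<omega>. ?f r \<omega> \<partial>M) \<le> norm (indicator {s..t} r *\<^sub>R ?K)"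
      proof (rule AE_I2)
        fix r
        have "norm (\<integral>\<omega>. ?f r \<omega> \<partial>M) = (\<integral>\<omega>. ?f r \<omega> \<partial>M)"
          unfolding real_norm_def by (rule abs_of_nonneg[OF f0])
        also have "\<dots> \<le> norm (indicator {s..t} r *\<^sub>R ?K)"
          unfolding real_norm_def by (rule order_trans[OF fr(2) abs_ge_self])
        finally show "norm (\<integral>\<omega>. ?f r \<omega> \<partial>M) \<le> norm (indicator {s..t} r *\<^sub>R ?K)" .
      qed
    qed
    show "AE r in lborel. integrable M (\<lambda>\<omega>. case (r, \<omega>) of (r, \<omega>) \<Rightarrow> ?f r \<omega>)" using fr(1) by simp
  qed
  have eq: "(\<lambda>r. ?f r \<omega>) = (\<lambda>r. indicator {s..t} r *\<^sub>R norm (X r \<omega> - X s \<omega> - noise s t \<omega>))" for \<omega>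
    using assms by (auto simp: fun_eq_iff indicator_def min_def)
  show "AE \<omega> in M. set_integrable lborel {s..t} (\<lambda>r. norm (X r \<omega> - X s \<omega> - noise s t \<omega>))"
    using LM.AE_integrable_snd[OF i] unfolding set_integrable_def eq .
  have req: "remainder s t = (\<lambda>\<omega>. \<integral>r. ?f r \<omega> \<partial>lborel)"
    unfolding remainder_def[abs_def] set_lebesgue_integral_def eq ..
  show "integrable M (remainder s t)"
    unfolding req by (rule LM.integrable_snd[OF i])
  have "(\<integral>\<omega>. remainder s t \<omega> \<partial>M) = (\<integral>r. (\<integral>\<omega>. ?f r \<omega> \<partial>M) \<partial>lborel)"
    unfolding req by (rule LM.Fubini_integral[OF i])
  also have "\<dots> \<le> (\<integral>r. indicator {s..t} r *\<^sub>R ?K \<partial>lborel)"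
  proof (rule integral_mono[OF LM.integrable_fst[OF i] _ fr(2)])
    show "integrable lborel (\<lambda>r. indicator {s..t} r *\<^sub>R ?K)"
      by (intro integrable_scaleR_left integrable_real_indicator) (auto simp: emeasure_lborel_Icc_eq)
  qed
  also have "\<dots> = (t - s) * ?K" by (rule integral_indicator_Icc) fact
  finally show "(\<integral>\<omega>. remainder s t \<omega> \<partial>M) \<le> (t - s) * ?K" .
qed

end

text \<open>A step of the drift with space frozen at y but time integrated: b is merely measurable
  in time, so freezing the time as well would give no control of the error.\<close>

definition flow :: "(real \<Rightarrow> 'a \<Rightarrow> 'a) \<Rightarrow> real \<Rightarrow> real \<Rightarrow> 'a::euclidean_space \<Rightarrow> 'a" where
  "flow b s t y = y + (LINT r:{s..t}|lborel. b r y)"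

text \<open>The Lipschitz constant is uniform in time while the size of the drift is only
  integrable: \<open>b_zero\<close> and the Lipschitz bound together give local integrability in
  time at every point.\<close>

locale lipschitz_drift =
  fixes b :: "real \<Rightarrow> 'a::euclidean_space \<Rightarrow> 'a" and c :: real
  assumes b_meas: "(\<lambda>z. b (fst z) (snd z)) \<in> borel_measurable borel"
    and b_lip: "\<And>r. c-lipschitz_on UNIV (b r)"
    and b_zero: "integrable lborel (\<lambda>r. b r 0)"
begin

lemma c_nonneg: "0 \<le> c"
  by (rule lipschitz_on_nonneg[OF b_lip])

lemma b_le: "norm (b r y) \<le> norm (b r 0) + c * norm y"
  using lipschitz_onD[OF b_lip, of y 0 r] norm_triangle_ineq2[of "b r y" "b r 0"] by (simp add: dist_norm)

lemma b_meas1 [measurable]: "(\<lambda>r. b r y) \<in> borel_measurable borel"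
  using measurable_compose[OF _ b_meas, of "\<lambda>r. (r, y)" borel]
  by (simp add: borel_measurable_continuous_onI continuous_on_Pair)

lemma b_int: "set_integrable lborel {s..t} (\<lambda>r. b r y)"
  unfolding set_integrable_def
proof (rule Bochner_Integration.integrable_bound)
  have "integrable lborel (\<lambda>r. indicator {s..t} r * (c * norm y))"
    by (intro integrable_mult_left integrable_real_indicator) (auto simp: emeasure_lborel_Icc_eq)
  then show "integrable lborel (\<lambda>r. norm (b r 0) + indicator {s..t} r * (c * norm y))"
    using integrable_norm[OF b_zero] by (intro Bochner_Integration.integrable_add)
  show "AE r in lborel. norm (indicator {s..t} r *\<^sub>R b r y) \<le> norm (norm (b r 0) + indicator {s..t} r * (c * norm y))"
    using b_le[of _ y] c_nonneg by (intro AE_I2) (auto simp: indicator_def)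
qed simp

lemma flow_error:
  assumes i: "set_integrable lborel {s..t} (\<lambda>r. b r (f r))"
    and j: "set_integrable lborel {s..t} (\<lambda>r. norm (f r - y))"
  shows "norm ((LINT r:{s..t}|lborel. b r (f r)) - (LINT r:{s..t}|lborel. b r y)) \<le> c * (LINT r:{s..t}|lborel. norm (f r - y))"
proof -
  have "(LINT r:{s..t}|lborel. b r (f r)) - (LINT r:{s..t}|lborel. b r y) = (LINT r:{s..t}|lborel. b r (f r) - b r y)"
    using i b_int by simp
  also have "norm \<dots> \<le> (\<integral>r. indicator {s..t} r *\<^sub>R (c * norm (f r - y)) \<partial>lborel)"
    unfolding set_lebesgue_integral_def
  proof (rule order_trans[OF integral_norm_bound integral_mono])
    show "integrable lborel (\<lambda>r. norm (indicator {s..t} r *\<^sub>R (b r (f r) - b r y)))"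
      using set_integral_diff(1)[OF i b_int] unfolding set_integrable_def by (rule integrable_norm)
    show "integrable lborel (\<lambda>r. indicator {s..t} r *\<^sub>R (c * norm (f r - y)))"
      using set_integrable_mult_right[of c, OF j] unfolding set_integrable_def by simp
    show "norm (indicator {s..t} r *\<^sub>R (b r (f r) - b r y)) \<le> indicator {s..t} r *\<^sub>R (c * norm (f r - y))" for r
      using lipschitz_onD[OF b_lip, of "f r" y r] by (simp add: indicator_def dist_norm)
  qed
  also have "\<dots> = c * (LINT r:{s..t}|lborel. norm (f r - y))"
    by (simp add: set_lebesgue_integral_def mult.left_commute)
  finally show ?thesis .
qed

lemma flow_lipschitz:
  assumes "s \<le> t"
  shows "(1 + c * (t - s))-lipschitz_on UNIV (flow b s t)"
proof (rule lipschitz_onI)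
  fix x y
  have "norm ((LINT r:{s..t}|lborel. b r x) - (LINT r:{s..t}|lborel. b r y)) \<le> c * (LINT r:{s..t}|lborel. norm (x - y))"
    by (rule flow_error[OF b_int]) (simp add: set_integrable_def, intro disjI2 integrable_real_indicator, auto simp: emeasure_lborel_Icc_eq)
  then have "norm ((LINT r:{s..t}|lborel. b r x) - (LINT r:{s..t}|lborel. b r y)) \<le> c * ((t - s) * norm (x - y))"
    using assms by (simp add: set_lebesgue_integral_def)
  then show "dist (flow b s t x) (flow b s t y) \<le> (1 + c * (t - s)) * dist x y"
    using norm_triangle_ineq[of "x - y" "(LINT r:{s..t}|lborel. b r x) - (LINT r:{s..t}|lborel. b r y)"]
    by (simp add: flow_def dist_norm algebra_simps)
qed (use assms c_nonneg in simp)

end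

section \<open>Integrals over grid cells\<close>

lemma set_integrable_Icc:
  fixes f :: "real \<Rightarrow> 'b::{banach, second_countable_topology}"
  assumes "integrable lborel f"
  shows "set_integrable lborel {a..b} f"
  using assms unfolding set_integrable_def by (intro integrable_mult_indicator) auto

lemma set_integral_Icc_split:
  fixes f :: "real \<Rightarrow> 'b::{banach, second_countable_topology}"
  assumes f: "integrable lborel f" and "a \<le> b" "b \<le> c"
  shows "(LINT r:{a..c}|lborel. f r) = (LINT r:{a..b}|lborel. f r) + (LINT r:{b..c}|lborel. f r)"
proof -
  have i: "set_integrable lborel A f" if "A \<in> sets lborel" for A
    using f that unfolding set_integrable_def by (intro integrable_mult_indicator)
  have "(LINT r:{a..b} \<union> {b<..c}|lborel. f r) = (LINT r:{a..b}|lborel. f r) + (LINT r:{b<..c}|lborel. f r)"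
    by (rule set_integral_Un) (auto intro!: i)
  moreover have "{a..b} \<union> {b<..c} = {a..c}" using assms by auto
  moreover have "(LINT r:{b<..c}|lborel. f r) = (LINT r:{b..c}|lborel. f r)"
    unfolding set_lebesgue_integral_def
  proof (rule integral_cong_AE)
    have [measurable]: "f \<in> borel_measurable lborel" by (rule borel_measurable_integrable[OF f])
    show "(\<lambda>r. indicator {b<..c} r *\<^sub>R f r) \<in> borel_measurable lborel"
      "(\<lambda>r. indicator {b..c} r *\<^sub>R f r) \<in> borel_measurable lborel" by measurable
    show "AE r in lborel. indicator {b<..c} r *\<^sub>R f r = indicator {b..c} r *\<^sub>R f r"
      using AE_lborel_singleton[of b] by eventually_elim (auto simp: indicator_def)
  qed
  ultimately show ?thesis by simp
qed

lemma set_integral_Icc_mono: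
  fixes f :: "real \<Rightarrow> real"
  assumes f: "integrable lborel f" "\<And>r. 0 \<le> f r" and "{a..b} \<subseteq> {a'..b'}"
  shows "(LINT r:{a..b}|lborel. f r) \<le> (LINT r:{a'..b'}|lborel. f r)"
  unfolding set_lebesgue_integral_def
proof (rule integral_mono)
  show "integrable lborel (\<lambda>r. indicator {a..b} r *\<^sub>R f r)" "integrable lborel (\<lambda>r. indicator {a'..b'} r *\<^sub>R f r)"
    using set_integrable_Icc[OF f(1)] unfolding set_integrable_def by auto
  show "indicator {a..b} r *\<^sub>R f r \<le> indicator {a'..b'} r *\<^sub>R f r" for r
    using assms(3) f(2)[of r] by (auto simp: indicator_def)
qed

lemma set_integral_Icc_nonneg:
  fixes f :: "real \<Rightarrow> real"
  assumes "\<And>r. 0 \<le> f r"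
  shows "0 \<le> (LINT r:{a..b}|lborel. f r)"
  unfolding set_lebesgue_integral_def using assms by (intro integral_nonneg_AE AE_I2) simp

definition grid :: "real \<Rightarrow> real \<Rightarrow> nat \<Rightarrow> real" where
  "grid \<tau> \<delta> k = \<tau> + real k * \<delta>"

lemma grid_simps: "grid \<tau> \<delta> 0 = \<tau>" "grid \<tau> \<delta> (Suc k) = grid \<tau> \<delta> k + \<delta>"
  by (auto simp: grid_def algebra_simps)

lemma grid_mono: "0 \<le> \<delta> \<Longrightarrow> j \<le> k \<Longrightarrow> grid \<tau> \<delta> j \<le> grid \<tau> \<delta> k"
  by (auto simp: grid_def intro!: mult_right_mono)

lemma set_integral_grid:
  fixes f :: "real \<Rightarrow> 'b::{banach, second_countable_topology}"
  assumes f: "integrable lborel f" and \<delta>: "0 \<le> \<delta>"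
  shows "(\<Sum>k<m. LINT r:{grid \<tau> \<delta> k..grid \<tau> \<delta> (Suc k)}|lborel. f r) = (LINT r:{\<tau>..grid \<tau> \<delta> m}|lborel. f r)"
proof (induction m)
  case 0
  \<comment> \<open>Splitting the degenerate interval at its own endpoint gives x + x = x, so the
    integral over a point vanishes.\<close>
  have "(LINT r:{\<tau>..\<tau>}|lborel. f r) + (LINT r:{\<tau>..\<tau>}|lborel. f r) = (LINT r:{\<tau>..\<tau>}|lborel. f r)"
    using set_integral_Icc_split[OF f, of \<tau> \<tau> \<tau>] by simp
  then show ?case by (simp add: grid_simps)
next
  case (Suc m)
  have "\<tau> \<le> grid \<tau> \<delta> m" using grid_mono[OF \<delta>, of 0 m \<tau>] by (simp add: grid_simps)
  moreover have "grid \<tau> \<delta> m \<le> grid \<tau> \<delta> (Suc m)" using \<delta> by (intro grid_mono) auto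
  ultimately show ?case using Suc set_integral_Icc_split[OF f, of \<tau> "grid \<tau> \<delta> m" "grid \<tau> \<delta> (Suc m)"] by simp
qed

text \<open>The mean square deviation of f from its average q over the interval is
  nonnegative.\<close>

lemma set_integral_Cauchy_Schwarz:
  fixes f :: "real \<Rightarrow> real"
  assumes i: "set_integrable lborel {a..b} f" and i2: "set_integrable lborel {a..b} (\<lambda>r. (f r)\<^sup>2)" and ab: "a < b"
  shows "(LINT r:{a..b}|lborel. f r)\<^sup>2 \<le> (b - a) * (LINT r:{a..b}|lborel. (f r)\<^sup>2)"
proof -
  define u where "u = (LINT r:{a..b}|lborel. f r)"
  define q where "q = u / (b - a)"
  have ic: "set_integrable lborel {a..b} (\<lambda>r. q\<^sup>2)"
    unfolding set_integrable_def by (intro integrable_scaleR_left integrable_real_indicator) (auto simp: emeasure_lborel_Icc_eq)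
  have c: "(LINT r:{a..b}|lborel. q\<^sup>2) = (b - a) * q\<^sup>2"
    unfolding set_lebesgue_integral_def using ab by (intro integral_indicator_Icc) simp
  have "0 \<le> (LINT r:{a..b}|lborel. (f r - q)\<^sup>2)" by (rule set_integral_Icc_nonneg) simp
  also have "(\<lambda>r. (f r - q)\<^sup>2) = (\<lambda>r. (f r)\<^sup>2 - (2 * q) * f r + q\<^sup>2)"
    by (simp add: fun_eq_iff power2_eq_square algebra_simps)
  also have "(LINT r:{a..b}|lborel. (f r)\<^sup>2 - (2 * q) * f r + q\<^sup>2)
      = (LINT r:{a..b}|lborel. (f r)\<^sup>2 - (2 * q) * f r) + (LINT r:{a..b}|lborel. q\<^sup>2)"
    by (rule set_integral_add(2)[OF set_integral_diff(1)[OF i2 set_integrable_mult_right[OF i]] ic])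
  also have "(LINT r:{a..b}|lborel. (f r)\<^sup>2 - (2 * q) * f r) = (LINT r:{a..b}|lborel. (f r)\<^sup>2) - (LINT r:{a..b}|lborel. (2 * q) * f r)"
    by (rule set_integral_diff(2)[OF i2 set_integrable_mult_right[OF i]])
  also have "(LINT r:{a..b}|lborel. (2 * q) * f r) = (2 * q) * u" unfolding u_def by simp
  finally have "0 \<le> (LINT r:{a..b}|lborel. (f r)\<^sup>2) - 2 * q * u + (b - a) * q\<^sup>2" unfolding c .
  also have "2 * q * u = 2 * (u\<^sup>2 / (b - a))" by (simp add: q_def power2_eq_square)
  also have "(b - a) * q\<^sup>2 = u\<^sup>2 / (b - a)" using ab by (simp add: q_def power2_eq_square)
  finally have "u\<^sup>2 / (b - a) \<le> (LINT r:{a..b}|lborel. (f r)\<^sup>2)" by simp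
  then show ?thesis using ab by (simp add: u_def field_simps)
qed

text \<open>The drift splits into a Lipschitz part b and a square-integrable part v without
  regularity in space. Both solutions are instances; for \<open>Y\<close> the part v is
  zero.\<close>

locale driven_process = ito_process M F B X "\<lambda>s \<omega>. b s (X s \<omega>) + v s (X s \<omega>)" S + lipschitz_drift b c
  for M :: "'w measure" and F B and X :: "real \<Rightarrow> 'w \<Rightarrow> 'a::euclidean_space" and S b c v +
  assumes b_out: "\<And>s y. s \<notin> {0..S} \<Longrightarrow> b s y = 0"
    and v_out: "\<And>s y. s \<notin> {0..S} \<Longrightarrow> v s y = 0"
    and v_meas: "(\<lambda>z. v (fst z) (snd z)) \<in> borel_measurable borel"
    and v_sq: "integrable (lborel \<Otimes>\<^sub>M M) (\<lambda>z. (norm (v (fst z) (X (fst z) (snd z))))\<^sup>2)"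
begin

definition v_path :: "real \<Rightarrow> real \<Rightarrow> 'w \<Rightarrow> 'a" where
  "v_path s t \<omega> = (LINT r:{s..t}|lborel. v r (X r \<omega>))"

definition energy :: "real \<Rightarrow> real" where
  "energy r = (\<integral>\<omega>. (norm (v r (X r \<omega>)))\<^sup>2 \<partial>M)"

lemma energy_nonneg: "0 \<le> energy r"
  by (simp add: energy_def)

lemma v_sq': "integrable (lborel \<Otimes>\<^sub>M M) (\<lambda>(r, \<omega>). (norm (v r (X r \<omega>)))\<^sup>2)"
  using v_sq by (simp add: split_beta')

lemma energy_int: "integrable lborel energy"
  unfolding energy_def[abs_def] by (rule LM.integrable_fst[OF v_sq'])

lemma v_prog:
  assumes t: "t \<in> {0..S}" and f: "(\<lambda>z. f (fst z) (snd z)) \<in> borel_measurable borel"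
  shows "(\<lambda>z. f (fst z) (X (min (fst z) t) (snd z))) \<in> borel_measurable (borel \<Otimes>\<^sub>M F t)"
proof -
  have "(\<lambda>z. (fst z, X (min (fst z) t) (snd z))) \<in> (borel \<Otimes>\<^sub>M F t) \<rightarrow>\<^sub>M (borel \<Otimes>\<^sub>M borel)"
    by (intro measurable_Pair X_prog t) simp
  from measurable_compose[OF this, of "\<lambda>z. f (fst z) (snd z)"] f show ?thesis by (simp add: borel_prod)
qed

lemma v_joint: "(\<lambda>(r, \<omega>). v r (X r \<omega>)) \<in> borel_measurable (lborel \<Otimes>\<^sub>M M)"
proof -
  have "(\<lambda>z. (fst z, X (min (fst z) S) (snd z))) \<in> (borel \<Otimes>\<^sub>M M) \<rightarrow>\<^sub>M (borel \<Otimes>\<^sub>M borel)"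
    by (intro measurable_Pair X_joint) simp
  from measurable_compose[OF this, of "\<lambda>z. v (fst z) (snd z)"] v_meas
  have "(\<lambda>z. v (fst z) (X (min (fst z) S) (snd z))) \<in> borel_measurable (borel \<Otimes>\<^sub>M M)" by (simp add: borel_prod)
  moreover have "v r (X (min r S) \<omega>) = v r (X r \<omega>)" for r \<omega>
    using v_out[of r] by (cases "r \<le> S") (auto simp: min_def)
  ultimately have "(\<lambda>z. v (fst z) (X (fst z) (snd z))) \<in> borel_measurable (borel \<Otimes>\<^sub>M M)" by simp
  then show ?thesis unfolding split_beta' by (simp cong: measurable_cong_sets)
qed

lemma v_int: "integrable (lborel \<Otimes>\<^sub>M M) (\<lambda>(r, \<omega>). v r (X r \<omega>))"
proof (rule Bochner_Integration.integrable_bound[OF _ v_joint])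
  have "integrable (lborel \<Otimes>\<^sub>M M) (\<lambda>z. indicator ({0..S} \<times> space M) z :: real)"
  proof (rule integrable_real_indicator)
    show "{0..S} \<times> space M \<in> sets (lborel \<Otimes>\<^sub>M M)" by (intro pair_measureI) auto
    show "emeasure (lborel \<Otimes>\<^sub>M M) ({0..S} \<times> space M) < \<infinity>"
      using S by (subst emeasure_pair_measure_Times) (auto simp: emeasure_space_1)
  qed
  then show "integrable (lborel \<Otimes>\<^sub>M M) (\<lambda>z. indicator ({0..S} \<times> space M) z + (norm (v (fst z) (X (fst z) (snd z))))\<^sup>2)"
    using v_sq by (rule Bochner_Integration.integrable_add)
  show "AE z in lborel \<Otimes>\<^sub>M M. norm (case z of (r, \<omega>) \<Rightarrow> v r (X r \<omega>))
     \<le> norm (indicator ({0..S} \<times> space M) z + (norm (v (fst z) (X (fst z) (snd z))))\<^sup>2)"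
  proof (rule AE_I2)
    fix z :: "real \<times> 'w" assume "z \<in> space (lborel \<Otimes>\<^sub>M M)"
    then obtain r \<omega> where z: "z = (r, \<omega>)" "\<omega> \<in> space M" by (auto simp: space_pair_measure)
    have "2 * norm (v r (X r \<omega>)) \<le> 1 + (norm (v r (X r \<omega>)))\<^sup>2"
      using sum_squares_bound[of "norm (v r (X r \<omega>))" 1] by simp
    then have "norm (v r (X r \<omega>)) \<le> 1 + (norm (v r (X r \<omega>)))\<^sup>2" using norm_ge_zero[of "v r (X r \<omega>)"] by linarith
    then show "norm (case z of (r, \<omega>) \<Rightarrow> v r (X r \<omega>))
       \<le> norm (indicator ({0..S} \<times> space M) z + (norm (v (fst z) (X (fst z) (snd z))))\<^sup>2)"
      using z v_out[of r "X r \<omega>"] by (cases "r \<in> {0..S}") auto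
  qed
qed

lemma AE_path_int:
  "AE \<omega> in M. integrable lborel (\<lambda>r. v r (X r \<omega>)) \<and> integrable lborel (\<lambda>r. (norm (v r (X r \<omega>)))\<^sup>2)
      \<and> integrable lborel (\<lambda>r. b r (X r \<omega>))"
  using LM.AE_integrable_snd[OF v_int] LM.AE_integrable_snd[OF v_sq'] AE_d_int
proof eventually_elim
  case (elim \<omega>)
  from Bochner_Integration.integrable_diff[OF elim(3) elim(1)] elim show ?case by simp
qed

lemma v_path_meas:
  assumes st: "0 \<le> s" "s \<le> t" "t \<le> S"
  shows "v_path s t \<in> borel_measurable (F t)"
proof -
  \<comment> \<open>Clipping the path at t leaves the integrand on [s, t] unchanged and exhibits the
    displacement as known at time t.\<close>
  have "(\<lambda>z. v (fst z) (X (min (fst z) t) (snd z))) \<in> borel_measurable (borel \<Otimes>\<^sub>M F t)"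
    by (rule v_prog[OF _ v_meas]) (use st in auto)
  then have "(\<lambda>z. indicator {s..t} (fst z) *\<^sub>R v (fst z) (X (min (fst z) t) (snd z))) \<in> borel_measurable (borel \<Otimes>\<^sub>M F t)"
    by (intro borel_measurable_scaleR) auto
  from measurable_compose[OF measurable_pair_swap' this]
  have "(\<lambda>(\<omega>, r). indicator {s..t} r *\<^sub>R v r (X (min r t) \<omega>)) \<in> borel_measurable (F t \<Otimes>\<^sub>M borel)"
    by (simp add: split_beta')
  then have "(\<lambda>(\<omega>, r). indicator {s..t} r *\<^sub>R v r (X (min r t) \<omega>)) \<in> borel_measurable (F t \<Otimes>\<^sub>M lborel)"
    by (simp cong: measurable_cong_sets)
  then have "(\<lambda>\<omega>. \<integral>r. indicator {s..t} r *\<^sub>R v r (X (min r t) \<omega>) \<partial>lborel) \<in> borel_measurable (F t)"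
    by (rule lborel.borel_measurable_lebesgue_integral)
  also have "(\<lambda>\<omega>. \<integral>r. indicator {s..t} r *\<^sub>R v r (X (min r t) \<omega>) \<partial>lborel) = v_path s t"
    unfolding v_path_def[abs_def] set_lebesgue_integral_def
    by (intro ext Bochner_Integration.integral_cong) (auto simp: indicator_def min_def)
  finally show ?thesis .
qed

lemma v_path_sq:
  assumes st: "0 \<le> s" "s < t" "t \<le> S"
  shows "integrable M (\<lambda>\<omega>. (norm (v_path s t \<omega>))\<^sup>2)"
    and "(\<integral>\<omega>. (norm (v_path s t \<omega>))\<^sup>2 \<partial>M) \<le> (t - s) * (LINT r:{s..t}|lborel. energy r)"
proof -
  have [measurable]: "v_path s t \<in> borel_measurable M" by (rule F_M[OF v_path_meas]) (use st in auto)
  have le: "AE \<omega> in M. (norm (v_path s t \<omega>))\<^sup>2 \<le> (t - s) * (LINT r:{s..t}|lborel. (norm (v r (X r \<omega>)))\<^sup>2)"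
    using AE_path_int
  proof eventually_elim
    case (elim \<omega>)
    have "norm (v_path s t \<omega>) \<le> (LINT r:{s..t}|lborel. norm (v r (X r \<omega>)))"
      unfolding v_path_def set_lebesgue_integral_def by (rule order_trans[OF integral_norm_bound]) simp
    then have "(norm (v_path s t \<omega>))\<^sup>2 \<le> (LINT r:{s..t}|lborel. norm (v r (X r \<omega>)))\<^sup>2"
      by (rule power_mono) simp
    also have "\<dots> \<le> (t - s) * (LINT r:{s..t}|lborel. (norm (v r (X r \<omega>)))\<^sup>2)"
    proof (rule set_integral_Cauchy_Schwarz[OF set_integrable_Icc set_integrable_Icc st(2)])
      show "integrable lborel (\<lambda>r. norm (v r (X r \<omega>)))" by (rule integrable_norm) (rule conjunct1[OF elim])
      show "integrable lborel (\<lambda>r. (norm (v r (X r \<omega>)))\<^sup>2)" by (rule conjunct1[OF conjunct2[OF elim]])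
    qed
    finally show ?case .
  qed
  have i: "integrable (lborel \<Otimes>\<^sub>M M) (\<lambda>(r, \<omega>). indicator {s..t} r *\<^sub>R (norm (v r (X r \<omega>)))\<^sup>2)"
    unfolding split_beta'
  proof (rule Bochner_Integration.integrable_bound[OF v_sq])
    define h where "h = (\<lambda>z. v (fst z) (X (fst z) (snd z)))"
    have [measurable]: "h \<in> borel_measurable (lborel \<Otimes>\<^sub>M M)" unfolding h_def using v_joint unfolding split_beta' .
    have "(\<lambda>z. indicator {s..t} (fst z) *\<^sub>R (norm (h z))\<^sup>2) \<in> borel_measurable (lborel \<Otimes>\<^sub>M M)" by measurable
    then show "(\<lambda>z. indicator {s..t} (fst z) *\<^sub>R (norm (v (fst z) (X (fst z) (snd z))))\<^sup>2) \<in> borel_measurable (lborel \<Otimes>\<^sub>M M)"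
      unfolding h_def .
    show "AE z in lborel \<Otimes>\<^sub>M M. norm (indicator {s..t} (fst z) *\<^sub>R (norm (v (fst z) (X (fst z) (snd z))))\<^sup>2)
        \<le> norm ((norm (v (fst z) (X (fst z) (snd z))))\<^sup>2)"
      by (rule AE_I2) (simp add: indicator_def)
  qed
  have i2: "integrable M (\<lambda>\<omega>. (t - s) * (LINT r:{s..t}|lborel. (norm (v r (X r \<omega>)))\<^sup>2))"
    using LM.integrable_snd[OF i] unfolding set_lebesgue_integral_def by (rule integrable_mult_right)
  show i1: "integrable M (\<lambda>\<omega>. (norm (v_path s t \<omega>))\<^sup>2)"
  proof (rule Bochner_Integration.integrable_bound[OF i2])
    show "AE \<omega> in M. norm ((norm (v_path s t \<omega>))\<^sup>2) \<le> norm ((t - s) * (LINT r:{s..t}|lborel. (norm (v r (X r \<omega>)))\<^sup>2))"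
      using le by eventually_elim (auto intro: order_trans[OF _ abs_ge_self])
  qed measurable
  have "(\<integral>\<omega>. (norm (v_path s t \<omega>))\<^sup>2 \<partial>M) \<le> (\<integral>\<omega>. (t - s) * (LINT r:{s..t}|lborel. (norm (v r (X r \<omega>)))\<^sup>2) \<partial>M)"
    by (rule integral_mono_AE[OF i1 i2 le])
  also have "\<dots> = (t - s) * (\<integral>\<omega>. (\<integral>r. indicator {s..t} r *\<^sub>R (norm (v r (X r \<omega>)))\<^sup>2 \<partial>lborel) \<partial>M)"
    unfolding set_lebesgue_integral_def by simp
  also have "(\<integral>\<omega>. (\<integral>r. indicator {s..t} r *\<^sub>R (norm (v r (X r \<omega>)))\<^sup>2 \<partial>lborel) \<partial>M)
      = (\<integral>r. (\<integral>\<omega>. indicator {s..t} r *\<^sub>R (norm (v r (X r \<omega>)))\<^sup>2 \<partial>M) \<partial>lborel)"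
    by (rule LM.Fubini_integral[OF i])
  also have "\<dots> = (LINT r:{s..t}|lborel. energy r)"
    unfolding set_lebesgue_integral_def energy_def by simp
  finally show "(\<integral>\<omega>. (norm (v_path s t \<omega>))\<^sup>2 \<partial>M) \<le> (t - s) * (LINT r:{s..t}|lborel. energy r)" .
qed

text \<open>Once the displacement by v is removed, the path follows the flow up to the Lipschitz
  bound and the remainder. The null set does not depend on y, since y will be a random
  point.\<close>

lemma flow_step_error:
  assumes st: "0 \<le> s" "s \<le> t" "t \<le> S"
  shows "AE \<omega> in M. \<forall>y. norm (X t \<omega> - v_path s t \<omega> - flow b s t (y + noise s t \<omega>))
      \<le> (1 + c * (t - s)) * norm (X s \<omega> - y) + c * remainder s t \<omega>"
  using AE_path_int path_increment remainder_mean(1)[OF st] AE_space[of M]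
proof eventually_elim
  case (elim \<omega>)
  show ?case
  proof
    fix y
    let ?y = "y + noise s t \<omega>"
    have bi: "set_integrable lborel {s..t} (\<lambda>r. b r (X r \<omega>))" and vi: "set_integrable lborel {s..t} (\<lambda>r. v r (X r \<omega>))"
      using elim(1) by (auto intro!: set_integrable_Icc simp del: integrable_norm_iff)
    let ?f = "\<lambda>r. norm (X r \<omega> - X s \<omega> - noise s t \<omega>) + norm (X s \<omega> - y)"
    have ci: "set_integrable lborel {s..t} (\<lambda>r. norm (X s \<omega> - y))"
      unfolding set_integrable_def by (intro integrable_scaleR_left integrable_real_indicator) (auto simp: emeasure_lborel_Icc_eq)
    have fi: "set_integrable lborel {s..t} ?f" by (rule set_integral_add(1)[OF elim(3) ci])
    have "set_integrable lborel {s..t} (\<lambda>r. b r (X r \<omega>) + v r (X r \<omega>))" by (rule set_integral_add(1)[OF bi vi])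
    have "X t \<omega> = X s \<omega> + noise s t \<omega> + (LINT r:{s..t}|lborel. b r (X r \<omega>) + v r (X r \<omega>))"
      using elim(2) st by blast
    also have "(LINT r:{s..t}|lborel. b r (X r \<omega>) + v r (X r \<omega>)) = (LINT r:{s..t}|lborel. b r (X r \<omega>)) + v_path s t \<omega>"
      unfolding v_path_def by (rule set_integral_add(2)[OF bi vi])
    finally have eq: "X t \<omega> - v_path s t \<omega> - flow b s t ?y
       = (X s \<omega> - y) + ((LINT r:{s..t}|lborel. b r (X r \<omega>)) - (LINT r:{s..t}|lborel. b r ?y))"
      by (simp add: flow_def)
    have ji: "set_integrable lborel {s..t} (\<lambda>r. norm (X r \<omega> - ?y))"
      unfolding set_integrable_def
    proof (rule Bochner_Integration.integrable_bound)
      show "integrable lborel (\<lambda>r. indicator {s..t} r *\<^sub>R ?f r)" using fi unfolding set_integrable_def .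
      have "(\<lambda>r. X (min r S) \<omega>) \<in> borel_measurable borel"
        using measurable_compose[OF measurable_Pair2'[OF elim(4)] X_joint] by simp
      then have "(\<lambda>r. indicator {s..t} r *\<^sub>R norm (X (min r S) \<omega> - ?y)) \<in> borel_measurable lborel" by simp
      also have "(\<lambda>r. indicator {s..t} r *\<^sub>R norm (X (min r S) \<omega> - ?y)) = (\<lambda>r. indicator {s..t} r *\<^sub>R norm (X r \<omega> - ?y))"
        using st by (auto simp: fun_eq_iff indicator_def min_def)
      finally show "(\<lambda>r. indicator {s..t} r *\<^sub>R norm (X r \<omega> - ?y)) \<in> borel_measurable lborel" .
      show "AE r in lborel. norm (indicator {s..t} r *\<^sub>R norm (X r \<omega> - ?y)) \<le> norm (indicator {s..t} r *\<^sub>R ?f r)"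
      proof (rule AE_I2)
        fix r
        have "X r \<omega> - ?y = (X r \<omega> - X s \<omega> - noise s t \<omega>) + (X s \<omega> - y)" by simp
        then have "norm (X r \<omega> - ?y) \<le> ?f r" by (metis norm_triangle_ineq)
        then show "norm (indicator {s..t} r *\<^sub>R norm (X r \<omega> - ?y)) \<le> norm (indicator {s..t} r *\<^sub>R ?f r)"
          unfolding indicator_def by simp
      qed
    qed
    have "norm ((LINT r:{s..t}|lborel. b r (X r \<omega>)) - (LINT r:{s..t}|lborel. b r ?y)) \<le> c * (LINT r:{s..t}|lborel. norm (X r \<omega> - ?y))"
      by (rule flow_error[OF bi ji])
    also have "(LINT r:{s..t}|lborel. norm (X r \<omega> - ?y)) \<le> (LINT r:{s..t}|lborel. ?f r)"
    proof (rule set_integral_mono[OF ji fi])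
      fix r
      have "X r \<omega> - ?y = (X r \<omega> - X s \<omega> - noise s t \<omega>) + (X s \<omega> - y)" by simp
      then show "norm (X r \<omega> - ?y) \<le> ?f r" by (metis norm_triangle_ineq)
    qed
    also have "(LINT r:{s..t}|lborel. ?f r) = remainder s t \<omega> + (t - s) * norm (X s \<omega> - y)"
      unfolding remainder_def set_integral_add(2)[OF elim(3) ci]
      using integral_indicator_Icc[OF st(2), of "norm (X s \<omega> - y)"] by (simp add: set_lebesgue_integral_def)
    finally have "norm ((LINT r:{s..t}|lborel. b r (X r \<omega>)) - (LINT r:{s..t}|lborel. b r ?y))
       \<le> c * (remainder s t \<omega> + (t - s) * norm (X s \<omega> - y))" using c_nonneg by (auto intro: mult_left_mono)
    then show "norm (X t \<omega> - v_path s t \<omega> - flow b s t ?y) \<le> (1 + c * (t - s)) * norm (X s \<omega> - y) + c * remainder s t \<omega>"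
      unfolding eq using norm_triangle_ineq[of "X s \<omega> - y" "(LINT r:{s..t}|lborel. b r (X r \<omega>)) - (LINT r:{s..t}|lborel. b r ?y)"]
      by (simp add: algebra_simps)
  qed
qed

end

section \<open>Backward recursion and discretisation\<close>

lemma (in prob_space) expectation_le_sqrt:
  fixes f :: "'a \<Rightarrow> real"
  assumes [measurable]: "f \<in> borel_measurable M" and f: "integrable M (\<lambda>x. (f x)\<^sup>2)"
  shows "integrable M f" and "(\<integral>x. f x \<partial>M) \<le> sqrt (\<integral>x. (f x)\<^sup>2 \<partial>M)"
proof -
  show i: "integrable M f"
  proof (rule Bochner_Integration.integrable_bound)
    show "integrable M (\<lambda>x. 1 + (f x)\<^sup>2)" using f by simp
    show "AE x in M. norm (f x) \<le> norm (1 + (f x)\<^sup>2)"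
    proof (rule AE_I2)
      fix x
      have "2 * \<bar>f x\<bar> \<le> 1 + (f x)\<^sup>2" using sum_squares_bound[of "\<bar>f x\<bar>" 1] by simp
      then show "norm (f x) \<le> norm (1 + (f x)\<^sup>2)" unfolding real_norm_def using abs_ge_zero[of "f x"] by linarith
    qed
  qed simp
  have "(\<integral>x. f x \<partial>M)\<^sup>2 \<le> (\<integral>x. (f x)\<^sup>2 \<partial>M)"
    using variance_positive[of f] variance_eq[OF i f] by simp
  then show "(\<integral>x. f x \<partial>M) \<le> sqrt (\<integral>x. (f x)\<^sup>2 \<partial>M)" by (rule real_le_rsqrt)
qed

lemma inverse_one_minus_le_exp:
  fixes x :: real
  assumes "0 \<le> x" "x \<le> 1 / 2"
  shows "1 / (1 - x) \<le> exp (2 * x)"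
proof -
  have "x * (2 * x) \<le> x * 1" using assms by (intro mult_left_mono) auto
  then have "1 \<le> (1 + 2 * x) * (1 - x)" by (simp add: algebra_simps)
  also have "\<dots> \<le> exp (2 * x) * (1 - x)" using assms exp_ge_add_one_self[of "2 * x"] by (intro mult_right_mono) auto
  finally show ?thesis using assms by (simp add: divide_le_eq)
qed

text \<open>Each step divides by a factor at least exp(-2 \<delta> G) and composes with a flow of
  Lipschitz constant 1 + c \<delta>. Over a total time at most S the bounds stay independent of
  \<delta>, which keeps \<open>hyper_const\<close> fixed in the limit.\<close>

lemma (in lipschitz_drift) backward_functions:
  fixes \<psi> :: "'a \<Rightarrow> real"
  assumes \<delta>: "0 < \<delta>" "real m * \<delta> \<le> S" and g: "\<And>k. k < m \<Longrightarrow> 0 \<le> g k" "\<And>k. k < m \<Longrightarrow> g k \<le> G" "\<delta> * G \<le> 1 / 2" "0 \<le> G"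
    and \<psi>: "\<Lambda>-lipschitz_on UNIV \<psi>" "\<And>x. \<bar>\<psi> x\<bar> \<le> K"
  obtains l where "l m = \<psi>"
    and "\<And>k. k < m \<Longrightarrow> l k = log_step (flow b (grid \<tau> \<delta> k) (grid \<tau> \<delta> (Suc k))) (2 * \<delta>) (\<lambda>x. l (Suc k) x / (1 - \<delta> * g k))"
    and "\<And>k x. k \<le> m \<Longrightarrow> \<bar>l k x\<bar> \<le> K * exp (2 * G * S)"
    and "\<And>k. k \<le> m \<Longrightarrow> (\<Lambda> * exp ((2 * G + c) * S))-lipschitz_on UNIV (l k)"
proof -
  \<comment> \<open>Primitive recursion runs over the number j = m - k of remaining steps, since the
    sequence is prescribed at its last index.\<close>
  define L where "L = rec_nat \<psi> (\<lambda>j f. log_step (flow b (grid \<tau> \<delta> (m - Suc j)) (grid \<tau> \<delta> (m - j))) (2 * \<delta>) (\<lambda>x. f x / (1 - \<delta> * g (m - Suc j))))"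
  have L0: "L 0 = \<psi>" and LS: "L (Suc j) = log_step (flow b (grid \<tau> \<delta> (m - Suc j)) (grid \<tau> \<delta> (m - j))) (2 * \<delta>) (\<lambda>x. L j x / (1 - \<delta> * g (m - Suc j)))" for j
    by (simp_all add: L_def)
  have \<Lambda>0: "\<Lambda> \<ge> 0" by (rule lipschitz_on_nonneg[OF \<psi>(1)])
  have K0: "K \<ge> 0" using \<psi>(2)[of undefined] by linarith
  have B: "(\<forall>x. \<bar>L j x\<bar> \<le> K * exp (2 * G * (real j * \<delta>))) \<and> (\<Lambda> * exp ((2 * G + c) * (real j * \<delta>)))-lipschitz_on UNIV (L j)" if "j \<le> m" for j
    using that
  proof (induction j)
    case 0
    then show ?case using \<psi> L0 by simp
  next
    case (Suc j)
    define k where "k = m - Suc j"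
    have k: "k < m" "m - j = Suc k" using Suc.prems by (auto simp: k_def)
    define \<theta> where "\<theta> = 1 - \<delta> * g k"
    have dg: "0 \<le> \<delta> * g k" "\<delta> * g k \<le> \<delta> * G" using \<delta> g(1,2)[OF k(1)] by (auto intro: mult_left_mono)
    have \<theta>: "\<theta> > 0" "1 / \<theta> \<le> exp (2 * (\<delta> * G))"
    proof -
      show "\<theta> > 0" using dg g(3) by (simp add: \<theta>_def)
      have "1 / \<theta> \<le> exp (2 * (\<delta> * g k))" unfolding \<theta>_def using dg g(3) by (intro inverse_one_minus_le_exp) auto
      also have "\<dots> \<le> exp (2 * (\<delta> * G))" using dg by simp
      finally show "1 / \<theta> \<le> exp (2 * (\<delta> * G))" .
    qed
    let ?E = "exp (2 * G * (real j * \<delta>))" and ?E' = "exp ((2 * G + c) * (real j * \<delta>))"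
    have IH: "\<bar>L j x\<bar> \<le> K * ?E" "(\<Lambda> * ?E')-lipschitz_on UNIV (L j)" for x using Suc by auto
    let ?K = "K * exp (2 * G * (real (Suc j) * \<delta>))"
    have K': "\<bar>L j x / \<theta>\<bar> \<le> ?K" for x
    proof -
      have "\<bar>L j x / \<theta>\<bar> = \<bar>L j x\<bar> * (1 / \<theta>)" using \<theta> by simp
      also have "\<dots> \<le> (K * ?E) * exp (2 * (\<delta> * G))" using IH(1)[of x] \<theta> K0 by (intro mult_mono) auto
      also have "\<dots> = ?K" by (simp add: mult.assoc exp_add[symmetric] algebra_simps)
      finally show ?thesis .
    qed
    have lip: "(\<Lambda> * ?E' * exp (2 * (\<delta> * G)))-lipschitz_on UNIV (\<lambda>x. L j x / \<theta>)"
    proof (rule lipschitz_onI)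
      fix x y
      have "dist (L j x / \<theta>) (L j y / \<theta>) = dist (L j x) (L j y) * (1 / \<theta>)"
        using \<theta> by (simp add: dist_real_def diff_divide_distrib[symmetric])
      also have "\<dots> \<le> (\<Lambda> * ?E' * dist x y) * exp (2 * (\<delta> * G))"
        using lipschitz_onD[OF IH(2), of x y] \<theta> \<Lambda>0 by (intro mult_mono) auto
      finally show "dist (L j x / \<theta>) (L j y / \<theta>) \<le> \<Lambda> * ?E' * exp (2 * (\<delta> * G)) * dist x y" by (simp add: mult_ac)
    qed (use \<Lambda>0 in simp)
    have gr: "grid \<tau> \<delta> k \<le> grid \<tau> \<delta> (Suc k)" "grid \<tau> \<delta> (Suc k) - grid \<tau> \<delta> k = \<delta>" using \<delta> by (auto simp: grid_simps)
    note fl = flow_lipschitz[OF gr(1), unfolded gr(2)]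
    have [measurable]: "flow b (grid \<tau> \<delta> k) (grid \<tau> \<delta> (Suc k)) \<in> borel_measurable borel" "(\<lambda>x. L j x / \<theta>) \<in> borel_measurable borel"
      using fl lip by (auto intro!: borel_measurable_continuous_onI dest: lipschitz_on_continuous_on)
    have eq: "L (Suc j) = log_step (flow b (grid \<tau> \<delta> k) (grid \<tau> \<delta> (Suc k))) (2 * \<delta>) (\<lambda>x. L j x / \<theta>)"
      using LS[of j] k unfolding k_def[symmetric] \<theta>_def by simp
    have "\<bar>L (Suc j) x\<bar> \<le> ?K" for x
      unfolding eq by (rule exp_log_step(2)) (use \<delta> K' in auto)
    moreover have "(\<Lambda> * exp ((2 * G + c) * (real (Suc j) * \<delta>)))-lipschitz_on UNIV (L (Suc j))"
    proof (rule lipschitz_on_le)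
      show "((\<Lambda> * ?E' * exp (2 * (\<delta> * G))) * (1 + c * \<delta>))-lipschitz_on UNIV (L (Suc j))"
        unfolding eq by (rule log_step_lipschitz[OF _ fl lip K']) (use \<delta> in simp)
      have "(\<Lambda> * ?E' * exp (2 * (\<delta> * G))) * (1 + c * \<delta>) \<le> (\<Lambda> * ?E' * exp (2 * (\<delta> * G))) * exp (c * \<delta>)"
        using \<Lambda>0 exp_ge_add_one_self[of "c * \<delta>"] by (intro mult_left_mono) auto
      also have "\<dots> = \<Lambda> * exp ((2 * G + c) * (real (Suc j) * \<delta>))" by (simp add: mult.assoc exp_add[symmetric] algebra_simps)
      finally show "(\<Lambda> * ?E' * exp (2 * (\<delta> * G))) * (1 + c * \<delta>) \<le> \<Lambda> * exp ((2 * G + c) * (real (Suc j) * \<delta>))" .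
    qed
    ultimately show ?case by blast
  qed
  have jS: "real j * \<delta> \<le> S" if "j \<le> m" for j
    using that \<delta> by (meson mult_right_mono of_nat_le_iff less_imp_le order_trans)
  show thesis
  proof (rule that[of "\<lambda>k. L (m - k)"])
    show "L (m - m) = \<psi>" by (simp add: L0)
    show "L (m - k) = log_step (flow b (grid \<tau> \<delta> k) (grid \<tau> \<delta> (Suc k))) (2 * \<delta>) (\<lambda>x. L (m - Suc k) x / (1 - \<delta> * g k))" if k: "k < m" for k
    proof -
      have "m - k = Suc (m - Suc k)" "m - Suc (m - Suc k) = k" "m - (m - Suc k) = Suc k" using k by auto
      then show ?thesis using LS[of "m - Suc k"] by simp
    qed
    show "\<bar>L (m - k) x\<bar> \<le> K * exp (2 * G * S)" for k x
    proof -
      have "\<bar>L (m - k) x\<bar> \<le> K * exp (2 * G * (real (m - k) * \<delta>))" using B[of "m - k"] by auto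
      also have "\<dots> \<le> K * exp (2 * G * S)" using jS[of "m - k"] K0 g(4) by (intro mult_left_mono) (auto intro: mult_left_mono)
      finally show ?thesis .
    qed
    show "(\<Lambda> * exp ((2 * G + c) * S))-lipschitz_on UNIV (L (m - k))" for k
    proof (rule lipschitz_on_le)
      show "(\<Lambda> * exp ((2 * G + c) * (real (m - k) * \<delta>)))-lipschitz_on UNIV (L (m - k))" using B[of "m - k"] by auto
      show "\<Lambda> * exp ((2 * G + c) * (real (m - k) * \<delta>)) \<le> \<Lambda> * exp ((2 * G + c) * S)"
        using jS[of "m - k"] \<Lambda>0 g(4) c_nonneg by (intro mult_left_mono) (auto intro: mult_left_mono)
    qed
  qed
qed

context driven_process
begin

text \<open>The displacement due to v over the preceding cell. At the first grid point nothing is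
  pending, because the chain starts exactly at \<open>X \<tau>\<close>.\<close>

definition delay :: "real \<Rightarrow> real \<Rightarrow> nat \<Rightarrow> 'w \<Rightarrow> 'a" where
  "delay \<tau> \<delta> k \<omega> = (if k = 0 then 0 else v_path (grid \<tau> \<delta> (k - 1)) (grid \<tau> \<delta> k) \<omega>)"

text \<open>
  The drift \<open>v\<close> acts one grid step late. It is then known before the next Gaussian increment, so
  that Girsanov's theorem reduces to a shift of a Gaussian vector.
\<close>
primrec delayed :: "real \<Rightarrow> real \<Rightarrow> nat \<Rightarrow> 'w \<Rightarrow> 'a" where
  "delayed \<tau> \<delta> 0 \<omega> = X \<tau> \<omega>"
| "delayed \<tau> \<delta> (Suc k) \<omega> = flow b (grid \<tau> \<delta> k) (grid \<tau> \<delta> (Suc k))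
     (delayed \<tau> \<delta> k \<omega> + delay \<tau> \<delta> k \<omega> + noise (grid \<tau> \<delta> k) (grid \<tau> \<delta> (Suc k)) \<omega>)"

lemma flow_meas [measurable]: "s \<le> t \<Longrightarrow> flow b s t \<in> borel_measurable borel"
  using flow_lipschitz[of s t] by (auto intro!: borel_measurable_continuous_onI dest: lipschitz_on_continuous_on)

lemma drift_mean_split:
  assumes "s \<le> r" "r \<le> t"
  shows "drift_mean s t = drift_mean s r + drift_mean r t"
  unfolding drift_mean_def by (rule set_integral_Icc_split[OF mean_d_int assms])

lemma drift_mean_mono: "s' \<le> s \<Longrightarrow> t \<le> t' \<Longrightarrow> drift_mean s t \<le> drift_mean s' t'"
  unfolding drift_mean_def by (rule set_integral_Icc_mono[OF mean_d_int]) auto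

lemma drift_mean_grid:
  assumes "0 \<le> \<delta>"
  shows "(\<Sum>k<m. drift_mean (grid \<tau> \<delta> k) (grid \<tau> \<delta> (Suc k))) = drift_mean \<tau> (grid \<tau> \<delta> m)"
  unfolding drift_mean_def by (rule set_integral_grid[OF mean_d_int assms])

context
  fixes \<tau> \<delta> :: real and m :: nat
  assumes \<tau>: "0 \<le> \<tau>" and \<delta>: "0 < \<delta>" and mS: "grid \<tau> \<delta> m \<le> S"
begin

abbreviation "tm \<equiv> grid \<tau> \<delta>"

lemma tm_bounds: "k \<le> m \<Longrightarrow> 0 \<le> tm k" "k \<le> m \<Longrightarrow> tm k \<le> S" "tm k < tm (Suc k)" "tm (Suc k) - tm k = \<delta>" "tm k \<le> tm (Suc k)"
  "k \<le> m \<Longrightarrow> tm k \<in> {0..S}"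
  using \<tau> \<delta> mS grid_mono[of \<delta> 0 k \<tau>] grid_mono[of \<delta> k m \<tau>] by (auto simp: grid_simps)

lemma delay_meas: "k \<le> m \<Longrightarrow> delay \<tau> \<delta> k \<in> borel_measurable (F (tm k))"
proof (cases k)
  case (Suc j)
  assume "k \<le> m"
  with Suc have "v_path (tm j) (tm k) \<in> borel_measurable (F (tm k))"
    using tm_bounds(1)[of j] tm_bounds(2)[of k] tm_bounds(5)[of j] by (intro v_path_meas) auto
  then show ?thesis using Suc by (simp add: delay_def[abs_def])
qed (simp add: delay_def[abs_def])

lemma delayed_meas: "k \<le> m \<Longrightarrow> delayed \<tau> \<delta> k \<in> borel_measurable (F (tm k))"
proof (induction k)
  case 0
  then show ?case using X_meas[of \<tau>] tm_bounds(6)[of 0] by (simp add: grid_simps)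
next
  case (Suc k)
  have "delayed \<tau> \<delta> k \<in> borel_measurable (F (tm (Suc k)))" "delay \<tau> \<delta> k \<in> borel_measurable (F (tm (Suc k)))"
    using Suc delay_meas[of k] tm_bounds(5)[of k] by (auto intro: F_mono)
  moreover have "noise (tm k) (tm (Suc k)) \<in> borel_measurable (F (tm (Suc k)))"
    using Suc tm_bounds(1)[of k] tm_bounds(5)[of k] by (intro noise_meas_F) auto
  ultimately have "(\<lambda>\<omega>. delayed \<tau> \<delta> k \<omega> + delay \<tau> \<delta> k \<omega> + noise (tm k) (tm (Suc k)) \<omega>) \<in> borel_measurable (F (tm (Suc k)))"
    by (intro borel_measurable_add)
  from measurable_compose[OF this flow_meas[OF tm_bounds(5)[of k]]] show ?case by (simp add: fun_eq_iff)
qed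

lemma path_meas:
  assumes "k \<le> m"
  shows "X (tm k) \<in> borel_measurable M" "delay \<tau> \<delta> k \<in> borel_measurable M" "delayed \<tau> \<delta> k \<in> borel_measurable M"
  by (rule X_meas_M[OF tm_bounds(6)[OF assms]], rule F_M[OF delay_meas[OF assms]], rule F_M[OF delayed_meas[OF assms]])

lemma delay_sq:
  assumes k: "k \<le> m"
  shows "integrable M (\<lambda>\<omega>. (norm (delay \<tau> \<delta> k \<omega>))\<^sup>2)"
    and "(\<integral>\<omega>. (norm (delay \<tau> \<delta> k \<omega>))\<^sup>2 \<partial>M) \<le> (if k = 0 then 0 else \<delta> * (LINT r:{tm (k - 1)..tm k}|lborel. energy r))"
proof -
  have "integrable M (\<lambda>\<omega>. (norm (delay \<tau> \<delta> k \<omega>))\<^sup>2) \<and>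
    (\<integral>\<omega>. (norm (delay \<tau> \<delta> k \<omega>))\<^sup>2 \<partial>M) \<le> (if k = 0 then 0 else \<delta> * (LINT r:{tm (k - 1)..tm k}|lborel. energy r))"
  proof (cases k)
    case (Suc j)
    then have "0 \<le> tm j" "tm j < tm k" "tm k \<le> S" using k tm_bounds(1)[of j] tm_bounds(2)[of k] tm_bounds(3)[of j] by auto
    from v_path_sq[OF this] tm_bounds(4)[of j] show ?thesis using Suc by (simp add: delay_def)
  qed (simp add: delay_def)
  then show "integrable M (\<lambda>\<omega>. (norm (delay \<tau> \<delta> k \<omega>))\<^sup>2)"
    "(\<integral>\<omega>. (norm (delay \<tau> \<delta> k \<omega>))\<^sup>2 \<partial>M) \<le> (if k = 0 then 0 else \<delta> * (LINT r:{tm (k - 1)..tm k}|lborel. energy r))" by auto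
qed

lemma delayed_step:
  assumes k: "k < m" and [measurable]: "l \<in> borel_measurable borel" and K: "\<And>x. \<bar>l x\<bar> \<le> K"
  shows "(\<integral>\<omega>. l (delayed \<tau> \<delta> (Suc k) \<omega>) \<partial>M)
    \<le> (\<integral>\<omega>. log_step (flow b (tm k) (tm (Suc k))) (2 * \<delta>) l (delayed \<tau> \<delta> k \<omega>) \<partial>M)
      + (\<integral>\<omega>. (norm (delay \<tau> \<delta> k \<omega>))\<^sup>2 \<partial>M) / (4 * \<delta>)"
proof -
  have km: "k \<le> m" using k by simp
  have mF: "delayed \<tau> \<delta> k \<in> borel_measurable (F (tm k))" "delay \<tau> \<delta> k \<in> borel_measurable (F (tm k))"
    using delayed_meas delay_meas km by auto
  have "(\<lambda>\<omega>. (delayed \<tau> \<delta> k \<omega>, delay \<tau> \<delta> k \<omega>)) \<in> F (tm k) \<rightarrow>\<^sub>M borel \<Otimes>\<^sub>M borel"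
    by (intro measurable_Pair mF)
  from noise_law[OF tm_bounds(1)[OF km] tm_bounds(3) this]
  have law: "distr M ((borel \<Otimes>\<^sub>M borel) \<Otimes>\<^sub>M borel) (\<lambda>\<omega>. ((delayed \<tau> \<delta> k \<omega>, delay \<tau> \<delta> k \<omega>), noise (tm k) (tm (Suc k)) \<omega>))
      = distr M (borel \<Otimes>\<^sub>M borel) (\<lambda>\<omega>. (delayed \<tau> \<delta> k \<omega>, delay \<tau> \<delta> k \<omega>)) \<Otimes>\<^sub>M gauss (2 * \<delta>)"
    unfolding tm_bounds(4) .
  have "(\<integral>\<omega>. l (flow b (tm k) (tm (Suc k)) (delayed \<tau> \<delta> k \<omega> + delay \<tau> \<delta> k \<omega> + noise (tm k) (tm (Suc k)) \<omega>)) \<partial>M)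
    \<le> (\<integral>\<omega>. log_step (flow b (tm k) (tm (Suc k))) (2 * \<delta>) l (delayed \<tau> \<delta> k \<omega>) \<partial>M)
      + (\<integral>\<omega>. (norm (delay \<tau> \<delta> k \<omega>))\<^sup>2 \<partial>M) / (2 * (2 * \<delta>))"
    by (rule drift_step[OF _ F_M[OF mF(1)] F_M[OF mF(2)] noise_meas flow_meas _ law K delay_sq(1)[OF km]])
       (use \<delta> tm_bounds(1)[OF km] tm_bounds(5)[of k] in auto)
  then show ?thesis by simp
qed

text \<open>The chain is compared with the path minus the pending displacement. In this form v
  cancels between the two, and a discrete Gronwall argument is left with the Lipschitz factor and
  the remainders.\<close>

lemma delayed_error:
  assumes "k \<le> m"
  shows "integrable M (\<lambda>\<omega>. norm (X (tm k) \<omega> - delay \<tau> \<delta> k \<omega> - delayed \<tau> \<delta> k \<omega>)) \<and>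
    (\<integral>\<omega>. norm (X (tm k) \<omega> - delay \<tau> \<delta> k \<omega> - delayed \<tau> \<delta> k \<omega>) \<partial>M)
      \<le> exp (c * (real k * \<delta>)) * (c * \<delta> * (drift_mean \<tau> (tm k) + real k * sqrt (2 * real DIM('a) * \<delta>)))"
  using assms
proof (induction k)
  case 0
  then show ?case using drift_mean_nonneg c_nonneg \<delta> by (simp add: delay_def grid_simps)
next
  case (Suc k)
  let ?D = "\<lambda>k \<omega>. norm (X (tm k) \<omega> - delay \<tau> \<delta> k \<omega> - delayed \<tau> \<delta> k \<omega>)"
  let ?q = "sqrt (2 * real DIM('a) * \<delta>)"
  have km: "k \<le> m" using Suc by simp
  have b: "0 \<le> tm k" "tm k \<le> tm (Suc k)" "tm (Suc k) \<le> S" using tm_bounds Suc.prems km by auto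
  have [measurable]: "X (tm (Suc k)) \<in> borel_measurable M" "delay \<tau> \<delta> (Suc k) \<in> borel_measurable M" "delayed \<tau> \<delta> (Suc k) \<in> borel_measurable M"
    by (rule path_meas[OF Suc.prems])+
  have le: "AE \<omega> in M. ?D (Suc k) \<omega> \<le> (1 + c * \<delta>) * ?D k \<omega> + c * remainder (tm k) (tm (Suc k)) \<omega>"
    using flow_step_error[OF b]
  proof eventually_elim
    case (elim \<omega>)
    \<comment> \<open>The flow is started at the chain plus its pending displacement, so the
      distance on the right is exactly the error at step k.\<close>
    from elim[rule_format, of "delayed \<tau> \<delta> k \<omega> + delay \<tau> \<delta> k \<omega>"] show ?case
      by (simp add: tm_bounds(4) delay_def[of _ _ "Suc k"] diff_diff_eq add.commute)
  qed
  have i: "integrable M (\<lambda>\<omega>. (1 + c * \<delta>) * ?D k \<omega> + c * remainder (tm k) (tm (Suc k)) \<omega>)"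
    using Suc.IH[OF km] remainder_mean(2)[OF b] by (intro Bochner_Integration.integrable_add integrable_mult_right) auto
  have i': "integrable M (?D (Suc k))"
  proof (rule Bochner_Integration.integrable_bound[OF i])
    show "AE \<omega> in M. norm (?D (Suc k) \<omega>) \<le> norm ((1 + c * \<delta>) * ?D k \<omega> + c * remainder (tm k) (tm (Suc k)) \<omega>)"
      using le by eventually_elim (simp add: order_trans[OF _ abs_ge_self])
  qed measurable
  have "(\<integral>\<omega>. ?D (Suc k) \<omega> \<partial>M) \<le> (\<integral>\<omega>. (1 + c * \<delta>) * ?D k \<omega> + c * remainder (tm k) (tm (Suc k)) \<omega> \<partial>M)"
    by (rule integral_mono_AE[OF i' i le])
  also have "\<dots> = (1 + c * \<delta>) * (\<integral>\<omega>. ?D k \<omega> \<partial>M) + c * (\<integral>\<omega>. remainder (tm k) (tm (Suc k)) \<omega> \<partial>M)"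
    using Suc.IH[OF km] remainder_mean(2)[OF b] by simp
  also have "\<dots> \<le> exp (c * \<delta>) * (exp (c * (real k * \<delta>)) * (c * \<delta> * (drift_mean \<tau> (tm k) + real k * ?q)))
      + c * (\<delta> * (drift_mean (tm k) (tm (Suc k)) + ?q))"
  proof (rule add_mono[OF mult_mono mult_left_mono])
    show "1 + c * \<delta> \<le> exp (c * \<delta>)" by (rule exp_ge_add_one_self)
    show "(\<integral>\<omega>. remainder (tm k) (tm (Suc k)) \<omega> \<partial>M) \<le> \<delta> * (drift_mean (tm k) (tm (Suc k)) + ?q)"
      using remainder_mean(3)[OF b] by (simp add: tm_bounds(4))
  qed (use Suc.IH[OF km] c_nonneg \<delta> in auto)
  also have "exp (c * \<delta>) * (exp (c * (real k * \<delta>)) * (c * \<delta> * (drift_mean \<tau> (tm k) + real k * ?q)))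
      = exp (c * (real (Suc k) * \<delta>)) * (c * \<delta> * (drift_mean \<tau> (tm k) + real k * ?q))"
  proof -
    have "exp (c * \<delta>) * exp (c * (real k * \<delta>)) = exp (c * (real (Suc k) * \<delta>))"
      by (simp add: exp_add[symmetric] algebra_simps)
    then show ?thesis by (simp only: mult.assoc[symmetric])
  qed
  also have "c * (\<delta> * (drift_mean (tm k) (tm (Suc k)) + ?q)) \<le> exp (c * (real (Suc k) * \<delta>)) * (c * \<delta> * (drift_mean (tm k) (tm (Suc k)) + ?q))"
  proof -
    have "1 \<le> exp (c * (real (Suc k) * \<delta>))" using c_nonneg \<delta> by simp
    moreover have "0 \<le> c * \<delta> * (drift_mean (tm k) (tm (Suc k)) + ?q)"
      using c_nonneg \<delta> drift_mean_nonneg by (intro mult_nonneg_nonneg add_nonneg_nonneg) auto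
    ultimately have "1 * (c * \<delta> * (drift_mean (tm k) (tm (Suc k)) + ?q)) \<le> exp (c * (real (Suc k) * \<delta>)) * (c * \<delta> * (drift_mean (tm k) (tm (Suc k)) + ?q))"
      by (rule mult_right_mono)
    then show ?thesis by (simp only: mult.assoc mult_1_left)
  qed
  also have "exp (c * (real (Suc k) * \<delta>)) * (c * \<delta> * (drift_mean \<tau> (tm k) + real k * ?q))
     + exp (c * (real (Suc k) * \<delta>)) * (c * \<delta> * (drift_mean (tm k) (tm (Suc k)) + ?q))
     = exp (c * (real (Suc k) * \<delta>)) * (c * \<delta> * (drift_mean \<tau> (tm (Suc k)) + real (Suc k) * ?q))"
  proof -
    have "\<tau> \<le> tm k" using grid_mono[of \<delta> 0 k \<tau>] \<delta> by (simp add: grid_simps)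
    note sp = drift_mean_split[OF this b(2)]
    have gen: "E * (A * (x + n * y)) + E * (A * (z + y)) = E * (A * (x + z + (1 + n) * y))" for E A x y z n :: real
      by (simp add: algebra_simps)
    show ?thesis unfolding sp gen by simp
  qed
  finally show ?case using i' by simp
qed

text \<open>At the last grid point the pending displacement is added back; by Cauchy-Schwarz its
  mean norm is at most the square root of \<delta> times the energy.\<close>

lemma delayed_end:
  shows "integrable M (\<lambda>\<omega>. dist (X (tm m) \<omega>) (delayed \<tau> \<delta> m \<omega>))"
    and "(\<integral>\<omega>. dist (X (tm m) \<omega>) (delayed \<tau> \<delta> m \<omega>) \<partial>M)
      \<le> exp (c * S) * (c * (\<delta> * drift_mean 0 S + S * sqrt (2 * real DIM('a) * \<delta>))) + sqrt (\<delta> * (LINT r:{0..S}|lborel. energy r))"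
proof -
  let ?D = "\<lambda>\<omega>. norm (X (tm m) \<omega> - delay \<tau> \<delta> m \<omega> - delayed \<tau> \<delta> m \<omega>)"
  have [measurable]: "X (tm m) \<in> borel_measurable M" "delay \<tau> \<delta> m \<in> borel_measurable M" "delayed \<tau> \<delta> m \<in> borel_measurable M"
    by (rule path_meas[OF order_refl])+
  have dsq: "integrable M (\<lambda>\<omega>. norm (delay \<tau> \<delta> m \<omega>))" "(\<integral>\<omega>. norm (delay \<tau> \<delta> m \<omega>) \<partial>M) \<le> sqrt (\<integral>\<omega>. (norm (delay \<tau> \<delta> m \<omega>))\<^sup>2 \<partial>M)"
    by (rule expectation_le_sqrt; use delay_sq(1) in simp)+
  have i: "integrable M (\<lambda>\<omega>. ?D \<omega> + norm (delay \<tau> \<delta> m \<omega>))" using dsq delayed_error[of m] by auto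
  have le: "dist (X (tm m) \<omega>) (delayed \<tau> \<delta> m \<omega>) \<le> ?D \<omega> + norm (delay \<tau> \<delta> m \<omega>)" for \<omega>
  proof -
    have "X (tm m) \<omega> - delayed \<tau> \<delta> m \<omega> = (X (tm m) \<omega> - delay \<tau> \<delta> m \<omega> - delayed \<tau> \<delta> m \<omega>) + delay \<tau> \<delta> m \<omega>" by simp
    then show ?thesis unfolding dist_norm by (metis norm_triangle_ineq)
  qed
  show i': "integrable M (\<lambda>\<omega>. dist (X (tm m) \<omega>) (delayed \<tau> \<delta> m \<omega>))"
  proof (rule Bochner_Integration.integrable_bound[OF i])
    show "AE \<omega> in M. norm (dist (X (tm m) \<omega>) (delayed \<tau> \<delta> m \<omega>)) \<le> norm (?D \<omega> + norm (delay \<tau> \<delta> m \<omega>))"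
      using le by (intro AE_I2) (simp add: order_trans[OF _ abs_ge_self])
  qed measurable
  have mS': "real m * \<delta> \<le> S" using mS \<tau> by (simp add: grid_def)
  have "(\<integral>\<omega>. dist (X (tm m) \<omega>) (delayed \<tau> \<delta> m \<omega>) \<partial>M) \<le> (\<integral>\<omega>. ?D \<omega> + norm (delay \<tau> \<delta> m \<omega>) \<partial>M)"
    by (rule integral_mono[OF i' i le])
  also have "\<dots> = (\<integral>\<omega>. ?D \<omega> \<partial>M) + (\<integral>\<omega>. norm (delay \<tau> \<delta> m \<omega>) \<partial>M)"
    using dsq delayed_error[of m] by simp
  also have "(\<integral>\<omega>. ?D \<omega> \<partial>M) \<le> exp (c * (real m * \<delta>)) * (c * \<delta> * (drift_mean \<tau> (tm m) + real m * sqrt (2 * real DIM('a) * \<delta>)))"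
    using delayed_error[of m] by simp
  also have "\<dots> \<le> exp (c * S) * (c * (\<delta> * drift_mean 0 S + S * sqrt (2 * real DIM('a) * \<delta>)))"
  proof -
    have e1: "c * (\<delta> * drift_mean \<tau> (tm m) + (real m * \<delta>) * sqrt (2 * real DIM('a) * \<delta>)) \<le> c * (\<delta> * drift_mean 0 S + S * sqrt (2 * real DIM('a) * \<delta>))"
      using c_nonneg \<delta> \<tau> mS mS' by (intro mult_left_mono add_mono mult_right_mono drift_mean_mono) auto
    have e2: "c * \<delta> * (drift_mean \<tau> (tm m) + real m * sqrt (2 * real DIM('a) * \<delta>)) = c * (\<delta> * drift_mean \<tau> (tm m) + (real m * \<delta>) * sqrt (2 * real DIM('a) * \<delta>))"
      by (simp add: algebra_simps)
    have e3: "0 \<le> c * \<delta> * (drift_mean \<tau> (tm m) + real m * sqrt (2 * real DIM('a) * \<delta>))"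
      using c_nonneg \<delta> drift_mean_nonneg by (intro mult_nonneg_nonneg add_nonneg_nonneg) auto
    have e4: "exp (c * (real m * \<delta>)) \<le> exp (c * S)" using mS' c_nonneg by (simp add: mult_left_mono)
    show ?thesis by (rule mult_mono[OF e4 ord_eq_le_trans[OF e2 e1] exp_ge_zero e3])
  qed
  also have "(\<integral>\<omega>. norm (delay \<tau> \<delta> m \<omega>) \<partial>M) \<le> sqrt (\<delta> * (LINT r:{0..S}|lborel. energy r))"
  proof (rule order_trans[OF dsq(2)], rule real_sqrt_le_mono)
    have "(\<integral>\<omega>. (norm (delay \<tau> \<delta> m \<omega>))\<^sup>2 \<partial>M) \<le> (if m = 0 then 0 else \<delta> * (LINT r:{tm (m - 1)..tm m}|lborel. energy r))"
      by (rule delay_sq(2)) simp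
    also have "\<dots> \<le> \<delta> * (LINT r:{0..S}|lborel. energy r)"
      using \<delta> tm_bounds(1)[of "m - 1"] mS set_integral_Icc_nonneg[of energy 0 S] energy_nonneg
      by (auto intro!: mult_left_mono set_integral_Icc_mono energy_int)
    finally show "(\<integral>\<omega>. (norm (delay \<tau> \<delta> m \<omega>))\<^sup>2 \<partial>M) \<le> \<delta> * (LINT r:{0..S}|lborel. energy r)" .
  qed
  finally show "(\<integral>\<omega>. dist (X (tm m) \<omega>) (delayed \<tau> \<delta> m \<omega>) \<partial>M)
      \<le> exp (c * S) * (c * (\<delta> * drift_mean 0 S + S * sqrt (2 * real DIM('a) * \<delta>))) + sqrt (\<delta> * (LINT r:{0..S}|lborel. energy r))"
    by simp
qed

text \<open>Weighting step k by twice \<open>\<alpha> k\<close>, where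
  \<open>\<alpha> k = \<theta> k * \<alpha> (Suc k)\<close>, absorbs the division by
  \<open>\<theta> k\<close> and makes the steps telescope. The cost at step k is the energy of the
  cell before it, hence the shifted index and the missing term k = 0.\<close>

lemma delayed_sum:
  assumes l: "\<And>k. k < m \<Longrightarrow> l k = log_step (flow b (tm k) (tm (Suc k))) (2 * \<delta>) (\<lambda>x. l (Suc k) x / \<theta> k)"
    and lm: "\<And>k. k \<le> m \<Longrightarrow> l k \<in> borel_measurable borel" and K: "\<And>k x. k \<le> m \<Longrightarrow> \<bar>l k x\<bar> \<le> K"
    and \<theta>: "\<And>k. k < m \<Longrightarrow> 0 < \<theta> k \<and> \<theta> k \<le> 1"
  shows "2 * (\<integral>\<omega>. l m (delayed \<tau> \<delta> m \<omega>) \<partial>M) \<le> 2 * (\<Prod>j\<in>{0..<m}. \<theta> j) * (\<integral>\<omega>. l 0 (X \<tau> \<omega>) \<partial>M)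
    + (\<Sum>k\<in>{1..<m}. (\<Prod>j\<in>{k..<m}. \<theta> j) * (LINT r:{tm (k - 1)..tm k}|lborel. energy r)) / 2"
proof -
  define \<alpha> where "\<alpha> k = (\<Prod>j\<in>{k..<m}. \<theta> j)" for k
  have \<alpha>S: "\<alpha> k = \<theta> k * \<alpha> (Suc k)" if "k < m" for k
    using that by (simp add: \<alpha>_def prod.atLeast_Suc_lessThan)
  have \<alpha>0: "\<alpha> k \<ge> 0" for k unfolding \<alpha>_def using \<theta> by (intro prod_nonneg) (auto simp: less_imp_le)
  let ?V = "\<lambda>k. \<integral>\<omega>. (norm (delay \<tau> \<delta> k \<omega>))\<^sup>2 \<partial>M"
  have A: "2 * \<alpha> n * (\<integral>\<omega>. l n (delayed \<tau> \<delta> n \<omega>) \<partial>M) \<le> 2 * \<alpha> 0 * (\<integral>\<omega>. l 0 (X \<tau> \<omega>) \<partial>M) + (\<Sum>k<n. \<alpha> k * (?V k / (2 * \<delta>)))"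
    if "n \<le> m" for n
    using that
  proof (induction n)
    case (Suc n)
    then have n: "n < m" by simp
    have t: "0 < \<theta> n" using \<theta>[OF n] by simp
    have "(\<integral>\<omega>. l (Suc n) (delayed \<tau> \<delta> (Suc n) \<omega>) / \<theta> n \<partial>M) \<le> (\<integral>\<omega>. l n (delayed \<tau> \<delta> n \<omega>) \<partial>M) + ?V n / (4 * \<delta>)"
      unfolding l[OF n]
    proof (rule delayed_step[OF n])
      show "(\<lambda>x. l (Suc n) x / \<theta> n) \<in> borel_measurable borel" using lm[of "Suc n"] Suc by simp
      show "\<bar>l (Suc n) x / \<theta> n\<bar> \<le> K / \<theta> n" for x using K[of "Suc n" x] Suc t by (simp add: divide_right_mono)
    qed
    then have "2 * \<alpha> n * ((\<integral>\<omega>. l (Suc n) (delayed \<tau> \<delta> (Suc n) \<omega>) \<partial>M) / \<theta> n)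
       \<le> 2 * \<alpha> n * ((\<integral>\<omega>. l n (delayed \<tau> \<delta> n \<omega>) \<partial>M) + ?V n / (4 * \<delta>))"
      using \<alpha>0[of n] by (intro mult_left_mono) auto
    also have "2 * \<alpha> n * ((\<integral>\<omega>. l (Suc n) (delayed \<tau> \<delta> (Suc n) \<omega>) \<partial>M) / \<theta> n) = 2 * \<alpha> (Suc n) * (\<integral>\<omega>. l (Suc n) (delayed \<tau> \<delta> (Suc n) \<omega>) \<partial>M)"
      using \<alpha>S[OF n] t by simp
    also have "2 * \<alpha> n * ((\<integral>\<omega>. l n (delayed \<tau> \<delta> n \<omega>) \<partial>M) + ?V n / (4 * \<delta>)) = 2 * \<alpha> n * (\<integral>\<omega>. l n (delayed \<tau> \<delta> n \<omega>) \<partial>M) + \<alpha> n * (?V n / (2 * \<delta>))"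
      by (simp add: algebra_simps)
    finally show ?case using Suc by simp
  qed (simp)
  have V: "\<alpha> k * (?V k / (2 * \<delta>)) \<le> (if k = 0 then 0 else \<alpha> k * (LINT r:{tm (k - 1)..tm k}|lborel. energy r) / 2)" if "k \<le> m" for k
  proof -
    have "\<alpha> k * (?V k / (2 * \<delta>)) \<le> \<alpha> k * ((if k = 0 then 0 else \<delta> * (LINT r:{tm (k - 1)..tm k}|lborel. energy r)) / (2 * \<delta>))"
      using delay_sq(2)[OF that] \<alpha>0 \<delta> by (intro mult_left_mono divide_right_mono) auto
    then show ?thesis using \<delta> by (auto split: if_splits)
  qed
  have "(\<Sum>k<m. \<alpha> k * (?V k / (2 * \<delta>))) \<le> (\<Sum>k<m. if k = 0 then 0 else \<alpha> k * (LINT r:{tm (k - 1)..tm k}|lborel. energy r) / 2)"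
    by (intro sum_mono V) auto
  also have "\<dots> = (\<Sum>k\<in>{1..<m}. \<alpha> k * (LINT r:{tm (k - 1)..tm k}|lborel. energy r) / 2)"
    by (rule sum.mono_neutral_cong_right) auto
  finally show ?thesis using A[of m] unfolding \<alpha>_def by (simp add: sum_divide_distrib)
qed

text \<open>The same weights telescope the hypercontractive inequality. Since they are at most 1,
  the errors of the cells simply add up, to a total that vanishes with \<delta>.\<close>

lemma hyper_sum:
  assumes v0: "\<And>s y. v s y = 0"
    and l: "\<And>k. k < m \<Longrightarrow> l k = log_step (flow b (tm k) (tm (Suc k))) (2 * \<delta>) (\<lambda>x. l (Suc k) x / (1 - \<delta> * g k))"
    and K: "\<And>k x. k \<le> m \<Longrightarrow> \<bar>l k x\<bar> \<le> K" and \<Lambda>: "\<And>k. k \<le> m \<Longrightarrow> \<Lambda>-lipschitz_on UNIV (l k)"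
    and g: "\<And>k. k < m \<Longrightarrow> 0 \<le> g k" "\<And>k. k < m \<Longrightarrow> g k \<le> G" "\<delta> * G \<le> 1 / 2" "4 * K * (\<delta> * G) \<le> 1"
      "\<And>k. k < m \<Longrightarrow> ennreal (g k) \<le> inverse (C_LS (distr M borel (X (tm k))))"
    and G0: "0 \<le> G"
  shows "(\<Prod>j\<in>{0..<m}. 1 - \<delta> * g j) * ln (\<integral>\<omega>. exp (2 * l 0 (X \<tau> \<omega>)) \<partial>M) \<le> ln (\<integral>\<omega>. exp (2 * l m (X (tm m) \<omega>)) \<partial>M)
    + hyper_const K \<Lambda> * ((c + G) * (\<delta> * drift_mean 0 S + S * sqrt (2 * real DIM('a) * \<delta>)) + S * \<delta> * G\<^sup>2)"
proof -
  let ?q = "sqrt (2 * real DIM('a) * \<delta>)"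
  define \<theta> where "\<theta> k = 1 - \<delta> * g k" for k
  define \<alpha> where "\<alpha> k = (\<Prod>j\<in>{k..<m}. \<theta> j)" for k
  have dg: "0 \<le> \<delta> * g k" "\<delta> * g k \<le> \<delta> * G" if "k < m" for k using \<delta> g(1,2)[OF that] by (auto intro: mult_left_mono)
  have \<theta>: "0 < \<theta> k \<and> \<theta> k \<le> 1" if "k < m" for k using dg[OF that] g(3) by (simp add: \<theta>_def)
  have \<alpha>S: "\<alpha> k = \<theta> k * \<alpha> (Suc k)" if "k < m" for k
    using that by (simp add: \<alpha>_def prod.atLeast_Suc_lessThan)
  have \<alpha>0: "0 \<le> \<alpha> k" "\<alpha> k \<le> 1" for k unfolding \<alpha>_def using \<theta> by (intro prod_nonneg prod_le_1; auto simp: less_imp_le)+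
  have K0: "0 \<le> K" using K[of m undefined] by simp
  have hc: "0 \<le> hyper_const K \<Lambda>"
    unfolding hyper_const_def using K0 lipschitz_on_nonneg[OF \<Lambda>[of m]] by (intro mult_nonneg_nonneg add_nonneg_nonneg) auto
  \<comment> \<open>The factor c comes from the mean flow error, the factor G from the mean distance
    weighted by \<open>\<delta> * g k\<close>, and the square from the \<epsilon>^2 term of
    \<open>hyper_step\<close>.\<close>
  define e where "e k = (c + G) * (\<delta> * (drift_mean (tm k) (tm (Suc k)) + ?q)) + (\<delta> * G)\<^sup>2" for k
  have e0: "0 \<le> e k" for k unfolding e_def
    using c_nonneg G0 \<delta> drift_mean_nonneg by (intro add_nonneg_nonneg mult_nonneg_nonneg) auto
  have step: "\<theta> k * ln (\<integral>\<omega>. exp (2 * l k (X (tm k) \<omega>)) \<partial>M) \<le> ln (\<integral>\<omega>. exp (2 * l (Suc k) (X (tm (Suc k)) \<omega>)) \<partial>M) + hyper_const K \<Lambda> * e k"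
    if k: "k < m" for k
  proof -
    have b: "0 \<le> tm k" "tm k \<le> tm (Suc k)" "tm (Suc k) \<le> S" using tm_bounds k by auto
    have [measurable]: "X (tm k) \<in> borel_measurable M" "X (tm (Suc k)) \<in> borel_measurable M" "noise (tm k) (tm (Suc k)) \<in> borel_measurable M"
      using tm_bounds(6)[of k] tm_bounds(6)[of "Suc k"] k b by (auto intro: X_meas_M noise_meas)
    let ?fl = "flow b (tm k) (tm (Suc k))"
    have law: "distr M (borel \<Otimes>\<^sub>M borel) (\<lambda>\<omega>. (X (tm k) \<omega>, noise (tm k) (tm (Suc k)) \<omega>)) = distr M borel (X (tm k)) \<Otimes>\<^sub>M gauss (2 * \<delta>)"
      using noise_law[OF b(1) tm_bounds(3) X_meas[OF tm_bounds(6)]] k unfolding tm_bounds(4) by simp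
    have fl: "(1 + c * \<delta>)-lipschitz_on UNIV ?fl" using flow_lipschitz[OF b(2)] by (simp add: tm_bounds(4))
    \<comment> \<open>Without v nothing is pending, so the flow may be started at the path itself
      and only the remainder is left.\<close>
    have vp: "v_path (tm k) (tm (Suc k)) \<omega> = 0" for \<omega> by (simp add: v_path_def v0 set_lebesgue_integral_def)
    have le: "AE \<omega> in M. dist (X (tm (Suc k)) \<omega>) (?fl (X (tm k) \<omega> + noise (tm k) (tm (Suc k)) \<omega>)) \<le> c * remainder (tm k) (tm (Suc k)) \<omega>"
      using flow_step_error[OF b]
    proof eventually_elim
      case (elim \<omega>)
      from elim[rule_format, of "X (tm k) \<omega>"] show ?case by (simp add: vp dist_norm)
    qed
    have [measurable]: "?fl \<in> borel_measurable borel" by (rule flow_meas[OF b(2)])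
    have ir: "integrable M (\<lambda>\<omega>. c * remainder (tm k) (tm (Suc k)) \<omega>)"
      using remainder_mean(2)[OF b] by simp
    have i1: "integrable M (\<lambda>\<omega>. dist (X (tm (Suc k)) \<omega>) (?fl (X (tm k) \<omega> + noise (tm k) (tm (Suc k)) \<omega>)))"
    proof (rule Bochner_Integration.integrable_bound[OF ir])
      show "AE \<omega> in M. norm (dist (X (tm (Suc k)) \<omega>) (?fl (X (tm k) \<omega> + noise (tm k) (tm (Suc k)) \<omega>))) \<le> norm (c * remainder (tm k) (tm (Suc k)) \<omega>)"
        using le by eventually_elim (simp add: order_trans[OF _ abs_ge_self])
    qed measurable
    have E1: "(\<integral>\<omega>. dist (X (tm (Suc k)) \<omega>) (?fl (X (tm k) \<omega> + noise (tm k) (tm (Suc k)) \<omega>)) \<partial>M) \<le> c * (\<delta> * (drift_mean (tm k) (tm (Suc k)) + ?q))"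
    proof -
      have "(\<integral>\<omega>. dist (X (tm (Suc k)) \<omega>) (?fl (X (tm k) \<omega> + noise (tm k) (tm (Suc k)) \<omega>)) \<partial>M) \<le> (\<integral>\<omega>. c * remainder (tm k) (tm (Suc k)) \<omega> \<partial>M)"
        by (rule integral_mono_AE[OF i1 ir le])
      also have "\<dots> = c * (\<integral>\<omega>. remainder (tm k) (tm (Suc k)) \<omega> \<partial>M)" by simp
      also have "\<dots> \<le> c * (\<delta> * (drift_mean (tm k) (tm (Suc k)) + ?q))"
        using remainder_mean(3)[OF b] c_nonneg by (intro mult_left_mono) (auto simp: tm_bounds(4))
      finally show ?thesis .
    qed
    note i2 = dist_mean(1)[OF b]
    have E2: "(\<integral>\<omega>. dist (X (tm (Suc k)) \<omega>) (X (tm k) \<omega>) \<partial>M) \<le> drift_mean (tm k) (tm (Suc k)) + ?q"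
      using dist_mean(2)[OF b] by (simp add: tm_bounds(4))
    have h: "(1 - \<delta> * g k) * ln (\<integral>\<omega>. exp (2 * log_step ?fl (2 * \<delta>) (\<lambda>x. l (Suc k) x / (1 - \<delta> * g k)) (X (tm k) \<omega>)) \<partial>M)
      \<le> ln (\<integral>\<omega>. exp (2 * l (Suc k) (X (tm (Suc k)) \<omega>)) \<partial>M)
       + hyper_const K \<Lambda> * ((\<integral>\<omega>. dist (X (tm (Suc k)) \<omega>) (?fl (X (tm k) \<omega> + noise (tm k) (tm (Suc k)) \<omega>)) \<partial>M)
          + (\<delta> * g k) * (\<integral>\<omega>. dist (X (tm (Suc k)) \<omega>) (X (tm k) \<omega>) \<partial>M) + (\<delta> * g k)\<^sup>2)"
    proof (rule hyper_step[where g = "g k" and \<rho> = "1 + c * \<delta>"])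
      show "4 * K * (\<delta> * g k) \<le> 1" using mult_left_mono[OF dg(2)[OF k], of "4 * K"] K0 g(4) by simp
      show "\<delta> * g k \<le> 1 / 2" using dg(2)[OF k] g(3) by simp
    qed (use \<delta> law fl \<Lambda>[of "Suc k"] K[of "Suc k"] g(1)[OF k] g(5)[OF k] k i1 i2 in auto)
    have "(\<integral>\<omega>. dist (X (tm (Suc k)) \<omega>) (?fl (X (tm k) \<omega> + noise (tm k) (tm (Suc k)) \<omega>)) \<partial>M)
          + (\<delta> * g k) * (\<integral>\<omega>. dist (X (tm (Suc k)) \<omega>) (X (tm k) \<omega>) \<partial>M) + (\<delta> * g k)\<^sup>2
       \<le> c * (\<delta> * (drift_mean (tm k) (tm (Suc k)) + ?q)) + (\<delta> * G) * (drift_mean (tm k) (tm (Suc k)) + ?q) + (\<delta> * G)\<^sup>2"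
      using dg[OF k] g(1,2)[OF k] E1 E2 \<delta> G0 by (intro add_mono mult_mono power_mono) auto
    also have "\<dots> = e k" by (simp add: e_def algebra_simps)
    finally have "hyper_const K \<Lambda> * ((\<integral>\<omega>. dist (X (tm (Suc k)) \<omega>) (?fl (X (tm k) \<omega> + noise (tm k) (tm (Suc k)) \<omega>)) \<partial>M)
          + (\<delta> * g k) * (\<integral>\<omega>. dist (X (tm (Suc k)) \<omega>) (X (tm k) \<omega>) \<partial>M) + (\<delta> * g k)\<^sup>2) \<le> hyper_const K \<Lambda> * e k"
      by (rule mult_left_mono[OF _ hc])
    then show ?thesis using h unfolding l[OF k] \<theta>_def by linarith
  qed
  have A: "\<alpha> 0 * ln (\<integral>\<omega>. exp (2 * l 0 (X \<tau> \<omega>)) \<partial>M) \<le> \<alpha> n * ln (\<integral>\<omega>. exp (2 * l n (X (tm n) \<omega>)) \<partial>M) + hyper_const K \<Lambda> * (\<Sum>k<n. e k)"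
    if "n \<le> m" for n
    using that
  proof (induction n)
    case (Suc n)
    then have n: "n < m" by simp
    have "\<alpha> n * ln (\<integral>\<omega>. exp (2 * l n (X (tm n) \<omega>)) \<partial>M) = \<alpha> (Suc n) * (\<theta> n * ln (\<integral>\<omega>. exp (2 * l n (X (tm n) \<omega>)) \<partial>M))"
      by (simp add: \<alpha>S[OF n] mult_ac)
    also have "\<dots> \<le> \<alpha> (Suc n) * (ln (\<integral>\<omega>. exp (2 * l (Suc n) (X (tm (Suc n)) \<omega>)) \<partial>M) + hyper_const K \<Lambda> * e n)"
      by (rule mult_left_mono[OF step[OF n] \<alpha>0(1)])
    also have "\<dots> = \<alpha> (Suc n) * ln (\<integral>\<omega>. exp (2 * l (Suc n) (X (tm (Suc n)) \<omega>)) \<partial>M) + \<alpha> (Suc n) * (hyper_const K \<Lambda> * e n)"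
      by (simp add: distrib_left)
    also have "\<alpha> (Suc n) * (hyper_const K \<Lambda> * e n) \<le> 1 * (hyper_const K \<Lambda> * e n)"
      using hc e0 by (intro mult_right_mono \<alpha>0) auto
    finally show ?case using Suc by (simp add: distrib_left)
  qed (simp add: grid_simps)
  have "(\<Sum>k<m. e k) = (c + G) * (\<delta> * (\<Sum>k<m. drift_mean (tm k) (tm (Suc k)) + ?q)) + real m * (\<delta> * G)\<^sup>2"
    unfolding e_def by (simp add: sum.distrib sum_distrib_left[symmetric])
  also have "(\<Sum>k<m. drift_mean (tm k) (tm (Suc k)) + ?q) = drift_mean \<tau> (tm m) + real m * ?q"
    using drift_mean_grid[of \<delta> \<tau> m] \<delta> by (simp add: sum.distrib)
  also have "(c + G) * (\<delta> * (drift_mean \<tau> (tm m) + real m * ?q)) + real m * (\<delta> * G)\<^sup>2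
     = (c + G) * (\<delta> * drift_mean \<tau> (tm m) + (real m * \<delta>) * ?q) + (real m * \<delta>) * (\<delta> * G\<^sup>2)"
    by (simp add: algebra_simps power2_eq_square)
  also have "\<dots> \<le> (c + G) * (\<delta> * drift_mean 0 S + S * ?q) + S * (\<delta> * G\<^sup>2)"
  proof -
    have mS': "real m * \<delta> \<le> S" using mS \<tau> by (simp add: grid_def)
    show ?thesis using c_nonneg G0 \<delta> \<tau> mS mS' by (intro add_mono mult_left_mono mult_right_mono drift_mean_mono) auto
  qed
  finally have "hyper_const K \<Lambda> * (\<Sum>k<m. e k) \<le> hyper_const K \<Lambda> * ((c + G) * (\<delta> * drift_mean 0 S + S * ?q) + S * \<delta> * G\<^sup>2)"
    using hc by (intro mult_left_mono) (auto simp: mult.assoc)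
  moreover have "\<alpha> m = 1" by (simp add: \<alpha>_def)
  ultimately show ?thesis using A[of m] unfolding \<alpha>_def \<theta>_def by simp
qed

end

end

section \<open>Riemann sums of a measurable rate\<close>

lemma set_integrable_bounded_Icc:
  fixes f :: "real \<Rightarrow> real"
  assumes [measurable]: "f \<in> borel_measurable borel" and "\<And>r. \<bar>f r\<bar> \<le> G"
  shows "set_integrable lborel {a..b} f"
  unfolding set_integrable_def
proof (rule Bochner_Integration.integrable_bound)
  show "integrable lborel (\<lambda>r. indicator {a..b} r *\<^sub>R G)"
    by (intro integrable_scaleR_left integrable_real_indicator) (auto simp: emeasure_lborel_Icc_eq)
  show "AE r in lborel. norm (indicator {a..b} r *\<^sub>R f r) \<le> norm (indicator {a..b} r *\<^sub>R G)"
    using assms(2) by (intro AE_I2) (auto simp: indicator_def intro: order_trans[OF _ abs_ge_self])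
qed measurable

lemma bounded_Icc_cutoff:
  fixes f :: "real \<Rightarrow> real"
  assumes "f \<in> borel_measurable borel" "\<And>r. \<bar>f r\<bar> \<le> G" and "{a..b} \<subseteq> {A..B}"
  shows "integrable lborel (\<lambda>r. indicator {A..B} r * f r)"
    and "(LINT r:{a..b}|lborel. indicator {A..B} r * f r) = (LINT r:{a..b}|lborel. f r)"
proof -
  show "integrable lborel (\<lambda>r. indicator {A..B} r * f r)"
    using set_integrable_bounded_Icc[OF assms(1,2), of A B] by (simp add: set_integrable_def)
  show "(LINT r:{a..b}|lborel. indicator {A..B} r * f r) = (LINT r:{a..b}|lborel. f r)"
    unfolding set_lebesgue_integral_def
    using assms(3) by (intro Bochner_Integration.integral_cong) (auto simp: indicator_def)
qed

text \<open>A measurable function is an almost everywhere limit of continuous ones; clipping these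
  to [0, G] keeps the bounds and allows dominated convergence.\<close>

lemma continuous_approximation:
  fixes g :: "real \<Rightarrow> real"
  assumes g [measurable]: "g \<in> borel_measurable borel" and G: "\<And>r. 0 \<le> g r" "\<And>r. g r \<le> G" and \<eta>: "0 < \<eta>"
  obtains h where "continuous_on UNIV h" "\<And>r. 0 \<le> h r" "\<And>r. h r \<le> G" "(LINT r:{a..b}|lborel. \<bar>g r - h r\<bar>) < \<eta>"
proof -
  have G0: "0 \<le> G" using G(1)[of 0] G(2)[of 0] by linarith
  have "g measurable_on UNIV"
    by (rule lebesgue_measurable_imp_measurable_on_real) (use g in \<open>auto intro: measurable_completion\<close>)
  then obtain N f where N: "negligible N" and f: "\<And>n. continuous_on UNIV (f n)" and lim: "\<And>x. x \<notin> N \<Longrightarrow> (\<lambda>n. f n x) \<longlonglongrightarrow> g x"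
    unfolding measurable_on_def by auto
  define h where "h n x = max 0 (min G (f n x))" for n :: nat and x
  have hc: "continuous_on UNIV (h n)" for n unfolding h_def by (intro continuous_intros f)
  have [measurable]: "h n \<in> borel_measurable borel" for n using hc by (rule borel_measurable_continuous_onI)
  have hb: "0 \<le> h n x" "h n x \<le> G" for n x using G0 by (auto simp: h_def)
  have hl: "(\<lambda>n. h n x) \<longlonglongrightarrow> g x" if "x \<notin> N" for x
  proof -
    have "(\<lambda>n. max 0 (min G (f n x))) \<longlonglongrightarrow> max 0 (min G (g x))" by (intro tendsto_intros lim that)
    then show ?thesis using G[of x] by (simp add: h_def)
  qed
  have AE: "AE x in lborel. x \<notin> N"
  proof -
    have "AE x in lebesgue. x \<notin> N" using N unfolding negligible_iff_null_sets by (rule AE_not_in)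
    then show ?thesis by (simp add: AE_completion_iff)
  qed
  have "(\<lambda>n. \<integral>r. indicator {a..b} r *\<^sub>R \<bar>g r - h n r\<bar> \<partial>lborel) \<longlonglongrightarrow> (\<integral>r. 0 \<partial>(lborel :: real measure))"
  proof (rule integral_dominated_convergence)
    show "integrable lborel (\<lambda>r. indicator {a..b} r *\<^sub>R (2 * G))"
      by (intro integrable_scaleR_left integrable_real_indicator) (auto simp: emeasure_lborel_Icc_eq)
    show "AE r in lborel. (\<lambda>n. indicator {a..b} r *\<^sub>R \<bar>g r - h n r\<bar>) \<longlonglongrightarrow> 0"
      using AE
    proof eventually_elim
      case (elim r)
      have "(\<lambda>n. indicator {a..b} r *\<^sub>R \<bar>g r - h n r\<bar>) \<longlonglongrightarrow> indicator {a..b} r *\<^sub>R \<bar>g r - g r\<bar>"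
        by (intro tendsto_intros hl elim)
      then show ?case by simp
    qed
    show "AE r in lborel. norm (indicator {a..b} r *\<^sub>R \<bar>g r - h n r\<bar>) \<le> indicator {a..b} r *\<^sub>R (2 * G)" for n
    proof (rule AE_I2)
      fix r
      have "\<bar>g r - h n r\<bar> \<le> 2 * G" using G[of r] hb[of n r] by linarith
      then show "norm (indicator {a..b} r *\<^sub>R \<bar>g r - h n r\<bar>) \<le> indicator {a..b} r *\<^sub>R (2 * G)" by (simp add: indicator_def)
    qed
  qed measurable
  then have "(\<lambda>n. LINT r:{a..b}|lborel. \<bar>g r - h n r\<bar>) \<longlonglongrightarrow> 0"
    by (simp add: set_lebesgue_integral_def)
  from order_tendstoD(2)[OF this \<eta>] obtain n where "(LINT r:{a..b}|lborel. \<bar>g r - h n r\<bar>) < \<eta>"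
    by (auto simp: eventually_sequentially)
  then show thesis using hc hb that by blast
qed

text \<open>Averaged over the shifts in [0, \<delta>], the Riemann sums give exactly the integral,
  so they cannot all reach a number above it.\<close>

lemma exists_good_shift:
  fixes e :: "real \<Rightarrow> real"
  assumes e [measurable]: "e \<in> borel_measurable borel" and E: "\<And>r. 0 \<le> e r" "\<And>r. e r \<le> G"
    and \<delta>: "0 < \<delta>" and \<eta>: "(LINT r:{0..real n * \<delta>}|lborel. e r) < \<eta>"
  shows "\<exists>\<tau>\<in>{0..\<delta>}. \<delta> * (\<Sum>j<n. e (grid \<tau> \<delta> j)) < \<eta>"
proof (rule ccontr)
  assume "\<not> ?thesis"
  then have ge: "\<eta> / \<delta> \<le> (\<Sum>j<n. e (grid \<tau> \<delta> j))" if "\<tau> \<in> {0..\<delta>}" for \<tau>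
    using that \<delta> by (auto simp: field_simps not_less)
  have E': "\<bar>e r\<bar> \<le> G" for r using E[of r] by simp
  let ?e = "\<lambda>r. indicator {0..real n * \<delta>} r * e r"
  have ei: "set_integrable lborel {0..\<delta>} (\<lambda>\<tau>. e (grid \<tau> \<delta> j))" for j
    by (rule set_integrable_bounded_Icc[of _ G]) (use E' in \<open>auto simp: grid_def\<close>)
  have shift: "(LINT \<tau>:{0..\<delta>}|lborel. e (grid \<tau> \<delta> j)) = (LINT r:{grid 0 \<delta> j..grid 0 \<delta> (Suc j)}|lborel. e r)" for j
  proof -
    have "(LINT r:{grid 0 \<delta> j..grid 0 \<delta> (Suc j)}|lborel. e r)
      = (\<integral>\<tau>. indicator {grid 0 \<delta> j..grid 0 \<delta> (Suc j)} (real j * \<delta> + 1 * \<tau>) *\<^sub>R e (real j * \<delta> + 1 * \<tau>) \<partial>lborel)"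
      unfolding set_lebesgue_integral_def
      by (subst lborel_integral_real_affine[of 1 _ "real j * \<delta>"]) auto
    also have "\<dots> = (LINT \<tau>:{0..\<delta>}|lborel. e (grid \<tau> \<delta> j))"
      unfolding set_lebesgue_integral_def
      by (intro Bochner_Integration.integral_cong) (auto simp: grid_def indicator_def algebra_simps)
    finally show ?thesis ..
  qed
  have "\<eta> = (LINT \<tau>:{0..\<delta>}|lborel. \<eta> / \<delta>)"
    using integral_indicator_Icc[of 0 \<delta> "\<eta> / \<delta>"] \<delta> by (simp add: set_lebesgue_integral_def)
  also have "\<dots> \<le> (LINT \<tau>:{0..\<delta>}|lborel. \<Sum>j<n. e (grid \<tau> \<delta> j))"
  proof (rule set_integral_mono)
    show "set_integrable lborel {0..\<delta>} (\<lambda>\<tau>. \<eta> / \<delta>)"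
      by (rule set_integrable_bounded_Icc[of _ "\<bar>\<eta> / \<delta>\<bar>"]) auto
    show "set_integrable lborel {0..\<delta>} (\<lambda>\<tau>. \<Sum>j<n. e (grid \<tau> \<delta> j))"
      using ei unfolding set_integrable_def scaleR_sum_right by (intro Bochner_Integration.integrable_sum)
  qed (use ge in auto)
  also have "\<dots> = (\<Sum>j<n. LINT \<tau>:{0..\<delta>}|lborel. e (grid \<tau> \<delta> j))"
    using ei unfolding set_lebesgue_integral_def set_integrable_def scaleR_sum_right by (intro Bochner_Integration.integral_sum)
  also have "\<dots> = (\<Sum>j<n. LINT r:{grid 0 \<delta> j..grid 0 \<delta> (Suc j)}|lborel. ?e r)"
  proof (intro sum.cong refl)
    fix j assume "j \<in> {..<n}"
    then have "Suc j \<le> n" by simp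
    from grid_mono[OF _ this, of \<delta> 0] grid_mono[of \<delta> 0 j 0] \<delta>
    have "{grid 0 \<delta> j..grid 0 \<delta> (Suc j)} \<subseteq> {0..real n * \<delta>}" by (auto simp: grid_def)
    then show "(LINT \<tau>:{0..\<delta>}|lborel. e (grid \<tau> \<delta> j)) = (LINT r:{grid 0 \<delta> j..grid 0 \<delta> (Suc j)}|lborel. ?e r)"
      using bounded_Icc_cutoff(2)[OF e E'] shift by simp
  qed
  also have "\<dots> = (LINT r:{0..grid 0 \<delta> n}|lborel. ?e r)"
    by (rule set_integral_grid) (use bounded_Icc_cutoff(1)[OF e E' order_refl] \<delta> in auto)
  also have "\<dots> = (LINT r:{0..real n * \<delta>}|lborel. e r)"
    using bounded_Icc_cutoff(2)[OF e E' order_refl] by (simp add: grid_def)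
  finally show False using \<eta> by simp
qed

text \<open>
  The rate is only measurable, so its Riemann sums need not converge. Comparison with a continuous
  function that is close in mean shows that they do for suitable shifts of the grid.
\<close>
lemma riemann_sum_shift:
  fixes g :: "real \<Rightarrow> real"
  assumes S: "0 < S" and g [measurable]: "g \<in> borel_measurable borel" and G: "\<And>r. 0 \<le> g r" "\<And>r. g r \<le> G" and \<eta>: "0 < \<eta>"
  shows "\<forall>\<^sub>F n in sequentially. \<exists>\<tau>\<in>{0..S / real (Suc n)}. \<forall>k\<le>n.
    (LINT r:{grid \<tau> (S / real (Suc n)) k..S}|lborel. g r)
      \<le> S / real (Suc n) * (\<Sum>j\<in>{k..<n}. g (grid \<tau> (S / real (Suc n)) j)) + \<eta>"
proof -
  \<comment> \<open>Four errors share \<eta>: the integral of |g - h|, its Riemann sum, the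
    oscillation of h on the cells, and the incomplete last cell.\<close>
  define \<epsilon> where "\<epsilon> = \<eta> / 4"
  have \<epsilon>: "0 < \<epsilon>" using \<eta> by (simp add: \<epsilon>_def)
  have G0: "0 \<le> G" using G(1)[of 0] G(2)[of 0] by linarith
  obtain h where h: "continuous_on UNIV h" "\<And>r. 0 \<le> h r" "\<And>r. h r \<le> G" "(LINT r:{0..S}|lborel. \<bar>g r - h r\<bar>) < \<epsilon>"
    using continuous_approximation[OF g G \<epsilon>, of 0 S] by metis
  have [measurable]: "h \<in> borel_measurable borel" using h(1) by (rule borel_measurable_continuous_onI)
  define e where "e r = \<bar>g r - h r\<bar>" for r
  have [measurable]: "e \<in> borel_measurable borel" unfolding e_def by measurable
  have e: "0 \<le> e r" "e r \<le> G" for r using G[of r] h(2,3)[of r] by (auto simp: e_def abs_le_iff)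
  have "uniformly_continuous_on {0..S} h"
    by (rule compact_uniformly_continuous) (use h(1) in \<open>auto intro: continuous_on_subset\<close>)
  then obtain d where d: "0 < d" "\<And>x y. x \<in> {0..S} \<Longrightarrow> y \<in> {0..S} \<Longrightarrow> dist y x < d \<Longrightarrow> dist (h y) (h x) < \<epsilon> / S"
    unfolding uniformly_continuous_on_def using \<epsilon> S by (metis divide_pos_pos)
  have lim: "(\<lambda>n. S / real (Suc n)) \<longlonglongrightarrow> 0"
    using tendsto_mult_right_zero[OF LIMSEQ_inverse_real_of_nat, of S] by (simp add: divide_inverse)
  have "\<forall>\<^sub>F n in sequentially. S / real (Suc n) < d" by (rule order_tendstoD(2)[OF lim d(1)])
  moreover have "\<forall>\<^sub>F n in sequentially. S / real (Suc n) < \<epsilon> / (G + 1)"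
    by (rule order_tendstoD(2)[OF lim]) (use \<epsilon> G0 in simp)
  ultimately show ?thesis
  proof eventually_elim
    case (elim n)
    \<comment> \<open>The interval holds n + 1 cells but the sums run over n of them. This leaves
      room for the shift: the point \<open>grid \<tau> \<delta> n\<close> lies in [S - \<delta>, S]
      for every \<tau> in [0, \<delta>].\<close>
    define \<delta> where "\<delta> = S / real (Suc n)"
    have \<delta>: "0 < \<delta>" "real (Suc n) * \<delta> = S" "\<delta> < d" using S elim by (auto simp: \<delta>_def)
    have G\<delta>: "G * \<delta> \<le> \<epsilon>"
    proof -
      have "(G + 1) * \<delta> \<le> \<epsilon>" using elim(2) G0 by (simp add: \<delta>_def less_divide_eq field_simps)
      then show ?thesis using \<delta> by (simp add: algebra_simps)
    qed
    have "(LINT r:{0..real (Suc n) * \<delta>}|lborel. e r) < \<epsilon>" unfolding \<delta>(2) using h(4) by (simp add: e_def)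
    from exists_good_shift[OF _ e \<delta>(1) this] obtain \<tau> where \<tau>: "\<tau> \<in> {0..\<delta>}" "\<delta> * (\<Sum>j<Suc n. e (grid \<tau> \<delta> j)) < \<epsilon>" by auto
    have tn: "grid \<tau> \<delta> n \<le> S" "S - grid \<tau> \<delta> n \<le> \<delta>"
      using \<tau>(1) \<delta>(2) by (auto simp: grid_def algebra_simps)
    show ?case unfolding \<delta>_def[symmetric]
    proof (intro bexI[OF _ \<tau>(1)] allI impI)
      fix k assume k: "k \<le> n"
      have tk: "0 \<le> grid \<tau> \<delta> k" "grid \<tau> \<delta> k \<le> grid \<tau> \<delta> n"
        using grid_mono[of \<delta> 0 k \<tau>] grid_mono[OF _ k, of \<delta> \<tau>] \<delta> \<tau> by (auto simp: grid_simps)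
      have gb: "\<bar>g r\<bar> \<le> G" "\<bar>e r\<bar> \<le> G" "\<bar>h r\<bar> \<le> G" for r using G[of r] e[of r] h(2,3)[of r] by auto
      \<comment> \<open>The splitting lemmas ask for integrability on the whole line, which a
        cut-off to [0, S] provides.\<close>
      let ?c = "\<lambda>f r. indicator {0..S} r * f r :: real"
      have ci: "integrable lborel (?c g)" "integrable lborel (?c e)"
        by (rule bounded_Icc_cutoff(1)[OF _ gb(1) order_refl] bounded_Icc_cutoff(1)[OF _ gb(2) order_refl]; simp)+
      have gi: "set_integrable lborel {a..b} g" "set_integrable lborel {a..b} e" "set_integrable lborel {a..b} h" for a b
        by (rule set_integrable_bounded_Icc[of _ G]; use gb in simp)+
      have last: "(LINT r:{grid \<tau> \<delta> n..S}|lborel. g r) \<le> \<epsilon>"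
      proof -
        have "(LINT r:{grid \<tau> \<delta> n..S}|lborel. g r) \<le> (LINT r:{grid \<tau> \<delta> n..S}|lborel. G)"
          by (rule set_integral_mono[OF gi(1)]) (use G G0 in \<open>auto intro: set_integrable_bounded_Icc[of _ G]\<close>)
        also have "\<dots> = (S - grid \<tau> \<delta> n) * G" using integral_indicator_Icc[OF tn(1), of G] by (simp add: set_lebesgue_integral_def)
        also have "\<dots> \<le> \<delta> * G" using tn G0 by (intro mult_right_mono)
        finally show ?thesis using G\<delta> by (simp add: mult.commute)
      qed
      \<comment> \<open>At r, g is within e of h; h at r is within \<epsilon> / S of its value at
        the left end of the cell, which is again within e of g there.\<close>
      have cell: "(LINT r:{grid \<tau> \<delta> j..grid \<tau> \<delta> (Suc j)}|lborel. g r) \<le> (LINT r:{grid \<tau> \<delta> j..grid \<tau> \<delta> (Suc j)}|lborel. e r) + \<delta> * (g (grid \<tau> \<delta> j) + e (grid \<tau> \<delta> j) + \<epsilon> / S)"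
        if j: "j < n" for j
      proof -
        let ?a = "grid \<tau> \<delta> j" and ?b = "grid \<tau> \<delta> (Suc j)"
        have ab: "0 \<le> ?a" "?b \<le> S" "?b = ?a + \<delta>"
          using grid_mono[of \<delta> 0 j \<tau>] grid_mono[of \<delta> "Suc j" n \<tau>] j \<delta> \<tau> tn by (auto simp: grid_simps)
        define C where "C = g ?a + e ?a + \<epsilon> / S"
        have "(LINT r:{?a..?b}|lborel. g r) \<le> (LINT r:{?a..?b}|lborel. e r + C)"
        proof (rule set_integral_mono[OF gi(1)])
          show "set_integrable lborel {?a..?b} (\<lambda>r. e r + C)"
            by (rule set_integral_add(1)[OF gi(2) set_integrable_bounded_Icc[of _ "\<bar>C\<bar>"]]) auto
          fix r assume r: "r \<in> {?a..?b}"
          show "g r \<le> e r + C"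
          proof -
            have "h r \<le> h ?a + \<epsilon> / S"
            proof (cases "dist r ?a < d")
              case True
              then show ?thesis using d(2)[of ?a r] r ab by (auto simp: dist_real_def)
            next
              case False
              then show ?thesis using r ab \<delta>(3) by (auto simp: dist_real_def)
            qed
            then show ?thesis by (auto simp: C_def e_def abs_if split: if_splits)
          qed
        qed
        also have "\<dots> = (LINT r:{?a..?b}|lborel. e r) + (LINT r:{?a..?b}|lborel. C)"
          by (rule set_integral_add(2)[OF gi(2) set_integrable_bounded_Icc[of _ "\<bar>C\<bar>"]]) auto
        also have "(LINT r:{?a..?b}|lborel. C) = \<delta> * C"
          using integral_indicator_Icc[of ?a ?b C] ab \<delta> by (simp add: set_lebesgue_integral_def)
        finally show ?thesis by (simp add: C_def)
      qed
      have tele: "(LINT r:{grid \<tau> \<delta> k..grid \<tau> \<delta> i}|lborel. g r) \<le> (\<Sum>j\<in>{k..<i}. (LINT r:{grid \<tau> \<delta> j..grid \<tau> \<delta> (Suc j)}|lborel. e r) + \<delta> * (g (grid \<tau> \<delta> j) + e (grid \<tau> \<delta> j) + \<epsilon> / S))"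
        if "k \<le> i" "i \<le> n" for i
        using that
      proof (induction i rule: dec_induct)
        case base
        have "(LINT r:{grid \<tau> \<delta> k..grid \<tau> \<delta> k}|lborel. g r) \<le> (LINT r:{grid \<tau> \<delta> k..grid \<tau> \<delta> k}|lborel. G)"
          by (rule set_integral_mono[OF gi(1)]) (use G G0 in \<open>auto intro: set_integrable_bounded_Icc[of _ G]\<close>)
        also have "\<dots> = 0" using integral_indicator_Icc[of "grid \<tau> \<delta> k" "grid \<tau> \<delta> k" G] by (simp add: set_lebesgue_integral_def)
        finally show ?case by simp
      next
        case (step i)
        have b: "grid \<tau> \<delta> k \<le> grid \<tau> \<delta> i" "grid \<tau> \<delta> i \<le> grid \<tau> \<delta> (Suc i)" "grid \<tau> \<delta> (Suc i) \<le> S"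
          using grid_mono[of \<delta> k i \<tau>] grid_mono[of \<delta> i "Suc i" \<tau>] grid_mono[of \<delta> "Suc i" n \<tau>] step \<delta> tn by auto
        have "(LINT r:{grid \<tau> \<delta> k..grid \<tau> \<delta> (Suc i)}|lborel. ?c g r) = (LINT r:{grid \<tau> \<delta> k..grid \<tau> \<delta> i}|lborel. ?c g r) + (LINT r:{grid \<tau> \<delta> i..grid \<tau> \<delta> (Suc i)}|lborel. ?c g r)"
          by (rule set_integral_Icc_split[OF ci(1) b(1,2)])
        then have "(LINT r:{grid \<tau> \<delta> k..grid \<tau> \<delta> (Suc i)}|lborel. g r) = (LINT r:{grid \<tau> \<delta> k..grid \<tau> \<delta> i}|lborel. g r) + (LINT r:{grid \<tau> \<delta> i..grid \<tau> \<delta> (Suc i)}|lborel. g r)"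
          using b tk(1) by (subst (asm) (1 2 3) bounded_Icc_cutoff(2)[OF g gb(1)]) auto
        then show ?case using step cell[of i] by simp
      qed
      have esum: "(\<Sum>j\<in>{k..<n}. LINT r:{grid \<tau> \<delta> j..grid \<tau> \<delta> (Suc j)}|lborel. e r) \<le> \<epsilon>"
      proof -
        have "(\<Sum>j\<in>{k..<n}. LINT r:{grid \<tau> \<delta> j..grid \<tau> \<delta> (Suc j)}|lborel. e r) \<le> (\<Sum>j<n. LINT r:{grid \<tau> \<delta> j..grid \<tau> \<delta> (Suc j)}|lborel. e r)"
          by (rule sum_mono2) (auto intro!: set_integral_Icc_nonneg e)
        also have "\<dots> = (\<Sum>j<n. LINT r:{grid \<tau> \<delta> j..grid \<tau> \<delta> (Suc j)}|lborel. ?c e r)"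
        proof (intro sum.cong refl)
          fix j assume "j \<in> {..<n}"
          then have "{grid \<tau> \<delta> j..grid \<tau> \<delta> (Suc j)} \<subseteq> {0..S}"
            using grid_mono[of \<delta> 0 j \<tau>] grid_mono[of \<delta> "Suc j" n \<tau>] \<delta> \<tau> tn by (auto simp: grid_simps)
          then show "(LINT r:{grid \<tau> \<delta> j..grid \<tau> \<delta> (Suc j)}|lborel. e r) = (LINT r:{grid \<tau> \<delta> j..grid \<tau> \<delta> (Suc j)}|lborel. ?c e r)"
            using bounded_Icc_cutoff(2)[OF _ gb(2)] by simp
        qed
        also have "\<dots> = (LINT r:{\<tau>..grid \<tau> \<delta> n}|lborel. ?c e r)" using \<delta> by (intro set_integral_grid ci) auto
        also have "\<dots> \<le> (LINT r:{0..S}|lborel. ?c e r)" using \<tau> tn e by (intro set_integral_Icc_mono ci) auto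
        also have "\<dots> = (LINT r:{0..S}|lborel. e r)" by (rule bounded_Icc_cutoff(2)[OF _ gb(2) order_refl]) simp
        also have "\<dots> \<le> \<epsilon>" using h(4) by (simp add: e_def)
        finally show ?thesis .
      qed
      have e2: "\<delta> * (\<Sum>j\<in>{k..<n}. e (grid \<tau> \<delta> j)) \<le> \<epsilon>"
      proof -
        have "(\<Sum>j\<in>{k..<n}. e (grid \<tau> \<delta> j)) \<le> (\<Sum>j<Suc n. e (grid \<tau> \<delta> j))" by (rule sum_mono2) (auto simp: e)
        then have "\<delta> * (\<Sum>j\<in>{k..<n}. e (grid \<tau> \<delta> j)) \<le> \<delta> * (\<Sum>j<Suc n. e (grid \<tau> \<delta> j))" using \<delta> by (intro mult_left_mono) auto
        then show ?thesis using \<tau>(2) by linarith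
      qed
      have e3: "(\<Sum>j\<in>{k..<n}. \<delta> * (\<epsilon> / S)) \<le> \<epsilon>"
      proof -
        have "(\<Sum>j\<in>{k..<n}. \<delta> * (\<epsilon> / S)) = (real (n - k) * \<delta>) * (\<epsilon> / S)" by simp
        also have "\<dots> \<le> S * (\<epsilon> / S)"
        proof (rule mult_right_mono)
          have "real (n - k) * \<delta> \<le> real (Suc n) * \<delta>" using \<delta> by (intro mult_right_mono) auto
          then show "real (n - k) * \<delta> \<le> S" using \<delta>(2) by simp
        qed (use \<epsilon> S in simp)
        finally show ?thesis using S by simp
      qed
      have "(LINT r:{grid \<tau> \<delta> k..S}|lborel. ?c g r) = (LINT r:{grid \<tau> \<delta> k..grid \<tau> \<delta> n}|lborel. ?c g r) + (LINT r:{grid \<tau> \<delta> n..S}|lborel. ?c g r)"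
        by (rule set_integral_Icc_split[OF ci(1) tk(2) tn(1)])
      then have "(LINT r:{grid \<tau> \<delta> k..S}|lborel. g r) = (LINT r:{grid \<tau> \<delta> k..grid \<tau> \<delta> n}|lborel. g r) + (LINT r:{grid \<tau> \<delta> n..S}|lborel. g r)"
        using tk tn by (subst (asm) (1 2 3) bounded_Icc_cutoff(2)[OF g gb(1)]) auto
      also have "\<dots> \<le> (\<Sum>j\<in>{k..<n}. (LINT r:{grid \<tau> \<delta> j..grid \<tau> \<delta> (Suc j)}|lborel. e r) + \<delta> * (g (grid \<tau> \<delta> j) + e (grid \<tau> \<delta> j) + \<epsilon> / S)) + \<epsilon>"
        by (intro add_mono tele[OF k order_refl] last)
      also have "\<dots> = (\<Sum>j\<in>{k..<n}. LINT r:{grid \<tau> \<delta> j..grid \<tau> \<delta> (Suc j)}|lborel. e r) + \<delta> * (\<Sum>j\<in>{k..<n}. g (grid \<tau> \<delta> j))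
          + \<delta> * (\<Sum>j\<in>{k..<n}. e (grid \<tau> \<delta> j)) + (\<Sum>j\<in>{k..<n}. \<delta> * (\<epsilon> / S)) + \<epsilon>"
        by (simp only: sum.distrib distrib_left sum_distrib_left)
      also have "\<dots> \<le> \<delta> * (\<Sum>j\<in>{k..<n}. g (grid \<tau> \<delta> j)) + \<eta>"
      proof -
        have "\<eta> = 4 * \<epsilon>" by (simp add: \<epsilon>_def)
        then show ?thesis using esum e2 e3 by linarith
      qed
      finally show "(LINT r:{grid \<tau> \<delta> k..S}|lborel. g r) \<le> \<delta> * (\<Sum>j\<in>{k..<n}. g (grid \<tau> \<delta> j)) + \<eta>" .
    qed
  qed
qed

section \<open>Comparison of the two processes and the limit of fine grids\<close>

lemma (in prob_space) lipschitz_expectation: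
  fixes Z Z' :: "'a \<Rightarrow> 'b::euclidean_space" and h :: "'b \<Rightarrow> real"
  assumes [measurable]: "Z \<in> borel_measurable M" "Z' \<in> borel_measurable M"
    and h: "\<Lambda>-lipschitz_on UNIV h" and K: "\<And>x. \<bar>h x\<bar> \<le> K"
    and i: "integrable M (\<lambda>\<omega>. dist (Z \<omega>) (Z' \<omega>))"
  shows "(\<integral>\<omega>. h (Z \<omega>) \<partial>M) \<le> (\<integral>\<omega>. h (Z' \<omega>) \<partial>M) + \<Lambda> * (\<integral>\<omega>. dist (Z \<omega>) (Z' \<omega>) \<partial>M)"
    and "ln (\<integral>\<omega>. exp (h (Z \<omega>)) \<partial>M) \<le> ln (\<integral>\<omega>. exp (h (Z' \<omega>)) \<partial>M) + exp (2 * K) * \<Lambda> * (\<integral>\<omega>. dist (Z \<omega>) (Z' \<omega>) \<partial>M)"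
    and "(\<integral>\<omega>. h (Z \<omega>) \<partial>M) \<le> ln (\<integral>\<omega>. exp (h (Z \<omega>)) \<partial>M)"
proof -
  have [measurable]: "h \<in> borel_measurable borel" using h by (auto intro!: borel_measurable_continuous_onI dest: lipschitz_on_continuous_on)
  have ih: "integrable M (\<lambda>\<omega>. h (V \<omega>))" if [measurable]: "V \<in> borel_measurable M" for V
    by (rule integrable_const_bound[where B = K]) (use K in auto)
  have K': "h x \<le> K" "- K \<le> h x" for x using K[of x] by auto
  have ie: "integrable M (\<lambda>\<omega>. exp (h (V \<omega>)))" if [measurable]: "V \<in> borel_measurable M" for V
    by (rule integrable_const_bound[where B = "exp K"]) (use K' in auto)
  have pe: "exp (- K) \<le> (\<integral>\<omega>. exp (h (V \<omega>)) \<partial>M)" if "V \<in> borel_measurable M" for V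
    by (rule integral_ge_const[OF ie[OF that]]) (use K' in auto)
  have pe0: "0 < (\<integral>\<omega>. exp (h (V \<omega>)) \<partial>M)" if "V \<in> borel_measurable M" for V
    using pe[OF that] exp_gt_zero[of "- K"] by linarith
  have hL: "\<bar>h x - h y\<bar> \<le> \<Lambda> * dist x y" for x y using lipschitz_onD[OF h, of x y] by (simp add: dist_real_def)
  have \<Lambda>0: "0 \<le> \<Lambda>" by (rule lipschitz_on_nonneg[OF h])
  have "(\<integral>\<omega>. h (Z \<omega>) \<partial>M) \<le> (\<integral>\<omega>. h (Z' \<omega>) + \<Lambda> * dist (Z \<omega>) (Z' \<omega>) \<partial>M)"
  proof (rule integral_mono)
    show "h (Z \<omega>) \<le> h (Z' \<omega>) + \<Lambda> * dist (Z \<omega>) (Z' \<omega>)" for \<omega> using hL[of "Z \<omega>" "Z' \<omega>"] by linarith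
  qed (use ih[of Z] ih[of Z'] i in auto)
  then show "(\<integral>\<omega>. h (Z \<omega>) \<partial>M) \<le> (\<integral>\<omega>. h (Z' \<omega>) \<partial>M) + \<Lambda> * (\<integral>\<omega>. dist (Z \<omega>) (Z' \<omega>) \<partial>M)"
    using ih[of Z'] i by simp
  let ?P = "\<integral>\<omega>. exp (h (Z \<omega>)) \<partial>M" and ?P' = "\<integral>\<omega>. exp (h (Z' \<omega>)) \<partial>M" and ?d = "\<integral>\<omega>. dist (Z \<omega>) (Z' \<omega>) \<partial>M"
  have "?P \<le> (\<integral>\<omega>. exp (h (Z' \<omega>)) + exp K * \<Lambda> * dist (Z \<omega>) (Z' \<omega>) \<partial>M)"
  proof (rule integral_mono)
    show "exp (h (Z \<omega>)) \<le> exp (h (Z' \<omega>)) + exp K * \<Lambda> * dist (Z \<omega>) (Z' \<omega>)" for \<omega>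
    proof -
      have "\<bar>exp (h (Z \<omega>)) - exp (h (Z' \<omega>))\<bar> \<le> exp K * \<bar>h (Z \<omega>) - h (Z' \<omega>)\<bar>" by (rule exp_lipschitz_bounded) (use K' in auto)
      also have "\<dots> \<le> exp K * (\<Lambda> * dist (Z \<omega>) (Z' \<omega>))" by (intro mult_left_mono hL) auto
      finally show ?thesis by (simp add: mult.assoc)
    qed
  qed (use ie[of Z] ie[of Z'] i in auto)
  also have "\<dots> = ?P' + exp K * \<Lambda> * ?d" using ie[of Z'] i by simp
  finally have PP: "?P - ?P' \<le> exp K * \<Lambda> * ?d" by simp
  have d0: "0 \<le> exp K * \<Lambda> * ?d" using \<Lambda>0 by simp
  have "ln ?P - ln ?P' \<le> (?P - ?P') / ?P'" by (rule ln_diff_le) (use pe0 in auto)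
  also have "\<dots> \<le> (exp K * \<Lambda> * ?d) / ?P'" by (rule divide_right_mono[OF PP]) (use pe0[of Z'] in simp)
  also have "\<dots> \<le> (exp K * \<Lambda> * ?d) / exp (- K)" using d0 pe[of Z'] pe0[of Z'] by (intro divide_left_mono) auto
  also have "\<dots> = exp (2 * K) * \<Lambda> * ?d"
  proof -
    have "exp (2 * K) = exp K / exp (- K)" by (simp add: exp_diff[symmetric])
    then show ?thesis by simp
  qed
  finally show "ln ?P \<le> ln ?P' + exp (2 * K) * \<Lambda> * ?d" by simp
  \<comment> \<open>Jensen's inequality, by the tangent of exp at the mean.\<close>
  define m where "m = (\<integral>\<omega>. h (Z \<omega>) \<partial>M)"
  have "exp m = (\<integral>\<omega>. exp m * (1 + (h (Z \<omega>) - m)) \<partial>M)"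
    using ih[of Z] prob_space by (simp add: m_def[symmetric])
  also have "\<dots> \<le> ?P"
  proof (rule integral_mono)
    show "exp m * (1 + (h (Z \<omega>) - m)) \<le> exp (h (Z \<omega>))" for \<omega>
    proof -
      have "exp m * (1 + (h (Z \<omega>) - m)) \<le> exp m * exp (h (Z \<omega>) - m)" by (intro mult_left_mono exp_ge_add_one_self) auto
      then show ?thesis by (simp add: exp_add[symmetric])
    qed
  qed (use ih[of Z] ie[of Z] in auto)
  finally have "exp m \<le> ?P" .
  then have "m \<le> ln ?P" using ln_ge_iff[OF pe0[of Z], of m] by simp
  then show "(\<integral>\<omega>. h (Z \<omega>) \<partial>M) \<le> ln ?P" unfolding m_def .
qed

text \<open>The two processes may live on different probability spaces with unrelated Brownian
  motions. They are linked only through b, the horizon and the initial law.\<close>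

locale comparison = X: driven_process MX FX BX X S b c v + Y: driven_process MY FY BY Y S b c "\<lambda>_ _. 0"
  for MX :: "'w1 measure" and FX BX and X :: "real \<Rightarrow> 'w1 \<Rightarrow> 'a::euclidean_space" and S b c v
    and MY :: "'w2 measure" and FY BY and Y :: "real \<Rightarrow> 'w2 \<Rightarrow> 'a" +
  assumes init: "distr MX borel (X 0) = distr MY borel (Y 0)"
begin

text \<open>In order: \<open>X\<close> between the last grid point and S, the delayed chain against
  \<open>X\<close>, \<open>Y\<close> on that last piece, \<open>X\<close> and then \<open>Y\<close>
  between 0 and the first grid point, and the accumulated hypercontractive error.\<close>

definition step_error :: "real \<Rightarrow> real \<Rightarrow> real \<Rightarrow> real \<Rightarrow> real \<Rightarrow> real \<Rightarrow> real" where
  "step_error K0 \<Lambda>0 K \<Lambda> G \<delta> =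
     \<Lambda>0 * (X.drift_mean (S - \<delta>) S + sqrt (2 * real DIM('a) * \<delta>))
   + \<Lambda>0 * (exp (c * S) * (c * (\<delta> * X.drift_mean 0 S + S * sqrt (2 * real DIM('a) * \<delta>))) + sqrt (\<delta> * (LINT r:{0..S}|lborel. X.energy r)))
   + exp (2 * K0) * \<Lambda>0 * (Y.drift_mean (S - \<delta>) S + sqrt (2 * real DIM('a) * \<delta>))
   + 2 * \<Lambda> * (X.drift_mean 0 \<delta> + sqrt (2 * real DIM('a) * \<delta>))
   + exp (4 * K) * (2 * \<Lambda>) * (Y.drift_mean 0 \<delta> + sqrt (2 * real DIM('a) * \<delta>))
   + hyper_const K \<Lambda> * ((c + G) * (\<delta> * Y.drift_mean 0 S + S * sqrt (2 * real DIM('a) * \<delta>)) + S * \<delta> * G\<^sup>2)"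

text \<open>The comparisons lead from \<open>X S\<close> through the delayed chain back to
  \<open>X \<tau>\<close> and \<open>X 0\<close>, cross to \<open>Y 0\<close> by equality of laws,
  and return along \<open>Y\<close> to time S. K and \<Lambda> are the bounds that
  \<open>backward_functions\<close> yields for half of \<phi>.\<close>

lemma grid_bound:
  assumes \<tau>: "0 \<le> \<tau>" "\<tau> \<le> \<delta>" and \<delta>: "0 < \<delta>" "\<delta> \<le> S" and mS: "grid \<tau> \<delta> m \<le> S" "S - grid \<tau> \<delta> m \<le> \<delta>"
    and \<phi>: "\<Lambda>0-lipschitz_on UNIV \<phi>" "\<And>x. \<bar>\<phi> x\<bar> \<le> K0"
    and g: "\<And>k. k < m \<Longrightarrow> 0 \<le> g k" "\<And>k. k < m \<Longrightarrow> g k \<le> G" "0 \<le> G"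
      "\<And>k. k < m \<Longrightarrow> ennreal (g k) \<le> inverse (C_LS (distr MY borel (Y (grid \<tau> \<delta> k))))"
    and K: "K = K0 / 2 * exp (2 * G * S)" and \<Lambda>: "\<Lambda> = \<Lambda>0 / 2 * exp ((2 * G + c) * S)"
    and small: "\<delta> * G \<le> 1 / 2" "4 * K * (\<delta> * G) \<le> 1"
  shows "(\<integral>\<omega>. \<phi> (X S \<omega>) \<partial>MX) - ln (\<integral>\<omega>. exp (\<phi> (Y S \<omega>)) \<partial>MY)
    \<le> (\<Sum>k\<in>{1..<m}. (\<Prod>j\<in>{k..<m}. 1 - \<delta> * g j) * (LINT r:{grid \<tau> \<delta> (k - 1)..grid \<tau> \<delta> k}|lborel. X.energy r)) / 2
      + step_error K0 \<Lambda>0 K \<Lambda> G \<delta>"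
proof -
  let ?t = "grid \<tau> \<delta>" and ?q = "sqrt (2 * real DIM('a) * \<delta>)"
  have S0: "0 < S" by (rule X.S)
  have m\<delta>: "real m * \<delta> \<le> S" using mS(1) \<tau>(1) by (simp add: grid_def)
  have \<Lambda>00: "0 \<le> \<Lambda>0" by (rule lipschitz_on_nonneg[OF \<phi>(1)])
  have \<Lambda>n: "0 \<le> \<Lambda>" using \<Lambda>00 by (simp add: \<Lambda>)
  have \<psi>: "(\<Lambda>0 / 2)-lipschitz_on UNIV (\<lambda>x. \<phi> x / 2)" "\<bar>\<phi> x / 2\<bar> \<le> K0 / 2" for x
  proof -
    show "(\<Lambda>0 / 2)-lipschitz_on UNIV (\<lambda>x. \<phi> x / 2)"
    proof (rule lipschitz_onI)
      show "dist (\<phi> x / 2) (\<phi> y / 2) \<le> \<Lambda>0 / 2 * dist x y" for x y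
        using lipschitz_onD[OF \<phi>(1), of x y] by (simp add: dist_real_def diff_divide_distrib[symmetric])
    qed (use \<Lambda>00 in simp)
    show "\<bar>\<phi> x / 2\<bar> \<le> K0 / 2" using \<phi>(2)[of x] by simp
  qed
  obtain l where l: "l m = (\<lambda>x. \<phi> x / 2)"
    and lS: "\<And>k. k < m \<Longrightarrow> l k = log_step (flow b (?t k) (?t (Suc k))) (2 * \<delta>) (\<lambda>x. l (Suc k) x / (1 - \<delta> * g k))"
    and lK: "\<And>k x. k \<le> m \<Longrightarrow> \<bar>l k x\<bar> \<le> K"
    and lL: "\<And>k. k \<le> m \<Longrightarrow> \<Lambda>-lipschitz_on UNIV (l k)"
    using X.backward_functions[where \<tau> = \<tau> and g = g, OF \<delta>(1) m\<delta> g(1,2) small(1) g(3) \<psi>] unfolding K \<Lambda> by blast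
  have lm: "l k \<in> borel_measurable borel" if "k \<le> m" for k
    using lL[OF that] by (auto intro!: borel_measurable_continuous_onI dest: lipschitz_on_continuous_on)
  define \<alpha> where "\<alpha> = (\<Prod>j\<in>{0..<m}. 1 - \<delta> * g j)"
  have th: "0 < 1 - \<delta> * g k \<and> 1 - \<delta> * g k \<le> 1" if "k < m" for k
  proof -
    have "\<delta> * g k \<le> \<delta> * G" "0 \<le> \<delta> * g k" using g(1,2)[OF that] \<delta>(1) by (auto intro: mult_left_mono)
    then show ?thesis using small(1) by linarith
  qed
  have \<alpha>: "0 \<le> \<alpha>" "\<alpha> \<le> 1" unfolding \<alpha>_def using th by (intro prod_nonneg prod_le_1; auto simp: less_imp_le)+
  have tmS: "0 \<le> ?t m" using X.tm_bounds(1)[OF \<tau>(1) \<delta>(1) mS(1) order_refl] .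
  have \<tau>S: "\<tau> \<le> S" using \<tau> \<delta> by simp
  have 1: "(\<integral>\<omega>. \<phi> (X S \<omega>) \<partial>MX) \<le> (\<integral>\<omega>. \<phi> (X (?t m) \<omega>) \<partial>MX) + \<Lambda>0 * (X.drift_mean (S - \<delta>) S + ?q)"
  proof -
    note dm = X.dist_mean[OF tmS mS(1) order_refl]
    have "(\<integral>\<omega>. \<phi> (X S \<omega>) \<partial>MX) \<le> (\<integral>\<omega>. \<phi> (X (?t m) \<omega>) \<partial>MX) + \<Lambda>0 * (\<integral>\<omega>. dist (X S \<omega>) (X (?t m) \<omega>) \<partial>MX)"
      by (rule X.lipschitz_expectation(1)[OF X.X_meas_M X.X_meas_M \<phi> dm(1)]) (use tmS mS S0 in auto)
    also have "(\<integral>\<omega>. dist (X S \<omega>) (X (?t m) \<omega>) \<partial>MX) \<le> X.drift_mean (S - \<delta>) S + ?q"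
    proof (rule order_trans[OF dm(2) add_mono])
      show "X.drift_mean (?t m) S \<le> X.drift_mean (S - \<delta>) S" by (rule X.drift_mean_mono) (use mS in auto)
      show "sqrt (2 * real DIM('a) * (S - ?t m)) \<le> ?q" using mS by (intro real_sqrt_le_mono mult_left_mono) auto
    qed
    finally show ?thesis using \<Lambda>00 by (auto intro: mult_left_mono)
  qed
  have 2: "(\<integral>\<omega>. \<phi> (X (?t m) \<omega>) \<partial>MX) \<le> (\<integral>\<omega>. \<phi> (X.delayed \<tau> \<delta> m \<omega>) \<partial>MX)
      + \<Lambda>0 * (exp (c * S) * (c * (\<delta> * X.drift_mean 0 S + S * ?q)) + sqrt (\<delta> * (LINT r:{0..S}|lborel. X.energy r)))"
  proof -
    note de = X.delayed_end[OF \<tau>(1) \<delta>(1) mS(1)]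
    note pm = X.path_meas[OF \<tau>(1) \<delta>(1) mS(1) order_refl]
    have "(\<integral>\<omega>. \<phi> (X (?t m) \<omega>) \<partial>MX) \<le> (\<integral>\<omega>. \<phi> (X.delayed \<tau> \<delta> m \<omega>) \<partial>MX) + \<Lambda>0 * (\<integral>\<omega>. dist (X (?t m) \<omega>) (X.delayed \<tau> \<delta> m \<omega>) \<partial>MX)"
      by (rule X.lipschitz_expectation(1)[OF pm(1) pm(3) \<phi> de(1)])
    also have "\<Lambda>0 * (\<integral>\<omega>. dist (X (?t m) \<omega>) (X.delayed \<tau> \<delta> m \<omega>) \<partial>MX) \<le> \<Lambda>0 * (exp (c * S) * (c * (\<delta> * X.drift_mean 0 S + S * ?q)) + sqrt (\<delta> * (LINT r:{0..S}|lborel. X.energy r)))"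
      by (rule mult_left_mono[OF de(2) \<Lambda>00])
    finally show ?thesis by simp
  qed
  have 3: "(\<integral>\<omega>. \<phi> (X.delayed \<tau> \<delta> m \<omega>) \<partial>MX) \<le> 2 * \<alpha> * (\<integral>\<omega>. l 0 (X \<tau> \<omega>) \<partial>MX)
     + (\<Sum>k\<in>{1..<m}. (\<Prod>j\<in>{k..<m}. 1 - \<delta> * g j) * (LINT r:{?t (k - 1)..?t k}|lborel. X.energy r)) / 2"
    using X.delayed_sum[OF \<tau>(1) \<delta>(1) mS(1) lS lm lK th] unfolding l \<alpha>_def by simp
  have h2: "(2 * \<Lambda>)-lipschitz_on UNIV (\<lambda>x. 2 * l 0 x)" "\<bar>2 * l 0 x\<bar> \<le> 2 * K" for x
  proof -
    show "(2 * \<Lambda>)-lipschitz_on UNIV (\<lambda>x. 2 * l 0 x)"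
    proof (rule lipschitz_onI)
      show "dist (2 * l 0 x) (2 * l 0 y) \<le> 2 * \<Lambda> * dist x y" for x y
      proof -
        have "\<bar>l 0 x - l 0 y\<bar> \<le> \<Lambda> * dist x y"
          using lipschitz_onD[OF lL[of 0], of x y] by (simp add: dist_real_def)
        then show ?thesis unfolding dist_real_def[of "2 * l 0 x"] by linarith
      qed
    qed (use \<Lambda>n in simp)
    show "\<bar>2 * l 0 x\<bar> \<le> 2 * K" using lK[of 0 x] by simp
  qed
  have tau: "\<tau> \<in> {0..S}" "0 \<in> {0..S}" using \<tau> \<tau>S S0 by auto
  have sqt: "sqrt (2 * real DIM('a) * (\<tau> - 0)) \<le> ?q" using \<tau> by (intro real_sqrt_le_mono mult_left_mono) auto
  \<comment> \<open>Jensen's inequality turns twice the mean into the logarithm of an exponential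
    mean, the form in which the chain continues along \<open>Y\<close>.\<close>
  have 4: "2 * (\<integral>\<omega>. l 0 (X \<tau> \<omega>) \<partial>MX) \<le> ln (\<integral>\<omega>. exp (2 * l 0 (X 0 \<omega>)) \<partial>MX) + 2 * \<Lambda> * (X.drift_mean 0 \<delta> + ?q)"
  proof -
    note dm = X.dist_mean[OF order_refl \<tau>(1) \<tau>S]
    have "(\<integral>\<omega>. 2 * l 0 (X \<tau> \<omega>) \<partial>MX) \<le> (\<integral>\<omega>. 2 * l 0 (X 0 \<omega>) \<partial>MX) + 2 * \<Lambda> * (\<integral>\<omega>. dist (X \<tau> \<omega>) (X 0 \<omega>) \<partial>MX)"
      by (rule X.lipschitz_expectation(1)[OF X.X_meas_M[OF tau(1)] X.X_meas_M[OF tau(2)] h2 dm(1)])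
    also have "(\<integral>\<omega>. 2 * l 0 (X 0 \<omega>) \<partial>MX) \<le> ln (\<integral>\<omega>. exp (2 * l 0 (X 0 \<omega>)) \<partial>MX)"
      by (rule X.lipschitz_expectation(3)[OF X.X_meas_M[OF tau(2)] X.X_meas_M[OF tau(2)] h2]) simp
    also have "2 * \<Lambda> * (\<integral>\<omega>. dist (X \<tau> \<omega>) (X 0 \<omega>) \<partial>MX) \<le> 2 * \<Lambda> * (X.drift_mean 0 \<delta> + ?q)"
    proof (rule mult_left_mono[OF order_trans[OF dm(2) add_mono[OF _ sqt]]])
      show "X.drift_mean 0 \<tau> \<le> X.drift_mean 0 \<delta>" by (rule X.drift_mean_mono) (use \<tau> in auto)
    qed (use \<Lambda>n in simp)
    finally show ?thesis by simp
  qed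
  have 5: "(\<integral>\<omega>. exp (2 * l 0 (X 0 \<omega>)) \<partial>MX) = (\<integral>\<omega>. exp (2 * l 0 (Y 0 \<omega>)) \<partial>MY)"
  proof -
    have [measurable]: "l 0 \<in> borel_measurable borel" "X 0 \<in> borel_measurable MX" "Y 0 \<in> borel_measurable MY"
      using lm[of 0] X.X_meas_M[OF tau(2)] Y.X_meas_M[OF tau(2)] by auto
    have "(\<integral>\<omega>. exp (2 * l 0 (X 0 \<omega>)) \<partial>MX) = (\<integral>x. exp (2 * l 0 x) \<partial>distr MX borel (X 0))" by (subst integral_distr) auto
    also have "\<dots> = (\<integral>\<omega>. exp (2 * l 0 (Y 0 \<omega>)) \<partial>MY)" unfolding init by (subst integral_distr) auto
    finally show ?thesis .
  qed
  have 6: "ln (\<integral>\<omega>. exp (2 * l 0 (Y 0 \<omega>)) \<partial>MY) \<le> ln (\<integral>\<omega>. exp (2 * l 0 (Y \<tau> \<omega>)) \<partial>MY) + exp (4 * K) * (2 * \<Lambda>) * (Y.drift_mean 0 \<delta> + ?q)"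
  proof -
    note dm = Y.dist_mean[OF order_refl \<tau>(1) \<tau>S]
    have dm1: "integrable MY (\<lambda>\<omega>. dist (Y 0 \<omega>) (Y \<tau> \<omega>))" using dm(1) by (simp add: dist_commute)
    have "ln (\<integral>\<omega>. exp (2 * l 0 (Y 0 \<omega>)) \<partial>MY) \<le> ln (\<integral>\<omega>. exp (2 * l 0 (Y \<tau> \<omega>)) \<partial>MY) + exp (2 * (2 * K)) * (2 * \<Lambda>) * (\<integral>\<omega>. dist (Y 0 \<omega>) (Y \<tau> \<omega>) \<partial>MY)"
      by (rule Y.lipschitz_expectation(2)[OF Y.X_meas_M[OF tau(2)] Y.X_meas_M[OF tau(1)] h2 dm1])
    also have "exp (2 * (2 * K)) * (2 * \<Lambda>) * (\<integral>\<omega>. dist (Y 0 \<omega>) (Y \<tau> \<omega>) \<partial>MY) \<le> exp (4 * K) * (2 * \<Lambda>) * (Y.drift_mean 0 \<delta> + ?q)"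
    proof -
      have "(\<integral>\<omega>. dist (Y 0 \<omega>) (Y \<tau> \<omega>) \<partial>MY) \<le> Y.drift_mean 0 \<delta> + ?q"
      proof (subst dist_commute, rule order_trans[OF dm(2) add_mono[OF _ sqt]])
        show "Y.drift_mean 0 \<tau> \<le> Y.drift_mean 0 \<delta>" by (rule Y.drift_mean_mono) (use \<tau> in auto)
      qed
      then show ?thesis using \<Lambda>n by (auto intro!: mult_left_mono)
    qed
    finally show ?thesis by simp
  qed
  have 7: "\<alpha> * ln (\<integral>\<omega>. exp (2 * l 0 (Y \<tau> \<omega>)) \<partial>MY) \<le> ln (\<integral>\<omega>. exp (\<phi> (Y (?t m) \<omega>)) \<partial>MY)
     + hyper_const K \<Lambda> * ((c + G) * (\<delta> * Y.drift_mean 0 S + S * ?q) + S * \<delta> * G\<^sup>2)"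
    using Y.hyper_sum[OF \<tau>(1) \<delta>(1) mS(1) refl lS lK lL g(1,2) small g(4) g(3)] unfolding l \<alpha>_def by simp
  have 8: "ln (\<integral>\<omega>. exp (\<phi> (Y (?t m) \<omega>)) \<partial>MY) \<le> ln (\<integral>\<omega>. exp (\<phi> (Y S \<omega>)) \<partial>MY) + exp (2 * K0) * \<Lambda>0 * (Y.drift_mean (S - \<delta>) S + ?q)"
  proof -
    note dm = Y.dist_mean[OF tmS mS(1) order_refl]
    have dm1: "integrable MY (\<lambda>\<omega>. dist (Y (?t m) \<omega>) (Y S \<omega>))" using dm(1) by (simp add: dist_commute)
    have "ln (\<integral>\<omega>. exp (\<phi> (Y (?t m) \<omega>)) \<partial>MY) \<le> ln (\<integral>\<omega>. exp (\<phi> (Y S \<omega>)) \<partial>MY) + exp (2 * K0) * \<Lambda>0 * (\<integral>\<omega>. dist (Y (?t m) \<omega>) (Y S \<omega>) \<partial>MY)"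
      by (rule Y.lipschitz_expectation(2)[OF Y.X_meas_M Y.X_meas_M \<phi> dm1]) (use tmS mS S0 in auto)
    also have "exp (2 * K0) * \<Lambda>0 * (\<integral>\<omega>. dist (Y (?t m) \<omega>) (Y S \<omega>) \<partial>MY) \<le> exp (2 * K0) * \<Lambda>0 * (Y.drift_mean (S - \<delta>) S + ?q)"
    proof (rule mult_left_mono)
      show "(\<integral>\<omega>. dist (Y (?t m) \<omega>) (Y S \<omega>) \<partial>MY) \<le> Y.drift_mean (S - \<delta>) S + ?q"
      proof (subst dist_commute, rule order_trans[OF dm(2) add_mono])
        show "Y.drift_mean (?t m) S \<le> Y.drift_mean (S - \<delta>) S" by (rule Y.drift_mean_mono) (use mS in auto)
        show "sqrt (2 * real DIM('a) * (S - ?t m)) \<le> ?q" using mS by (intro real_sqrt_le_mono mult_left_mono) auto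
      qed
    qed (use \<Lambda>00 in simp)
    finally show ?thesis by simp
  qed
  \<comment> \<open>These two errors arise before the multiplication by \<alpha> and survive it
    because \<alpha> \<le> 1.\<close>
  define E1 where "E1 = 2 * \<Lambda> * (X.drift_mean 0 \<delta> + ?q)"
  define E2 where "E2 = exp (4 * K) * (2 * \<Lambda>) * (Y.drift_mean 0 \<delta> + ?q)"
  have E: "0 \<le> E1" "0 \<le> E2" unfolding E1_def E2_def using \<Lambda>n X.drift_mean_nonneg Y.drift_mean_nonneg \<delta> by auto
  have "2 * (\<integral>\<omega>. l 0 (X \<tau> \<omega>) \<partial>MX) \<le> ln (\<integral>\<omega>. exp (2 * l 0 (Y \<tau> \<omega>)) \<partial>MY) + (E1 + E2)"
    using 4[unfolded 5] 6 unfolding E1_def E2_def by linarith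
  then have "\<alpha> * (2 * (\<integral>\<omega>. l 0 (X \<tau> \<omega>) \<partial>MX)) \<le> \<alpha> * (ln (\<integral>\<omega>. exp (2 * l 0 (Y \<tau> \<omega>)) \<partial>MY) + (E1 + E2))"
    by (rule mult_left_mono[OF _ \<alpha>(1)])
  also have "\<dots> = \<alpha> * ln (\<integral>\<omega>. exp (2 * l 0 (Y \<tau> \<omega>)) \<partial>MY) + \<alpha> * (E1 + E2)" by (simp only: distrib_left)
  also have "\<alpha> * (E1 + E2) \<le> 1 * (E1 + E2)" using \<alpha> E by (intro mult_right_mono) auto
  finally have 9: "2 * \<alpha> * (\<integral>\<omega>. l 0 (X \<tau> \<omega>) \<partial>MX) \<le> \<alpha> * ln (\<integral>\<omega>. exp (2 * l 0 (Y \<tau> \<omega>)) \<partial>MY) + (E1 + E2)"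
    by (simp add: mult_ac)
  show ?thesis
    using 1 2 3 7 8 9 unfolding step_error_def E1_def E2_def by linarith
qed

text \<open>Each contribution contains a factor \<delta> or sqrt \<delta>, or an integral over an
  interval shrinking to an endpoint; the remaining constants do not depend on \<delta>.\<close>

lemma step_error_tendsto:
  fixes a :: "nat \<Rightarrow> real"
  assumes lim: "a \<longlonglongrightarrow> 0"
  shows "(\<lambda>n. step_error K0 \<Lambda>0 K \<Lambda> G (a n)) \<longlonglongrightarrow> 0"
proof -
  \<comment> \<open>The intervals eventually leave every point other than p, so the indicators
    vanish in the limit almost everywhere.\<close>
  have small: "(\<lambda>n. LINT r:{A n..A' n}|lborel. f r) \<longlonglongrightarrow> 0"
    if f: "integrable lborel f" and a: "\<And>r. r \<noteq> p \<Longrightarrow> \<forall>\<^sub>F n in sequentially. r \<notin> {A n..A' n}" for f :: "real \<Rightarrow> real" and A A' p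
  proof -
    have [measurable]: "f \<in> borel_measurable lborel" by (rule borel_measurable_integrable[OF f])
    have "(\<lambda>n. \<integral>r. indicator {A n..A' n} r *\<^sub>R f r \<partial>lborel) \<longlonglongrightarrow> (\<integral>r. 0 \<partial>(lborel :: real measure))"
    proof (rule integral_dominated_convergence)
      show "integrable lborel (\<lambda>r. norm (f r))" using f by (rule integrable_norm)
      show "AE r in lborel. (\<lambda>n. indicator {A n..A' n} r *\<^sub>R f r) \<longlonglongrightarrow> 0"
        using AE_lborel_singleton[of p]
      proof eventually_elim
        case (elim r)
        show ?case by (rule tendsto_eventually) (use a[OF elim] in \<open>auto elim!: eventually_mono simp: indicator_def\<close>)
      qed
      show "AE r in lborel. norm (indicator {A n..A' n} r *\<^sub>R f r) \<le> norm (f r)" for n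
        by (intro AE_I2) (simp add: indicator_def)
    qed measurable
    then show ?thesis by (simp add: set_lebesgue_integral_def)
  qed
  have p: "\<forall>\<^sub>F n in sequentially. r \<notin> {0..a n}" if "r \<noteq> 0" for r
  proof (cases "r > 0")
    case True
    from order_tendstoD(2)[OF lim this] show ?thesis by (rule eventually_mono) auto
  qed (use that in simp)
  have p': "\<forall>\<^sub>F n in sequentially. r \<notin> {S - a n..S}" if "r \<noteq> S" for r
  proof (cases "r < S")
    case True
    then have "0 < S - r" by simp
    from order_tendstoD(2)[OF lim this] show ?thesis by (rule eventually_mono) auto
  qed (use that in simp)
  have q: "(\<lambda>n. sqrt (2 * real DIM('a) * a n)) \<longlonglongrightarrow> 0"
    using tendsto_real_sqrt[OF tendsto_mult_right_zero[OF lim, of "2 * real DIM('a)"]] by simp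
  have e: "(\<lambda>n. sqrt (a n * (LINT r:{0..S}|lborel. X.energy r))) \<longlonglongrightarrow> 0"
    using tendsto_real_sqrt[OF tendsto_mult_left_zero[OF lim, of "LINT r:{0..S}|lborel. X.energy r"]] by simp
  have I: "(\<lambda>n. X.drift_mean 0 (a n)) \<longlonglongrightarrow> 0" "(\<lambda>n. X.drift_mean (S - a n) S) \<longlonglongrightarrow> 0"
    "(\<lambda>n. Y.drift_mean 0 (a n)) \<longlonglongrightarrow> 0" "(\<lambda>n. Y.drift_mean (S - a n) S) \<longlonglongrightarrow> 0"
    unfolding X.drift_mean_def Y.drift_mean_def
    by (rule small[OF X.mean_d_int p], assumption) (rule small[OF X.mean_d_int p'], assumption,
        rule small[OF Y.mean_d_int p], assumption, rule small[OF Y.mean_d_int p'], assumption)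
  show ?thesis
    unfolding step_error_def
    by (rule tendsto_eq_rhs, (rule q e I lim tendsto_const tendsto_add tendsto_mult)+) simp
qed

text \<open>Here the products of the factors 1 - \<delta> g become the exponential of minus an
  integral. K, \<Lambda> and G stay fixed while the mesh tends to zero, so \<open>step_error\<close>
  disappears.\<close>

lemma dual_bound:
  assumes \<phi>: "\<Lambda>0-lipschitz_on UNIV \<phi>" "\<And>x. \<bar>\<phi> x\<bar> \<le> K0"
    and g: "g \<in> borel_measurable borel" "\<And>r. 0 \<le> g r" "\<And>r. g r \<le> G"
      "\<And>t. t \<in> {0..S} \<Longrightarrow> ennreal (g t) \<le> inverse (C_LS (distr MY borel (Y t)))"
  shows "(\<integral>\<omega>. \<phi> (X S \<omega>) \<partial>MX) - ln (\<integral>\<omega>. exp (\<phi> (Y S \<omega>)) \<partial>MY)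
    \<le> (LINT r:{0..S}|lborel. X.energy r * exp (- (LINT q:{r..S}|lborel. g q))) / 2" (is "?D \<le> ?I / 2")
proof -
  have S0: "0 < S" by (rule X.S)
  have G0: "0 \<le> G" using g(2)[of 0] g(3)[of 0] by linarith
  have gb: "\<bar>g r\<bar> \<le> G" for r using g(2,3)[of r] by simp
  have gi: "set_integrable lborel {a..b} g" for a b by (rule set_integrable_bounded_Icc[OF g(1) gb])
  define J where "J r = (LINT q:{r..S}|lborel. g q)" for r
  define f where "f r = X.energy r * exp (- J r)" for r
  have J0: "0 \<le> J r" for r unfolding J_def by (rule set_integral_Icc_nonneg) (rule g(2))
  have J_mono: "J r' \<le> J r" if "r \<le> r'" for r r'
    unfolding J_def set_lebesgue_integral_def
  proof (rule integral_mono)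
    show "integrable lborel (\<lambda>q. indicator {r'..S} q *\<^sub>R g q)" "integrable lborel (\<lambda>q. indicator {r..S} q *\<^sub>R g q)"
      using gi unfolding set_integrable_def by auto
    show "indicator {r'..S} q *\<^sub>R g q \<le> indicator {r..S} q *\<^sub>R g q" for q
      using that g(2)[of q] by (auto simp: indicator_def)
  qed
  \<comment> \<open>r enters only as the left end of the interval, so J is decreasing and hence
    measurable.\<close>
  have Jm [measurable]: "J \<in> borel_measurable borel"
  proof -
    have "mono (\<lambda>r. - J r)" using J_mono by (auto simp: mono_def)
    then have "(\<lambda>r. - (- J r)) \<in> borel_measurable borel" by (intro borel_measurable_uminus borel_measurable_mono)
    then show ?thesis by simp
  qed
  have f0: "0 \<le> f r" for r by (simp add: f_def X.energy_nonneg)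
  have fi: "integrable lborel f"
  proof (rule Bochner_Integration.integrable_bound[OF X.energy_int])
    have [measurable]: "X.energy \<in> borel_measurable lborel" by (rule borel_measurable_integrable[OF X.energy_int])
    show "f \<in> borel_measurable lborel" unfolding f_def by measurable
    show "AE r in lborel. norm (f r) \<le> norm (X.energy r)"
      using J0 X.energy_nonneg by (intro AE_I2) (simp add: f_def abs_mult mult_left_le)
  qed
  define K where "K = K0 / 2 * exp (2 * G * S)"
  define \<Lambda> where "\<Lambda> = \<Lambda>0 / 2 * exp ((2 * G + c) * S)"
  define a where "a n = S / real (Suc n)" for n
  have lim: "a \<longlonglongrightarrow> 0"
    using tendsto_mult_right_zero[OF LIMSEQ_inverse_real_of_nat, of S] by (simp add: a_def[abs_def] divide_inverse)
  have bound: "\<forall>\<^sub>F n in sequentially. ?D \<le> exp (\<eta> + G * a n) * (?I / 2) + step_error K0 \<Lambda>0 K \<Lambda> G (a n)" if \<eta>: "0 < \<eta>" for \<eta>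
  proof -
    have s1: "\<forall>\<^sub>F n in sequentially. a n * G < 1 / 2"
      by (rule order_tendstoD(2)[OF tendsto_mult_left_zero[OF lim]]) simp
    have s2: "\<forall>\<^sub>F n in sequentially. 4 * K * (a n * G) < 1"
      by (rule order_tendstoD(2)[OF tendsto_mult_right_zero[OF tendsto_mult_left_zero[OF lim]]]) simp
    show ?thesis
      using riemann_sum_shift[OF S0 g(1-3) \<eta>, folded a_def] s1 s2
    proof eventually_elim
      case (elim n)
      define \<delta> where "\<delta> = a n"
      have \<delta>: "0 < \<delta>" "\<delta> \<le> S" "real (Suc n) * \<delta> = S"
        using S0 by (auto simp: \<delta>_def a_def divide_le_eq)
      obtain \<tau> where \<tau>: "\<tau> \<in> {0..\<delta>}"
        and rs: "\<And>k. k \<le> n \<Longrightarrow> J (grid \<tau> \<delta> k) \<le> \<delta> * (\<Sum>j\<in>{k..<n}. g (grid \<tau> \<delta> j)) + \<eta>"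
        using elim(1) unfolding J_def \<delta>_def by blast
      have tn: "grid \<tau> \<delta> n \<le> S" "S - grid \<tau> \<delta> n \<le> \<delta>"
        using \<tau> \<delta>(3) by (auto simp: grid_def algebra_simps)
      have \<tau>': "0 \<le> \<tau>" "\<tau> \<le> \<delta>" using \<tau> by auto
      note tb = X.tm_bounds[OF \<tau>'(1) \<delta>(1) tn(1)]
      let ?P = "\<lambda>k. \<Prod>j\<in>{k..<n}. 1 - \<delta> * g (grid \<tau> \<delta> j)"
      have "?D \<le> (\<Sum>k\<in>{1..<n}. ?P k * (LINT r:{grid \<tau> \<delta> (k - 1)..grid \<tau> \<delta> k}|lborel. X.energy r)) / 2
          + step_error K0 \<Lambda>0 K \<Lambda> G \<delta>"
        by (rule grid_bound[OF \<tau>' \<delta>(1,2) tn \<phi> g(2) g(3) G0 g(4)[OF tb(6)] K_def \<Lambda>_def])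
           (use elim(2,3) in \<open>auto simp: \<delta>_def\<close>)
      also have "(\<Sum>k\<in>{1..<n}. ?P k * (LINT r:{grid \<tau> \<delta> (k - 1)..grid \<tau> \<delta> k}|lborel. X.energy r))
          \<le> (\<Sum>k\<in>{1..<n}. exp (\<eta> + G * \<delta>) * (LINT r:{grid \<tau> \<delta> (k - 1)..grid \<tau> \<delta> k}|lborel. f r))"
      proof (rule sum_mono)
        fix k assume k: "k \<in> {1..<n}"
        then have tk: "grid \<tau> \<delta> k = grid \<tau> \<delta> (k - 1) + \<delta>" by (cases k) (auto simp: grid_simps)
        have P1: "?P k \<le> exp (- (\<delta> * (\<Sum>j\<in>{k..<n}. g (grid \<tau> \<delta> j))))"
        proof -
          have "?P k \<le> (\<Prod>j\<in>{k..<n}. exp (- (\<delta> * g (grid \<tau> \<delta> j))))"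
          proof (rule prod_mono)
            fix j
            have "\<delta> * g (grid \<tau> \<delta> j) \<le> \<delta> * G" using \<delta>(1) g(3) by (intro mult_left_mono) auto
            then show "0 \<le> 1 - \<delta> * g (grid \<tau> \<delta> j) \<and> 1 - \<delta> * g (grid \<tau> \<delta> j) \<le> exp (- (\<delta> * g (grid \<tau> \<delta> j)))"
              using elim(2) exp_ge_add_one_self[of "- (\<delta> * g (grid \<tau> \<delta> j))"] by (auto simp: \<delta>_def)
          qed
          also have "\<dots> = exp (- (\<delta> * (\<Sum>j\<in>{k..<n}. g (grid \<tau> \<delta> j))))"
            by (simp add: exp_sum[symmetric] sum_distrib_left sum_negf)
          finally show ?thesis .
        qed
        \<comment> \<open>r lies at most \<delta> before the right end of its cell, so
          \<open>J r\<close> exceeds J there by at most G \<delta>; \<eta> is the defect of the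
          Riemann sum.\<close>
        have key: "?P k \<le> exp (\<eta> + G * \<delta>) * exp (- J r)" if r: "r \<in> {grid \<tau> \<delta> (k - 1)..grid \<tau> \<delta> k}" for r
        proof -
          have cut: "integrable lborel (\<lambda>q. indicator {r..S} q * g q)"
            by (rule bounded_Icc_cutoff(1)[OF g(1) gb order_refl])
          have tkS: "grid \<tau> \<delta> k \<le> S" using tb(2)[of k] k by simp
          have "J r = (LINT q:{r..grid \<tau> \<delta> k}|lborel. g q) + J (grid \<tau> \<delta> k)"
          proof -
            have "(LINT q:{r..S}|lborel. indicator {r..S} q * g q)
              = (LINT q:{r..grid \<tau> \<delta> k}|lborel. indicator {r..S} q * g q) + (LINT q:{grid \<tau> \<delta> k..S}|lborel. indicator {r..S} q * g q)"
              by (rule set_integral_Icc_split[OF cut]) (use r tkS in auto)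
            then show ?thesis unfolding J_def
              using r tkS by (subst (asm) (1 2 3) bounded_Icc_cutoff(2)[OF g(1) gb]) auto
          qed
          also have "(LINT q:{r..grid \<tau> \<delta> k}|lborel. g q) \<le> (LINT q:{r..grid \<tau> \<delta> k}|lborel. G)"
            by (rule set_integral_mono[OF gi set_integrable_bounded_Icc[of _ G]]) (use g(3) G0 in auto)
          also have "\<dots> = (grid \<tau> \<delta> k - r) * G"
            using integral_indicator_Icc[of r "grid \<tau> \<delta> k" G] r by (simp add: set_lebesgue_integral_def)
          also have "\<dots> \<le> \<delta> * G" using r tk G0 by (intro mult_right_mono) auto
          finally have "J r \<le> \<delta> * G + (\<delta> * (\<Sum>j\<in>{k..<n}. g (grid \<tau> \<delta> j)) + \<eta>)"
            using rs[of k] k by simp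
          then have "exp (- (\<delta> * (\<Sum>j\<in>{k..<n}. g (grid \<tau> \<delta> j)))) \<le> exp (\<eta> + G * \<delta> + - J r)"
            by (simp add: mult.commute)
          then show ?thesis using P1 unfolding exp_add by linarith
        qed
        have "?P k * (LINT r:{grid \<tau> \<delta> (k - 1)..grid \<tau> \<delta> k}|lborel. X.energy r)
           = (LINT r:{grid \<tau> \<delta> (k - 1)..grid \<tau> \<delta> k}|lborel. ?P k * X.energy r)" by simp
        also have "\<dots> \<le> (LINT r:{grid \<tau> \<delta> (k - 1)..grid \<tau> \<delta> k}|lborel. exp (\<eta> + G * \<delta>) * f r)"
        proof (rule set_integral_mono)
          show "set_integrable lborel {grid \<tau> \<delta> (k - 1)..grid \<tau> \<delta> k} (\<lambda>r. ?P k * X.energy r)"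
            by (intro set_integrable_mult_right set_integrable_Icc X.energy_int)
          show "set_integrable lborel {grid \<tau> \<delta> (k - 1)..grid \<tau> \<delta> k} (\<lambda>r. exp (\<eta> + G * \<delta>) * f r)"
            by (intro set_integrable_mult_right set_integrable_Icc fi)
          fix r assume "r \<in> {grid \<tau> \<delta> (k - 1)..grid \<tau> \<delta> k}"
          from mult_right_mono[OF key[OF this] X.energy_nonneg[of r]]
          show "?P k * X.energy r \<le> exp (\<eta> + G * \<delta>) * f r" by (simp add: f_def mult_ac)
        qed
        also have "\<dots> = exp (\<eta> + G * \<delta>) * (LINT r:{grid \<tau> \<delta> (k - 1)..grid \<tau> \<delta> k}|lborel. f r)" by simp
        finally show "?P k * (LINT r:{grid \<tau> \<delta> (k - 1)..grid \<tau> \<delta> k}|lborel. X.energy r)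
          \<le> exp (\<eta> + G * \<delta>) * (LINT r:{grid \<tau> \<delta> (k - 1)..grid \<tau> \<delta> k}|lborel. f r)" .
      qed
      also have "(\<Sum>k\<in>{1..<n}. exp (\<eta> + G * \<delta>) * (LINT r:{grid \<tau> \<delta> (k - 1)..grid \<tau> \<delta> k}|lborel. f r)) \<le> exp (\<eta> + G * \<delta>) * ?I"
        unfolding sum_distrib_left[symmetric]
      proof (rule mult_left_mono)
        have "(\<Sum>k\<in>{1..<n}. LINT r:{grid \<tau> \<delta> (k - 1)..grid \<tau> \<delta> k}|lborel. f r) = (\<Sum>k<n - 1. LINT r:{grid \<tau> \<delta> k..grid \<tau> \<delta> (Suc k)}|lborel. f r)"
          by (rule sum.reindex_bij_witness[of _ Suc "\<lambda>k. k - 1"]) auto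
        also have "\<dots> = (LINT r:{\<tau>..grid \<tau> \<delta> (n - 1)}|lborel. f r)" by (rule set_integral_grid[OF fi]) (use \<delta> in simp)
        also have "\<dots> \<le> (LINT r:{0..S}|lborel. f r)"
          using \<tau> tb(2)[of "n - 1"] by (intro set_integral_Icc_mono[OF fi f0]) auto
        finally show "(\<Sum>k\<in>{1..<n}. LINT r:{grid \<tau> \<delta> (k - 1)..grid \<tau> \<delta> k}|lborel. f r) \<le> ?I"
          unfolding f_def J_def .
      qed simp
      finally show ?case unfolding \<delta>_def by simp
    qed
  qed
  \<comment> \<open>The mesh is refined for fixed \<eta> first, because the choice of the shifts
    depends on \<eta>; only then \<eta> tends to zero.\<close>
  have eta: "?D \<le> exp \<eta> * (?I / 2)" if \<eta>: "0 < \<eta>" for \<eta>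
  proof (rule tendsto_lowerbound[OF _ bound[OF \<eta>]])
    have "(\<lambda>n. exp (\<eta> + G * a n) * (?I / 2) + step_error K0 \<Lambda>0 K \<Lambda> G (a n)) \<longlonglongrightarrow> exp (\<eta> + G * 0) * (?I / 2) + 0"
      by (intro tendsto_intros lim step_error_tendsto[OF lim])
    then show "(\<lambda>n. exp (\<eta> + G * a n) * (?I / 2) + step_error K0 \<Lambda>0 K \<Lambda> G (a n)) \<longlonglongrightarrow> exp \<eta> * (?I / 2)" by simp
  qed simp
  show ?thesis
  proof (rule tendsto_lowerbound)
    show "(\<lambda>n. exp (inverse (real (Suc n))) * (?I / 2)) \<longlonglongrightarrow> ?I / 2"
      by (rule tendsto_eq_rhs, (rule tendsto_intros LIMSEQ_inverse_real_of_nat)+) simp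
    show "\<forall>\<^sub>F n in sequentially. ?D \<le> exp (inverse (real (Suc n))) * (?I / 2)"
      by (intro always_eventually allI eta) simp
  qed simp
qed

end

section \<open>Dual formula for the relative entropy\<close>

text \<open>One function has to serve two measures. Inner and outer regularity give compact and open
  sets for each; the union of the compact and the intersection of the open ones work for both, and
  the distance to the compact set interpolates.\<close>

lemma lipschitz_indicator_approx:
  fixes \<mu> \<theta> :: "'a::euclidean_space measure"
  assumes \<mu>: "prob_space \<mu>" "sets \<mu> = sets borel" and \<theta>: "prob_space \<theta>" "sets \<theta> = sets borel"
    and A: "A \<in> sets borel" and \<epsilon>: "0 < \<epsilon>"
  obtains f C where "C-lipschitz_on UNIV f" "\<And>x. 0 \<le> f x" "\<And>x. f x \<le> (1::real)"
    "(\<integral>x. \<bar>f x - indicator A x\<bar> \<partial>\<mu>) \<le> \<epsilon>" "(\<integral>x. \<bar>f x - indicator A x\<bar> \<partial>\<theta>) \<le> \<epsilon>"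
proof -
  interpret M: prob_space \<mu> by fact
  interpret T: prob_space \<theta> by fact
  define e where "e = \<epsilon> / 2"
  have e: "0 < e" using \<epsilon> by (simp add: e_def)
  have comp: "\<exists>K. compact K \<and> K \<subseteq> A \<and> measure N (A - K) < e" if N: "prob_space N" "sets N = sets borel" for N :: "'a measure"
  proof -
    interpret N: prob_space N by fact
    have s: "emeasure N A = (SUP K\<in>{K. K \<subseteq> A \<and> compact K}. emeasure N K)"
      by (rule inner_regular) (use N A in \<open>auto simp: N.emeasure_eq_measure\<close>)
    have "\<exists>K\<in>{K. K \<subseteq> A \<and> compact K}. emeasure N A < emeasure N K + ennreal e"
    proof (rule SUP_approx_ennreal[OF e _ s])
      show "emeasure N A \<noteq> \<infinity>" by (simp add: N.emeasure_eq_measure)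
      have "{} \<in> {K. K \<subseteq> A \<and> compact K}" by simp
      then show "{K. K \<subseteq> A \<and> compact K} \<noteq> {}" by (metis empty_iff)
    qed
    then obtain K where K: "K \<subseteq> A" "compact K" "emeasure N A < emeasure N K + ennreal e" by auto
    have Kb: "K \<in> sets N" using K(2) N(2) by (simp add: borel_compact)
    have "measure N A < measure N K + e"
      using K(3) e by (simp add: N.emeasure_eq_measure ennreal_plus[symmetric] ennreal_less_iff del: ennreal_plus)
    then have "measure N (A - K) < e" using K(1) Kb A N(2) by (subst N.finite_measure_Diff) auto
    then show ?thesis using K by blast
  qed
  have opn: "\<exists>U. open U \<and> A \<subseteq> U \<and> measure N (U - A) < e" if N: "prob_space N" "sets N = sets borel" for N :: "'a measure"
  proof -
    interpret N: prob_space N by fact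
    have s: "emeasure N A = (INF U\<in>{U. A \<subseteq> U \<and> open U}. emeasure N U)"
      by (rule outer_regular) (use N A in \<open>auto simp: N.emeasure_eq_measure\<close>)
    have "\<exists>U\<in>{U. A \<subseteq> U \<and> open U}. emeasure N U < emeasure N A + ennreal e"
    proof (rule INF_approx_ennreal[OF e s])
      show "emeasure N A \<noteq> \<infinity>" by (simp add: N.emeasure_eq_measure)
    qed
    then obtain U where U: "A \<subseteq> U" "open U" "emeasure N U < emeasure N A + ennreal e" by auto
    have "measure N U < measure N A + e"
      using U(3) e by (simp add: N.emeasure_eq_measure ennreal_plus[symmetric] ennreal_less_iff del: ennreal_plus)
    then have "measure N (U - A) < e" using U A N(2) by (subst N.finite_measure_Diff) auto
    then show ?thesis using U by blast
  qed
  obtain K1 K2 U1 U2 where K: "compact K1" "K1 \<subseteq> A" "measure \<mu> (A - K1) < e" "compact K2" "K2 \<subseteq> A" "measure \<theta> (A - K2) < e"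
    and U: "open U1" "A \<subseteq> U1" "measure \<mu> (U1 - A) < e" "open U2" "A \<subseteq> U2" "measure \<theta> (U2 - A) < e"
    using comp[OF \<mu>] comp[OF \<theta>] opn[OF \<mu>] opn[OF \<theta>] by metis
  define K0 where "K0 = K1 \<union> K2"
  define U0 where "U0 = U1 \<inter> U2"
  have K0: "compact K0" "K0 \<subseteq> A" and U0: "open U0" "A \<subseteq> U0" using K U by (auto simp: K0_def U0_def)
  have diff: "measure N (U0 - K0) \<le> \<epsilon>" if N: "N = \<mu> \<or> N = \<theta>" for N
  proof -
    interpret N: prob_space N using N \<mu> \<theta> by auto
    have sN: "sets N = sets borel" using N \<mu> \<theta> by auto
    have [measurable]: "K1 \<in> sets N" "K2 \<in> sets N" "U1 \<in> sets N" "U2 \<in> sets N" "A \<in> sets N"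
      using K U A sN by (auto simp: borel_compact)
    have sub: "U0 - K0 \<subseteq> (Ui - A) \<union> (A - Ki)" if "Ui = U1 \<and> Ki = K1 \<or> Ui = U2 \<and> Ki = K2" for Ui Ki
      using that by (auto simp: U0_def K0_def)
    have "measure N (U0 - K0) \<le> measure N (Ui - A) + measure N (A - Ki)" if "Ui = U1 \<and> Ki = K1 \<or> Ui = U2 \<and> Ki = K2" for Ui Ki
    proof -
      have [measurable]: "Ui \<in> sets N" "Ki \<in> sets N" using that by auto
      have "measure N (U0 - K0) \<le> measure N ((Ui - A) \<union> (A - Ki))" using sub[OF that] by (intro N.finite_measure_mono) auto
      also have "\<dots> \<le> measure N (Ui - A) + measure N (A - Ki)" by (intro measure_Un_le) auto
      finally show ?thesis .
    qed
    from this[of U1 K1] this[of U2 K2] N K U show ?thesis by (auto simp: e_def)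
  qed
  show thesis
  \<comment> \<open>\<open>infdist\<close> to the empty set is 0 by convention, which would turn the
    interpolation into the constant 1; here the zero function is the right one.\<close>
  proof (cases "K0 = {}")
    case True
    show thesis
    proof (rule that[of 0 "\<lambda>_. 0"])
      have "(\<integral>x. \<bar>0 - indicator A x :: real\<bar> \<partial>N) \<le> \<epsilon>" if N: "N = \<mu> \<or> N = \<theta>" for N
      proof -
        interpret N: prob_space N using N \<mu> \<theta> by auto
        have sN: "sets N = sets borel" using N \<mu> \<theta> by auto
        have "(\<integral>x. \<bar>0 - indicator A x :: real\<bar> \<partial>N) = (\<integral>x. indicator A x \<partial>N)"
          by (rule Bochner_Integration.integral_cong) (auto simp: indicator_def)
        also have "\<dots> = measure N A" using A sN by simp
        also have "\<dots> \<le> measure N (U0 - K0)" using True U0 sN A by (intro N.finite_measure_mono) auto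
        finally show ?thesis using diff[OF N] by linarith
      qed
      then show "(\<integral>x. \<bar>0 - indicator A x\<bar> \<partial>\<mu>) \<le> \<epsilon>" "(\<integral>x. \<bar>0 - indicator A x\<bar> \<partial>\<theta>) \<le> \<epsilon>" by auto
    qed (auto intro!: lipschitz_onI)
  next
    case False
    \<comment> \<open>A positive gap between the compact set and the complement of the open one. If
      that complement is empty, \<open>setdist\<close> is 0 by convention, and any radius will
      do.\<close>
    obtain r where r: "0 < r" "\<And>x. x \<notin> U0 \<Longrightarrow> r \<le> infdist x K0"
    proof (cases "U0 = UNIV")
      case True
      then show thesis using that[of 1] by simp
    next
      case nU: False
      have d: "setdist K0 (- U0) > 0"
      proof -
        have "setdist K0 (- U0) \<noteq> 0"
          using setdist_eq_0_compact_closed[OF K0(1), of "- U0"] U0 K0 False nU by (auto simp: closed_Compl)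
        then show ?thesis using setdist_pos_le[of K0 "- U0"] by linarith
      qed
      show thesis
      proof (rule that[OF d])
        fix x assume "x \<notin> U0"
        then show "setdist K0 (- U0) \<le> infdist x K0"
          unfolding infdist_eq_setdist by (subst setdist_sym, intro setdist_subset_right) auto
      qed
    qed
    define f where "f x = max 0 (1 - infdist x K0 / r)" for x
    have fL: "(1 / r)-lipschitz_on UNIV f"
    proof (rule lipschitz_onI)
      fix x y
      have "\<bar>infdist x K0 - infdist y K0\<bar> \<le> dist x y" by (rule infdist_triangle_abs)
      then have "\<bar>infdist x K0 / r - infdist y K0 / r\<bar> \<le> dist x y / r"
        using r by (simp add: diff_divide_distrib[symmetric] divide_right_mono)
      moreover have "\<bar>max 0 (1 - a) - max 0 (1 - b)\<bar> \<le> \<bar>a - b\<bar>" for a b :: real by (auto simp: max_def)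
      ultimately show "dist (f x) (f y) \<le> 1 / r * dist x y"
        unfolding f_def dist_real_def by (simp add: order_trans)
    qed (use r in simp)
    have fb: "0 \<le> f x" "f x \<le> 1" for x using r by (auto simp: f_def infdist_nonneg)
    have fU: "f x = 0" if "x \<notin> U0" for x using r(2)[OF that] r(1) by (simp add: f_def)
    have fK: "f x = 1" if "x \<in> K0" for x using that by (simp add: f_def)
    have fA: "\<bar>f x - indicator A x\<bar> \<le> indicator (U0 - K0) x" for x
      using fb[of x] fU[of x] fK[of x] K0 U0 by (auto simp: indicator_def abs_le_iff)
    have fm: "f \<in> borel_measurable borel" using fL by (auto intro!: borel_measurable_continuous_onI dest: lipschitz_on_continuous_on)
    have "(\<integral>x. \<bar>f x - indicator A x\<bar> \<partial>N) \<le> \<epsilon>" if N: "N = \<mu> \<or> N = \<theta>" for N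
    proof -
      interpret N: prob_space N using N \<mu> \<theta> by auto
      have sN: "sets N = sets borel" using N \<mu> \<theta> by auto
      have [measurable]: "f \<in> borel_measurable N" "A \<in> sets N" "U0 - K0 \<in> sets N"
        using fm A sN U0 K0 by (auto simp: borel_compact cong: measurable_cong_sets)
      have "(\<integral>x. \<bar>f x - indicator A x\<bar> \<partial>N) \<le> (\<integral>x. indicator (U0 - K0) x \<partial>N)"
      proof (rule integral_mono)
        show "integrable N (\<lambda>x. \<bar>f x - indicator A x\<bar>)"
          by (rule N.integrable_const_bound[where B = 1])
             (use fA in \<open>auto intro!: AE_I2 intro: order_trans simp: indicator_le_1\<close>)
        show "integrable N (indicat_real (U0 - K0))"
          by (rule integrable_real_indicator) (auto simp: N.emeasure_eq_measure)
      qed (use fA in auto)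
      also have "\<dots> = measure N (U0 - K0)" by simp
      finally show ?thesis using diff[OF N] by linarith
    qed
    then show thesis using that[OF fL fb] by auto
  qed
qed

text \<open>Layer cake decomposition: up to 1/n, h is the sum of the indicators of the sets where h
  \<ge> j/n, divided by n, and each indicator is approximated separately.\<close>

lemma lipschitz_bounded_approx:
  fixes \<mu> \<theta> :: "'a::euclidean_space measure" and h :: "'a \<Rightarrow> real"
  assumes \<mu>: "prob_space \<mu>" "sets \<mu> = sets borel" and \<theta>: "prob_space \<theta>" "sets \<theta> = sets borel"
    and h: "h \<in> borel_measurable borel" "\<And>x. 0 \<le> h x" "\<And>x. h x \<le> real k" and \<epsilon>: "0 < \<epsilon>"
  obtains f C where "C-lipschitz_on UNIV f" "\<And>x. 0 \<le> f x" "\<And>x. f x \<le> real k"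
    "(\<integral>x. \<bar>f x - h x\<bar> \<partial>\<mu>) \<le> \<epsilon>" "(\<integral>x. \<bar>f x - h x\<bar> \<partial>\<theta>) \<le> \<epsilon>"
proof -
  obtain n where n: "0 < n" "1 / real n < \<epsilon> / 2"
    using \<epsilon> by (metis half_gt_zero nat_approx_posE zero_less_Suc)
  \<comment> \<open>There are n k layers, each divided by n, so their errors add up to k e \<le>
    \<epsilon> / 2; k + 1 in the denominator allows k = 0.\<close>
  define e where "e = \<epsilon> / (2 * (real k + 1))"
  have e: "0 < e" using \<epsilon> by (simp add: e_def)
  define A where "A j = {x. real j / real n \<le> h x}" for j
  have A: "A j \<in> sets borel" for j
    using h(1) unfolding A_def by measurable
  define P where "P j f C \<longleftrightarrow> C-lipschitz_on UNIV f \<and> (\<forall>x. 0 \<le> f x) \<and> (\<forall>x. f x \<le> (1::real)) \<and>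
    (\<integral>x. \<bar>f x - indicator (A j) x\<bar> \<partial>\<mu>) \<le> e \<and> (\<integral>x. \<bar>f x - indicator (A j) x\<bar> \<partial>\<theta>) \<le> e" for j f C
  have "\<exists>f C. P j f C" for j
  proof (rule lipschitz_indicator_approx[OF \<mu> \<theta> A[of j] e])
    fix f C
    assume "C-lipschitz_on UNIV f" "\<And>x. 0 \<le> f x" "\<And>x. f x \<le> (1::real)"
      "(\<integral>x. \<bar>f x - indicator (A j) x\<bar> \<partial>\<mu>) \<le> e" "(\<integral>x. \<bar>f x - indicator (A j) x\<bar> \<partial>\<theta>) \<le> e"
    then have "P j f C" unfolding P_def by (intro conjI allI)
    then show ?thesis by blast
  qed
  then obtain F C where "\<And>j. P j (F j) (C j)" by metis
  then have F: "\<And>j. (C j)-lipschitz_on UNIV (F j)" "\<And>j x. 0 \<le> F j x" "\<And>j x. F j x \<le> (1::real)"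
    "\<And>j. (\<integral>x. \<bar>F j x - indicator (A j) x\<bar> \<partial>\<mu>) \<le> e" "\<And>j. (\<integral>x. \<bar>F j x - indicator (A j) x\<bar> \<partial>\<theta>) \<le> e"
    unfolding P_def by simp_all
  let ?J = "{1..n * k}"
  define f where "f x = (\<Sum>j\<in>?J. F j x) / real n" for x
  have layer: "\<bar>(\<Sum>j\<in>?J. indicator (A j) x) / real n - h x\<bar> \<le> 1 / real n" for x
  proof -
    \<comment> \<open>The number of levels j/n with j \<ge> 1 that lie at or below
      \<open>h x\<close>.\<close>
    define q where "q = nat \<lfloor>real n * h x\<rfloor>"
    have q: "real q \<le> real n * h x" "real n * h x < real q + 1"
      using h(2)[of x] by (auto simp: q_def)
    have "real n * h x \<le> real (n * k)" using h(3)[of x] by (simp add: mult_left_mono)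
    then have qk: "q \<le> n * k" using q(1) by (metis of_nat_le_iff order_trans)
    have "(\<Sum>j\<in>?J. indicator (A j) x :: real) = (\<Sum>j\<in>?J. if j \<le> q then 1 else 0)"
    proof (rule sum.cong[OF refl])
      fix j assume "j \<in> ?J"
      have "real j / real n \<le> h x \<longleftrightarrow> real j \<le> real n * h x" using n by (simp add: divide_le_eq mult.commute)
      also have "\<dots> \<longleftrightarrow> j \<le> q"
      proof
        assume "real j \<le> real n * h x"
        then have "real j < real (q + 1)" using q(2) by simp
        then show "j \<le> q" by linarith
      next
        assume "j \<le> q" then show "real j \<le> real n * h x" using q(1) by (meson of_nat_le_iff order_trans)
      qed
      finally show "indicator (A j) x = (if j \<le> q then 1 else 0 :: real)" by (simp add: A_def indicator_def)
    qed
    also have "\<dots> = real (card {1..q})"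
    proof -
      have "{j \<in> ?J. j \<le> q} = {1..q}" using qk by auto
      then show ?thesis by (subst sum.inter_filter[symmetric]) auto
    qed
    finally have s: "(\<Sum>j\<in>?J. indicator (A j) x) = real q" by simp
    have "\<bar>real q / real n - h x\<bar> = \<bar>real q - real n * h x\<bar> / real n" using n by (simp add: field_simps abs_if)
    also have "\<dots> \<le> 1 / real n" using q by (intro divide_right_mono) auto
    finally show ?thesis unfolding s .
  qed
  have fL: "((\<Sum>j\<in>?J. C j) / real n)-lipschitz_on UNIV f"
  proof (rule lipschitz_onI)
    have C0: "0 \<le> C j" for j by (rule lipschitz_on_nonneg[OF F(1)])
    show "0 \<le> (\<Sum>j\<in>?J. C j) / real n" using C0 by (intro divide_nonneg_nonneg sum_nonneg) auto
    fix x y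
    have "\<bar>(\<Sum>j\<in>?J. F j x) - (\<Sum>j\<in>?J. F j y)\<bar> \<le> (\<Sum>j\<in>?J. \<bar>F j x - F j y\<bar>)"
      unfolding sum_subtractf[symmetric] by (rule sum_abs)
    also have "\<dots> \<le> (\<Sum>j\<in>?J. C j * dist x y)" using lipschitz_onD[OF F(1), of x y] by (intro sum_mono) (simp add: dist_real_def)
    finally show "dist (f x) (f y) \<le> (\<Sum>j\<in>?J. C j) / real n * dist x y"
      unfolding f_def dist_real_def diff_divide_distrib[symmetric] using n
      by (simp add: abs_divide sum_distrib_right divide_right_mono)
  qed
  have f0: "0 \<le> f x" for x unfolding f_def by (intro divide_nonneg_nonneg sum_nonneg F) auto
  have fk: "f x \<le> real k" for x
  proof -
    have "(\<Sum>j\<in>?J. F j x) \<le> (\<Sum>j\<in>?J. 1)" by (intro sum_mono F)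
    then show ?thesis using n by (simp add: f_def divide_le_eq mult.commute)
  qed
  have "(\<integral>x. \<bar>f x - h x\<bar> \<partial>N) \<le> \<epsilon>" if N: "prob_space N" "sets N = sets borel" "\<And>j. (\<integral>x. \<bar>F j x - indicator (A j) x\<bar> \<partial>N) \<le> e" for N
  proof -
    interpret N: prob_space N by fact
    have [measurable]: "f \<in> borel_measurable N" "h \<in> borel_measurable N" "\<And>j. F j \<in> borel_measurable N" "\<And>j. A j \<in> sets N"
    proof -
      show "f \<in> borel_measurable N" using fL N(2) by (auto cong: measurable_cong_sets intro!: borel_measurable_continuous_onI dest: lipschitz_on_continuous_on)
      show "h \<in> borel_measurable N" using h(1) N(2) by (simp cong: measurable_cong_sets)
      show "F j \<in> borel_measurable N" for j using F(1)[of j] N(2) by (auto cong: measurable_cong_sets intro!: borel_measurable_continuous_onI dest: lipschitz_on_continuous_on)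
      show "A j \<in> sets N" for j using A N(2) by simp
    qed
    have iF: "integrable N (\<lambda>x. \<bar>F j x - indicator (A j) x\<bar>)" for j
    proof (rule N.integrable_const_bound[where B = 1])
      show "AE x in N. norm \<bar>F j x - indicator (A j) x\<bar> \<le> 1"
      proof (rule AE_I2)
        fix x show "norm \<bar>F j x - indicator (A j) x\<bar> \<le> 1"
          using F(2)[of j x] F(3)[of j x] by (auto simp: indicator_def abs_le_iff)
      qed
    qed measurable
    have "(\<integral>x. \<bar>f x - h x\<bar> \<partial>N) \<le> (\<integral>x. (\<Sum>j\<in>?J. \<bar>F j x - indicator (A j) x\<bar>) / real n + 1 / real n \<partial>N)"
    proof (rule integral_mono)
      show "integrable N (\<lambda>x. \<bar>f x - h x\<bar>)"
      proof (rule N.integrable_const_bound[where B = "real k"])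
        show "AE x in N. norm \<bar>f x - h x\<bar> \<le> real k"
        proof (rule AE_I2)
          fix x show "norm \<bar>f x - h x\<bar> \<le> real k" using f0[of x] fk[of x] h(2,3)[of x] by (simp add: abs_le_iff)
        qed
      qed measurable
      show "integrable N (\<lambda>x. (\<Sum>j\<in>?J. \<bar>F j x - indicator (A j) x\<bar>) / real n + 1 / real n)"
        using iF by (intro Bochner_Integration.integrable_add integrable_divide Bochner_Integration.integrable_sum) auto
      fix x
      have "\<bar>f x - (\<Sum>j\<in>?J. indicator (A j) x) / real n\<bar> = \<bar>\<Sum>j\<in>?J. F j x - indicator (A j) x\<bar> / real n"
        by (simp add: f_def diff_divide_distrib[symmetric] sum_subtractf)
      also have "\<dots> \<le> (\<Sum>j\<in>?J. \<bar>F j x - indicator (A j) x\<bar>) / real n"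
        by (intro divide_right_mono sum_abs) simp
      finally show "\<bar>f x - h x\<bar> \<le> (\<Sum>j\<in>?J. \<bar>F j x - indicator (A j) x\<bar>) / real n + 1 / real n"
        using layer[of x] by linarith
    qed
    also have "\<dots> = (\<Sum>j\<in>?J. \<integral>x. \<bar>F j x - indicator (A j) x\<bar> \<partial>N) / real n + 1 / real n"
      using iF N.prob_space by (simp add: Bochner_Integration.integral_add[OF integrable_divide[OF Bochner_Integration.integrable_sum]])
    also have "\<dots> \<le> (\<Sum>j\<in>?J. e) / real n + \<epsilon> / 2"
      using N(3) n by (intro add_mono divide_right_mono sum_mono) auto
    also have "(\<Sum>j\<in>?J. e) / real n = real k * e" using n by simp
    also have "real k * e \<le> (real k + 1) * e" using e by (simp add: algebra_simps)
    also have "(real k + 1) * e = \<epsilon> / 2"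
    proof -
      have p: "real k + 1 \<noteq> 0" by linarith
      have "(real k + 1) * e = (real k + 1) * (\<epsilon> / 2 / (real k + 1))" unfolding e_def by (simp only: divide_divide_eq_left)
      also have "\<dots> = \<epsilon> / 2"
      proof -
        have "a * (b / a) = b" if "a \<noteq> 0" for a b :: real using that by simp
        from this[OF p] show ?thesis .
      qed
      finally show ?thesis .
    qed
    finally show ?thesis by simp
  qed
  from this[OF \<mu> F(4)] this[OF \<theta> F(5)] show thesis using that[OF fL f0 fk] by blast
qed

text \<open>One term of the dual functional is continuous in mean for the first measure and the
  other for the second, which is why the approximation has to be good for both at once.\<close>

lemma dual_bounded_borel:
  fixes \<mu> \<theta> :: "'a::euclidean_space measure" and \<phi> :: "'a \<Rightarrow> real"
  assumes \<mu>: "prob_space \<mu>" "sets \<mu> = sets borel" and \<theta>: "prob_space \<theta>" "sets \<theta> = sets borel"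
    and dual: "\<And>(f :: 'a \<Rightarrow> real) C K. C-lipschitz_on UNIV f \<Longrightarrow> (\<And>x. \<bar>f x\<bar> \<le> K) \<Longrightarrow> (\<integral>x. f x \<partial>\<mu>) - ln (\<integral>x. exp (f x) \<partial>\<theta>) \<le> R"
    and \<phi>: "\<phi> \<in> borel_measurable borel" "\<And>x. \<bar>\<phi> x\<bar> \<le> K"
  shows "(\<integral>x. \<phi> x \<partial>\<mu>) - ln (\<integral>x. exp (\<phi> x) \<partial>\<theta>) \<le> R"
proof -
  interpret M: prob_space \<mu> by fact
  interpret T: prob_space \<theta> by fact
  obtain k :: nat where k: "K \<le> real k" using real_arch_simple by blast
  have \<phi>k: "\<bar>\<phi> x\<bar> \<le> real k" for x using \<phi>(2)[of x] k by linarith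
  have m\<phi> [measurable]: "\<phi> \<in> borel_measurable \<mu>" "\<phi> \<in> borel_measurable \<theta>" using \<phi>(1) \<mu>(2) \<theta>(2) by (auto cong: measurable_cong_sets)
  show ?thesis
  proof (rule field_le_epsilon)
    fix e :: real assume e: "0 < e"
    \<comment> \<open>The first term changes by at most \<epsilon> and the logarithm by at most
      exp(2 k) \<epsilon>; together they make e.\<close>
    define \<epsilon> where "\<epsilon> = e / (1 + exp (2 * real k))"
    have \<epsilon>: "0 < \<epsilon>" "\<epsilon> + exp (2 * real k) * \<epsilon> = e"
    proof -
      have p: "0 < 1 + exp (2 * real k)" by (simp add: add_pos_pos)
      then show "0 < \<epsilon>" using e by (simp add: \<epsilon>_def)
      have "\<epsilon> * (1 + exp (2 * real k)) = e" using p unfolding \<epsilon>_def by simp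
      then show "\<epsilon> + exp (2 * real k) * \<epsilon> = e" by (simp add: algebra_simps)
    qed
    \<comment> \<open>The approximation is stated for nonnegative functions, so \<phi> is raised by
      k and the result lowered again.\<close>
    have h: "(\<lambda>x. \<phi> x + real k) \<in> borel_measurable borel" "\<And>x. 0 \<le> \<phi> x + real k" "\<And>x. \<phi> x + real k \<le> real (2 * k)"
      using \<phi>(1) \<phi>k by (auto simp: abs_le_iff minus_le_iff add.commute) (smt (verit) \<phi>k)+
    obtain f0 C where f0: "C-lipschitz_on UNIV f0" "\<And>x. 0 \<le> f0 x" "\<And>x. f0 x \<le> real (2 * k)"
      "(\<integral>x. \<bar>f0 x - (\<phi> x + real k)\<bar> \<partial>\<mu>) \<le> \<epsilon>" "(\<integral>x. \<bar>f0 x - (\<phi> x + real k)\<bar> \<partial>\<theta>) \<le> \<epsilon>"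
    proof (rule lipschitz_bounded_approx[OF \<mu> \<theta> h \<epsilon>(1)])
      fix f C assume "C-lipschitz_on UNIV f" "\<And>x. 0 \<le> f x" "\<And>x. f x \<le> real (2 * k)"
        "(\<integral>x. \<bar>f x - (\<phi> x + real k)\<bar> \<partial>\<mu>) \<le> \<epsilon>" "(\<integral>x. \<bar>f x - (\<phi> x + real k)\<bar> \<partial>\<theta>) \<le> \<epsilon>"
      then show thesis by (rule that)
    qed
    define f where "f x = f0 x - real k" for x
    have fL: "C-lipschitz_on UNIV f" using f0(1) by (auto simp: lipschitz_on_def f_def dist_real_def)
    have fk: "\<bar>f x\<bar> \<le> real k" for x using f0(2,3)[of x] by (auto simp: f_def abs_le_iff)
    have fe: "(\<integral>x. \<bar>f x - \<phi> x\<bar> \<partial>\<mu>) \<le> \<epsilon>" "(\<integral>x. \<bar>f x - \<phi> x\<bar> \<partial>\<theta>) \<le> \<epsilon>"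
      using f0(4,5) by (simp_all add: f_def diff_diff_eq add.commute)
    have fb: "f \<in> borel_measurable borel" using fL by (auto intro!: borel_measurable_continuous_onI dest: lipschitz_on_continuous_on)
    then have [measurable]: "f \<in> borel_measurable \<mu>" "f \<in> borel_measurable \<theta>" using \<mu>(2) \<theta>(2) by (auto cong: measurable_cong_sets)
    have i1: "integrable \<mu> f" "integrable \<mu> \<phi>" by (rule M.integrable_const_bound[where B = "real k"]; use fk \<phi>k in simp)+
    have i2: "integrable \<theta> f" "integrable \<theta> \<phi>" by (rule T.integrable_const_bound[where B = "real k"]; use fk \<phi>k in simp)+
    have le: "f x \<le> real k" "\<phi> x \<le> real k" "- real k \<le> f x" "- real k \<le> \<phi> x" for x
      using fk[of x] \<phi>k[of x] by (auto simp: abs_le_iff)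
    have i3: "integrable \<theta> (\<lambda>x. exp (f x))" "integrable \<theta> (\<lambda>x. exp (\<phi> x))"
      by (rule T.integrable_const_bound[where B = "exp (real k)"]; use le in simp)+
    have "(\<integral>x. \<phi> x \<partial>\<mu>) - (\<integral>x. f x \<partial>\<mu>) = (\<integral>x. \<phi> x - f x \<partial>\<mu>)" using i1 by simp
    also have "\<dots> \<le> (\<integral>x. \<bar>f x - \<phi> x\<bar> \<partial>\<mu>)" using i1 by (intro integral_mono) auto
    finally have d1: "(\<integral>x. \<phi> x \<partial>\<mu>) - (\<integral>x. f x \<partial>\<mu>) \<le> \<epsilon>" using fe(1) by linarith
    let ?a = "\<integral>x. exp (f x) \<partial>\<theta>" and ?b = "\<integral>x. exp (\<phi> x) \<partial>\<theta>"
    have b: "exp (- real k) \<le> ?b" by (rule T.integral_ge_const[OF i3(2)]) (use le in auto)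
    have a: "exp (- real k) \<le> ?a" by (rule T.integral_ge_const[OF i3(1)]) (use le in auto)
    have ab0: "0 < ?a" "0 < ?b" using a b exp_gt_zero[of "- real k"] by linarith+
    have "?a - ?b = (\<integral>x. exp (f x) - exp (\<phi> x) \<partial>\<theta>)" using i3 by simp
    also have "\<dots> \<le> (\<integral>x. exp (real k) * \<bar>f x - \<phi> x\<bar> \<partial>\<theta>)"
    proof (rule integral_mono)
      show "exp (f x) - exp (\<phi> x) \<le> exp (real k) * \<bar>f x - \<phi> x\<bar>" for x
        using exp_lipschitz_bounded[of "f x" "real k" "\<phi> x"] le[of x] by linarith
    qed (use i2 i3 in auto)
    also have "\<dots> = exp (real k) * (\<integral>x. \<bar>f x - \<phi> x\<bar> \<partial>\<theta>)" by simp
    also have "\<dots> \<le> exp (real k) * \<epsilon>" using fe(2) by simp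
    finally have d2: "?a - ?b \<le> exp (real k) * \<epsilon>" .
    have "ln ?a - ln ?b \<le> (?a - ?b) / ?b" by (rule ln_diff_le[OF ab0])
    also have "\<dots> \<le> (exp (real k) * \<epsilon>) / ?b" using d2 ab0 by (intro divide_right_mono) auto
    also have "\<dots> \<le> (exp (real k) * \<epsilon>) / exp (- real k)" using b ab0 \<epsilon> by (intro divide_left_mono) auto
    also have "\<dots> = exp (2 * real k) * \<epsilon>"
    proof -
      have "exp (2 * real k) = exp (real k) / exp (- real k)" by (simp add: exp_diff[symmetric])
      then show ?thesis by simp
    qed
    finally have "ln ?a \<le> ln ?b + exp (2 * real k) * \<epsilon>" by simp
    with dual[OF fL fk] d1 \<epsilon>(2) show "(\<integral>x. \<phi> x \<partial>\<mu>) - ln ?b \<le> R + e" by linarith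
  qed
qed

text \<open>Donsker--Varadhan: bounded Lipschitz test functions suffice to bound the relative entropy.\<close>
lemma d_KL_le_dual:
  fixes \<mu> \<theta> :: "'a::euclidean_space measure"
  assumes \<mu>: "prob_space \<mu>" "sets \<mu> = sets borel" and \<theta>: "prob_space \<theta>" "sets \<theta> = sets borel"
    and dual: "\<And>(f :: 'a \<Rightarrow> real) C K. C-lipschitz_on UNIV f \<Longrightarrow> (\<And>x. \<bar>f x\<bar> \<le> K) \<Longrightarrow> (\<integral>x. f x \<partial>\<mu>) - ln (\<integral>x. exp (f x) \<partial>\<theta>) \<le> R"
  shows "d_KL \<mu> \<theta> \<le> ennreal R"
proof -
  interpret M: prob_space \<mu> by fact
  interpret T: prob_space \<theta> by fact
  have D: "(\<integral>x. \<phi> x \<partial>\<mu>) - ln (\<integral>x. exp (\<phi> x) \<partial>\<theta>) \<le> R"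
    if "\<phi> \<in> borel_measurable borel" "\<And>x. \<bar>\<phi> x\<bar> \<le> K" for \<phi> :: "'a \<Rightarrow> real" and K
    by (rule dual_bounded_borel[OF \<mu> \<theta> _ that]) (rule dual)
  have R0: "0 \<le> R" using D[of "\<lambda>_. 0" 0] by (simp add: T.prob_space M.prob_space)
  \<comment> \<open>Testing with n times the indicator of a null set A of \<theta> leaves the
    logarithmic term at zero, so n \<mu>(A) \<le> R for every n.\<close>
  have ac: "absolutely_continuous \<theta> \<mu>"
    unfolding absolutely_continuous_def
  proof
    fix A assume A: "A \<in> null_sets \<theta>"
    then have As: "A \<in> sets borel" "A \<in> sets \<mu>" "A \<in> sets \<theta>" using \<mu>(2) \<theta>(2) by (auto simp: null_sets_def)
    have le: "real n * measure \<mu> A \<le> R" for n :: nat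
    proof -
      have "(\<integral>x. real n * indicator A x \<partial>\<mu>) - ln (\<integral>x. exp (real n * indicator A x) \<partial>\<theta>) \<le> R"
        by (rule D[of "\<lambda>x. real n * indicator A x" "real n"]) (use As in \<open>auto simp: indicator_def\<close>)
      moreover have "(\<integral>x. exp (real n * indicator A x) \<partial>\<theta>) = (\<integral>x. 1 \<partial>\<theta>)"
      proof (rule integral_cong_AE)
        show "AE x in \<theta>. exp (real n * indicator A x) = (1::real)"
          using AE_not_in[OF A] by eventually_elim simp
      qed (use As in auto)
      ultimately show ?thesis using As by (simp add: T.prob_space)
    qed
    have "measure \<mu> A = 0"
    proof (rule ccontr)
      assume "measure \<mu> A \<noteq> 0"
      then have "0 < measure \<mu> A" by (simp add: zero_less_measure_iff)
      then obtain n :: nat where "R < real n * measure \<mu> A" using reals_Archimedean3 by blast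
      then show False using le[of n] by linarith
    qed
    then show "A \<in> null_sets \<mu>" using As by (simp add: null_sets_def M.emeasure_eq_measure)
  qed
  obtain d where d: "d \<in> borel_measurable \<theta>" "AE x in \<theta>. RN_deriv \<theta> \<mu> x = ennreal (d x)" "AE x in \<mu>. 0 < d x" "\<And>x. 0 \<le> d x"
    using T.real_RN_deriv[OF M.finite_measure_axioms ac] \<mu>(2) \<theta>(2) by auto
  have dm [measurable]: "d \<in> borel_measurable borel" "d \<in> borel_measurable \<theta>" "d \<in> borel_measurable \<mu>"
    using d(1) \<mu>(2) \<theta>(2) by (auto cong: measurable_cong_sets)
  have dens: "\<mu> = density \<theta> (\<lambda>x. ennreal (d x))"
  proof -
    have "\<mu> = density \<theta> (RN_deriv \<theta> \<mu>)" using T.density_RN_deriv[OF ac] \<mu>(2) \<theta>(2) by simp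
    also have "\<dots> = density \<theta> (\<lambda>x. ennreal (d x))" using d(2) by (intro density_cong) auto
    finally show ?thesis .
  qed
  have AEd: "AE x in \<mu>. RN_deriv \<theta> \<mu> x = ennreal (d x)"
    by (rule absolutely_continuous_AE[OF _ ac d(2)]) (use \<mu>(2) \<theta>(2) in simp)
  have ent: "AE x in \<mu>. entropy_density (exp 1) \<theta> \<mu> x = ln (d x)"
    using AEd by eventually_elim (simp add: entropy_density_def d(4) log_def)
  have int1: "(\<integral>\<^sup>+x. ennreal (d x) \<partial>\<theta>) = 1"
    using M.emeasure_space_1 unfolding dens by (simp add: emeasure_density cong: nn_integral_cong)
  have idth: "integrable \<theta> d" "(\<integral>x. d x \<partial>\<theta>) = 1"
  proof -
    have "has_bochner_integral \<theta> d 1" by (rule has_bochner_integral_nn_integral) (use int1 d in auto)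
    then show "integrable \<theta> d" "(\<integral>x. d x \<partial>\<theta>) = 1" by (auto simp: has_bochner_integral_iff)
  qed
  \<comment> \<open>The optimal test function is the logarithm of the density; truncation at -n and
    n makes it admissible. Where the density vanishes it takes the lowest value -n.\<close>
  define p where "p n x = (if 0 < d x then max (- real n) (min (real n) (ln (d x))) else - real n)" for n x
  have pm [measurable]: "p n \<in> borel_measurable borel" for n unfolding p_def by measurable
  have pm' [measurable]: "p n \<in> borel_measurable \<mu>" "p n \<in> borel_measurable \<theta>" for n
    using pm[of n] \<mu>(2) \<theta>(2) by (auto cong: measurable_cong_sets)
  have pb: "\<bar>p n x\<bar> \<le> real n" for n x by (auto simp: p_def abs_le_iff)
  \<comment> \<open>The lower truncation raises the exponential by at most exp(-n). Since the
    density integrates to one, the logarithmic term is then at most exp(-n).\<close>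
  have pe: "exp (p n x) \<le> d x + exp (- real n)" for n x
  proof (cases "0 < d x")
    case True
    have "p n x \<le> max (- real n) (ln (d x))" using True by (auto simp: p_def)
    then have "exp (p n x) \<le> exp (max (- real n) (ln (d x)))" by simp
    also have "\<dots> \<le> d x + exp (- real n)" using True by (auto simp: max_def)
    finally show ?thesis .
  qed (use d(4)[of x] in \<open>auto simp: p_def\<close>)
  have ip: "integrable \<mu> (p n)" for n by (rule M.integrable_const_bound[where B = "real n"]) (use pb in auto)
  have pR: "(\<integral>x. p n x \<partial>\<mu>) \<le> R + exp (- real n)" for n
  proof -
    have "(\<integral>x. p n x \<partial>\<mu>) - ln (\<integral>x. exp (p n x) \<partial>\<theta>) \<le> R" by (rule D[OF pm pb])
    moreover have "ln (\<integral>x. exp (p n x) \<partial>\<theta>) \<le> exp (- real n)"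
    proof -
      have pl: "- real n \<le> p n x" "p n x \<le> real n" for x using pb[of n x] by (auto simp: abs_le_iff)
      have iep: "integrable \<theta> (\<lambda>x. exp (p n x))" by (rule T.integrable_const_bound[where B = "exp (real n)"]) (use pl in auto)
      have "exp (- real n) \<le> (\<integral>x. exp (p n x) \<partial>\<theta>)" by (rule T.integral_ge_const[OF iep]) (use pl in auto)
      then have pos: "0 < (\<integral>x. exp (p n x) \<partial>\<theta>)" using exp_gt_zero[of "- real n"] by linarith
      have "(\<integral>x. exp (p n x) \<partial>\<theta>) \<le> (\<integral>x. d x + exp (- real n) \<partial>\<theta>)"
        by (rule integral_mono[OF iep]) (use idth pe in auto)
      also have "\<dots> = 1 + exp (- real n)" using idth T.prob_space by simp
      finally have "ln (\<integral>x. exp (p n x) \<partial>\<theta>) \<le> ln (1 + exp (- real n))" using pos by (simp add: add_pos_pos)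
      also have "\<dots> \<le> exp (- real n)" by (rule ln_add_one_self_le_self) simp
      finally show ?thesis .
    qed
    ultimately show ?thesis by linarith
  qed
  define neg where "neg x = max 0 (- ln (d x))" for x
  have [measurable]: "neg \<in> borel_measurable borel" unfolding neg_def by measurable
  then have [measurable]: "neg \<in> borel_measurable \<mu>" "neg \<in> borel_measurable \<theta>" using \<mu>(2) \<theta>(2) by (auto cong: measurable_cong_sets)
  have neg_nn: "(\<integral>\<^sup>+x. ennreal (neg x) \<partial>\<mu>) \<le> 1"
  proof -
    have "(\<integral>\<^sup>+x. ennreal (neg x) \<partial>\<mu>) = (\<integral>\<^sup>+x. ennreal (d x) * ennreal (neg x) \<partial>\<theta>)"
      by (subst dens, subst nn_integral_density) auto
    also have "\<dots> \<le> (\<integral>\<^sup>+x. 1 \<partial>\<theta>)"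
    proof (rule nn_integral_mono)
      fix x
      \<comment> \<open>From ln y \<le> y - 1 at the reciprocal of the density: the negative part of
        the entropy integrand is integrable for any two probability measures of this kind.\<close>
      have "d x * neg x \<le> 1"
      proof (cases "0 < d x")
        case True
        have "- ln (d x) = ln (inverse (d x))" using True by (simp add: ln_inverse)
        also have "\<dots> \<le> inverse (d x) - 1" by (rule ln_le_minus_one) (use True in simp)
        finally have "d x * (- ln (d x)) \<le> d x * (inverse (d x) - 1)" using True by (intro mult_left_mono) auto
        also have "\<dots> = 1 - d x" using True by (simp add: algebra_simps)
        finally show ?thesis using True by (auto simp: neg_def max_def)
      qed (use d(4)[of x] in \<open>auto simp: neg_def\<close>)
      then show "ennreal (d x) * ennreal (neg x) \<le> 1"
        by (subst ennreal_mult''[symmetric]) (auto simp: neg_def)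
    qed
    also have "\<dots> = 1" by (simp add: T.emeasure_space_1)
    finally show ?thesis .
  qed
  have negi: "integrable \<mu> neg"
  proof (rule integrableI_bounded)
    show "(\<integral>\<^sup>+x. ennreal (norm (neg x)) \<partial>\<mu>) < \<infinity>"
      using neg_nn by (simp add: neg_def order.strict_trans1)
  qed measurable
  \<comment> \<open>The dual bound on the truncations, together with the integrable negative part,
    bounds these means uniformly; monotone convergence then makes the positive part
    integrable.\<close>
  define pos where "pos n x = max 0 (min (real n) (ln (d x)))" for n x
  have posm: "pos n \<in> borel_measurable borel" for n unfolding pos_def by measurable
  then have [measurable]: "pos n \<in> borel_measurable \<mu>" for n using \<mu>(2) by (auto cong: measurable_cong_sets)
  have posi: "integrable \<mu> (pos n)" for n
    by (rule M.integrable_const_bound[where B = "real n"]) (auto simp: pos_def)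
  have pos_le: "(\<integral>x. pos n x \<partial>\<mu>) \<le> R + 1 + (\<integral>x. neg x \<partial>\<mu>)" for n
  proof -
    have "(\<integral>x. pos n x \<partial>\<mu>) \<le> (\<integral>x. p n x + neg x \<partial>\<mu>)"
    proof (rule integral_mono_AE)
      show "AE x in \<mu>. pos n x \<le> p n x + neg x" using d(3) by eventually_elim (auto simp: pos_def p_def neg_def)
    qed (use posi ip negi in auto)
    also have "\<dots> = (\<integral>x. p n x \<partial>\<mu>) + (\<integral>x. neg x \<partial>\<mu>)" using ip negi by simp
    also have "(\<integral>x. p n x \<partial>\<mu>) \<le> R + 1" using pR[of n] by (rule order_trans) simp
    finally show ?thesis by simp
  qed
  define posl where "posl x = max 0 (ln (d x))" for x
  have [measurable]: "posl \<in> borel_measurable borel" unfolding posl_def by measurable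
  then have [measurable]: "posl \<in> borel_measurable \<mu>" using \<mu>(2) by (auto cong: measurable_cong_sets)
  have posl: "integrable \<mu> posl"
  proof (rule integrable_monotone_convergence[where f = pos and x = "lim (\<lambda>n. \<integral>x. pos n x \<partial>\<mu>)"])
    show "AE x in \<mu>. mono (\<lambda>n. pos n x)" by (intro AE_I2) (auto simp: mono_def pos_def)
    show "AE x in \<mu>. (\<lambda>n. pos n x) \<longlonglongrightarrow> posl x"
    proof (rule AE_I2)
      fix x
      obtain m :: nat where m: "ln (d x) \<le> real m" using real_arch_simple by blast
      have "\<forall>\<^sub>F n in sequentially. pos n x = posl x"
        using eventually_ge_at_top[of m]
      proof eventually_elim
        case (elim n)
        then have "ln (d x) \<le> real n" using m by (meson of_nat_le_iff order_trans)
        then show ?case by (simp add: pos_def posl_def)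
      qed
      then show "(\<lambda>n. pos n x) \<longlonglongrightarrow> posl x" by (rule tendsto_eventually)
    qed
    have "incseq (\<lambda>n. \<integral>x. pos n x \<partial>\<mu>)"
      by (intro incseq_SucI integral_mono posi) (auto simp: pos_def)
    then have "convergent (\<lambda>n. \<integral>x. pos n x \<partial>\<mu>)"
    proof (rule incseq_convergent[of "\<lambda>n. \<integral>x. pos n x \<partial>\<mu>"])
      show "\<forall>n. (\<integral>x. pos n x \<partial>\<mu>) \<le> R + 1 + (\<integral>x. neg x \<partial>\<mu>)" using pos_le by blast
    qed (auto simp: convergent_def)
    then show "(\<lambda>n. \<integral>x. pos n x \<partial>\<mu>) \<longlonglongrightarrow> lim (\<lambda>n. \<integral>x. pos n x \<partial>\<mu>)" by (simp add: convergent_LIMSEQ_iff)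
  qed (use posi in auto)
  have lni: "integrable \<mu> (\<lambda>x. ln (d x))"
  proof -
    have "(\<lambda>x. ln (d x)) = (\<lambda>x. posl x - neg x)" by (auto simp: posl_def neg_def fun_eq_iff)
    then show ?thesis using posl negi by simp
  qed
  have "(\<lambda>n. \<integral>x. p n x \<partial>\<mu>) \<longlonglongrightarrow> (\<integral>x. ln (d x) \<partial>\<mu>)"
  proof (rule integral_dominated_convergence[where w = "\<lambda>x. \<bar>ln (d x)\<bar>"])
    show "AE x in \<mu>. (\<lambda>n. p n x) \<longlonglongrightarrow> ln (d x)"
      using d(3)
    proof eventually_elim
      case (elim x)
      obtain m :: nat where m: "\<bar>ln (d x)\<bar> \<le> real m" using real_arch_simple by blast
      have "\<forall>\<^sub>F n in sequentially. p n x = ln (d x)"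
        using eventually_ge_at_top[of m]
      proof eventually_elim
        case (elim n)
        then have "\<bar>ln (d x)\<bar> \<le> real n" using m by (meson of_nat_le_iff order_trans)
        then show ?case using \<open>0 < d x\<close> by (auto simp: p_def abs_le_iff)
      qed
      then show ?case by (rule tendsto_eventually)
    qed
    show "AE x in \<mu>. norm (p n x) \<le> \<bar>ln (d x)\<bar>" for n using d(3) by eventually_elim (auto simp: p_def)
  qed (use lni in auto)
  moreover have "(\<lambda>n. R + exp (- real n)) \<longlonglongrightarrow> R + 0"
    by (intro tendsto_intros filterlim_compose[OF exp_at_bot] filterlim_compose[OF filterlim_uminus_at_bot_at_top] filterlim_real_sequentially)
  ultimately have lnR: "(\<integral>x. ln (d x) \<partial>\<mu>) \<le> R"
    using pR by (auto intro!: LIMSEQ_le[of "\<lambda>n. \<integral>x. p n x \<partial>\<mu>" _ "\<lambda>n. R + exp (- real n)"])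
  have em: "entropy_density (exp 1) \<theta> \<mu> \<in> borel_measurable \<mu>"
    using measurable_entropy_density[of "exp 1" \<theta> \<mu>] \<mu>(2) \<theta>(2) by (simp cong: measurable_cong_sets)
  have "integrable \<mu> (entropy_density (exp 1) \<theta> \<mu>)"
    by (rule integrable_cong_AE_imp[OF lni em]) (use ent in \<open>auto elim: eventually_mono\<close>)
  moreover have "KL_divergence (exp 1) \<theta> \<mu> = (\<integral>x. ln (d x) \<partial>\<mu>)"
    unfolding KL_divergence_def by (rule integral_cong_AE[OF em _ ent]) measurable
  ultimately show ?thesis using ac lnR by (simp add: d_KL_def ennreal_leI)
qed

section \<open>Measurability and moments\<close>

text \<open>Each x is replaced by the first member of a dense sequence within 1/(n+1). The choice
  takes countably many values, so measurability in t suffices, and continuity in x gives the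
  limit.\<close>

lemma caratheodory_measurable:
  fixes f :: "real \<Rightarrow> 'a::euclidean_space \<Rightarrow> 'b::euclidean_space"
  assumes t: "\<And>x. (\<lambda>t. f t x) \<in> borel_measurable borel" and x: "\<And>t. continuous_on UNIV (f t)"
  shows "(\<lambda>z. f (fst z) (snd z)) \<in> borel_measurable borel"
proof -
  obtain D :: "'a set" where D: "countable D" "\<And>X. open X \<Longrightarrow> X \<noteq> {} \<Longrightarrow> \<exists>d\<in>D. d \<in> X"
    by (rule countable_dense_setE) blast
  have "D \<noteq> {}" using D(2)[of UNIV] by auto
  define d where "d = from_nat_into D"
  have near: "\<exists>i. dist x (d i) < r" if "0 < r" for x r
  proof -
    obtain y where "y \<in> D" "y \<in> ball x r" using D(2)[of "ball x r"] \<open>0 < r\<close> by auto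
    moreover obtain i where "d i = y" using from_nat_into_surj[OF D(1) \<open>y \<in> D\<close>] unfolding d_def by blast
    ultimately show ?thesis by auto
  qed
  define g where "g n x = (LEAST i. dist x (d i) < inverse (real (Suc n)))" for n x
  have g: "dist x (d (g n x)) < inverse (real (Suc n))" for n x
    unfolding g_def by (rule LeastI_ex, rule near) simp
  have lim: "(\<lambda>n. d (g n x)) \<longlonglongrightarrow> x" for x
  proof (rule metric_tendsto_imp_tendsto[OF LIMSEQ_inverse_real_of_nat])
    show "\<forall>\<^sub>F n in sequentially. dist (d (g n x)) x \<le> dist (inverse (real (Suc n))) 0"
      using g[of x] by (intro always_eventually allI) (simp add: dist_commute less_imp_le)
  qed
  have "(\<lambda>z. f (fst z) (snd z)) \<in> borel_measurable (borel \<Otimes>\<^sub>M borel)"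
  proof (rule borel_measurable_LIMSEQ_metric)
    fix n
    have gm: "g n \<in> borel \<rightarrow>\<^sub>M count_space UNIV" unfolding g_def by measurable
    have "(\<lambda>z. f (fst z) (d i)) \<in> borel_measurable (borel \<Otimes>\<^sub>M (borel :: 'a measure))" for i
      by (rule measurable_compose[OF measurable_fst t])
    then show "(\<lambda>z. f (fst z) (d (g n (snd z)))) \<in> borel_measurable (borel \<Otimes>\<^sub>M borel)"
      by (rule measurable_compose_countable) (rule measurable_compose[OF measurable_snd gm])
  next
    fix z :: "real \<times> 'a"
    show "(\<lambda>n. f (fst z) (d (g n (snd z)))) \<longlonglongrightarrow> f (fst z) (snd z)"
      by (rule continuous_on_tendsto_compose[OF x lim]) auto
  qed
  then show ?thesis by (simp add: borel_prod)
qed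

text \<open>Recovers the value of a density at a continuity point from probabilities of balls, so
  that measurability of these probabilities in time passes to the density itself.\<close>

lemma ball_average_tendsto:
  fixes f :: "'a::euclidean_space \<Rightarrow> real"
  assumes i: "integrable lborel f" and c: "continuous (at x) f"
  shows "(\<lambda>n. (LINT y:ball x (inverse (real (Suc n)))|lborel. f y) / measure lborel (ball x (inverse (real (Suc n))))) \<longlonglongrightarrow> f x"
proof (rule LIMSEQ_I)
  fix e :: real assume e: "0 < e"
  obtain r where r: "0 < r" "\<And>y. dist y x < r \<Longrightarrow> dist (f y) (f x) < e / 2"
    using c e unfolding continuous_at_eps_delta by (metis half_gt_zero)
  obtain N where N: "inverse (real (Suc N)) < r" using reals_Archimedean[OF r(1)] by blast
  show "\<exists>N. \<forall>n\<ge>N. norm ((LINT y:ball x (inverse (real (Suc n)))|lborel. f y) / measure lborel (ball x (inverse (real (Suc n)))) - f x) < e"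
  proof (intro exI[of _ N] allI impI)
    fix n assume n: "N \<le> n"
    let ?B = "ball x (inverse (real (Suc n)))"
    have "inverse (real (Suc n)) \<le> inverse (real (Suc N))" using n by (intro le_imp_inverse_le) auto
    then have "inverse (real (Suc n)) < r" using N by linarith
    then have B: "dist y x < r" if "y \<in> ?B" for y
      using that unfolding mem_ball dist_commute[of x y] by (rule less_trans[rotated])
    have v: "0 < measure lborel ?B" by (rule content_ball_pos) simp
    have ind: "integrable lborel (indicat_real ?B)"
      by (rule integrable_real_indicator) (use emeasure_bounded_finite[OF bounded_ball] in \<open>auto\<close>)
    have fi: "set_integrable lborel ?B f"
      using i unfolding set_integrable_def by (intro integrable_mult_indicator) auto
    have ci: "set_integrable lborel ?B (\<lambda>_. k)" for k :: real
      unfolding set_integrable_def using ind by (intro integrable_scaleR_left)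
    have cv: "(LINT y:?B|lborel. k) = k * measure lborel ?B" for k :: real
      unfolding set_lebesgue_integral_def by simp
    have "(LINT y:?B|lborel. f y) \<le> (LINT y:?B|lborel. f x + e / 2)"
    proof (rule set_integral_mono[OF fi ci])
      fix y assume "y \<in> ?B"
      from r(2)[OF B[OF this]] show "f y \<le> f x + e / 2" unfolding dist_real_def by linarith
    qed
    moreover have "(LINT y:?B|lborel. f x - e / 2) \<le> (LINT y:?B|lborel. f y)"
    proof (rule set_integral_mono[OF ci fi])
      fix y assume "y \<in> ?B"
      from r(2)[OF B[OF this]] show "f x - e / 2 \<le> f y" unfolding dist_real_def by linarith
    qed
    ultimately have "(LINT y:?B|lborel. f y) / measure lborel ?B \<le> f x + e / 2" "f x - e / 2 \<le> (LINT y:?B|lborel. f y) / measure lborel ?B"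
      unfolding cv using v by (simp_all add: divide_le_eq le_divide_eq)
    then show "norm ((LINT y:?B|lborel. f y) / measure lborel ?B - f x) < e"
      using e unfolding real_norm_def abs_less_iff by linarith
  qed
qed

lemma GDERIV_grad:
  fixes f :: "'a::euclidean_space \<Rightarrow> real"
  assumes "f differentiable (at x)"
  shows "GDERIV f x :> grad f x"
proof -
  obtain f' where f': "(f has_derivative f') (at x)" using assms by (auto simp: differentiable_def)
  then have lin: "linear f'" by (rule has_derivative_linear)
  define D where "D = (\<Sum>b\<in>Basis. f' b *\<^sub>R b)"
  have "f' h = h \<bullet> D" for h
  proof -
    have "f' h = f' (\<Sum>b\<in>Basis. (h \<bullet> b) *\<^sub>R b)" by (simp add: euclidean_representation)
    also have "\<dots> = (\<Sum>b\<in>Basis. (h \<bullet> b) * f' b)" using lin by (simp add: linear_sum linear_cmul)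
    also have "\<dots> = h \<bullet> D" by (simp add: D_def inner_sum_right mult.commute)
    finally show ?thesis .
  qed
  then have "GDERIV f x :> D" using f' unfolding gderiv_def by (metis (no_types, lifting) ext)
  then show ?thesis using grad_eqI by metis
qed

text \<open>Presents the gradient as a limit of difference quotients along a fixed sequence, so that
  it inherits measurability in a parameter.\<close>

lemma grad_inner_tendsto:
  fixes f :: "'a::euclidean_space \<Rightarrow> real"
  assumes "f differentiable (at x)"
  shows "(\<lambda>n. (f (x + inverse (real (Suc n)) *\<^sub>R e) - f x) / inverse (real (Suc n))) \<longlonglongrightarrow> grad f x \<bullet> e"
proof -
  have f: "(f has_derivative (\<lambda>h. h \<bullet> grad f x)) (at (x + 0 *\<^sub>R e))"
    using GDERIV_grad[OF assms] by (simp add: gderiv_def)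
  have l: "((\<lambda>s. x + s *\<^sub>R e) has_derivative (\<lambda>s. s *\<^sub>R e)) (at (0::real))"
    by (auto intro!: derivative_eq_intros)
  have "((\<lambda>s. f (x + s *\<^sub>R e)) has_derivative (\<lambda>s. (s *\<^sub>R e) \<bullet> grad f x)) (at 0)"
    using has_derivative_compose[OF l f] by simp
  then have "((\<lambda>s. f (x + s *\<^sub>R e)) has_field_derivative (grad f x \<bullet> e)) (at 0)"
    unfolding has_field_derivative_def by (simp add: inner_commute mult_commute_abs)
  then have "(\<lambda>s. (f (x + s *\<^sub>R e) - f x) / s) \<midarrow>0\<rightarrow> grad f x \<bullet> e" by (simp add: DERIV_def)
  moreover have "filterlim (\<lambda>n. inverse (real (Suc n))) (at 0) sequentially"
    unfolding filterlim_at using LIMSEQ_inverse_real_of_nat by (simp del: of_nat_Suc)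
  ultimately show ?thesis by (rule filterlim_compose)
qed

section \<open>From solutions of the equations to the abstract processes\<close>

lemma square_integrable_pair_imp_integrable:
  fixes f :: "real \<times> 'w \<Rightarrow> 'a::euclidean_space"
  assumes "prob_space M" and m: "f \<in> borel_measurable (lborel \<Otimes>\<^sub>M M)" and out: "\<And>r \<omega>. r \<notin> {0..S} \<Longrightarrow> f (r, \<omega>) = 0"
    and sq: "integrable (lborel \<Otimes>\<^sub>M M) (\<lambda>z. (norm (f z))\<^sup>2)"
  shows "integrable (lborel \<Otimes>\<^sub>M M) f"
proof (rule Bochner_Integration.integrable_bound[OF _ m])
  interpret prob_space M by fact
  have "integrable (lborel \<Otimes>\<^sub>M M) (\<lambda>z. indicator ({0..S} \<times> space M) z :: real)"
  proof (rule integrable_real_indicator)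
    show "{0..S} \<times> space M \<in> sets (lborel \<Otimes>\<^sub>M M)" by (intro pair_measureI) auto
    show "emeasure (lborel \<Otimes>\<^sub>M M) ({0..S} \<times> space M) < \<infinity>"
      by (subst emeasure_pair_measure_Times) (auto simp: emeasure_space_1 emeasure_lborel_Icc_eq)
  qed
  then show "integrable (lborel \<Otimes>\<^sub>M M) (\<lambda>z. indicator ({0..S} \<times> space M) z + (norm (f z))\<^sup>2)"
    using sq by (rule Bochner_Integration.integrable_add)
  show "AE z in lborel \<Otimes>\<^sub>M M. norm (f z) \<le> norm (indicator ({0..S} \<times> space M) z + (norm (f z))\<^sup>2)"
  proof (rule AE_I2)
    fix z :: "real \<times> 'w" assume "z \<in> space (lborel \<Otimes>\<^sub>M M)"
    then obtain r \<omega> where z: "z = (r, \<omega>)" "\<omega> \<in> space M" by (auto simp: space_pair_measure)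
    have "2 * norm (f z) \<le> 1 + (norm (f z))\<^sup>2" using sum_squares_bound[of "norm (f z)" 1] by simp
    then have "norm (f z) \<le> 1 + (norm (f z))\<^sup>2" using norm_ge_zero[of "f z"] by linarith
    then show "norm (f z) \<le> norm (indicator ({0..S} \<times> space M) z + (norm (f z))\<^sup>2)"
      using z out[of r \<omega>] by (cases "r \<in> {0..S}") auto
  qed
qed

text \<open>\<open>X'\<close> is the progressive version of the given solution. The two agree at all
  times of [0, S] outside one null set, so the integral equation carries over with the drift cut off
  outside [0, S].\<close>

lemma sde_driven_process:
  assumes sde: "sde_solution M F B \<beta> S \<mu>0 X" and S: "0 < S"
    and \<beta>: "\<And>s x. s \<in> {0..S} \<Longrightarrow> \<beta> s x = b s x + v s x"
    and b: "lipschitz_drift b c" and out: "\<And>s y. s \<notin> {0..S} \<Longrightarrow> b s y = 0" "\<And>s y. s \<notin> {0..S} \<Longrightarrow> v s y = 0"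
    and vm: "(\<lambda>z. v (fst z) (snd z)) \<in> borel_measurable borel"
    and X': "\<And>t. t \<in> {0..S} \<Longrightarrow> (\<lambda>z. X' (min (fst z) t) (snd z)) \<in> borel_measurable (borel \<Otimes>\<^sub>M F t)"
      "AE \<omega> in M. \<forall>t\<in>{0..S}. X' t \<omega> = X t \<omega>"
    and bi: "integrable (lborel \<Otimes>\<^sub>M M) (\<lambda>z. b (fst z) (X' (fst z) (snd z)))"
    and vi: "integrable (lborel \<Otimes>\<^sub>M M) (\<lambda>z. v (fst z) (X' (fst z) (snd z)))"
    and v2: "integrable (lborel \<Otimes>\<^sub>M M) (\<lambda>z. (norm (v (fst z) (X' (fst z) (snd z))))\<^sup>2)"
  shows "driven_process M F B X' S b c v"
proof -
  have bm: "brownian_motion M F B" and eq: "AE \<omega> in M. set_integrable lborel {0..S} (\<lambda>s. \<beta> s (X s \<omega>)) \<and>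
      (\<forall>t\<in>{0..S}. X t \<omega> = X 0 \<omega> + sqrt 2 *\<^sub>R B t \<omega> + (LINT s:{0..t}|lborel. \<beta> s (X s \<omega>)))"
    using sde unfolding sde_solution_def by auto
  interpret prob_space M using bm by (simp add: brownian_motion_def)
  interpret lipschitz_drift b c by fact
  show ?thesis
  proof unfold_locales
    show "0 < S" by fact
    show "\<And>i. space (F i) = space M" "\<And>i j. i \<le> j \<Longrightarrow> sets (F i) \<subseteq> sets (F j)"
      using bm unfolding brownian_motion_def filtration_def by auto
    show "\<And>t. sets (F t) \<subseteq> sets M" "\<And>t. 0 \<le> t \<Longrightarrow> B t \<in> borel_measurable (F t)"
      using bm unfolding brownian_motion_def by auto
    show "\<And>s t. 0 \<le> s \<Longrightarrow> s < t \<Longrightarrow> distributed M lborel (\<lambda>\<omega>. B t \<omega> - B s \<omega>)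
        (\<lambda>x. ennreal (\<Prod>b\<in>Basis. normal_density 0 (sqrt (t - s)) (x \<bullet> b)))"
      using bm unfolding brownian_motion_def by blast
    show "\<And>s t. 0 \<le> s \<Longrightarrow> s < t \<Longrightarrow> indep_set (sets (F s))
        {(\<lambda>\<omega>. B t \<omega> - B s \<omega>) -` A \<inter> space M | A. A \<in> sets borel}"
      using bm unfolding brownian_motion_def by blast
    show "\<And>t. t \<in> {0..S} \<Longrightarrow> (\<lambda>z. X' (min (fst z) t) (snd z)) \<in> borel_measurable (borel \<Otimes>\<^sub>M F t)" by (rule X'(1))
    show "integrable (lborel \<Otimes>\<^sub>M M) (\<lambda>z. b (fst z) (X' (fst z) (snd z)) + v (fst z) (X' (fst z) (snd z)))"
      by (rule Bochner_Integration.integrable_add[OF bi vi])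
    show "AE \<omega> in M. \<forall>t\<in>{0..S}. X' t \<omega> = X' 0 \<omega> + sqrt 2 *\<^sub>R B t \<omega> + (LINT r:{0..t}|lborel. b r (X' r \<omega>) + v r (X' r \<omega>))"
      using eq X'(2)
    proof eventually_elim
      case (elim \<omega>)
      show ?case
      proof
        fix t assume t: "t \<in> {0..S}"
        have "(LINT s:{0..t}|lborel. \<beta> s (X s \<omega>)) = (LINT r:{0..t}|lborel. b r (X' r \<omega>) + v r (X' r \<omega>))"
          using elim(2) t by (intro set_lebesgue_integral_cong) (auto simp: \<beta>)
        moreover have "X t \<omega> = X 0 \<omega> + sqrt 2 *\<^sub>R B t \<omega> + (LINT s:{0..t}|lborel. \<beta> s (X s \<omega>))"
          using elim(1) t by blast
        moreover have "X' t \<omega> = X t \<omega>" "X' 0 \<omega> = X 0 \<omega>" using elim(2) t S by auto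
        ultimately show "X' t \<omega> = X' 0 \<omega> + sqrt 2 *\<^sub>R B t \<omega> + (LINT r:{0..t}|lborel. b r (X' r \<omega>) + v r (X' r \<omega>))"
          by simp
      qed
    qed
    show "\<And>s y. s \<notin> {0..S} \<Longrightarrow> b s y = 0" "\<And>s y. s \<notin> {0..S} \<Longrightarrow> v s y = 0" by (fact out)+
    show "(\<lambda>z. v (fst z) (snd z)) \<in> borel_measurable borel" by (rule vm)
    show "integrable (lborel \<Otimes>\<^sub>M M) (\<lambda>z. (norm (v (fst z) (X' (fst z) (snd z))))\<^sup>2)" by (rule v2)
  qed
qed

text \<open>The size of the drift at the origin is read off one path along which the drift is
  integrable: the path is bounded by continuity, and the Lipschitz bound compares its points with
  0.\<close>

lemma drift_zero_integrable:
  fixes b :: "real \<Rightarrow> 'a::euclidean_space \<Rightarrow> 'a"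
  assumes bm: "(\<lambda>r. b r 0) \<in> borel_measurable borel" and lip: "\<And>r. c-lipschitz_on UNIV (b r)"
    and out: "\<And>s y. s \<notin> {0..S} \<Longrightarrow> b s y = 0"
    and y: "continuous_on {0..S} y" and i: "set_integrable lborel {0..S} (\<lambda>s. b s (y s))"
  shows "integrable lborel (\<lambda>r. b r 0)"
proof -
  obtain K where "\<forall>z\<in>y ` {0..S}. norm z \<le> K"
    using compact_imp_bounded[OF compact_continuous_image[OF y compact_Icc]] unfolding bounded_iff by blast
  then have K: "norm (y s) \<le> K" if "s \<in> {0..S}" for s using that by simp
  have "integrable lborel (\<lambda>s. norm (indicator {0..S} s *\<^sub>R b s (y s)) + indicator {0..S} s *\<^sub>R (c * K))"
    using i unfolding set_integrable_def
    by (intro Bochner_Integration.integrable_add integrable_norm integrable_scaleR_left integrable_real_indicator) (auto simp: emeasure_lborel_Icc_eq)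
  moreover have "AE r in lborel. norm (b r 0) \<le> norm (norm (indicator {0..S} r *\<^sub>R b r (y r)) + indicator {0..S} r *\<^sub>R (c * K))"
  proof (rule AE_I2)
    fix r
    show "norm (b r 0) \<le> norm (norm (indicator {0..S} r *\<^sub>R b r (y r)) + indicator {0..S} r *\<^sub>R (c * K))"
    proof (cases "r \<in> {0..S}")
      case True
      have c0: "0 \<le> c" by (rule lipschitz_on_nonneg[OF lip])
      have "norm (b r 0 - b r (y r)) \<le> c * norm (y r)"
        using lipschitz_onD[OF lip, of 0 "y r" r] by (simp add: dist_norm)
      also have "\<dots> \<le> c * K" by (rule mult_left_mono[OF K[OF True] c0])
      finally have "norm (b r 0) \<le> norm (b r (y r)) + c * K"
        using norm_triangle_ineq2[of "b r 0" "b r (y r)"] by linarith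
      then show ?thesis using True by simp
    qed (simp add: out)
  qed
  moreover have "(\<lambda>r. b r 0) \<in> borel_measurable lborel" using bm by simp
  ultimately show ?thesis using Bochner_Integration.integrable_bound by blast
qed

text \<open>Linear growth reduces the claim to the first moment of the path, integrated over time,
  and to the integral of the drift at 0.\<close>

lemma (in lipschitz_drift) drift_path_integrable:
  fixes X :: "real \<Rightarrow> 'w \<Rightarrow> 'a"
  assumes "prob_space M" and out: "\<And>s y. s \<notin> {0..S} \<Longrightarrow> b s y = 0"
    and X: "(\<lambda>z. X (min (fst z) S) (snd z)) \<in> borel_measurable (borel \<Otimes>\<^sub>M M)"
    and fin: "(\<integral>\<^sup>+r. indicator {0..S} r * (\<integral>\<^sup>+\<omega>. ennreal (norm (X (min r S) \<omega>)) \<partial>M) \<partial>lborel) < \<infinity>"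
  shows "integrable (lborel \<Otimes>\<^sub>M M) (\<lambda>z. b (fst z) (X (fst z) (snd z)))"
proof -
  interpret prob_space M by fact
  interpret LM: pair_sigma_finite lborel M ..
  define h where "h = (\<lambda>z. X (min (fst z) S) (snd z))"
  have hm [measurable]: "h \<in> borel_measurable (lborel \<Otimes>\<^sub>M M)"
    using X unfolding h_def by (rule measurable_cong_sets[THEN equalityD2, THEN subsetD, rotated -1]) (simp_all cong: sets_pair_measure_cong)
  have beq: "(\<lambda>z. b (fst z) (X (fst z) (snd z))) = (\<lambda>z. b (fst z) (h z))"
  proof
    fix z :: "real \<times> 'w"
    show "b (fst z) (X (fst z) (snd z)) = b (fst z) (h z)"
      using out[of "fst z"] by (cases "fst z \<le> S") (auto simp: h_def min_def)
  qed
  have bm: "(\<lambda>z. b (fst z) (h z)) \<in> borel_measurable (lborel \<Otimes>\<^sub>M M)"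
  proof -
    have "(\<lambda>z. (fst z, h z)) \<in> (lborel \<Otimes>\<^sub>M M) \<rightarrow>\<^sub>M (borel \<Otimes>\<^sub>M borel)" by measurable
    from measurable_compose[OF this, of "\<lambda>z. b (fst z) (snd z)"] b_meas show ?thesis by (simp add: borel_prod)
  qed
  have i1: "integrable (lborel \<Otimes>\<^sub>M M) (\<lambda>z. indicator {0..S} (fst z) *\<^sub>R norm (h z))"
  proof (rule integrableI_bounded)
    have "(\<integral>\<^sup>+z. ennreal (norm (indicator {0..S} (fst z) *\<^sub>R norm (h z))) \<partial>(lborel \<Otimes>\<^sub>M M))
        = (\<integral>\<^sup>+r. (\<integral>\<^sup>+\<omega>. ennreal (norm (indicator {0..S} (fst (r, \<omega>)) *\<^sub>R norm (h (r, \<omega>)))) \<partial>M) \<partial>lborel)"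
      by (subst nn_integral_fst[symmetric]) auto
    also have "\<dots> = (\<integral>\<^sup>+r. indicator {0..S} r * (\<integral>\<^sup>+\<omega>. ennreal (norm (X (min r S) \<omega>)) \<partial>M) \<partial>lborel)"
      by (intro nn_integral_cong) (auto simp: h_def indicator_def)
    finally show "(\<integral>\<^sup>+z. ennreal (norm (indicator {0..S} (fst z) *\<^sub>R norm (h z))) \<partial>(lborel \<Otimes>\<^sub>M M)) < \<infinity>" using fin by simp
  qed measurable
  have i2: "integrable (lborel \<Otimes>\<^sub>M M) (\<lambda>z. norm (b (fst z) 0))"
  proof (rule integrableI_bounded)
    have [measurable]: "(\<lambda>r. b r 0) \<in> borel_measurable borel" by (rule b_meas1)
    show "(\<lambda>z. norm (b (fst z) 0)) \<in> borel_measurable (lborel \<Otimes>\<^sub>M M)" by measurable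
    have "(\<integral>\<^sup>+z. ennreal (norm (norm (b (fst z) 0))) \<partial>(lborel \<Otimes>\<^sub>M M)) = (\<integral>\<^sup>+r. ennreal (norm (b r 0)) \<partial>lborel)"
      by (subst nn_integral_fst[symmetric]) (auto simp: emeasure_space_1)
    also have "\<dots> < \<infinity>" using b_zero by (simp add: integrable_iff_bounded)
    finally show "(\<integral>\<^sup>+z. ennreal (norm (norm (b (fst z) 0))) \<partial>(lborel \<Otimes>\<^sub>M M)) < \<infinity>" .
  qed
  show ?thesis unfolding beq
  proof (rule Bochner_Integration.integrable_bound[OF Bochner_Integration.integrable_add[OF i2 integrable_mult_right[OF i1]] bm])
    show "AE z in lborel \<Otimes>\<^sub>M M. norm (b (fst z) (h z)) \<le> norm (norm (b (fst z) 0) + c * (indicator {0..S} (fst z) *\<^sub>R norm (h z)))"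
    proof (rule AE_I2)
      fix z :: "real \<times> 'w"
      show "norm (b (fst z) (h z)) \<le> norm (norm (b (fst z) 0) + c * (indicator {0..S} (fst z) *\<^sub>R norm (h z)))"
        using b_le[of "fst z" "h z"] out[of "fst z"] c_nonneg by (cases "fst z \<in> {0..S}") auto
    qed
  qed
qed

text \<open>Against the weight exp(-k t) the Volterra operator shrinks integrals by the factor c / k
  \<le> 1/2, so its contribution can be absorbed on the left. The integrated form suits a merely
  measurable A.\<close>

lemma gronwall_integral:
  fixes y A :: "real \<Rightarrow> real"
  assumes y: "continuous_on {0..S} y" "\<And>t. t \<in> {0..S} \<Longrightarrow> 0 \<le> y t" and c: "0 \<le> c" and S: "0 < S"
    and A: "A \<in> borel_measurable borel"
    and le: "\<And>t. t \<in> {0..S} \<Longrightarrow> y t \<le> A t + c * (LINT s:{0..t}|lborel. y s)"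
  shows "(\<integral>\<^sup>+t. indicator {0..S} t * ennreal (y t) \<partial>lborel) \<le> ennreal (2 * exp (2 * (c + 1) * S)) * (\<integral>\<^sup>+t. indicator {0..S} t * ennreal (A t) \<partial>lborel)"
proof -
  \<comment> \<open>c + 1 rather than c keeps the rate positive when c = 0.\<close>
  define k where "k = 2 * (c + 1)"
  have k: "0 < k" "c / k \<le> 1 / 2" using c by (auto simp: k_def field_simps)
  define Y where "Y t = indicator {0..S} t * y t" for t
  have Y0: "0 \<le> Y t" for t using y(2)[of t] by (auto simp: Y_def indicator_def)
  have Yi: "integrable lborel Y"
    using borel_integrable_atLeastAtMost'[OF y(1)] unfolding set_integrable_def Y_def by simp
  have [measurable]: "Y \<in> borel_measurable borel" using borel_measurable_integrable[OF Yi] by simp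
  note [measurable] = A
  define J where "J = (\<integral>\<^sup>+t. ennreal (exp (- k * t)) * ennreal (Y t) \<partial>lborel)"
  define I where "I = (\<integral>\<^sup>+t. indicator {0..S} t * ennreal (A t) \<partial>lborel)"
  have Yn: "(\<integral>\<^sup>+t. ennreal (Y t) \<partial>lborel) < \<infinity>" using Yi Y0 by (simp add: integrable_iff_bounded)
  have supp: "ennreal (exp (- k * t)) * ennreal (Y t) \<le> ennreal (Y t)" for t
  proof (cases "t \<in> {0..S}")
    case True
    then have "exp (- k * t) * Y t \<le> 1 * Y t" using k Y0[of t] by (intro mult_right_mono) auto
    then show ?thesis using Y0[of t] by (simp add: ennreal_mult''[symmetric] ennreal_leI)
  qed (simp add: Y_def)
  have "J \<le> (\<integral>\<^sup>+t. ennreal (Y t) \<partial>lborel)" unfolding J_def by (rule nn_integral_mono) (rule supp)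
  \<comment> \<open>Finiteness of J is what allows half of it to be moved to the other side.\<close>
  then have Jfin: "J < \<infinity>" using Yn by (rule le_less_trans)
  have pt: "ennreal (exp (- k * t)) * ennreal (Y t) \<le> indicator {0..S} t * ennreal (A t)
      + (\<integral>\<^sup>+s. ennreal c * (indicator {s..S} t * ennreal (exp (- k * t))) * ennreal (Y s) \<partial>lborel)" for t
  proof (cases "t \<in> {0..S}")
    case True
    have "(\<integral>\<^sup>+s. ennreal c * (indicator {s..S} t * ennreal (exp (- k * t))) * ennreal (Y s) \<partial>lborel)
        = (\<integral>\<^sup>+s. ennreal (c * exp (- k * t)) * ennreal (indicator {0..t} s * y s) \<partial>lborel)"
      using True c by (intro nn_integral_cong) (auto simp: indicator_def Y_def ennreal_mult'')
    also have "\<dots> = ennreal (c * exp (- k * t)) * ennreal (LINT s:{0..t}|lborel. y s)"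
    proof -
      have it: "integrable lborel (\<lambda>s. indicator {0..t} s * y s)"
        using borel_integrable_atLeastAtMost'[OF continuous_on_subset[OF y(1)], of 0 t] True unfolding set_integrable_def by simp
      then have [measurable]: "(\<lambda>s. indicator {0..t} s * y s) \<in> borel_measurable lborel" by (rule borel_measurable_integrable)
      have "0 \<le> indicator {0..t} s * y s" for s using y(2)[of s] True by (auto simp: indicator_def)
      then have "(\<integral>\<^sup>+s. ennreal (indicator {0..t} s * y s) \<partial>lborel) = ennreal (LINT s:{0..t}|lborel. y s)"
        using it by (subst nn_integral_eq_integral) (auto simp: set_lebesgue_integral_def)
      moreover have "(\<lambda>s. ennreal (indicator {0..t} s * y s)) \<in> borel_measurable lborel" by measurable
      ultimately show ?thesis by (simp only: nn_integral_cmult)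
    qed
    finally have e: "(\<integral>\<^sup>+s. ennreal c * (indicator {s..S} t * ennreal (exp (- k * t))) * ennreal (Y s) \<partial>lborel)
        = ennreal (c * exp (- k * t) * (LINT s:{0..t}|lborel. y s))"
      using c by (simp only: ennreal_mult'[symmetric] mult_nonneg_nonneg exp_ge_zero)
    have L0: "0 \<le> (LINT s:{0..t}|lborel. y s)"
      unfolding set_lebesgue_integral_def by (intro integral_nonneg_AE AE_I2) (use y(2) True in \<open>auto simp: indicator_def\<close>)
    have "exp (- k * t) * Y t \<le> exp (- k * t) * (A t + c * (LINT s:{0..t}|lborel. y s))"
      using le[OF True] True by (intro mult_left_mono) (auto simp: Y_def)
    also have "\<dots> = exp (- k * t) * A t + c * exp (- k * t) * (LINT s:{0..t}|lborel. y s)" by (simp add: algebra_simps)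
    also have "exp (- k * t) * A t \<le> max 0 (A t)"
    proof (cases "0 \<le> A t")
      case pos: True
      have "exp (- k * t) * A t \<le> 1 * A t" using k True pos by (intro mult_right_mono) auto
      then show ?thesis using pos by simp
    next
      case False
      then show ?thesis by (simp add: mult_nonneg_nonpos order.trans[of _ 0])
    qed
    finally have "ennreal (exp (- k * t) * Y t) \<le> ennreal (max 0 (A t) + c * exp (- k * t) * (LINT s:{0..t}|lborel. y s))"
      by (simp add: ennreal_leI)
    also have "\<dots> = ennreal (A t) + ennreal (c * exp (- k * t) * (LINT s:{0..t}|lborel. y s))"
      using c L0 by (simp add: ennreal_plus ennreal_max_0)
    finally show ?thesis using True Y0[of t] unfolding e by (simp add: ennreal_mult'')
  qed (simp add: Y_def)
  have in1: "(\<integral>\<^sup>+t. indicator {s..S} t * ennreal (exp (- k * t)) \<partial>lborel) \<le> ennreal (exp (- k * s) / k)" if s: "s \<in> {0..S}" for s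
  proof -
    have der: "((\<lambda>t. - exp (- k * t) / k) has_real_derivative exp (- k * t)) (at t)" for t
      using k by (auto intro!: derivative_eq_intros)
    have "(\<integral>\<^sup>+t. ennreal (exp (- k * t)) * indicator {s..S} t \<partial>lborel) = ennreal ((- exp (- k * S) / k) - (- exp (- k * s) / k))"
      by (rule nn_integral_FTC_Icc) (use s der in \<open>auto intro: has_field_derivative_at_within\<close>)
    also have "\<dots> \<le> ennreal (exp (- k * s) / k)" using k by (intro ennreal_leI) (simp add: field_simps)
    finally show ?thesis by (simp add: mult.commute)
  qed
  have "J \<le> (\<integral>\<^sup>+t. indicator {0..S} t * ennreal (A t) + (\<integral>\<^sup>+s. ennreal c * (indicator {s..S} t * ennreal (exp (- k * t))) * ennreal (Y s) \<partial>lborel) \<partial>lborel)"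
    unfolding J_def by (rule nn_integral_mono) (rule pt)
  also have "\<dots> = I + (\<integral>\<^sup>+t. (\<integral>\<^sup>+s. ennreal c * (indicator {s..S} t * ennreal (exp (- k * t))) * ennreal (Y s) \<partial>lborel) \<partial>lborel)"
    unfolding I_def by (rule nn_integral_add) (auto simp: indicator_def)
  also have "(\<integral>\<^sup>+t. (\<integral>\<^sup>+s. ennreal c * (indicator {s..S} t * ennreal (exp (- k * t))) * ennreal (Y s) \<partial>lborel) \<partial>lborel)
     = (\<integral>\<^sup>+s. (\<integral>\<^sup>+t. ennreal c * (indicator {s..S} t * ennreal (exp (- k * t))) * ennreal (Y s) \<partial>lborel) \<partial>lborel)"
    by (rule lborel_pair.Fubini') (auto simp: indicator_def)
  also have "\<dots> \<le> (\<integral>\<^sup>+s. ennreal (1 / 2) * (ennreal (exp (- k * s)) * ennreal (Y s)) \<partial>lborel)"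
  proof (rule nn_integral_mono)
    fix s :: real
    show "(\<integral>\<^sup>+t. ennreal c * (indicator {s..S} t * ennreal (exp (- k * t))) * ennreal (Y s) \<partial>lborel) \<le> ennreal (1 / 2) * (ennreal (exp (- k * s)) * ennreal (Y s))"
    proof (cases "s \<in> {0..S}")
      case True
      have "(\<integral>\<^sup>+t. ennreal c * (indicator {s..S} t * ennreal (exp (- k * t))) * ennreal (Y s) \<partial>lborel)
        = ennreal c * (\<integral>\<^sup>+t. indicator {s..S} t * ennreal (exp (- k * t)) \<partial>lborel) * ennreal (Y s)"
        by (subst nn_integral_multc, simp, subst nn_integral_cmult) auto
      also have "\<dots> \<le> ennreal c * ennreal (exp (- k * s) / k) * ennreal (Y s)"
        by (intro mult_right_mono mult_left_mono in1[OF True]) auto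
      also have "\<dots> = ennreal ((c / k) * (exp (- k * s) * Y s))"
        using c k Y0[of s] by (simp add: ennreal_mult''[symmetric] mult_ac)
      also have "\<dots> \<le> ennreal ((1 / 2) * (exp (- k * s) * Y s))"
        using k Y0[of s] by (intro ennreal_leI mult_right_mono) auto
      also have "\<dots> = ennreal (1 / 2) * (ennreal (exp (- k * s)) * ennreal (Y s))"
        using Y0[of s] by (simp only: ennreal_mult'' mult_nonneg_nonneg exp_ge_zero)
      finally show ?thesis .
    qed (simp add: Y_def)
  qed
  also have "\<dots> = ennreal (1 / 2) * J" unfolding J_def by (rule nn_integral_cmult) simp
  finally have JJ: "J \<le> I + ennreal (1 / 2) * J" by simp
  have J2: "J \<le> 2 * I"
  proof (cases "I = \<infinity>")
    case False
    obtain j i where ji: "J = ennreal j" "0 \<le> j" "I = ennreal i" "0 \<le> i"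
      using Jfin False by (cases J; cases I) auto
    from JJ have "ennreal j \<le> ennreal (i + 1 / 2 * j)"
      unfolding ji using ji by (simp only: ennreal_mult''[symmetric] ennreal_plus[symmetric] mult_nonneg_nonneg)
    then have "j \<le> i + 1 / 2 * j" using ji by (subst (asm) ennreal_le_iff) auto
    then have "j \<le> 2 * i" by simp
    then show ?thesis unfolding ji using ji by (simp add: ennreal_leI ennreal_mult''[symmetric] del: ennreal_numeral flip: ennreal_numeral)
  qed (simp add: ennreal_mult_top)
  have "(\<integral>\<^sup>+t. indicator {0..S} t * ennreal (y t) \<partial>lborel) = (\<integral>\<^sup>+t. ennreal (Y t) \<partial>lborel)"
    by (intro nn_integral_cong) (auto simp: Y_def indicator_def)
  also have "\<dots> \<le> (\<integral>\<^sup>+t. ennreal (exp (k * S)) * (ennreal (exp (- k * t)) * ennreal (Y t)) \<partial>lborel)"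
  proof (rule nn_integral_mono)
    fix t
    show "ennreal (Y t) \<le> ennreal (exp (k * S)) * (ennreal (exp (- k * t)) * ennreal (Y t))"
    proof (cases "t \<in> {0..S}")
      case True
      then have "k * t \<le> k * S" using k by simp
      then have "1 \<le> exp (k * S) * exp (- k * t)" by (simp add: exp_add[symmetric])
      then have "1 * Y t \<le> (exp (k * S) * exp (- k * t)) * Y t" by (rule mult_right_mono) (rule Y0)
      then show ?thesis using Y0[of t] by (simp add: ennreal_mult''[symmetric] ennreal_leI mult.assoc)
    qed (simp add: Y_def)
  qed
  also have "\<dots> = ennreal (exp (k * S)) * J" unfolding J_def by (rule nn_integral_cmult) simp
  also have "\<dots> \<le> ennreal (exp (k * S)) * (2 * I)" by (rule mult_left_mono[OF J2]) simp
  also have "\<dots> = ennreal (2 * exp (2 * (c + 1) * S)) * I"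
    by (simp add: k_def ennreal_mult'' mult_ac)
  finally show ?thesis unfolding I_def .
qed

section \<open>Measurability of the density in time, and first moments\<close>

lemma clamped_mono_measurable:
  fixes lam :: "real \<Rightarrow> real"
  assumes "mono_on {0..T} lam" "0 < T"
  shows "(\<lambda>t. lam (max 0 (min T t))) \<in> borel_measurable borel"
proof (rule borel_measurable_mono, rule monoI)
  fix s t :: real assume "s \<le> t"
  then show "lam (max 0 (min T s)) \<le> lam (max 0 (min T t))"
    using assms(2) by (intro mono_onD[OF assms(1)]) (auto simp: max_def min_def)
qed

text \<open>The densities are given one time at a time, so joint information must come from the
  interpolation: \<open>lam\<close> is monotone, hence measurable, ball probabilities are measurable
  in t by Fubini, and continuity in x turns their averages into values of p.\<close>

lemma density_path_measurable:
  fixes \<xi> \<zeta> :: "'w \<Rightarrow> 'a::euclidean_space" and p :: "real \<Rightarrow> 'a \<Rightarrow> real"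
  assumes "prob_space M" and lam: "mono_on {0..T} lam" and T: "0 < T"
    and rv: "\<xi> \<in> borel_measurable M" "\<zeta> \<in> borel_measurable M"
    and p: "\<And>t. t \<in> {0..T} \<Longrightarrow>
      distributed M lborel (\<lambda>\<omega>. sqrt (lam t) *\<^sub>R \<xi> \<omega> + sqrt (1 - lam t) *\<^sub>R \<zeta> \<omega>) (\<lambda>x. ennreal (p t x))"
    and cont: "\<And>t. t \<in> {0..T} \<Longrightarrow> continuous_on UNIV (p t)"
    and pos: "\<And>t x. t \<in> {0..T} \<Longrightarrow> 0 \<le> p t x"
  shows "(\<lambda>t. if t \<in> {0..T} then p t x else 1) \<in> borel_measurable borel"
proof -
  interpret prob_space M by fact
  define l where "l t = lam (max 0 (min T t))" for t
  have [measurable]: "l \<in> borel_measurable borel"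
    unfolding l_def[abs_def] by (rule clamped_mono_measurable[OF lam T])
  note [measurable] = rv
  define Z where "Z t \<omega> = sqrt (l t) *\<^sub>R \<xi> \<omega> + sqrt (1 - l t) *\<^sub>R \<zeta> \<omega>" for t \<omega>
  define r where "r n = inverse (real (Suc n))" for n
  define Q where "Q n t = emeasure M {\<omega> \<in> space M. Z t \<omega> \<in> ball x (r n)}" for n t
  have [measurable]: "Q n \<in> borel_measurable borel" for n
  proof -
    have A: "{z \<in> space (borel \<Otimes>\<^sub>M M). Z (fst z) (snd z) \<in> ball x (r n)} \<in> sets (borel \<Otimes>\<^sub>M M)"
      unfolding Z_def mem_ball by measurable
    have "Q n t = emeasure M (Pair t -` {z \<in> space (borel \<Otimes>\<^sub>M M). Z (fst z) (snd z) \<in> ball x (r n)})" for t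
      unfolding Q_def by (rule arg_cong[where f = "emeasure M"]) (auto simp: space_pair_measure)
    then show ?thesis using measurable_emeasure_Pair[OF A] by (simp cong: measurable_cong)
  qed
  have Q: "enn2real (Q n t) = (LINT y:ball x (r n)|lborel. p t y)"
    and pi: "integrable lborel (p t)" if t: "t \<in> {0..T}" for n t
  proof -
    have m [measurable]: "p t \<in> borel_measurable borel" by (rule borel_measurable_continuous_onI[OF cont[OF t]])
    have lt: "l t = lam t" using t by (simp add: l_def)
    have d: "distr M lborel (Z t) = density lborel (\<lambda>x. ennreal (p t x))"
      using p[OF t] by (simp add: distributed_def Z_def[abs_def] lt)
    have Zm: "Z t \<in> measurable M lborel" unfolding Z_def by measurable
    have tot: "(\<integral>\<^sup>+y. ennreal (p t y) \<partial>lborel) = 1"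
    proof -
      have "(\<integral>\<^sup>+y. ennreal (p t y) \<partial>lborel) = emeasure (density lborel (\<lambda>x. ennreal (p t x))) UNIV"
        by (simp add: emeasure_density)
      also have "\<dots> = 1" unfolding d[symmetric] using emeasure_space_1 by (subst emeasure_distr[OF Zm]) auto
      finally show ?thesis .
    qed
    show i: "integrable lborel (p t)"
      by (rule integrableI_nonneg) (use m pos[OF t] tot in auto)
    have "Q n t = emeasure (distr M lborel (Z t)) (ball x (r n))"
      unfolding Q_def by (subst emeasure_distr[OF Zm]) (auto intro!: arg_cong[where f = "emeasure M"])
    also have "\<dots> = (\<integral>\<^sup>+y. ennreal (indicator (ball x (r n)) y * p t y) \<partial>lborel)"
      unfolding d by (subst emeasure_density) (auto intro!: nn_integral_cong simp: indicator_def)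
    also have "\<dots> = ennreal (LINT y:ball x (r n)|lborel. p t y)"
      unfolding set_lebesgue_integral_def real_scaleR_def
    proof (rule nn_integral_eq_integral)
      show "integrable lborel (\<lambda>y. indicator (ball x (r n)) y * p t y)"
        using integrable_mult_indicator[OF _ i, of "ball x (r n)"] by simp
    qed (use pos[OF t] in auto)
    finally show "enn2real (Q n t) = (LINT y:ball x (r n)|lborel. p t y)"
      using pos[OF t] by (simp add: set_lebesgue_integral_def integral_nonneg_AE)
  qed
  show ?thesis
  proof (rule borel_measurable_LIMSEQ_real)
    fix t
    show "(\<lambda>n. if t \<in> {0..T} then enn2real (Q n t) / measure lborel (ball x (r n)) else 1)
      \<longlonglongrightarrow> (if t \<in> {0..T} then p t x else 1)"
    proof (cases "t \<in> {0..T}")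
      case True
      have "continuous (at x) (p t)" using cont[OF True] by (simp add: continuous_on_eq_continuous_at)
      from ball_average_tendsto[OF pi[OF True] this] True show ?thesis by (simp only: Q if_True r_def)
    next
      case False
      then show ?thesis by (simp only: if_False tendsto_const)
    qed
  next
    fix n
    show "(\<lambda>t. if t \<in> {0..T} then enn2real (Q n t) / measure lborel (ball x (r n)) else 1) \<in> borel_measurable borel"
      by measurable
  qed
qed

lemma grad_path_measurable:
  fixes q :: "real \<Rightarrow> 'a::euclidean_space \<Rightarrow> real"
  assumes [measurable]: "\<And>x. (\<lambda>t. q t x) \<in> borel_measurable borel" and d: "\<And>t x. q t differentiable (at x)"
  shows "(\<lambda>t. grad (q t) x) \<in> borel_measurable borel"
proof (rule borel_measurable_euclidean_space[THEN iffD2], rule ballI)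
  fix e :: 'a
  show "(\<lambda>t. grad (q t) x \<bullet> e) \<in> borel_measurable borel"
  proof (rule borel_measurable_LIMSEQ_real)
    fix t
    show "(\<lambda>n. (q t (x + inverse (real (Suc n)) *\<^sub>R e) - q t x) / inverse (real (Suc n))) \<longlonglongrightarrow> grad (q t) x \<bullet> e"
      by (rule grad_inner_tendsto[OF d])
  qed measurable
qed

lemma brownian_norm_mean_le:
  fixes B :: "real \<Rightarrow> 'w \<Rightarrow> 'a::euclidean_space"
  assumes B: "brownian_motion M F B" and t: "t \<in> {0..S}"
  shows "(\<integral>\<^sup>+\<omega>. ennreal (norm (B t \<omega>)) \<partial>M) \<le> ennreal (sqrt (real DIM('a) * S))"
proof (cases "t = 0")
  case True
  have "AE \<omega> in M. B t \<omega> = 0" using B True by (simp add: brownian_motion_def)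
  then have "(\<integral>\<^sup>+\<omega>. ennreal (norm (B t \<omega>)) \<partial>M) = (\<integral>\<^sup>+\<omega>. 0 \<partial>M)" by (intro nn_integral_cong_AE) auto
  then show ?thesis by simp
next
  case False
  then have t0: "0 < t" using t by simp
  have m: "(\<lambda>\<omega>. B t \<omega> - B 0 \<omega>) \<in> measurable M lborel"
    and d: "distr M lborel (\<lambda>\<omega>. B t \<omega> - B 0 \<omega>) = gauss t"
    using B t0 unfolding brownian_motion_def distributed_def gauss_def by (auto simp: gauss_density_prod)
  have "AE \<omega> in M. B 0 \<omega> = 0" using B by (simp add: brownian_motion_def)
  then have "(\<integral>\<^sup>+\<omega>. ennreal (norm (B t \<omega>)) \<partial>M) = (\<integral>\<^sup>+\<omega>. ennreal (norm (B t \<omega> - B 0 \<omega>)) \<partial>M)"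
    by (intro nn_integral_cong_AE) auto
  also have "\<dots> = (\<integral>\<^sup>+x. ennreal (norm x) \<partial>distr M lborel (\<lambda>\<omega>. B t \<omega> - B 0 \<omega>))"
    by (subst nn_integral_distr[OF m]) auto
  also have "\<dots> = ennreal (\<integral>x. norm x \<partial>(gauss t :: 'a measure))"
    unfolding d by (rule nn_integral_eq_integral) (use gauss_norm_moments(1)[OF t0] in auto)
  also have "\<dots> \<le> ennreal (sqrt (real DIM('a) * S))"
  proof (rule ennreal_leI)
    have "(\<integral>x. norm x \<partial>(gauss t :: 'a measure)) \<le> sqrt (real DIM('a) * t)" by (rule gauss_norm_moments(3)[OF t0])
    also have "\<dots> \<le> sqrt (real DIM('a) * S)" using t by (intro real_sqrt_le_mono mult_left_mono) auto
    finally show "(\<integral>x. norm x \<partial>(gauss t :: 'a measure)) \<le> sqrt (real DIM('a) * S)" .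
  qed
  finally show ?thesis .
qed

text \<open>The law of \<open>Y t\<close> is not prescribed for t > 0, so its first moment comes
  from the equation: Gronwall's inequality on each path, then Tonelli's theorem and the Gaussian
  moments of the noise.\<close>

lemma lipschitz_sde_moment:
  fixes Y Y' :: "real \<Rightarrow> 'w \<Rightarrow> 'a::euclidean_space"
  assumes sde: "sde_solution M F B \<beta> S \<mu>0 Y" and S: "0 < S"
    and \<beta>: "\<And>s x. s \<in> {0..S} \<Longrightarrow> \<beta> s x = b s x"
    and b: "lipschitz_drift b c"
    and Y': "(\<lambda>z. Y' (min (fst z) S) (snd z)) \<in> borel_measurable (borel \<Otimes>\<^sub>M M)"
      "AE \<omega> in M. \<forall>t\<in>{0..S}. Y' t \<omega> = Y t \<omega>"
    and init: "(\<integral>\<^sup>+\<omega>. ennreal (norm (Y 0 \<omega>)) \<partial>M) < \<infinity>"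
  shows "(\<integral>\<^sup>+r. indicator {0..S} r * (\<integral>\<^sup>+\<omega>. ennreal (norm (Y' (min r S) \<omega>)) \<partial>M) \<partial>lborel) < \<infinity>"
proof -
  interpret lipschitz_drift b c by fact
  have bm: "brownian_motion M F B" and Yc: "AE \<omega> in M. continuous_on {0..S} (\<lambda>t. Y t \<omega>)"
    and eq: "AE \<omega> in M. set_integrable lborel {0..S} (\<lambda>s. \<beta> s (Y s \<omega>)) \<and>
      (\<forall>t\<in>{0..S}. Y t \<omega> = Y 0 \<omega> + sqrt 2 *\<^sub>R B t \<omega> + (LINT s:{0..t}|lborel. \<beta> s (Y s \<omega>)))"
    using sde unfolding sde_solution_def by auto
  interpret prob_space M using bm by (simp add: brownian_motion_def)
  interpret LM: pair_sigma_finite lborel M ..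
  have Bc: "AE \<omega> in M. continuous_on {0..S} (\<lambda>t. B t \<omega>)"
  proof -
    have "AE \<omega> in M. continuous_on {0..} (\<lambda>t. B t \<omega>)" using bm by (simp add: brownian_motion_def)
    then show ?thesis by eventually_elim (auto elim: continuous_on_subset)
  qed
  have filt: "filtration (space M) F" and sub: "\<And>t. sets (F t) \<subseteq> sets M"
    and BF: "\<And>t. t \<in> {0..S} \<Longrightarrow> B t \<in> borel_measurable (F t)"
    using bm by (auto simp: brownian_motion_def)
  obtain B' where B'p: "\<And>t. t \<in> {0..S} \<Longrightarrow> (\<lambda>z. B' (min (fst z) t) (snd z)) \<in> borel_measurable (borel \<Otimes>\<^sub>M F t)"
    and B'e: "AE \<omega> in M. \<forall>t\<in>{0..S}. B' t \<omega> = B t \<omega>"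
  proof (rule progressive_version[OF filt S BF Bc])
    fix B' assume "\<And>t. t \<in> {0..S} \<Longrightarrow> (\<lambda>z. B' (min (fst z) t) (snd z)) \<in> borel_measurable (borel \<Otimes>\<^sub>M F t)"
      and "AE \<omega> in M. \<forall>t\<in>{0..S}. B' t \<omega> = B t \<omega>"
    then show thesis by (rule that)
  qed
  \<comment> \<open>Brownian motion also gets a jointly measurable version, as path integrals and
    expectations will be exchanged; both versions are clipped at S.\<close>
  define Bb where "Bb r \<omega> = B' (min r S) \<omega>" for r \<omega>
  define Yb where "Yb r \<omega> = Y' (min r S) \<omega>" for r \<omega>
  have id: "(\<lambda>\<omega>. \<omega>) \<in> M \<rightarrow>\<^sub>M F S"
  proof -
    have "space (F S) = space M" using filt by (simp add: filtration_def)
    then show ?thesis using sub[of S] by (auto simp: measurable_def)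
  qed
  have [measurable]: "(\<lambda>z. Bb (fst z) (snd z)) \<in> borel_measurable (borel \<Otimes>\<^sub>M M)"
  proof -
    have "(\<lambda>z. (fst z, snd z)) \<in> borel \<Otimes>\<^sub>M M \<rightarrow>\<^sub>M borel \<Otimes>\<^sub>M F S"
      by (intro measurable_Pair measurable_fst measurable_compose[OF measurable_snd id])
    from measurable_compose[OF this B'p[of S]] S show ?thesis by (simp add: Bb_def)
  qed
  have [measurable]: "(\<lambda>z. Yb (fst z) (snd z)) \<in> borel_measurable (borel \<Otimes>\<^sub>M M)" using Y'(1) by (simp add: Yb_def)
  have [measurable]: "Bb r \<in> borel_measurable M" "Yb r \<in> borel_measurable M" for r
    using measurable_compose[OF measurable_Pair1'[of r borel M] \<open>(\<lambda>z. Bb (fst z) (snd z)) \<in> borel_measurable (borel \<Otimes>\<^sub>M M)\<close>]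
      measurable_compose[OF measurable_Pair1'[of r borel M] \<open>(\<lambda>z. Yb (fst z) (snd z)) \<in> borel_measurable (borel \<Otimes>\<^sub>M M)\<close>] by simp_all
  define N where "N = (LINT r|lborel. norm (b r 0))"
  have N0: "0 \<le> N" unfolding N_def by simp
  \<comment> \<open>N bounds the integral of the drift at 0 over every [0, t], which leaves only the
    linear term for Gronwall's inequality.\<close>
  define A where "A r \<omega> = norm (Yb 0 \<omega>) + sqrt 2 * norm (Bb r \<omega>) + N" for r \<omega>
  have Am [measurable]: "(\<lambda>z. A (fst z) (snd z)) \<in> borel_measurable (borel \<Otimes>\<^sub>M M)" unfolding A_def by measurable
  have [measurable]: "(\<lambda>z. A (snd z) (fst z)) \<in> borel_measurable (M \<Otimes>\<^sub>M borel)"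
    using measurable_compose[OF measurable_pair_swap' Am] by (simp add: case_prod_beta)
  define C where "C = ennreal (2 * exp (2 * (c + 1) * S))"
  have path: "AE \<omega> in M. (\<integral>\<^sup>+r. indicator {0..S} r * ennreal (norm (Yb r \<omega>)) \<partial>lborel)
      \<le> C * (\<integral>\<^sup>+r. indicator {0..S} r * ennreal (A r \<omega>) \<partial>lborel)"
    using eq Yc Y'(2) B'e AE_space
  proof eventually_elim
    case (elim \<omega>)
    have Ye: "Yb r \<omega> = Y r \<omega>" "Bb r \<omega> = B r \<omega>" if "r \<in> {0..S}" for r using elim(3,4) that by (auto simp: Yb_def Bb_def)
    have i: "set_integrable lborel {0..S} (\<lambda>s. \<beta> s (Y s \<omega>))" using elim(1) by blast
    show ?case unfolding C_def
    proof (rule gronwall_integral[OF _ _ c_nonneg S])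
      show yc: "continuous_on {0..S} (\<lambda>r. norm (Yb r \<omega>))"
      proof -
        have "continuous_on {0..S} (\<lambda>r. norm (Y r \<omega>))" by (rule continuous_on_norm[OF elim(2)])
        then show ?thesis by (rule continuous_on_eq) (simp add: Ye)
      qed
      show "(\<lambda>r. A r \<omega>) \<in> borel_measurable borel"
        using measurable_compose[OF measurable_Pair2'[OF elim(5), of borel] Am] by simp
      fix t assume t: "t \<in> {0..S}"
      then have sub: "{0..t} \<subseteq> {0..S}" by auto
      have it: "set_integrable lborel {0..t} (\<lambda>s. \<beta> s (Y s \<omega>))" by (rule set_integrable_subset[OF i _ sub]) simp
      have ib: "set_integrable lborel {0..t} (\<lambda>s. norm (b s 0))"
        unfolding set_integrable_def by (rule integrable_mult_indicator) (use b_zero in auto)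
      have iy: "set_integrable lborel {0..t} (\<lambda>s. norm (Yb s \<omega>))"
        by (rule borel_integrable_atLeastAtMost'[OF continuous_on_subset[OF yc sub]])
      have "norm (LINT s:{0..t}|lborel. \<beta> s (Y s \<omega>)) \<le> (LINT s:{0..t}|lborel. norm (\<beta> s (Y s \<omega>)))"
        by (rule set_integral_norm_bound[OF it])
      also have "\<dots> \<le> (LINT s:{0..t}|lborel. norm (b s 0) + c * norm (Yb s \<omega>))"
      proof (rule set_integral_mono[OF set_integrable_norm[OF it] set_integral_add(1)[OF ib set_integrable_mult_right[OF iy]]])
        fix s assume "s \<in> {0..t}"
        then have s: "s \<in> {0..S}" using sub by blast
        show "norm (\<beta> s (Y s \<omega>)) \<le> norm (b s 0) + c * norm (Yb s \<omega>)" unfolding Ye[OF s] \<beta>[OF s] by (rule b_le)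
      qed
      also have "\<dots> = (LINT s:{0..t}|lborel. norm (b s 0)) + c * (LINT s:{0..t}|lborel. norm (Yb s \<omega>))"
        by (subst set_integral_add(2)[OF ib set_integrable_mult_right[OF iy]]) simp
      also have "(LINT s:{0..t}|lborel. norm (b s 0)) \<le> N"
        unfolding N_def set_lebesgue_integral_def
        by (rule integral_mono[OF ib[unfolded set_integrable_def]]) (use b_zero in \<open>auto simp: indicator_def\<close>)
      finally have D: "norm (LINT s:{0..t}|lborel. \<beta> s (Y s \<omega>)) \<le> N + c * (LINT s:{0..t}|lborel. norm (Yb s \<omega>))" by simp
      have z: "(0::real) \<in> {0..S}" using S by simp
      have "Yb t \<omega> = Yb 0 \<omega> + sqrt 2 *\<^sub>R Bb t \<omega> + (LINT s:{0..t}|lborel. \<beta> s (Y s \<omega>))"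
        unfolding Ye[OF t] Ye[OF z] using elim(1) t by blast
      then have "norm (Yb t \<omega>) \<le> norm (Yb 0 \<omega>) + norm (sqrt 2 *\<^sub>R Bb t \<omega>) + norm (LINT s:{0..t}|lborel. \<beta> s (Y s \<omega>))"
        by (simp add: norm_add_rule_thm norm_triangle_mono)
      then show "norm (Yb t \<omega>) \<le> A t \<omega> + c * (LINT s:{0..t}|lborel. norm (Yb s \<omega>))" using D by (simp add: A_def)
    qed simp
  qed
  define k where "k = ennreal (sqrt (real DIM('a) * S))"
  define K where "K = (\<integral>\<^sup>+\<omega>. ennreal (norm (Y 0 \<omega>)) \<partial>M) + ennreal (sqrt 2) * k + ennreal N"
  have EA: "(\<integral>\<^sup>+\<omega>. ennreal (A r \<omega>) \<partial>M) \<le> K" if r: "r \<in> {0..S}" for r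
  proof -
    have "(\<integral>\<^sup>+\<omega>. ennreal (A r \<omega>) \<partial>M) = (\<integral>\<^sup>+\<omega>. ennreal (norm (Yb 0 \<omega>)) + ennreal (sqrt 2) * ennreal (norm (Bb r \<omega>)) + ennreal N \<partial>M)"
      unfolding A_def using N0 by (intro nn_integral_cong) (simp add: ennreal_mult''[symmetric])
    also have "\<dots> = (\<integral>\<^sup>+\<omega>. ennreal (norm (Yb 0 \<omega>)) \<partial>M) + ennreal (sqrt 2) * (\<integral>\<^sup>+\<omega>. ennreal (norm (Bb r \<omega>)) \<partial>M) + ennreal N"
      by (simp add: nn_integral_add nn_integral_cmult emeasure_space_1)
    also have "(\<integral>\<^sup>+\<omega>. ennreal (norm (Yb 0 \<omega>)) \<partial>M) = (\<integral>\<^sup>+\<omega>. ennreal (norm (Y 0 \<omega>)) \<partial>M)"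
      by (rule nn_integral_cong_AE) (use Y'(2) S in \<open>auto simp: Yb_def elim!: eventually_mono\<close>)
    also have "(\<integral>\<^sup>+\<omega>. ennreal (norm (Bb r \<omega>)) \<partial>M) = (\<integral>\<^sup>+\<omega>. ennreal (norm (B r \<omega>)) \<partial>M)"
      by (rule nn_integral_cong_AE) (use B'e r in \<open>auto simp: Bb_def elim!: eventually_mono\<close>)
    also have "(\<integral>\<^sup>+\<omega>. ennreal (norm (Y 0 \<omega>)) \<partial>M) + ennreal (sqrt 2) * (\<integral>\<^sup>+\<omega>. ennreal (norm (B r \<omega>)) \<partial>M) + ennreal N \<le> K"
      unfolding K_def k_def by (intro add_mono mult_left_mono brownian_norm_mean_le[OF bm r] order_refl) auto
    finally show ?thesis .
  qed
  have K: "K < \<infinity>" using init by (simp add: K_def k_def ennreal_mult_less_top ennreal_add_less_top)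
  have "(\<integral>\<^sup>+r. indicator {0..S} r * (\<integral>\<^sup>+\<omega>. ennreal (norm (Yb r \<omega>)) \<partial>M) \<partial>lborel)
      = (\<integral>\<^sup>+r. (\<integral>\<^sup>+\<omega>. indicator {0..S} r * ennreal (norm (Yb r \<omega>)) \<partial>M) \<partial>lborel)"
    by (intro nn_integral_cong nn_integral_cmult[symmetric]) measurable
  also have "\<dots> = (\<integral>\<^sup>+\<omega>. (\<integral>\<^sup>+r. indicator {0..S} r * ennreal (norm (Yb r \<omega>)) \<partial>lborel) \<partial>M)"
    by (rule LM.Fubini'[symmetric]) (simp add: case_prod_beta)
  also have "\<dots> \<le> (\<integral>\<^sup>+\<omega>. C * (\<integral>\<^sup>+r. indicator {0..S} r * ennreal (A r \<omega>) \<partial>lborel) \<partial>M)"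
    by (rule nn_integral_mono_AE[OF path])
  also have "\<dots> = C * (\<integral>\<^sup>+\<omega>. (\<integral>\<^sup>+r. indicator {0..S} r * ennreal (A r \<omega>) \<partial>lborel) \<partial>M)"
    by (rule nn_integral_cmult) measurable
  also have "(\<integral>\<^sup>+\<omega>. (\<integral>\<^sup>+r. indicator {0..S} r * ennreal (A r \<omega>) \<partial>lborel) \<partial>M)
      = (\<integral>\<^sup>+r. (\<integral>\<^sup>+\<omega>. indicator {0..S} r * ennreal (A r \<omega>) \<partial>M) \<partial>lborel)"
    by (rule LM.Fubini') (simp add: case_prod_beta)
  also have "\<dots> \<le> (\<integral>\<^sup>+r. indicator {0..S} r * K \<partial>lborel)"
  proof (rule nn_integral_mono)
    fix r :: real
    show "(\<integral>\<^sup>+\<omega>. indicator {0..S} r * ennreal (A r \<omega>) \<partial>M) \<le> indicator {0..S} r * K"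
      using EA[of r] by (cases "r \<in> {0..S}") auto
  qed
  also have "\<dots> = K * ennreal S" using S by (subst nn_integral_multc) (auto simp: mult.commute)
  also have "C * (K * ennreal S) < \<infinity>" using K by (simp add: C_def ennreal_mult_less_top)
  finally show ?thesis by (simp add: Yb_def mult_left_mono)
qed

section \<open>Lower integrals and change of time\<close>

text \<open>\<open>nn_integral\<close> is a supremum over simple functions below h even if h is not
  measurable, that is, a lower integral. A countable supremum of nearly optimal simple functions is
  a measurable minorant that attains it.\<close>

lemma measurable_minorant:
  fixes h :: "'b \<Rightarrow> ennreal"
  obtains g where "g \<in> borel_measurable M" and "\<And>x. g x \<le> h x" and "integral\<^sup>N M g = integral\<^sup>N M h"
proof -
  let ?A = "{g. simple_function M g \<and> g \<le> h}"
  have "?A \<noteq> {}" by (auto intro!: exI[of _ "\<lambda>_. 0"] simp: le_fun_def)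
  from ennreal_SUP_countable_SUP[OF this, of "integral\<^sup>S M"]
  obtain a :: "nat \<Rightarrow> ennreal" where a: "range a \<subseteq> integral\<^sup>S M ` ?A" "integral\<^sup>N M h = (SUP i. a i)"
    unfolding nn_integral_def by blast
  have "\<forall>i. \<exists>g. simple_function M g \<and> g \<le> h \<and> a i = integral\<^sup>S M g" using a(1) by blast
  then obtain g where g: "\<And>i. simple_function M (g i)" "\<And>i. g i \<le> h" "\<And>i. a i = integral\<^sup>S M (g i)"
    by metis
  let ?g = "\<lambda>x. SUP i. g i x"
  have [measurable]: "g i \<in> borel_measurable M" for i by (rule borel_measurable_simple_function[OF g(1)])
  show thesis
  proof (rule that)
    show "?g \<in> borel_measurable M" by measurable
    show le: "?g x \<le> h x" for x using g(2) by (auto intro: SUP_least simp: le_fun_def)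
    have "a i \<le> integral\<^sup>N M ?g" for i
      unfolding g(3) nn_integral_eq_simple_integral[OF g(1), symmetric]
      by (rule nn_integral_mono) (auto intro: SUP_upper)
    then have "integral\<^sup>N M h \<le> integral\<^sup>N M ?g" unfolding a(2) by (rule SUP_least)
    then show "integral\<^sup>N M ?g = integral\<^sup>N M h" using nn_integral_mono[of M ?g h] le by (intro antisym) auto
  qed
qed

text \<open>A single measurable minorant of the rate has to be optimal on all the intervals [s, T].
  Optimal minorants for rational left ends are joined by a supremum, and a general s is reached from
  the right.\<close>

lemma lower_integral_minorant:
  fixes f :: "real \<Rightarrow> ennreal"
  obtains F where "F \<in> borel_measurable borel" and "\<And>u. F u \<le> f u"
    and "\<And>s. (\<integral>\<^sup>+u\<in>{s..T}. F u \<partial>lborel) = (\<integral>\<^sup>+u\<in>{s..T}. f u \<partial>lborel)"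
proof -
  have "\<forall>q. \<exists>G. G \<in> borel_measurable lborel \<and> (\<forall>u. G u \<le> f u * indicator {q..T} u) \<and>
      integral\<^sup>N lborel G = (\<integral>\<^sup>+u\<in>{q..T}. f u \<partial>lborel)" for q :: real
  proof
    fix q :: real
    obtain G where "G \<in> borel_measurable lborel" "\<And>u. G u \<le> f u * indicator {q..T} u"
      "integral\<^sup>N lborel G = (\<integral>\<^sup>+u\<in>{q..T}. f u \<partial>lborel)"
      by (rule measurable_minorant[of lborel "\<lambda>u. f u * indicator {q..T} u"]) blast
    then show "\<exists>G. G \<in> borel_measurable lborel \<and> (\<forall>u. G u \<le> f u * indicator {q..T} u) \<and>
      integral\<^sup>N lborel G = (\<integral>\<^sup>+u\<in>{q..T}. f u \<partial>lborel)" by blast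
  qed
  then obtain G where G: "\<And>q. G q \<in> borel_measurable lborel" "\<And>q u. G q u \<le> f u * indicator {q..T} u"
      "\<And>q. integral\<^sup>N lborel (G q) = (\<integral>\<^sup>+u\<in>{q..T}. f u \<partial>lborel)" by metis
  note [measurable] = G(1)
  define F where "F u = (SUP q\<in>\<rat>. G q u)" for u
  have F [measurable]: "F \<in> borel_measurable borel"
    unfolding F_def[abs_def] by (rule borel_measurable_SUP) (use countable_rat G(1) in auto)
  have Ff: "F u \<le> f u" for u
    unfolding F_def
  proof (rule SUP_least)
    fix q
    have "G q u \<le> f u * indicator {q..T} u" by (rule G(2))
    also have "\<dots> \<le> f u" by (simp add: indicator_def)
    finally show "G q u \<le> f u" .
  qed
  have rat: "(\<integral>\<^sup>+u\<in>{q..T}. f u \<partial>lborel) \<le> (\<integral>\<^sup>+u\<in>{q..T}. F u \<partial>lborel)" if q: "q \<in> \<rat>" for q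
    unfolding G(3)[symmetric]
  proof (rule nn_integral_mono)
    fix u
    have "G q u \<le> F u" unfolding F_def by (rule SUP_upper[OF q])
    then show "G q u \<le> F u * indicator {q..T} u" using G(2)[of q u] by (cases "u \<in> {q..T}") auto
  qed
  have ge: "(\<integral>\<^sup>+u\<in>{s..T}. f u \<partial>lborel) \<le> (\<integral>\<^sup>+u\<in>{s..T}. F u \<partial>lborel)" for s
  proof -
    have "\<exists>q. q \<in> \<rat> \<and> s < q \<and> q < s + inverse (real (Suc n))" for n
      using Rats_dense_in_real[of s "s + inverse (real (Suc n))"] by auto
    then obtain q where q: "\<And>n. q n \<in> \<rat>" "\<And>n. s < q n" "\<And>n. q n < s + inverse (real (Suc n))" by metis
    \<comment> \<open>Running minima of rationals that approach s from the right: they decrease, so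
      these half-lines increase to the open half-line beyond s.\<close>
    define E where "E n = {Min (q ` {..n})..}" for n
    have mq0: "Min (q ` {..n}) \<in> \<rat>" "s < Min (q ` {..n})" "Min (q ` {..n}) \<le> q n" for n
    proof -
      have "Min (q ` {..n}) \<in> q ` {..n}" by (rule Min_in) auto
      then obtain j where j: "Min (q ` {..n}) = q j" by blast
      show "Min (q ` {..n}) \<in> \<rat>" "s < Min (q ` {..n})" unfolding j by (rule q)+
      show "Min (q ` {..n}) \<le> q n" by (rule Min_le) auto
    qed
    define m where "m n = Min (q ` {..n})" for n
    note mq = mq0[folded m_def] and E_def = E_def[folded m_def]
    have E_inc: "incseq E"
    proof (rule incseq_SucI)
      fix n
      have "m (Suc n) \<le> m n" unfolding m_def by (rule Min_antimono) auto
      then show "E n \<subseteq> E (Suc n)" by (auto simp: E_def)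
    qed
    have E_un: "(SUP n. indicator (E n) u :: ennreal) = indicator {s<..} u" for u
    proof (cases "s < u")
      case True
      then obtain n where "inverse (real (Suc n)) < u - s" using reals_Archimedean[of "u - s"] by auto
      then have "m n \<le> u" using q(3)[of n] mq(3)[of n] by linarith
      then have "u \<in> E n" unfolding E_def by simp
      then have "1 \<le> (SUP n. indicator (E n) u :: ennreal)" by (intro SUP_upper2[of n]) auto
      moreover have "(SUP n. indicator (E n) u :: ennreal) \<le> 1" by (rule SUP_least) (simp add: indicator_def)
      ultimately have "(SUP n. indicator (E n) u :: ennreal) = 1" by (rule antisym[rotated])
      then show ?thesis using True by simp
    next
      case False
      then have "u \<notin> E n" for n using mq(2)[of n] by (auto simp: E_def)
      then show ?thesis using False by simp
    qed
    \<comment> \<open>The optimal minorant \<open>G s\<close> is exhausted by its restrictions to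
      the sets \<open>E n\<close>, each of which is a minorant on an interval with rational left
      end. The point s itself is a null set.\<close>
    have "(\<integral>\<^sup>+u\<in>{s..T}. f u \<partial>lborel) = (\<integral>\<^sup>+u. G s u \<partial>lborel)" by (simp add: G(3))
    also have "\<dots> = (\<integral>\<^sup>+u. (SUP n. G s u * indicator (E n) u) \<partial>lborel)"
    proof (rule nn_integral_cong_AE)
      have "AE u in lborel. u \<noteq> s" by (rule AE_lborel_singleton)
      then show "AE u in lborel. G s u = (SUP n. G s u * indicator (E n) u)"
      proof eventually_elim
        case (elim u)
        have "(SUP n. G s u * indicator (E n) u) = G s u * indicator {s<..} u"
          unfolding E_un[symmetric] by (simp add: SUP_mult_left_ennreal)
        also have "\<dots> = G s u" using G(2)[of s u] elim by (cases "s < u") auto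
        finally show ?case by simp
      qed
    qed
    also have "\<dots> = (SUP n. \<integral>\<^sup>+u. G s u * indicator (E n) u \<partial>lborel)"
    proof (rule nn_integral_monotone_convergence_SUP)
      show "incseq (\<lambda>n u. G s u * indicator (E n) u)"
        using E_inc by (auto simp: incseq_def le_fun_def intro!: mult_left_mono split: split_indicator)
    qed (simp add: E_def)
    also have "\<dots> \<le> (\<integral>\<^sup>+u\<in>{s..T}. F u \<partial>lborel)"
    proof (rule SUP_least)
      fix n
      have "(\<integral>\<^sup>+u. G s u * indicator (E n) u \<partial>lborel) \<le> (\<integral>\<^sup>+u\<in>{m n..T}. f u \<partial>lborel)"
      proof (rule nn_integral_mono)
        fix u
        show "G s u * indicator (E n) u \<le> f u * indicator {m n..T} u"
          using G(2)[of s u] by (cases "u \<in> E n"; cases "u \<in> {s..T}") (auto simp: E_def)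
      qed
      also have "\<dots> \<le> (\<integral>\<^sup>+u\<in>{m n..T}. F u \<partial>lborel)" by (rule rat[OF mq(1)])
      also have "\<dots> \<le> (\<integral>\<^sup>+u\<in>{s..T}. F u \<partial>lborel)"
        by (rule nn_integral_mono) (use mq(2)[of n] in \<open>auto simp: indicator_def\<close>)
      finally show "(\<integral>\<^sup>+u. G s u * indicator (E n) u \<partial>lborel) \<le> (\<integral>\<^sup>+u\<in>{s..T}. F u \<partial>lborel)" .
    qed
    finally show ?thesis .
  qed
  show thesis
  proof (rule that[OF F Ff])
    fix s
    show "(\<integral>\<^sup>+u\<in>{s..T}. F u \<partial>lborel) = (\<integral>\<^sup>+u\<in>{s..T}. f u \<partial>lborel)"
      by (intro antisym ge nn_integral_mono mult_right_mono Ff) auto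
  qed
qed

lemma exp_minus_measurable [measurable]: "exp_minus \<in> borel_measurable borel"
  unfolding exp_minus_def[abs_def] by measurable

text \<open>\<open>enn2real\<close> sends infinity to 0, so an infinite limit is treated separately:
  the real exponents then diverge, and the exponentials tend to the value 0 of
  \<open>exp_minus\<close>.\<close>

lemma exp_minus_tendsto:
  fixes J :: "nat \<Rightarrow> ennreal"
  assumes J: "J \<longlonglongrightarrow> l" and fin: "\<And>n. J n < \<top>"
  shows "(\<lambda>n. exp_minus (J n)) \<longlonglongrightarrow> exp_minus l"
proof -
  have e: "exp_minus (J n) = ennreal (exp (- enn2real (J n)))" for n using fin[of n] by (simp add: exp_minus_def)
  show ?thesis
  proof (cases "l = \<top>")
    case True
    have "filterlim (\<lambda>n. enn2real (J n)) at_top sequentially"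
      unfolding filterlim_at_top
    proof
      fix Z
      have "\<forall>\<^sub>F n in sequentially. ennreal Z < J n" by (rule order_tendstoD(1)[OF J]) (simp add: True)
      then show "\<forall>\<^sub>F n in sequentially. Z \<le> enn2real (J n)"
      proof eventually_elim
        case (elim n)
        then have "ennreal Z \<le> ennreal (enn2real (J n))" using fin[of n] by simp
        then show ?case by (cases "0 \<le> Z") (auto intro: order.trans[of _ 0])
      qed
    qed
    then have "(\<lambda>n. exp (- enn2real (J n))) \<longlonglongrightarrow> 0"
      by (intro filterlim_compose[OF exp_at_bot] filterlim_compose[OF filterlim_uminus_at_bot_at_top])
    then have "(\<lambda>n. ennreal (exp (- enn2real (J n)))) \<longlonglongrightarrow> ennreal 0" by (rule tendsto_ennrealI)
    then show ?thesis unfolding e using True by (simp add: exp_minus_def)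
  next
    case False
    then have "(\<lambda>n. enn2real (J n)) \<longlonglongrightarrow> enn2real l"
      by (intro tendsto_enn2real) (use J fin in \<open>auto simp: less_top\<close>)
    then show ?thesis unfolding e using False by (auto simp: exp_minus_def intro!: tendsto_ennrealI tendsto_exp tendsto_minus)
  qed
qed

text \<open>Removes the cap n on the rate: the inner integrals increase, possibly to infinity, and
  \<open>exp_minus\<close> follows them there. The energy dominates the outer integrands.\<close>

lemma weighted_energy_limit:
  fixes e :: "real \<Rightarrow> real" and H :: "real \<Rightarrow> ennreal"
  assumes [measurable]: "e \<in> borel_measurable borel" "H \<in> borel_measurable borel"
    and e0: "\<And>r. 0 \<le> e r" and fin: "(\<integral>\<^sup>+r. ennreal (e r) \<partial>lborel) < \<infinity>"
    and D: "\<And>n :: nat. D \<le> ennreal ((LINT r:{0..S}|lborel. e r * exp (- (LINT q:{r..S}|lborel. enn2real (min (H q) (of_nat n))))) / 2)"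
  shows "D \<le> ennreal (1 / 2) * (\<integral>\<^sup>+r\<in>{0..S}. ennreal (e r) * exp_minus (\<integral>\<^sup>+q\<in>{r..S}. H q \<partial>lborel) \<partial>lborel)"
proof -
  define h where "h n q = min (H q) (of_nat n)" for n :: nat and q
  have [measurable]: "h n \<in> borel_measurable borel" for n unfolding h_def[abs_def] by measurable
  have h_fin: "h n q < \<top>" for n q unfolding h_def by (simp add: min_less_iff_disj of_nat_less_top)
  have hn: "h n q \<le> of_nat n" for n q by (simp add: h_def)
  define J where "J n r = (\<integral>\<^sup>+q\<in>{r..S}. h n q \<partial>lborel)" for n r
  have [measurable]: "J n \<in> borel_measurable borel" for n
    unfolding J_def[abs_def] by (rule sigma_finite_measure.borel_measurable_nn_integral) (auto simp: indicator_def lborel.sigma_finite_measure_axioms)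
  have J_fin: "J n r < \<top>" for n r
  proof -
    have "J n r \<le> (\<integral>\<^sup>+q\<in>{r..S}. of_nat n \<partial>lborel)" unfolding J_def by (intro nn_integral_mono mult_right_mono hn) simp
    also have "\<dots> = of_nat n * emeasure lborel {r..S}" by (rule nn_integral_cmult_indicator) simp
    also have "\<dots> < \<top>" by (simp add: emeasure_lborel_Icc_eq ennreal_mult_less_top of_nat_less_top)
    finally show ?thesis .
  qed
  have J_real: "(LINT q:{r..S}|lborel. enn2real (h n q)) = enn2real (J n r)" for n r
  proof -
    have "J n r = (\<integral>\<^sup>+q. ennreal (indicator {r..S} q *\<^sub>R enn2real (h n q)) \<partial>lborel)"
      unfolding J_def by (intro nn_integral_cong) (use h_fin in \<open>auto simp: indicator_def\<close>)
    then show ?thesis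
      unfolding set_lebesgue_integral_def by (subst integral_eq_nn_integral) auto
  qed
  have lim: "(\<lambda>n. J n r) \<longlonglongrightarrow> (\<integral>\<^sup>+q\<in>{r..S}. H q \<partial>lborel)" for r
  proof -
    have inc: "incseq (\<lambda>n q. h n q * indicator {r..S} q)"
      unfolding incseq_def le_fun_def h_def
      by (intro allI impI mult_right_mono min.mono order_refl) auto
    have sup: "(SUP n. h n q * indicator {r..S} q) = H q * indicator {r..S} q" for q
    proof -
      have "(SUP n. h n q) = H q"
      proof (cases "H q = \<top>")
        case True
        then show ?thesis by (simp add: h_def ennreal_SUP_of_nat_eq_top)
      next
        case False
        then obtain n where "H q < of_nat n" using ennreal_Ex_less_of_nat[of "H q"] by (auto simp: less_top)
        then have n: "h n q = H q" by (simp add: h_def min_def less_imp_le)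
        show ?thesis
        proof (rule antisym)
          show "(SUP n. h n q) \<le> H q" by (rule SUP_least) (simp add: h_def)
          show "H q \<le> (SUP n. h n q)" unfolding n[symmetric] by (rule SUP_upper) simp
        qed
      qed
      then show ?thesis by (simp add: SUP_mult_right_ennreal[symmetric])
    qed
    have "(\<integral>\<^sup>+q\<in>{r..S}. H q \<partial>lborel) = (SUP n. J n r)"
      unfolding J_def sup[symmetric] by (rule nn_integral_monotone_convergence_SUP[OF inc]) measurable
    moreover have "incseq (\<lambda>n. J n r)"
      unfolding J_def by (intro incseq_SucI nn_integral_mono) (use inc in \<open>simp add: incseq_Suc_iff le_fun_def\<close>)
    ultimately show ?thesis using LIMSEQ_SUP[of "\<lambda>n. J n r"] by simp
  qed
  have one: "exp_minus x \<le> 1" for x by (simp add: exp_minus_def)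
  have conv: "(\<lambda>n. \<integral>\<^sup>+r\<in>{0..S}. ennreal (e r) * exp_minus (J n r) \<partial>lborel)
    \<longlonglongrightarrow> (\<integral>\<^sup>+r\<in>{0..S}. ennreal (e r) * exp_minus (\<integral>\<^sup>+q\<in>{r..S}. H q \<partial>lborel) \<partial>lborel)"
  proof (rule nn_integral_dominated_convergence[where w = "\<lambda>r. ennreal (e r)"])
    show "(\<lambda>r. ennreal (e r) * exp_minus (\<integral>\<^sup>+q\<in>{r..S}. H q \<partial>lborel) * indicator {0..S} r) \<in> borel_measurable lborel"
    proof -
      have [measurable]: "(\<lambda>r. \<integral>\<^sup>+q\<in>{r..S}. H q \<partial>lborel) \<in> borel_measurable borel"
        by (rule sigma_finite_measure.borel_measurable_nn_integral) (auto simp: indicator_def lborel.sigma_finite_measure_axioms)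
      show ?thesis by measurable
    qed
    show "(\<integral>\<^sup>+r. ennreal (e r) \<partial>lborel) < \<infinity>" by (rule fin)
    fix n
    show "AE r in lborel. ennreal (e r) * exp_minus (J n r) * indicator {0..S} r \<le> ennreal (e r)"
    proof (rule AE_I2)
      fix r
      have "ennreal (e r) * exp_minus (J n r) * indicator {0..S} r \<le> ennreal (e r) * 1 * 1"
        by (intro mult_mono one) (auto simp: indicator_def)
      then show "ennreal (e r) * exp_minus (J n r) * indicator {0..S} r \<le> ennreal (e r)" by simp
    qed
  next
    show "AE r in lborel. (\<lambda>n. ennreal (e r) * exp_minus (J n r) * indicator {0..S} r)
      \<longlonglongrightarrow> ennreal (e r) * exp_minus (\<integral>\<^sup>+q\<in>{r..S}. H q \<partial>lborel) * indicator {0..S} r"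
    proof (rule AE_I2)
      fix r
      have "(\<lambda>n. (ennreal (e r) * indicator {0..S} r) * exp_minus (J n r))
        \<longlonglongrightarrow> (ennreal (e r) * indicator {0..S} r) * exp_minus (\<integral>\<^sup>+q\<in>{r..S}. H q \<partial>lborel)"
        by (intro ennreal_tendsto_cmult exp_minus_tendsto[OF lim J_fin]) (auto simp: ennreal_mult_less_top indicator_def)
      then show "(\<lambda>n. ennreal (e r) * exp_minus (J n r) * indicator {0..S} r)
        \<longlonglongrightarrow> ennreal (e r) * exp_minus (\<integral>\<^sup>+q\<in>{r..S}. H q \<partial>lborel) * indicator {0..S} r" by (simp only: mult_ac)
    qed
  qed measurable
  have Dn: "D \<le> ennreal (1 / 2) * (\<integral>\<^sup>+r\<in>{0..S}. ennreal (e r) * exp_minus (J n r) \<partial>lborel)" for n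
  proof -
    have em: "exp_minus (J n r) = ennreal (exp (- enn2real (J n r)))" for r using J_fin[of n r] by (simp add: exp_minus_def)
    have ei: "integrable lborel e" by (rule integrableI_nonneg) (use e0 fin in auto)
    have i: "integrable lborel (\<lambda>r. indicator {0..S} r *\<^sub>R (e r * exp (- enn2real (J n r))))"
    proof (rule Bochner_Integration.integrable_bound[OF ei])
      show "AE r in lborel. norm (indicator {0..S} r *\<^sub>R (e r * exp (- enn2real (J n r)))) \<le> norm (e r)"
      proof (rule AE_I2)
        fix r
        have "e r * exp (- enn2real (J n r)) \<le> e r * 1" using e0 by (intro mult_left_mono) auto
        then show "norm (indicator {0..S} r *\<^sub>R (e r * exp (- enn2real (J n r)))) \<le> norm (e r)"
          using e0[of r] by (auto simp: indicator_def abs_mult)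
      qed
    qed measurable
    have "(\<integral>\<^sup>+r\<in>{0..S}. ennreal (e r) * exp_minus (J n r) \<partial>lborel)
        = (\<integral>\<^sup>+r. ennreal (indicator {0..S} r *\<^sub>R (e r * exp (- enn2real (J n r)))) \<partial>lborel)"
      by (intro nn_integral_cong) (use e0 in \<open>auto simp: em indicator_def ennreal_mult''\<close>)
    also have "\<dots> = ennreal (LINT r:{0..S}|lborel. e r * exp (- enn2real (J n r)))"
      unfolding set_lebesgue_integral_def by (rule nn_integral_eq_integral[OF i]) (use e0 in auto)
    finally have eq: "(\<integral>\<^sup>+r\<in>{0..S}. ennreal (e r) * exp_minus (J n r) \<partial>lborel)
      = ennreal (LINT r:{0..S}|lborel. e r * exp (- enn2real (J n r)))" .
    have "D \<le> ennreal ((1 / 2) * (LINT r:{0..S}|lborel. e r * exp (- enn2real (J n r))))"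
      using D[of n] unfolding h_def[symmetric] J_real by simp
    also have "\<dots> = ennreal (1 / 2) * ennreal (LINT r:{0..S}|lborel. e r * exp (- enn2real (J n r)))"
      by (rule ennreal_mult') simp
    finally show ?thesis unfolding eq .
  qed
  have "(\<lambda>n. ennreal (1 / 2) * (\<integral>\<^sup>+r\<in>{0..S}. ennreal (e r) * exp_minus (J n r) \<partial>lborel))
    \<longlonglongrightarrow> ennreal (1 / 2) * (\<integral>\<^sup>+r\<in>{0..S}. ennreal (e r) * exp_minus (\<integral>\<^sup>+q\<in>{r..S}. H q \<partial>lborel) \<partial>lborel)"
    by (rule ennreal_tendsto_cmult[OF ennreal_less_top conv])
  then show ?thesis by (rule LIMSEQ_le_const) (use Dn in auto)
qed

section \<open>Change of time and the bound on the terminal entropy\<close>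

lemma AE_lborel_scale:
  fixes \<kappa> :: real
  assumes P: "AE t in lborel. P t" and \<kappa>: "\<kappa> \<noteq> 0"
  shows "AE s in lborel. P (s / \<kappa>)"
proof -
  obtain N where N: "{t \<in> space lborel. \<not> P t} \<subseteq> N" "emeasure lborel N = 0" "N \<in> sets lborel"
    by (rule AE_E[OF P])
  have "N \<in> null_sets lborel" using N by auto
  then have "AE t in lborel. t \<notin> N" by (rule AE_not_in)
  then have "AE s in lborel. 0 + (1 / \<kappa>) * s \<notin> N"
    by (intro AE_borel_affine) (use N(3) \<kappa> in auto)
  then show ?thesis by eventually_elim (use N(1) in auto)
qed

text \<open>Substituting u = \<kappa> q inside and s = \<kappa> r outside produces one factor
  1/\<kappa> each.\<close>

lemma weighted_energy_time_change:
  fixes e :: "real \<Rightarrow> real" and F :: "real \<Rightarrow> ennreal"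
  assumes [measurable]: "e \<in> borel_measurable borel" "F \<in> borel_measurable borel" and \<kappa>: "0 < \<kappa>"
  shows "(\<integral>\<^sup>+r\<in>{0..T / \<kappa>}. ennreal (e r) * exp_minus (\<integral>\<^sup>+q\<in>{r..T / \<kappa>}. F (\<kappa> * q) \<partial>lborel) \<partial>lborel)
    = ennreal (1 / \<kappa>) * (\<integral>\<^sup>+s\<in>{0..T}. ennreal (e (s / \<kappa>)) * exp_minus (ennreal (1 / \<kappa>) * (\<integral>\<^sup>+u\<in>{s..T}. F u \<partial>lborel)) \<partial>lborel)"
proof -
  have inner: "(\<integral>\<^sup>+q\<in>{r..T / \<kappa>}. F (\<kappa> * q) \<partial>lborel) = ennreal (1 / \<kappa>) * (\<integral>\<^sup>+u\<in>{\<kappa> * r..T}. F u \<partial>lborel)" for r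
  proof -
    have "(\<integral>\<^sup>+q\<in>{r..T / \<kappa>}. F (\<kappa> * q) \<partial>lborel) = ennreal \<bar>1 / \<kappa>\<bar> *
        (\<integral>\<^sup>+u. F (\<kappa> * (0 + (1 / \<kappa>) * u)) * indicator {r..T / \<kappa>} (0 + (1 / \<kappa>) * u) \<partial>lborel)"
      by (rule nn_integral_real_affine) (use \<kappa> in auto)
    also have "(\<integral>\<^sup>+u. F (\<kappa> * (0 + (1 / \<kappa>) * u)) * indicator {r..T / \<kappa>} (0 + (1 / \<kappa>) * u) \<partial>lborel)
        = (\<integral>\<^sup>+u\<in>{\<kappa> * r..T}. F u \<partial>lborel)"
      by (intro nn_integral_cong) (use \<kappa> in \<open>auto simp: indicator_def field_simps\<close>)
    finally show ?thesis using \<kappa> by simp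
  qed
  have [measurable]: "(\<lambda>r. \<integral>\<^sup>+u\<in>{\<kappa> * r..T}. F u \<partial>lborel) \<in> borel_measurable borel"
    by (rule sigma_finite_measure.borel_measurable_nn_integral) (auto simp: indicator_def lborel.sigma_finite_measure_axioms)
  have "(\<integral>\<^sup>+r\<in>{0..T / \<kappa>}. ennreal (e r) * exp_minus (ennreal (1 / \<kappa>) * (\<integral>\<^sup>+u\<in>{\<kappa> * r..T}. F u \<partial>lborel)) \<partial>lborel)
    = ennreal \<bar>1 / \<kappa>\<bar> * (\<integral>\<^sup>+s. ennreal (e (0 + (1 / \<kappa>) * s)) *
      exp_minus (ennreal (1 / \<kappa>) * (\<integral>\<^sup>+u\<in>{\<kappa> * (0 + (1 / \<kappa>) * s)..T}. F u \<partial>lborel)) * indicator {0..T / \<kappa>} (0 + (1 / \<kappa>) * s) \<partial>lborel)"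
    by (rule nn_integral_real_affine) (use \<kappa> in auto)
  also have "(\<integral>\<^sup>+s. ennreal (e (0 + (1 / \<kappa>) * s)) *
      exp_minus (ennreal (1 / \<kappa>) * (\<integral>\<^sup>+u\<in>{\<kappa> * (0 + (1 / \<kappa>) * s)..T}. F u \<partial>lborel)) * indicator {0..T / \<kappa>} (0 + (1 / \<kappa>) * s) \<partial>lborel)
    = (\<integral>\<^sup>+s\<in>{0..T}. ennreal (e (s / \<kappa>)) * exp_minus (ennreal (1 / \<kappa>) * (\<integral>\<^sup>+u\<in>{s..T}. F u \<partial>lborel)) \<partial>lborel)"
    by (intro nn_integral_cong) (use \<kappa> in \<open>auto simp: indicator_def divide_le_cancel zero_le_divide_iff\<close>)
  finally show ?thesis unfolding inner using \<kappa> by simp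
qed

text \<open>The constant \<kappa> / 2 collects 1/2 from the dual bound, 1/\<kappa> from the outer
  substitution and \<kappa>^2 from the energy. The estimate runs with a measurable minorant of the
  rate, whose integrals are the lower integrals of the rate itself.\<close>

lemma (in comparison) d_KL_terminal_le:
  fixes m :: "real \<Rightarrow> real"
  assumes \<kappa>: "0 < \<kappa>" and S: "S = T / \<kappa>"
    and m: "AE s in lborel. s \<in> {0..T} \<longrightarrow> X.energy (s / \<kappa>) = (\<kappa> * m s)\<^sup>2"
  shows "d_KL (distr MX borel (X S)) (distr MY borel (Y S)) \<le> ennreal (\<kappa> / 2) *
    (\<integral>\<^sup>+s\<in>{0..T}. ennreal ((m s)\<^sup>2) * exp_minus (ennreal (1 / \<kappa>) *
      (\<integral>\<^sup>+u\<in>{s..T}. inverse (C_LS (distr MY borel (Y (u / \<kappa>)))) \<partial>lborel)) \<partial>lborel)"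
proof -
  let ?f = "\<lambda>u. inverse (C_LS (distr MY borel (Y (u / \<kappa>))))"
  obtain F where F [measurable]: "F \<in> borel_measurable borel" and F_le: "\<And>u. F u \<le> ?f u"
    and F_int: "\<And>s. (\<integral>\<^sup>+u\<in>{s..T}. F u \<partial>lborel) = (\<integral>\<^sup>+u\<in>{s..T}. ?f u \<partial>lborel)"
    by (rule lower_integral_minorant[of ?f T]) blast
  have S0: "S \<in> {0..S}" using X.S by simp
  have [measurable]: "X S \<in> borel_measurable MX" "Y S \<in> borel_measurable MY"
    by (rule X.X_meas_M[OF S0], rule Y.X_meas_M[OF S0])
  have [measurable]: "X.energy \<in> borel_measurable borel" using borel_measurable_integrable[OF X.energy_int] by simp
  have "d_KL (distr MX borel (X S)) (distr MY borel (Y S)) \<le> ennreal (1 / 2) *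
    (\<integral>\<^sup>+r\<in>{0..S}. ennreal (X.energy r) * exp_minus (\<integral>\<^sup>+q\<in>{r..S}. F (\<kappa> * q) \<partial>lborel) \<partial>lborel)"
  proof (rule weighted_energy_limit)
    show "(\<integral>\<^sup>+r. ennreal (X.energy r) \<partial>lborel) < \<infinity>"
      using X.energy_int X.energy_nonneg by (simp add: integrable_iff_bounded)
    fix n :: nat
    \<comment> \<open>The rate in the slowed time, capped so that the estimate for bounded rates
      applies.\<close>
    define g where "g q = enn2real (min (F (\<kappa> * q)) (of_nat n))" for q
    have fin: "min (F (\<kappa> * q)) (of_nat n) < \<top>" for q by (simp add: min_less_iff_disj of_nat_less_top)
    then have g_eq: "ennreal (g q) = min (F (\<kappa> * q)) (of_nat n)" for q unfolding g_def by (rule ennreal_enn2real)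
    have g1: "g \<in> borel_measurable borel" unfolding g_def[abs_def] by measurable
    have g2: "0 \<le> g q" for q by (simp add: g_def)
    have g3: "g q \<le> real n" for q
    proof -
      have "ennreal (g q) \<le> ennreal (real n)" unfolding g_eq by (simp add: ennreal_of_nat_eq_real_of_nat)
      then show ?thesis by simp
    qed
    have g4: "ennreal (g t) \<le> inverse (C_LS (distr MY borel (Y t)))" for t
    proof -
      have "ennreal (g t) \<le> F (\<kappa> * t)" unfolding g_eq by simp
      also have "\<dots> \<le> ?f (\<kappa> * t)" by (rule F_le)
      finally show ?thesis using \<kappa> by simp
    qed
    have "d_KL (distr MX borel (X S)) (distr MY borel (Y S)) \<le>
        ennreal ((LINT r:{0..S}|lborel. X.energy r * exp (- (LINT q:{r..S}|lborel. g q))) / 2)"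
    proof (rule d_KL_le_dual)
      fix \<phi> :: "'a \<Rightarrow> real" and \<Lambda> K
      assume \<phi>: "\<Lambda>-lipschitz_on UNIV \<phi>" "\<And>x. \<bar>\<phi> x\<bar> \<le> K"
      have [measurable]: "\<phi> \<in> borel_measurable borel"
        by (rule borel_measurable_continuous_onI[OF lipschitz_on_continuous_on[OF \<phi>(1)]])
      have "(\<integral>x. \<phi> x \<partial>distr MX borel (X S)) = (\<integral>\<omega>. \<phi> (X S \<omega>) \<partial>MX)"
        "(\<integral>x. exp (\<phi> x) \<partial>distr MY borel (Y S)) = (\<integral>\<omega>. exp (\<phi> (Y S \<omega>)) \<partial>MY)"
        by (simp_all add: integral_distr)
      then show "(\<integral>x. \<phi> x \<partial>distr MX borel (X S)) - ln (\<integral>x. exp (\<phi> x) \<partial>distr MY borel (Y S))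
          \<le> (LINT r:{0..S}|lborel. X.energy r * exp (- (LINT q:{r..S}|lborel. g q))) / 2"
        using dual_bound[OF \<phi> g1 g2 g3 g4] by simp
    qed (simp_all add: X.prob_space_distr Y.prob_space_distr)
    then show "d_KL (distr MX borel (X S)) (distr MY borel (Y S)) \<le>
        ennreal ((LINT r:{0..S}|lborel. X.energy r * exp (- (LINT q:{r..S}|lborel. enn2real (min (F (\<kappa> * q)) (of_nat n))))) / 2)"
      unfolding g_def .
  qed (simp_all add: X.energy_nonneg)
  also have "\<dots> = ennreal (1 / 2) * (ennreal (1 / \<kappa>) * (\<integral>\<^sup>+s\<in>{0..T}. ennreal (X.energy (s / \<kappa>)) *
      exp_minus (ennreal (1 / \<kappa>) * (\<integral>\<^sup>+u\<in>{s..T}. F u \<partial>lborel)) \<partial>lborel))"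
    unfolding S by (subst weighted_energy_time_change) (use \<kappa> in auto)
  \<comment> \<open>m is tied to the energy only almost everywhere, and its measurability is not at
    hand. So \<kappa>^2 is extracted while the integrand is still written with the measurable
    energy, and m is inserted afterwards.\<close>
  also have "(\<integral>\<^sup>+s\<in>{0..T}. ennreal (X.energy (s / \<kappa>)) * exp_minus (ennreal (1 / \<kappa>) * (\<integral>\<^sup>+u\<in>{s..T}. F u \<partial>lborel)) \<partial>lborel)
    = (\<integral>\<^sup>+s. ennreal (\<kappa>\<^sup>2) * (ennreal (X.energy (s / \<kappa>) / \<kappa>\<^sup>2) *
        exp_minus (ennreal (1 / \<kappa>) * (\<integral>\<^sup>+u\<in>{s..T}. F u \<partial>lborel)) * indicator {0..T} s) \<partial>lborel)"
  proof (rule nn_integral_cong)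
    fix s
    have "ennreal (X.energy (s / \<kappa>)) = ennreal (\<kappa>\<^sup>2) * ennreal (X.energy (s / \<kappa>) / \<kappa>\<^sup>2)"
      using \<kappa> by (subst ennreal_mult''[symmetric]) (auto simp: X.energy_nonneg)
    then show "ennreal (X.energy (s / \<kappa>)) * exp_minus (ennreal (1 / \<kappa>) * (\<integral>\<^sup>+u\<in>{s..T}. F u \<partial>lborel)) * indicator {0..T} s
      = ennreal (\<kappa>\<^sup>2) * (ennreal (X.energy (s / \<kappa>) / \<kappa>\<^sup>2) *
        exp_minus (ennreal (1 / \<kappa>) * (\<integral>\<^sup>+u\<in>{s..T}. F u \<partial>lborel)) * indicator {0..T} s)"
      by (simp only: mult.assoc)
  qed
  also have "\<dots> = ennreal (\<kappa>\<^sup>2) * (\<integral>\<^sup>+s\<in>{0..T}. ennreal (X.energy (s / \<kappa>) / \<kappa>\<^sup>2) *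
        exp_minus (ennreal (1 / \<kappa>) * (\<integral>\<^sup>+u\<in>{s..T}. F u \<partial>lborel)) \<partial>lborel)"
  proof (rule nn_integral_cmult)
    have [measurable]: "(\<lambda>s. \<integral>\<^sup>+u\<in>{s..T}. F u \<partial>lborel) \<in> borel_measurable borel"
      by (rule sigma_finite_measure.borel_measurable_nn_integral) (auto simp: indicator_def lborel.sigma_finite_measure_axioms)
    show "(\<lambda>s. ennreal (X.energy (s / \<kappa>) / \<kappa>\<^sup>2) *
        exp_minus (ennreal (1 / \<kappa>) * (\<integral>\<^sup>+u\<in>{s..T}. F u \<partial>lborel)) * indicator {0..T} s) \<in> borel_measurable lborel"
      by measurable
  qed
  also have "(\<integral>\<^sup>+s\<in>{0..T}. ennreal (X.energy (s / \<kappa>) / \<kappa>\<^sup>2) *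
        exp_minus (ennreal (1 / \<kappa>) * (\<integral>\<^sup>+u\<in>{s..T}. F u \<partial>lborel)) \<partial>lborel)
    = (\<integral>\<^sup>+s\<in>{0..T}. ennreal ((m s)\<^sup>2) * exp_minus (ennreal (1 / \<kappa>) * (\<integral>\<^sup>+u\<in>{s..T}. ?f u \<partial>lborel)) \<partial>lborel)"
  proof (rule nn_integral_cong_AE)
    show "AE s in lborel. ennreal (X.energy (s / \<kappa>) / \<kappa>\<^sup>2) *
        exp_minus (ennreal (1 / \<kappa>) * (\<integral>\<^sup>+u\<in>{s..T}. F u \<partial>lborel)) * indicator {0..T} s
      = ennreal ((m s)\<^sup>2) * exp_minus (ennreal (1 / \<kappa>) * (\<integral>\<^sup>+u\<in>{s..T}. ?f u \<partial>lborel)) * indicator {0..T} s"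
      using m
    proof eventually_elim
      case (elim s)
      show ?case
      proof (cases "s \<in> {0..T}")
        case True
        then have "X.energy (s / \<kappa>) / \<kappa>\<^sup>2 = (m s)\<^sup>2" using elim \<kappa> by (simp add: power_mult_distrib)
        then show ?thesis by (simp only: F_int)
      next
        case False
        then have "indicator {0..T} s = (0 :: ennreal)" by (rule indicator_simps(2))
        then show ?thesis by (simp only: mult_zero_right)
      qed
    qed
  qed
  also have "ennreal (1 / 2) * (ennreal (1 / \<kappa>) * (ennreal (\<kappa>\<^sup>2) * J)) = ennreal (\<kappa> / 2) * J" for J
  proof -
    have "ennreal (1 / 2) * (ennreal (1 / \<kappa>) * ennreal (\<kappa>\<^sup>2)) = ennreal (1 / 2 * (1 / \<kappa> * \<kappa>\<^sup>2))"
      using \<kappa> by (simp only: ennreal_mult'' zero_le_power2 mult_nonneg_nonneg zero_le_divide_1_iff less_imp_le)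
    also have "1 / 2 * (1 / \<kappa> * \<kappa>\<^sup>2) = \<kappa> / 2" using \<kappa> by (simp add: power2_eq_square)
    finally show ?thesis by (simp only: mult.assoc[symmetric])
  qed
  finally show ?thesis .
qed

section \<open>Verification of the abstract hypotheses for the given data\<close>

lemma measurable_pair_filtration:
  assumes "filtration (space M) F" "\<And>t. sets (F t) \<subseteq> sets M" and f: "f \<in> borel_measurable (borel \<Otimes>\<^sub>M F t)"
  shows "f \<in> borel_measurable (borel \<Otimes>\<^sub>M M)"
proof -
  have "(\<lambda>\<omega>. \<omega>) \<in> M \<rightarrow>\<^sub>M F t"
    using assms(1,2) by (auto simp: measurable_def filtration_def)
  then have "(\<lambda>z. (fst z, snd z)) \<in> borel \<Otimes>\<^sub>M M \<rightarrow>\<^sub>M borel \<Otimes>\<^sub>M F t"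
    by (intro measurable_Pair measurable_fst measurable_compose[OF measurable_snd])
  from measurable_compose[OF this f] show ?thesis by simp
qed

lemma distr_cong_AE_borel:
  fixes X X' :: "'w \<Rightarrow> 'a::euclidean_space"
  assumes "X \<in> borel_measurable M" "X' \<in> borel_measurable M" "AE \<omega> in M. X' \<omega> = X \<omega>"
  shows "distr M borel X' = distr M borel X"
  by (rule distr_cong_AE) (use assms in auto)

text \<open>Both interpolation weights are at most 1, so the bound is uniform in time.\<close>

lemma interpolation_moment:
  fixes \<xi> \<zeta> :: "'w \<Rightarrow> 'a::euclidean_space"
  assumes d: "distributed M lborel (\<lambda>\<omega>. sqrt l *\<^sub>R \<xi> \<omega> + sqrt (1 - l) *\<^sub>R \<zeta> \<omega>) (\<lambda>x. ennreal (p x))"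
    and l: "l \<in> {0..1}"
  shows "(\<integral>\<^sup>+x. ennreal (norm x) \<partial>dens p) \<le> (\<integral>\<^sup>+\<omega>. ennreal (norm (\<xi> \<omega>) + norm (\<zeta> \<omega>)) \<partial>M)"
proof -
  let ?Z = "\<lambda>\<omega>. sqrt l *\<^sub>R \<xi> \<omega> + sqrt (1 - l) *\<^sub>R \<zeta> \<omega>"
  have m: "?Z \<in> M \<rightarrow>\<^sub>M lborel" and e: "distr M lborel ?Z = dens p" using d by (auto simp: distributed_def)
  have "(\<integral>\<^sup>+x. ennreal (norm x) \<partial>dens p) = (\<integral>\<^sup>+\<omega>. ennreal (norm (?Z \<omega>)) \<partial>M)"
    unfolding e[symmetric] by (rule nn_integral_distr[OF m]) simp
  also have "\<dots> \<le> (\<integral>\<^sup>+\<omega>. ennreal (norm (\<xi> \<omega>) + norm (\<zeta> \<omega>)) \<partial>M)"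
  proof (intro nn_integral_mono ennreal_leI)
    fix \<omega>
    have "norm (?Z \<omega>) \<le> sqrt l * norm (\<xi> \<omega>) + sqrt (1 - l) * norm (\<zeta> \<omega>)"
      using norm_triangle_ineq[of "sqrt l *\<^sub>R \<xi> \<omega>" "sqrt (1 - l) *\<^sub>R \<zeta> \<omega>"] l by simp
    also have "\<dots> \<le> 1 * norm (\<xi> \<omega>) + 1 * norm (\<zeta> \<omega>)"
      using l by (intro add_mono mult_right_mono) auto
    finally show "norm (?Z \<omega>) \<le> norm (\<xi> \<omega>) + norm (\<zeta> \<omega>)" by simp
  qed
  finally show ?thesis .
qed

theorem theorem6p1:
  fixes T \<kappa> c :: real
    and lam L :: "real \<Rightarrow> real"
    and U W :: "'a::euclidean_space \<Rightarrow> real"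
    and M0 :: "'w0 measure" and \<xi> \<zeta> :: "'w0 \<Rightarrow> 'a"
    and p p_hat :: "real \<Rightarrow> 'a \<Rightarrow> real"
    and v :: "real \<Rightarrow> 'a \<Rightarrow> 'a"
    and MX :: "'w1 measure" and FX :: "real \<Rightarrow> 'w1 measure" and BX X :: "real \<Rightarrow> 'w1 \<Rightarrow> 'a"
    and MY :: "'w2 measure" and FY :: "real \<Rightarrow> 'w2 measure" and BY Y :: "real \<Rightarrow> 'w2 \<Rightarrow> 'a"
  assumes "T > 0"
    and "0 < \<kappa>" and "\<kappa> < 1"
    and "\<And>t. t \<in> {0..T} \<Longrightarrow> lam t \<in> {0..1}"
    and "mono_on {0..T} lam"
    and "lam 0 = 0"
    and "prob_space M0"
    and "distributed M0 lborel \<xi> (\<lambda>x. ennreal (exp (- U x)))"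
    and "distributed M0 lborel \<zeta> (\<lambda>x. ennreal (exp (- W x)))"
    and "prob_space.indep_var M0 borel \<xi> borel \<zeta>"
    and "bounded (range (\<lambda>x. exp (- U x)))"
    and "bounded (range (\<lambda>x. exp (- W x)))"
    and "integrable M0 (\<lambda>\<omega>. (norm (\<xi> \<omega>))\<^sup>2)"
    and "integrable M0 (\<lambda>\<omega>. (norm (\<zeta> \<omega>))\<^sup>2)"
    and "\<And>t. t \<in> {0..T} \<Longrightarrow>
           distributed M0 lborel (\<lambda>\<omega>. sqrt (lam t) *\<^sub>R \<xi> \<omega> + sqrt (1 - lam t) *\<^sub>R \<zeta> \<omega>)
             (\<lambda>x. ennreal (p t x))"
    and "W2_absolutely_continuous T (\<lambda>t. dens (p t))"
    and "AE t in lborel. t \<in> {0..T} \<longrightarrow> metric_derivative_exists T (\<lambda>t. dens (p t)) t"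
    and "(\<integral>\<^sup>+t\<in>{0..T}. ennreal ((metric_derivative T (\<lambda>t. dens (p t)) t)\<^sup>2) \<partial>lborel) < \<infinity>"
    and "\<And>t. p_hat t = p (\<kappa> * t)"
    and "(\<lambda>(t, x). v t x) \<in> borel_measurable (restrict_space borel ({0..T / \<kappa>} \<times> UNIV))"
    and "weak_continuity_equation (T / \<kappa>) p_hat v"
    and "AE t in lborel. t \<in> {0..T / \<kappa>} \<longrightarrow>
           integrable (dens (p_hat t)) (\<lambda>x. (norm (v t x))\<^sup>2) \<and>
           sqrt (\<integral>x. (norm (v t x))\<^sup>2 \<partial>(dens (p_hat t)))
             = \<kappa> * metric_derivative T (\<lambda>t. dens (p t)) (\<kappa> * t)"
    and "strictly_log_concave W"
    and "\<And>t x. t \<in> {0..T} \<Longrightarrow> p t x > 0 \<and> (\<lambda>y. ln (p t y)) differentiable (at x)"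
    and "\<And>t. t \<in> {0..T} \<Longrightarrow> (L t)-lipschitz_on UNIV (grad (\<lambda>y. ln (p t y))) \<and> L t \<le> c"
    and "sde_solution MX FX BX (\<lambda>t x. grad (\<lambda>y. ln (p_hat t y)) x + v t x)
           (T / \<kappa>) (dens (p 0)) X"
    and "\<And>t. t \<in> {0..T / \<kappa>} \<Longrightarrow> distributed MX lborel (X t) (\<lambda>x. ennreal (p_hat t x))"
    and "sde_solution MY FY BY (\<lambda>t. grad (\<lambda>y. ln (p_hat t y))) (T / \<kappa>) (dens (p 0)) Y"
  shows "d_KL (dens (p T)) (distr MY borel (Y (T / \<kappa>)))
    \<le> ennreal (\<kappa> / 2) *
       (\<integral>\<^sup>+s\<in>{0..T}. ennreal ((metric_derivative T (\<lambda>t. dens (p t)) s)\<^sup>2) *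
          exp_minus (ennreal (1 / \<kappa>) *
            (\<integral>\<^sup>+u\<in>{s..T}. inverse (C_LS (distr MY borel (Y (u / \<kappa>)))) \<partial>lborel)) \<partial>lborel)"
proof -
  note T = assms(1) and \<kappa> = assms(2) and \<kappa>1 = assms(3) and lam = assms(4) and lam_mono = assms(5)
    and M0 = assms(7) and \<xi> = assms(8) and \<zeta> = assms(9) and \<xi>2 = assms(13) and \<zeta>2 = assms(14)
    and p = assms(15) and m2 = assms(18) and p_hat = assms(19) and v_meas = assms(20)
    and v_norm = assms(22) and p_diff = assms(24) and p_lip = assms(25)
    and X_sde = assms(26) and X_law = assms(27) and Y_sde = assms(28)
  define S where "S = T / \<kappa>"
  define m where "m = metric_derivative T (\<lambda>t. dens (p t))"
  have S: "0 < S" using T \<kappa> by (simp add: S_def)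
  have \<kappa>S: "\<kappa> * S = T" using \<kappa> by (simp add: S_def)
  have time: "\<kappa> * s \<in> {0..T} \<longleftrightarrow> s \<in> {0..S}" for s
    using \<kappa> by (auto simp: S_def field_simps zero_le_mult_iff)
  interpret M0: prob_space M0 by fact
  have [measurable]: "\<xi> \<in> borel_measurable M0" "\<zeta> \<in> borel_measurable M0"
    using \<xi> \<zeta> by (auto simp: distributed_def)
  have p_pos: "0 < p t x" if "t \<in> {0..T}" for t x using p_diff[OF that] by blast
  have lnp_diff: "(\<lambda>y. ln (p t y)) differentiable (at x)" if "t \<in> {0..T}" for t x using p_diff[OF that] by blast
  \<comment> \<open>Differentiability is assumed of ln p, so continuity of p is recovered through
    the exponential.\<close>
  have p_cont: "continuous_on UNIV (p t)" if t: "t \<in> {0..T}" for t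
  proof -
    have "continuous_on UNIV (\<lambda>y. exp (ln (p t y)))"
      by (intro continuous_on_exp differentiable_imp_continuous_on)
        (simp add: differentiable_on_def differentiable_at_withinI lnp_diff[OF t])
    then show ?thesis using p_pos[OF t] by simp
  qed

  \<comment> \<open>Outside [0, T] the density is replaced by 1: the logarithm and its gradient
    vanish there, which is the cut-off required of b.\<close>
  define q where "q t y = ln (if t \<in> {0..T} then p t y else 1)" for t y
  have q_in: "q t = (\<lambda>y. ln (p t y))" if "t \<in> {0..T}" for t using that by (simp add: q_def[abs_def] del: atLeastAtMost_iff)
  have q_out: "q t = (\<lambda>y. 0)" if "t \<notin> {0..T}" for t using that by (simp add: q_def[abs_def] del: atLeastAtMost_iff)
  have q_diff: "q t differentiable (at x)" for t x
    by (cases "t \<in> {0..T}") (simp_all add: q_in q_out lnp_diff del: atLeastAtMost_iff)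
  have q_meas: "(\<lambda>t. q t x) \<in> borel_measurable borel" for x
  proof -
    have "(\<lambda>t. if t \<in> {0..T} then p t x else 1) \<in> borel_measurable borel"
      by (rule density_path_measurable[OF M0 lam_mono T _ _ p p_cont]) (use p_pos in \<open>auto intro: less_imp_le\<close>)
    then show ?thesis unfolding q_def by (rule borel_measurable_ln)
  qed
  define b where "b s = grad (q (\<kappa> * s))" for s
  have b_in: "b s = grad (\<lambda>y. ln (p_hat s y))" if "s \<in> {0..S}" for s
    using that unfolding b_def p_hat by (simp only: q_in time)
  have b_out: "b s y = 0" if "s \<notin> {0..S}" for s y
    using that unfolding b_def by (subst q_out) (auto simp only: time intro!: grad_eqI GDERIV_const)
  have c: "0 \<le> c"
    using p_lip[of 0] T by (auto dest!: lipschitz_on_nonneg)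
  have b_lip: "c-lipschitz_on UNIV (b s)" for s
  proof (cases "s \<in> {0..S}")
    case True
    then have "\<kappa> * s \<in> {0..T}" by (simp only: time)
    from p_lip[OF this] show ?thesis unfolding b_in[OF True] p_hat by (auto intro: lipschitz_on_le)
  next
    case False
    then show ?thesis using c by (intro lipschitz_onI) (simp_all add: b_out del: atLeastAtMost_iff)
  qed
  have b_path: "(\<lambda>s. b s x) \<in> borel_measurable borel" for x
    unfolding b_def
    by (rule measurable_compose[OF _ grad_path_measurable[OF q_meas q_diff]]) measurable
  have b_meas: "(\<lambda>z. b (fst z) (snd z)) \<in> borel_measurable borel"
    by (rule caratheodory_measurable[OF b_path lipschitz_on_continuous_on[OF b_lip]])

  have BX: "brownian_motion MX FX BX" and X_F: "\<And>t. t \<in> {0..S} \<Longrightarrow> X t \<in> borel_measurable (FX t)"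
    and X_cont: "AE \<omega> in MX. continuous_on {0..S} (\<lambda>t. X t \<omega>)" and X_init: "distr MX borel (X 0) = dens (p 0)"
    using X_sde unfolding sde_solution_def S_def by auto
  have BY: "brownian_motion MY FY BY" and Y_F: "\<And>t. t \<in> {0..S} \<Longrightarrow> Y t \<in> borel_measurable (FY t)"
    and Y_cont: "AE \<omega> in MY. continuous_on {0..S} (\<lambda>t. Y t \<omega>)" and Y_init: "distr MY borel (Y 0) = dens (p 0)"
    and Y_int: "AE \<omega> in MY. set_integrable lborel {0..S} (\<lambda>s. grad (\<lambda>y. ln (p_hat s y)) (Y s \<omega>))"
    using Y_sde unfolding sde_solution_def S_def by auto
  interpret MX: prob_space MX using BX by (simp add: brownian_motion_def)
  interpret MY: prob_space MY using BY by (simp add: brownian_motion_def)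
  interpret LX: pair_sigma_finite lborel MX ..
  have FX: "filtration (space MX) FX" "\<And>t. sets (FX t) \<subseteq> sets MX" using BX by (auto simp: brownian_motion_def)
  have FY: "filtration (space MY) FY" "\<And>t. sets (FY t) \<subseteq> sets MY" using BY by (auto simp: brownian_motion_def)
  obtain X' where X'p: "\<And>t. t \<in> {0..S} \<Longrightarrow> (\<lambda>z. X' (min (fst z) t) (snd z)) \<in> borel_measurable (borel \<Otimes>\<^sub>M FX t)"
    and X'e: "AE \<omega> in MX. \<forall>t\<in>{0..S}. X' t \<omega> = X t \<omega>"
  proof (rule progressive_version[OF FX(1) S X_F X_cont])
    fix X' assume "\<And>t. t \<in> {0..S} \<Longrightarrow> (\<lambda>z. X' (min (fst z) t) (snd z)) \<in> borel_measurable (borel \<Otimes>\<^sub>M FX t)"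
      and "AE \<omega> in MX. \<forall>t\<in>{0..S}. X' t \<omega> = X t \<omega>"
    then show thesis by (rule that)
  qed
  obtain Y' where Y'p: "\<And>t. t \<in> {0..S} \<Longrightarrow> (\<lambda>z. Y' (min (fst z) t) (snd z)) \<in> borel_measurable (borel \<Otimes>\<^sub>M FY t)"
    and Y'e: "AE \<omega> in MY. \<forall>t\<in>{0..S}. Y' t \<omega> = Y t \<omega>"
  proof (rule progressive_version[OF FY(1) S Y_F Y_cont])
    fix Y' assume "\<And>t. t \<in> {0..S} \<Longrightarrow> (\<lambda>z. Y' (min (fst z) t) (snd z)) \<in> borel_measurable (borel \<Otimes>\<^sub>M FY t)"
      and "AE \<omega> in MY. \<forall>t\<in>{0..S}. Y' t \<omega> = Y t \<omega>"
    then show thesis by (rule that)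
  qed
  have S_in: "S \<in> {0..S}" "0 \<in> {0..S}" using S by auto
  have X'm: "(\<lambda>z. X' (min (fst z) S) (snd z)) \<in> borel_measurable (borel \<Otimes>\<^sub>M MX)"
    by (rule measurable_pair_filtration[OF FX X'p[OF S_in(1)]])
  have Y'm: "(\<lambda>z. Y' (min (fst z) S) (snd z)) \<in> borel_measurable (borel \<Otimes>\<^sub>M MY)"
    by (rule measurable_pair_filtration[OF FY Y'p[OF S_in(1)]])
  have X'1: "X' (min t S) \<in> borel_measurable MX" for t
    using measurable_compose[OF measurable_Pair1'[of t borel MX] X'm] by simp
  have Y'1: "Y' (min t S) \<in> borel_measurable MY" for t
    using measurable_compose[OF measurable_Pair1'[of t borel MY] Y'm] by simp
  have X_MX: "X t \<in> borel_measurable MX" if "t \<in> {0..S}" for t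
    using X_law that unfolding S_def by (auto simp: distributed_def)
  have Y_MY: "Y t \<in> borel_measurable MY" if "t \<in> {0..S}" for t
    using Y_F[OF that] FY by (auto simp: measurable_def filtration_def)
  have X'_law: "distr MX borel (X' t) = distr MX borel (X t)" if t: "t \<in> {0..S}" for t
    by (rule distr_cong_AE_borel[OF X_MX[OF t]])
      (use X'1[of t] t X'e in \<open>auto simp: min_def elim!: eventually_mono\<close>)
  have Y'_law: "distr MY borel (Y' t) = distr MY borel (Y t)" if t: "t \<in> {0..S}" for t
    by (rule distr_cong_AE_borel[OF Y_MY[OF t]])
      (use Y'1[of t] t Y'e in \<open>auto simp: min_def elim!: eventually_mono\<close>)
  have X_dens: "distr MX borel (X t) = dens (p (\<kappa> * t))" if "t \<in> {0..S}" for t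
  proof -
    have "distr MX lborel (X t) = dens (p_hat t)" using X_law that unfolding S_def by (auto simp: distributed_def)
    moreover have "distr MX borel (X t) = distr MX lborel (X t)" by (rule distr_cong) auto
    ultimately show ?thesis by (simp add: p_hat)
  qed

  define K where "K = (\<integral>\<^sup>+\<omega>. ennreal (norm (\<xi> \<omega>) + norm (\<zeta> \<omega>)) \<partial>M0)"
  have K: "K < \<infinity>"
  proof -
    have "integrable M0 (\<lambda>\<omega>. norm (\<xi> \<omega>))" "integrable M0 (\<lambda>\<omega>. norm (\<zeta> \<omega>))"
      by (rule M0.square_integrable_imp_integrable; use \<xi>2 \<zeta>2 in simp)+
    then have "integrable M0 (\<lambda>\<omega>. norm (\<xi> \<omega>) + norm (\<zeta> \<omega>))" by (rule Bochner_Integration.integrable_add)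
    then show ?thesis by (simp add: K_def integrable_iff_bounded)
  qed
  have p_mom: "(\<integral>\<^sup>+x. ennreal (norm x) \<partial>dens (p t)) \<le> K" if t: "t \<in> {0..T}" for t
    unfolding K_def by (rule interpolation_moment[OF p[OF t] lam[OF t]])

  \<comment> \<open>Almost every path of \<open>Y\<close> is continuous with integrable drift along
    it; a single such path settles integrability at the origin.\<close>
  have b_zero: "integrable lborel (\<lambda>r. b r 0)"
  proof -
    have "AE \<omega> in MY. continuous_on {0..S} (\<lambda>t. Y t \<omega>) \<and> set_integrable lborel {0..S} (\<lambda>s. b s (Y s \<omega>))"
      using Y_cont Y_int
    proof eventually_elim
      case (elim \<omega>)
      have "set_integrable lborel {0..S} (\<lambda>s. b s (Y s \<omega>)) \<longleftrightarrow>
          set_integrable lborel {0..S} (\<lambda>s. grad (\<lambda>y. ln (p_hat s y)) (Y s \<omega>))"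
        by (rule set_integrable_cong) (simp_all only: b_in)
      then show ?case using elim by blast
    qed
    then obtain \<omega> where \<omega>: "continuous_on {0..S} (\<lambda>t. Y t \<omega>)" "set_integrable lborel {0..S} (\<lambda>s. b s (Y s \<omega>))"
      using eventually_happens'[OF MY.ae_filter_bot] by blast
    show ?thesis by (rule drift_zero_integrable[OF b_path b_lip b_out \<omega>])
  qed
  have drift: "lipschitz_drift b c"
    by unfold_locales (fact b_meas b_lip b_zero)+

  have Y0: "(\<integral>\<^sup>+\<omega>. ennreal (norm (Y 0 \<omega>)) \<partial>MY) < \<infinity>"
  proof -
    have "(\<integral>\<^sup>+\<omega>. ennreal (norm (Y 0 \<omega>)) \<partial>MY) = (\<integral>\<^sup>+x. ennreal (norm x) \<partial>distr MY borel (Y 0))"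
      by (rule nn_integral_distr[symmetric]) (use Y_MY[OF S_in(2)] in auto)
    also have "\<dots> \<le> K" unfolding Y_init by (rule p_mom) (use T in simp)
    finally show ?thesis using K by (rule le_less_trans)
  qed
  \<comment> \<open>For \<open>Y\<close> the first moment comes from its equation. For
    \<open>X\<close> it follows below from the prescribed laws and the interpolation.\<close>
  have Y_b: "integrable (lborel \<Otimes>\<^sub>M MY) (\<lambda>z. b (fst z) (Y' (fst z) (snd z)))"
    by (rule lipschitz_drift.drift_path_integrable[OF drift MY.prob_space_axioms b_out Y'm
        lipschitz_sde_moment[OF Y_sde[folded S_def] S _ drift Y'm Y'e Y0]]) (assumption, simp only: b_in)
  have X_b: "integrable (lborel \<Otimes>\<^sub>M MX) (\<lambda>z. b (fst z) (X' (fst z) (snd z)))"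
  proof (rule lipschitz_drift.drift_path_integrable[OF drift MX.prob_space_axioms b_out X'm])
    have "(\<integral>\<^sup>+r. indicator {0..S} r * (\<integral>\<^sup>+\<omega>. ennreal (norm (X' (min r S) \<omega>)) \<partial>MX) \<partial>lborel)
        \<le> (\<integral>\<^sup>+r. K * indicator {0..S} r \<partial>lborel)"
    proof (rule nn_integral_mono)
      fix r :: real
      show "indicator {0..S} r * (\<integral>\<^sup>+\<omega>. ennreal (norm (X' (min r S) \<omega>)) \<partial>MX) \<le> K * indicator {0..S} r"
      proof (cases "r \<in> {0..S}")
        case True
        have "(\<integral>\<^sup>+\<omega>. ennreal (norm (X' (min r S) \<omega>)) \<partial>MX) = (\<integral>\<^sup>+x. ennreal (norm x) \<partial>distr MX borel (X' (min r S)))"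
          by (rule nn_integral_distr[symmetric]) (use X'1 in auto)
        also have "distr MX borel (X' (min r S)) = dens (p (\<kappa> * r))" using True X'_law[OF True] X_dens[OF True] by (simp add: min_def)
        also have "(\<integral>\<^sup>+x. ennreal (norm x) \<partial>dens (p (\<kappa> * r))) \<le> K" by (rule p_mom) (use True in \<open>simp only: time\<close>)
        finally show ?thesis using True by simp
      qed simp
    qed
    also have "\<dots> = K * emeasure lborel {0..S}" by (rule nn_integral_cmult_indicator) simp
    also have "\<dots> < \<infinity>" using K by (simp add: ennreal_mult_less_top emeasure_lborel_Icc_eq)
    finally show "(\<integral>\<^sup>+r. indicator {0..S} r * (\<integral>\<^sup>+\<omega>. ennreal (norm (X' (min r S) \<omega>)) \<partial>MX) \<partial>lborel) < \<infinity>" .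
  qed

  \<comment> \<open>v is Borel on the time strip only and is extended by zero.\<close>
  define w where "w s x = (if s \<in> {0..S} then v s x else 0)" for s x
  have w_out: "w s x = 0" if "s \<notin> {0..S}" for s x using that by (simp only: w_def if_False)
  have w_meas: "(\<lambda>z. w (fst z) (snd z)) \<in> borel_measurable borel"
  proof -
    have "(\<lambda>z. if z \<in> {0..S} \<times> UNIV then (case z of (t, x) \<Rightarrow> v t x) else 0) \<in> borel_measurable borel"
      by (rule measurable_restrict_space_iff[THEN iffD1, OF _ _ v_meas[folded S_def]])
        (auto intro!: borel_closed closed_Times)
    also have "(\<lambda>z. if z \<in> {0..S} \<times> UNIV then (case z of (t, x) \<Rightarrow> v t x) else 0) = (\<lambda>z. w (fst z) (snd z))"
      by (auto simp: w_def fun_eq_iff)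
    finally show ?thesis .
  qed
  have w_path: "w s \<in> borel_measurable borel" for s
    using measurable_compose[OF _ w_meas, of "\<lambda>x. (s, x)" borel] by (simp add: borel_prod[symmetric])
  \<comment> \<open>A nonnegative integral, since integrability of the squared velocity along
    \<open>X\<close> is not yet established; the clipping at S gives joint measurability.\<close>
  define R where "R r = (\<integral>\<^sup>+\<omega>. ennreal ((norm (w r (X' (min r S) \<omega>)))\<^sup>2) \<partial>MX)" for r
  have wX_eq: "(\<lambda>z. w (fst z) (X' (fst z) (snd z))) = (\<lambda>z. w (fst z) (X' (min (fst z) S) (snd z)))"
  proof
    fix z :: "real \<times> 'w1"
    show "w (fst z) (X' (fst z) (snd z)) = w (fst z) (X' (min (fst z) S) (snd z))"
    proof (cases "fst z \<in> {0..S}")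
      case True
      then have "min (fst z) S = fst z" by simp
      then show ?thesis by (simp only:)
    qed (simp add: w_out del: atLeastAtMost_iff)
  qed
  have wX_meas: "(\<lambda>z. w (fst z) (X' (fst z) (snd z))) \<in> borel_measurable (lborel \<Otimes>\<^sub>M MX)"
  proof -
    have "(\<lambda>z. (fst z, X' (min (fst z) S) (snd z))) \<in> borel \<Otimes>\<^sub>M MX \<rightarrow>\<^sub>M borel \<Otimes>\<^sub>M borel"
      by (intro measurable_Pair measurable_fst X'm)
    from measurable_compose[OF this, of "\<lambda>z. w (fst z) (snd z)"] w_meas
    have "(\<lambda>z. w (fst z) (X' (min (fst z) S) (snd z))) \<in> borel_measurable (borel \<Otimes>\<^sub>M MX)" by (simp add: borel_prod)
    then show ?thesis unfolding wX_eq by (simp cong: measurable_cong_sets sets_pair_measure_cong)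
  qed
  \<comment> \<open>At time r the law of \<open>X\<close> has density \<open>p_hat r\<close>, so
    \<open>R r\<close> is the squared norm that is prescribed for v.\<close>
  have R: "AE r in lborel. r \<in> {0..S} \<longrightarrow> R r = ennreal ((\<kappa> * m (\<kappa> * r))\<^sup>2)"
    using v_norm[folded S_def m_def]
  proof eventually_elim
    case (elim r)
    show ?case
    proof
      assume r: "r \<in> {0..S}"
      have i: "integrable (dens (p_hat r)) (\<lambda>x. (norm (v r x))\<^sup>2)"
        and e: "sqrt (\<integral>x. (norm (v r x))\<^sup>2 \<partial>dens (p_hat r)) = \<kappa> * m (\<kappa> * r)" using elim r by blast+
      have wv: "w r = v r" using r by (simp add: w_def[abs_def] del: atLeastAtMost_iff)
      have "R r = (\<integral>\<^sup>+x. ennreal ((norm (w r x))\<^sup>2) \<partial>distr MX borel (X' (min r S)))"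
        unfolding R_def by (rule nn_integral_distr[symmetric, OF X'1]) (use w_path in measurable)
      also have "distr MX borel (X' (min r S)) = dens (p_hat r)"
        using r X'_law[OF r] X_dens[OF r] by (simp add: min_def p_hat)
      also have "(\<integral>\<^sup>+x. ennreal ((norm (w r x))\<^sup>2) \<partial>dens (p_hat r)) = ennreal (\<integral>x. (norm (v r x))\<^sup>2 \<partial>dens (p_hat r))"
        unfolding wv by (rule nn_integral_eq_integral[OF i]) simp
      also have "(\<integral>x. (norm (v r x))\<^sup>2 \<partial>dens (p_hat r)) = (\<kappa> * m (\<kappa> * r))\<^sup>2"
        unfolding e[symmetric] by (simp add: integral_nonneg_AE)
      finally show "R r = ennreal ((\<kappa> * m (\<kappa> * r))\<^sup>2)" .
    qed
  qed
  have R_scaled: "AE s in lborel. s \<in> {0..T} \<longrightarrow> R (s / \<kappa>) = ennreal ((\<kappa> * m s)\<^sup>2)"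
    using AE_lborel_scale[OF R less_imp_neq[OF \<kappa>, symmetric]]
  proof eventually_elim
    case (elim s)
    then show ?case using time[of "s / \<kappa>"] \<kappa> by simp
  qed
  have w_sq: "integrable (lborel \<Otimes>\<^sub>M MX) (\<lambda>z. (norm (w (fst z) (X' (fst z) (snd z))))\<^sup>2)"
  proof (rule integrableI_nonneg)
    note [measurable] = wX_meas
    show m: "(\<lambda>z. (norm (w (fst z) (X' (fst z) (snd z))))\<^sup>2) \<in> borel_measurable (lborel \<Otimes>\<^sub>M MX)" by measurable
    then have m': "(\<lambda>z. ennreal ((norm (w (fst z) (X' (min (fst z) S) (snd z))))\<^sup>2)) \<in> borel_measurable (lborel \<Otimes>\<^sub>M MX)"
      using wX_meas unfolding wX_eq by measurable
    have Rm: "R \<in> borel_measurable borel"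
      using MX.borel_measurable_nn_integral_fst[OF m'] unfolding R_def by simp
    have R0: "R r = 0" if "r \<notin> {0..S}" for r unfolding R_def by (simp only: w_out[OF that]) simp
    have "(\<integral>\<^sup>+z. ennreal ((norm (w (fst z) (X' (fst z) (snd z))))\<^sup>2) \<partial>(lborel \<Otimes>\<^sub>M MX)) = (\<integral>\<^sup>+r. R r \<partial>lborel)"
    proof -
      have "ennreal ((norm (w (fst z) (X' (fst z) (snd z))))\<^sup>2) = ennreal ((norm (w (fst z) (X' (min (fst z) S) (snd z))))\<^sup>2)" for z
        using fun_cong[OF wX_eq, of z] by (simp only:)
      then show ?thesis using MX.nn_integral_fst[OF m'] by (simp add: R_def)
    qed
    also have "\<dots> = ennreal \<bar>1 / \<kappa>\<bar> * (\<integral>\<^sup>+s. R (0 + (1 / \<kappa>) * s) \<partial>lborel)"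
      by (rule nn_integral_real_affine[OF Rm]) (use \<kappa> in simp)
    also have "\<dots> \<le> ennreal \<bar>1 / \<kappa>\<bar> * (\<integral>\<^sup>+s\<in>{0..T}. ennreal ((m s)\<^sup>2) \<partial>lborel)"
    proof (intro mult_left_mono nn_integral_mono_AE)
      show "AE s in lborel. R (0 + (1 / \<kappa>) * s) \<le> ennreal ((m s)\<^sup>2) * indicator {0..T} s"
        using R_scaled
      proof eventually_elim
        case (elim s)
        show ?case
        proof (cases "s \<in> {0..T}")
          case True
          have "(\<kappa> * m s)\<^sup>2 \<le> 1 * (m s)\<^sup>2"
            unfolding power_mult_distrib using \<kappa> \<kappa>1 by (intro mult_right_mono) (auto simp: power_le_one)
          then show ?thesis using elim True by (simp add: ennreal_leI)
        next
          case False
          then have "s / \<kappa> \<notin> {0..S}" using time[of "s / \<kappa>"] \<kappa> by (simp del: atLeastAtMost_iff)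
          from R0[OF this] show ?thesis by simp
        qed
      qed
    qed simp
    also have "\<dots> < \<infinity>" using m2[folded m_def] by (simp add: ennreal_mult_less_top)
    finally show "(\<integral>\<^sup>+z. ennreal ((norm (w (fst z) (X' (fst z) (snd z))))\<^sup>2) \<partial>(lborel \<Otimes>\<^sub>M MX)) < \<infinity>" .
  qed simp
  have w_int: "integrable (lborel \<Otimes>\<^sub>M MX) (\<lambda>z. w (fst z) (X' (fst z) (snd z)))"
    by (rule square_integrable_pair_imp_integrable[where S = S, OF MX.prob_space_axioms wX_meas _ w_sq]) (simp add: w_out del: atLeastAtMost_iff)

  have DX: "driven_process MX FX BX X' S b c w"
    by (rule sde_driven_process[OF X_sde[folded S_def] S _ drift b_out w_out w_meas X'p X'e X_b w_int w_sq])
      (simp add: b_in w_def del: atLeastAtMost_iff)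
  have DY: "driven_process MY FY BY Y' S b c (\<lambda>_ _. 0)"
    by (rule sde_driven_process[OF Y_sde[folded S_def] S _ drift b_out _ _ Y'p Y'e Y_b])
      (simp_all add: b_in del: atLeastAtMost_iff)
  interpret comparison MX FX BX X' S b c w MY FY BY Y'
    by (intro comparison.intro comparison_axioms.intro DX DY)
      (simp only: X'_law[OF S_in(2)] Y'_law[OF S_in(2)] X_init Y_init)

  \<comment> \<open>The nonnegative integral has a finite value here, so passing to the real
    integral loses nothing.\<close>
  have energy: "AE s in lborel. s \<in> {0..T} \<longrightarrow> X.energy (s / \<kappa>) = (\<kappa> * m s)\<^sup>2"
    using R_scaled
  proof eventually_elim
    case (elim s)
    show ?case
    proof
      assume s: "s \<in> {0..T}"
      then have "s / \<kappa> \<in> {0..S}" using time[of "s / \<kappa>"] \<kappa> by simp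
      then have mn: "min (s / \<kappa>) S = s / \<kappa>" by simp
      have Rs: "(\<integral>\<^sup>+\<omega>. ennreal ((norm (w (s / \<kappa>) (X' (s / \<kappa>) \<omega>)))\<^sup>2) \<partial>MX) = ennreal ((\<kappa> * m s)\<^sup>2)"
        using elim s unfolding R_def mn by simp
      have "(\<lambda>\<omega>. (norm (w (s / \<kappa>) (X' (s / \<kappa>) \<omega>)))\<^sup>2) \<in> borel_measurable MX"
        using X'1[of "s / \<kappa>"] w_path unfolding mn by measurable
      then have "X.energy (s / \<kappa>) = enn2real (\<integral>\<^sup>+\<omega>. ennreal ((norm (w (s / \<kappa>) (X' (s / \<kappa>) \<omega>)))\<^sup>2) \<partial>MX)"
        unfolding X.energy_def by (intro integral_eq_nn_integral) auto
      then show "X.energy (s / \<kappa>) = (\<kappa> * m s)\<^sup>2" unfolding Rs by simp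
    qed
  qed
  have laws: "distr MX borel (X' S) = dens (p T)" "distr MY borel (Y' S) = distr MY borel (Y (T / \<kappa>))"
    using X'_law[OF S_in(1)] X_dens[OF S_in(1)] Y'_law[OF S_in(1)] by (simp_all add: \<kappa>S S_def[symmetric])
  \<comment> \<open>Equality in law of the version and the solution is known for times of [0, S]
    only, hence the case distinction on the indicator.\<close>
  have "(\<integral>\<^sup>+u\<in>{s..T}. inverse (C_LS (distr MY borel (Y' (u / \<kappa>)))) \<partial>lborel)
      = (\<integral>\<^sup>+u\<in>{s..T}. inverse (C_LS (distr MY borel (Y (u / \<kappa>)))) \<partial>lborel)" if s: "s \<in> {0..T}" for s
  proof (rule nn_integral_cong)
    fix u
    show "inverse (C_LS (distr MY borel (Y' (u / \<kappa>)))) * indicator {s..T} u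
        = inverse (C_LS (distr MY borel (Y (u / \<kappa>)))) * indicator {s..T} u"
    proof (cases "u \<in> {s..T}")
      case True
      then have "u \<in> {0..T}" using s by simp
      then have "u / \<kappa> \<in> {0..S}" using time[of "u / \<kappa>"] \<kappa> by simp
      then show ?thesis by (simp only: Y'_law)
    next
      case False
      then have "indicator {s..T} u = (0 :: ennreal)" by (rule indicator_simps(2))
      then show ?thesis by (simp only: mult_zero_right)
    qed
  qed
  note inner = this
  have "(\<integral>\<^sup>+s\<in>{0..T}. ennreal ((m s)\<^sup>2) * exp_minus (ennreal (1 / \<kappa>) *
      (\<integral>\<^sup>+u\<in>{s..T}. inverse (C_LS (distr MY borel (Y' (u / \<kappa>)))) \<partial>lborel)) \<partial>lborel)
    = (\<integral>\<^sup>+s\<in>{0..T}. ennreal ((m s)\<^sup>2) * exp_minus (ennreal (1 / \<kappa>) *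
      (\<integral>\<^sup>+u\<in>{s..T}. inverse (C_LS (distr MY borel (Y (u / \<kappa>)))) \<partial>lborel)) \<partial>lborel)"
  proof (rule nn_integral_cong)
    fix s
    show "ennreal ((m s)\<^sup>2) * exp_minus (ennreal (1 / \<kappa>) *
      (\<integral>\<^sup>+u\<in>{s..T}. inverse (C_LS (distr MY borel (Y' (u / \<kappa>)))) \<partial>lborel)) * indicator {0..T} s
      = ennreal ((m s)\<^sup>2) * exp_minus (ennreal (1 / \<kappa>) *
      (\<integral>\<^sup>+u\<in>{s..T}. inverse (C_LS (distr MY borel (Y (u / \<kappa>)))) \<partial>lborel)) * indicator {0..T} s"
    proof (cases "s \<in> {0..T}")
      case True
      then show ?thesis by (simp only: inner)
    next
      case False
      then have "indicator {0..T} s = (0 :: ennreal)" by (rule indicator_simps(2))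
      then show ?thesis by (simp only: mult_zero_right)
    qed
  qed
  with d_KL_terminal_le[OF \<kappa> S_def energy] show ?thesis unfolding laws m_def by (simp only:)
qed

end
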